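(* Let $k$ be a Noetherian commutative ring and $A$ a $k$-algebra. Then $C\mapsto C^*:=\mathrm{Hom}_k(C,k)$ is a dualizing functor $*\colon\mathbb{AM}_A\to\mathbb{AM}_A$. If $A$ is filtered, then $*$ induces two more dualizing functors: $*\colon\mathbb{AF}_A\to\mathbb{AF}_A$ and $*\colon\mathbb{AG}_{G_\bullet A}\to\mathbb{AG}_{G_\bullet A}$; the latter two functors $*$ commute with $G_\bullet\colon\mathbb{AF}_A\to\mathbb{AG}_{G_\bullet A}$. Moreover, if $A$ is filtered, then for any $B,C\in\mathbb{AF}_A$, there is a canonical identification of filtered $A$-modules $\mathrm{Hom}_A(B,C)=\mathrm{Hom}_A(C^*,B^* )$.
   Context: $C^*$ is an $A$-module via $(af)(\psi)=f(a\psi)$; a map $\gamma$ has dual $\gamma^*g=g\circ\gamma$. A contravariant functor $\mathbf D$ from an additive category to itself is dualizing if $\mathbf D^2$ is naturally isomorphic to the identity functor. A filtered $k$-algebra $A$ has a descending chain of $A$-submodules (ideals) $F^mA$, $m\in\mathbb Z$, with $F^mA=A$ for $m\le0$ and $F^mA\cdot F^nA\subset F^{m+n}A$. A filtered $A$-module $C$ has a descending chain of $A$-submodules $F^nC$, $n\in\mathbb Z$, with $F^mA\cdot F^nC\subset F^{m+n}C$; maps of filtered modules are $A$-maps preserving the filtrations. $G_nC:=F^nC/F^{n+1}C$, $G_\bullet C:=\bigoplus_nG_nC$, a graded module over the graded $k$-algebra $G_\bullet A$. The filtration is finite if $F^nC=C$ for $n\ll0$ and $F^nC=0$ for $n\gg0$.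 For filtered $B,C$, $\mathrm{Hom}_A(B,C)$ (all $A$-linear maps) is filtered by $F^p\mathrm{Hom}_A(B,C):=\{\beta:\beta(F^nB)\subset F^{n+p}C\ \forall n\}$. $B^*$ is filtered by $F^p(B^* ):=(B/F^{1-p}B)^*$, i.e. the functionals vanishing on $F^{1-p}B$. For graded $C$, $C^*$ is graded by $(C^* )_q=(C_{-q})^*$ (for $C$ nonzero in finitely many degrees). $\mathbb{AM}_A$: category of $A$-modules locally free of constant finite rank over $k$. $\mathbb{AF}_A$: category of filtered $A$-modules $C$ with finite filtration and each $G_nC$ locally free over $k$ of constant finite rank. $\mathbb{AG}_{G_\bullet A}$: category of graded $G_\bullet A$-modules $C=\bigoplus C_n$ (homogeneous degree-0 maps) with each $C_n$ locally free over $k$ of constant finite rank and $C_n=0$ for almost all $n$. "Commute with $G_\bullet$" means $G_\bullet(C^* )=(G_\bullet C)^*$ canonically. *)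

theory Defs
  imports "HOL-Algebra.Module" "HOL-Algebra.Ring_Divisibility"
begin

section \<open>Modules and linear maps\<close>

definition rep :: "'a set \<Rightarrow> 'a" where
  "rep X = (SOME x. x \<in> X)"

definition ident :: "('b, 'z) ring_scheme \<Rightarrow> 'b \<Rightarrow> 'b" where
  "ident M = (\<lambda>x\<in>carrier M. x)"

definition mod_hom ::
  "('a, 'r) ring_scheme \<Rightarrow> ('a, 'b, 'y) module_scheme \<Rightarrow> ('a, 'c, 'z) module_scheme \<Rightarrow> ('b \<Rightarrow> 'c) set"
where
  "mod_hom R M N = {f \<in> carrier M \<rightarrow>\<^sub>E carrier N.
     (\<forall>x\<in>carrier M. \<forall>y\<in>carrier M. f (x \<oplus>\<^bsub>M\<^esub> y) = f x \<oplus>\<^bsub>N\<^esub> f y) \<and>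
     (\<forall>r\<in>carrier R. \<forall>x\<in>carrier M. f (r \<odot>\<^bsub>M\<^esub> x) = r \<odot>\<^bsub>N\<^esub> f x)}"

definition self_module :: "('k, 'l) ring_scheme \<Rightarrow> ('k, 'k) module" where
  "self_module k = \<lparr>carrier = carrier k, mult = mult k, one = one k, zero = zero k, add = add k,
     smult = mult k\<rparr>"

text \<open>An \<open>A\<close>-module viewed as a \<open>k\<close>-module along the structure map \<open>c \<mapsto> c \<cdot> 1\<close> of the
  \<open>k\<close>-algebra \<open>A\<close>. As in the library, modules are records with the fields \<open>mult\<close> and \<open>one\<close> of rings,
  which carry no meaning.\<close>

definition restrict_scalars ::
  "('k, 'a, 'y) module_scheme \<Rightarrow> ('a, 'c, 'z) module_scheme \<Rightarrow> ('k, 'c) module" where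
  "restrict_scalars A C = \<lparr>carrier = carrier C, mult = mult C, one = one C, zero = zero C,
     add = add C, smult = (\<lambda>c x. (c \<odot>\<^bsub>A\<^esub> \<one>\<^bsub>A\<^esub>) \<odot>\<^bsub>C\<^esub> x)\<rparr>"


section \<open>Locally free modules of constant finite rank\<close>

definition loc_rel ::
  "'k set \<Rightarrow> ('k, 'm, 'z) module_scheme \<Rightarrow> (('m \<times> 'k) \<times> ('m \<times> 'k)) set" where
  "loc_rel S M = {((x, s), (y, t)). x \<in> carrier M \<and> y \<in> carrier M \<and> s \<in> S \<and> t \<in> S \<and>
     (\<exists>u\<in>S. u \<odot>\<^bsub>M\<^esub> (t \<odot>\<^bsub>M\<^esub> x) = u \<odot>\<^bsub>M\<^esub> (s \<odot>\<^bsub>M\<^esub> y))}"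

definition frac :: "'k set \<Rightarrow> ('k, 'm, 'z) module_scheme \<Rightarrow> 'm \<Rightarrow> 'k \<Rightarrow> ('m \<times> 'k) set" where
  "frac S M x s = loc_rel S M `` {(x, s)}"

text \<open>The localization of a \<open>k\<close>-module at a multiplicative set \<open>S\<close>, with its scalar multiplication
  by the localized ring (which is the localization of \<open>k\<close> as a module over itself).\<close>

definition loc_module ::
  "('k, 'l) ring_scheme \<Rightarrow> 'k set \<Rightarrow> ('k, 'm, 'z) module_scheme \<Rightarrow>
     (('k \<times> 'k) set, ('m \<times> 'k) set) module" where
  "loc_module k S M =
    \<lparr>carrier = (carrier M \<times> S) // loc_rel S M,
     mult = undefined, one = undefined,
     zero = frac S M \<zero>\<^bsub>M\<^esub> \<one>\<^bsub>k\<^esub>,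
     add = (\<lambda>X Y. let (x, s) = rep X; (y, t) = rep Y
                   in frac S M ((t \<odot>\<^bsub>M\<^esub> x) \<oplus>\<^bsub>M\<^esub> (s \<odot>\<^bsub>M\<^esub> y)) (s \<otimes>\<^bsub>k\<^esub> t)),
     smult = (\<lambda>X Y. let (a, s) = rep X; (y, t) = rep Y in frac S M (a \<odot>\<^bsub>M\<^esub> y) (s \<otimes>\<^bsub>k\<^esub> t))\<rparr>"

definition loc_ring :: "('k, 'l) ring_scheme \<Rightarrow> 'k set \<Rightarrow> ('k \<times> 'k) set ring" where
  "loc_ring k S = (let L = loc_module k S (self_module k) in
    \<lparr>carrier = carrier L, mult = smult L,
     one = frac S (self_module k) \<one>\<^bsub>k\<^esub> \<one>\<^bsub>k\<^esub>, zero = zero L, add = add L\<rparr>)"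

definition powers :: "('k, 'l) ring_scheme \<Rightarrow> 'k \<Rightarrow> 'k set" where
  "powers k f = {f [^]\<^bsub>k\<^esub> n |n::nat. True}"

definition free_of_rank ::
  "('k, 'l) ring_scheme \<Rightarrow> ('k, 'm, 'z) module_scheme \<Rightarrow> nat \<Rightarrow> bool" where
  "free_of_rank R M r \<longleftrightarrow>
    (\<exists>e \<in> {..<r} \<rightarrow> carrier M. \<forall>x\<in>carrier M.
       \<exists>!c. c \<in> {..<r} \<rightarrow>\<^sub>E carrier R \<and> x = (\<Oplus>\<^bsub>M\<^esub>i\<in>{..<r}. c i \<odot>\<^bsub>M\<^esub> e i))"

text \<open>Locally free in the Zariski topology: every point \<open>P\<close> of the spectrum has a basic open
  neighbourhood \<open>D(f)\<close> over which the module is free of rank \<open>r\<close>, with \<open>r\<close> independent of \<open>P\<close>.\<close>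

definition locally_free_const_rank ::
  "('k, 'l) ring_scheme \<Rightarrow> ('k, 'm, 'z) module_scheme \<Rightarrow> bool" where
  "locally_free_const_rank k M \<longleftrightarrow>
    (\<exists>r::nat. \<forall>P. primeideal P k \<longrightarrow>
       (\<exists>f \<in> carrier k - P.
          free_of_rank (loc_ring k (powers k f)) (loc_module k (powers k f) M) r))"


section \<open>Categories of modules, functors, dualizing functors\<close>

text \<open>Categories whose objects are modules with carriers in a fixed type and whose morphisms are
  functions, extensional on the carrier, composed by \<^const>\<open>compose\<close>.\<close>

record ('c, 'z) mod_cat =
  Obj :: "('c, 'z) ring_scheme set"
  Mor :: "('c, 'z) ring_scheme \<Rightarrow> ('c, 'z) ring_scheme \<Rightarrow> ('c \<Rightarrow> 'c) set"

definition hom_add ::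
  "('b, 'y) ring_scheme \<Rightarrow> ('c, 'z) ring_scheme \<Rightarrow> ('b \<Rightarrow> 'c) \<Rightarrow> ('b \<Rightarrow> 'c) \<Rightarrow> 'b \<Rightarrow> 'c" where
  "hom_add B C f g = (\<lambda>x\<in>carrier B. f x \<oplus>\<^bsub>C\<^esub> g x)"

definition hom_zero ::
  "('b, 'y) ring_scheme \<Rightarrow> ('c, 'z) ring_scheme \<Rightarrow> 'b \<Rightarrow> 'c" where
  "hom_zero B C = (\<lambda>x\<in>carrier B. \<zero>\<^bsub>C\<^esub>)"

definition category :: "('c, 'z) mod_cat \<Rightarrow> bool" where
  "category X \<longleftrightarrow>
    (\<forall>B\<in>Obj X. \<forall>C\<in>Obj X. Mor X B C \<subseteq> carrier B \<rightarrow>\<^sub>E carrier C) \<and>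
    (\<forall>C\<in>Obj X. ident C \<in> Mor X C C) \<and>
    (\<forall>B\<in>Obj X. \<forall>C\<in>Obj X. \<forall>D\<in>Obj X. \<forall>f\<in>Mor X B C. \<forall>g\<in>Mor X C D.
       compose (carrier B) g f \<in> Mor X B D)"

text \<open>A type of carriers need not be closed under products, so a biproduct of two objects of \<open>X\<close> is
  sought among the objects of \<open>X2\<close>, the category of the same kind of modules with carriers in the
  product type; \<open>Hin\<close> and \<open>Hout\<close> are the sets of morphisms from \<open>X\<close> to \<open>X2\<close> and back.\<close>

definition additive_category ::
  "('c, 'z) mod_cat \<Rightarrow> ('c \<times> 'c, 'w) mod_cat \<Rightarrow>
   (('c, 'z) ring_scheme \<Rightarrow> ('c \<times> 'c, 'w) ring_scheme \<Rightarrow> ('c \<Rightarrow> 'c \<times> 'c) set) \<Rightarrow>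
   (('c \<times> 'c, 'w) ring_scheme \<Rightarrow> ('c, 'z) ring_scheme \<Rightarrow> ('c \<times> 'c \<Rightarrow> 'c) set) \<Rightarrow> bool" where
  "additive_category X X2 Hin Hout \<longleftrightarrow>
    category X \<and>
    (\<forall>B\<in>Obj X. \<forall>C\<in>Obj X.
       comm_group \<lparr>carrier = Mor X B C, mult = hom_add B C, one = hom_zero B C\<rparr>) \<and>
    (\<forall>B\<in>Obj X. \<forall>C\<in>Obj X. \<forall>D\<in>Obj X.
       \<forall>f\<in>Mor X B C. \<forall>f'\<in>Mor X B C. \<forall>g\<in>Mor X C D. \<forall>g'\<in>Mor X C D.
       compose (carrier B) g (hom_add B C f f') =
         hom_add B D (compose (carrier B) g f) (compose (carrier B) g f') \<and>
       compose (carrier B) (hom_add C D g g') f =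
         hom_add B D (compose (carrier B) g f) (compose (carrier B) g' f)) \<and>
    (\<exists>Z\<in>Obj X. \<forall>C\<in>Obj X. Mor X Z C = {hom_zero Z C} \<and> Mor X C Z = {hom_zero C Z}) \<and>
    (\<forall>B\<in>Obj X. \<forall>C\<in>Obj X. \<exists>P\<in>Obj X2.
       \<exists>i\<in>Hin B P. \<exists>j\<in>Hin C P. \<exists>p\<in>Hout P B. \<exists>q\<in>Hout P C.
       compose (carrier B) p i = ident B \<and> compose (carrier C) q j = ident C \<and>
       compose (carrier B) q i = hom_zero B C \<and> compose (carrier C) p j = hom_zero C B \<and>
       hom_add P P (compose (carrier P) i p) (compose (carrier P) j q) = ident P)"

text \<open>The action of a functor on a morphism \<open>f\<close> from \<open>B\<close> to \<open>C\<close> is given as \<open>Fm B C f\<close>.\<close>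

definition covariant_functor ::
  "('b, 'y) mod_cat \<Rightarrow> ('c, 'z) mod_cat \<Rightarrow> (('b, 'y) ring_scheme \<Rightarrow> ('c, 'z) ring_scheme) \<Rightarrow>
   (('b, 'y) ring_scheme \<Rightarrow> ('b, 'y) ring_scheme \<Rightarrow> ('b \<Rightarrow> 'b) \<Rightarrow> 'c \<Rightarrow> 'c) \<Rightarrow> bool" where
  "covariant_functor X Y Fo Fm \<longleftrightarrow>
    (\<forall>C\<in>Obj X. Fo C \<in> Obj Y) \<and>
    (\<forall>B\<in>Obj X. \<forall>C\<in>Obj X. \<forall>f\<in>Mor X B C. Fm B C f \<in> Mor Y (Fo B) (Fo C)) \<and>
    (\<forall>C\<in>Obj X. Fm C C (ident C) = ident (Fo C)) \<and>
    (\<forall>B\<in>Obj X. \<forall>C\<in>Obj X. \<forall>D\<in>Obj X. \<forall>f\<in>Mor X B C. \<forall>g\<in>Mor X C D.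
       Fm B D (compose (carrier B) g f) = compose (carrier (Fo B)) (Fm C D g) (Fm B C f))"

definition contravariant_functor ::
  "('b, 'y) mod_cat \<Rightarrow> ('c, 'z) mod_cat \<Rightarrow> (('b, 'y) ring_scheme \<Rightarrow> ('c, 'z) ring_scheme) \<Rightarrow>
   (('b, 'y) ring_scheme \<Rightarrow> ('b, 'y) ring_scheme \<Rightarrow> ('b \<Rightarrow> 'b) \<Rightarrow> 'c \<Rightarrow> 'c) \<Rightarrow> bool" where
  "contravariant_functor X Y Fo Fm \<longleftrightarrow>
    (\<forall>C\<in>Obj X. Fo C \<in> Obj Y) \<and>
    (\<forall>B\<in>Obj X. \<forall>C\<in>Obj X. \<forall>f\<in>Mor X B C. Fm B C f \<in> Mor Y (Fo C) (Fo B)) \<and>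
    (\<forall>C\<in>Obj X. Fm C C (ident C) = ident (Fo C)) \<and>
    (\<forall>B\<in>Obj X. \<forall>C\<in>Obj X. \<forall>D\<in>Obj X. \<forall>f\<in>Mor X B C. \<forall>g\<in>Mor X C D.
       Fm B D (compose (carrier B) g f) = compose (carrier (Fo D)) (Fm B C f) (Fm C D g))"

text \<open>Isomorphisms between modules whose carriers may live in different types: \<open>H\<close> and \<open>H'\<close> are the
  sets of morphisms in the two directions.\<close>

definition iso_via ::
  "(('b, 'y) ring_scheme \<Rightarrow> ('c, 'z) ring_scheme \<Rightarrow> ('b \<Rightarrow> 'c) set) \<Rightarrow>
   (('c, 'z) ring_scheme \<Rightarrow> ('b, 'y) ring_scheme \<Rightarrow> ('c \<Rightarrow> 'b) set) \<Rightarrow>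
   ('b, 'y) ring_scheme \<Rightarrow> ('c, 'z) ring_scheme \<Rightarrow> ('b \<Rightarrow> 'c) \<Rightarrow> bool" where
  "iso_via H H' M N f \<longleftrightarrow> f \<in> H M N \<and>
    (\<exists>g\<in>H' N M. compose (carrier M) g f = ident M \<and> compose (carrier N) f g = ident N)"

text \<open>Natural isomorphisms between two covariant, respectively two contravariant, functors on \<open>X\<close>.\<close>

definition nat_iso_covariant ::
  "('x, 'u) mod_cat \<Rightarrow>
   (('b, 'y) ring_scheme \<Rightarrow> ('c, 'z) ring_scheme \<Rightarrow> ('b \<Rightarrow> 'c) set) \<Rightarrow>
   (('c, 'z) ring_scheme \<Rightarrow> ('b, 'y) ring_scheme \<Rightarrow> ('c \<Rightarrow> 'b) set) \<Rightarrow>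
   (('x, 'u) ring_scheme \<Rightarrow> ('b, 'y) ring_scheme) \<Rightarrow>
   (('x, 'u) ring_scheme \<Rightarrow> ('x, 'u) ring_scheme \<Rightarrow> ('x \<Rightarrow> 'x) \<Rightarrow> 'b \<Rightarrow> 'b) \<Rightarrow>
   (('x, 'u) ring_scheme \<Rightarrow> ('c, 'z) ring_scheme) \<Rightarrow>
   (('x, 'u) ring_scheme \<Rightarrow> ('x, 'u) ring_scheme \<Rightarrow> ('x \<Rightarrow> 'x) \<Rightarrow> 'c \<Rightarrow> 'c) \<Rightarrow>
   (('x, 'u) ring_scheme \<Rightarrow> 'b \<Rightarrow> 'c) \<Rightarrow> bool" where
  "nat_iso_covariant X H H' Fo Fm Go Gm \<eta> \<longleftrightarrow>
    (\<forall>C\<in>Obj X. iso_via H H' (Fo C) (Go C) (\<eta> C)) \<and>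
    (\<forall>B\<in>Obj X. \<forall>C\<in>Obj X. \<forall>f\<in>Mor X B C.
       compose (carrier (Fo B)) (\<eta> C) (Fm B C f) = compose (carrier (Fo B)) (Gm B C f) (\<eta> B))"

definition nat_iso_contravariant ::
  "('x, 'u) mod_cat \<Rightarrow>
   (('b, 'y) ring_scheme \<Rightarrow> ('c, 'z) ring_scheme \<Rightarrow> ('b \<Rightarrow> 'c) set) \<Rightarrow>
   (('c, 'z) ring_scheme \<Rightarrow> ('b, 'y) ring_scheme \<Rightarrow> ('c \<Rightarrow> 'b) set) \<Rightarrow>
   (('x, 'u) ring_scheme \<Rightarrow> ('b, 'y) ring_scheme) \<Rightarrow>
   (('x, 'u) ring_scheme \<Rightarrow> ('x, 'u) ring_scheme \<Rightarrow> ('x \<Rightarrow> 'x) \<Rightarrow> 'b \<Rightarrow> 'b) \<Rightarrow>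
   (('x, 'u) ring_scheme \<Rightarrow> ('c, 'z) ring_scheme) \<Rightarrow>
   (('x, 'u) ring_scheme \<Rightarrow> ('x, 'u) ring_scheme \<Rightarrow> ('x \<Rightarrow> 'x) \<Rightarrow> 'c \<Rightarrow> 'c) \<Rightarrow>
   (('x, 'u) ring_scheme \<Rightarrow> 'b \<Rightarrow> 'c) \<Rightarrow> bool" where
  "nat_iso_contravariant X H H' Fo Fm Go Gm \<eta> \<longleftrightarrow>
    (\<forall>C\<in>Obj X. iso_via H H' (Fo C) (Go C) (\<eta> C)) \<and>
    (\<forall>B\<in>Obj X. \<forall>C\<in>Obj X. \<forall>f\<in>Mor X B C.
       compose (carrier (Fo C)) (\<eta> B) (Fm B C f) = compose (carrier (Fo C)) (Gm B C f) (\<eta> C))"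

text \<open>The dual of a module with carrier in a type \<open>'c\<close> has its carrier in \<open>'c \<Rightarrow> 'k\<close>, so a functor
  from a category of modules to itself that forms duals appears in HOL as a family indexed by types.
  In the following definition \<open>X\<close>, \<open>X1\<close>, \<open>X2\<close> are to be three instances of one and the same
  category, \<open>(Do, Dm)\<close> and \<open>(Do', Dm')\<close> two instances of one and the same functor \<open>D\<close>, and \<open>H\<close>,
  \<open>H'\<close> the morphisms of that category from objects of \<open>X\<close> to objects of \<open>X2\<close> and back.\<close>

definition dualizing_functor ::
  "('c, 'z) mod_cat \<Rightarrow> ('c1, 'z1) mod_cat \<Rightarrow> ('c2, 'z2) mod_cat \<Rightarrow>
   (('c, 'z) ring_scheme \<Rightarrow> ('c2, 'z2) ring_scheme \<Rightarrow> ('c \<Rightarrow> 'c2) set) \<Rightarrow>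
   (('c2, 'z2) ring_scheme \<Rightarrow> ('c, 'z) ring_scheme \<Rightarrow> ('c2 \<Rightarrow> 'c) set) \<Rightarrow>
   (('c, 'z) ring_scheme \<Rightarrow> ('c1, 'z1) ring_scheme) \<Rightarrow>
   (('c, 'z) ring_scheme \<Rightarrow> ('c, 'z) ring_scheme \<Rightarrow> ('c \<Rightarrow> 'c) \<Rightarrow> 'c1 \<Rightarrow> 'c1) \<Rightarrow>
   (('c1, 'z1) ring_scheme \<Rightarrow> ('c2, 'z2) ring_scheme) \<Rightarrow>
   (('c1, 'z1) ring_scheme \<Rightarrow> ('c1, 'z1) ring_scheme \<Rightarrow> ('c1 \<Rightarrow> 'c1) \<Rightarrow> 'c2 \<Rightarrow> 'c2) \<Rightarrow> bool" where
  "dualizing_functor X X1 X2 H H' Do Dm Do' Dm' \<longleftrightarrow>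
    contravariant_functor X X1 Do Dm \<and>
    contravariant_functor X1 X2 Do' Dm' \<and>
    (\<exists>\<eta>. nat_iso_covariant X H H'
       (\<lambda>C. C) (\<lambda>B C f. f)
       (\<lambda>C. Do' (Do C)) (\<lambda>B C f. Dm' (Do C) (Do B) (Dm B C f)) \<eta>)"


section \<open>The category of \<open>A\<close>-modules locally free over \<open>k\<close>, and the dual\<close>

definition AM :: "('k, 'l) ring_scheme \<Rightarrow> ('k, 'a, 'y) module_scheme \<Rightarrow>
    ('c, \<lparr>smult :: 'a \<Rightarrow> 'c \<Rightarrow> 'c\<rparr>) mod_cat" where
  "AM k A = \<lparr>Obj = {C. module A C \<and> locally_free_const_rank k (restrict_scalars A C)},
             Mor = mod_hom A\<rparr>"

definition dual :: "('k, 'l) ring_scheme \<Rightarrow> ('k, 'a, 'y) module_scheme \<Rightarrow>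
    ('a, 'c, 'z) module_scheme \<Rightarrow> ('a, 'c \<Rightarrow> 'k) module" where
  "dual k A C =
    \<lparr>carrier = mod_hom k (restrict_scalars A C) (self_module k),
     mult = undefined, one = undefined,
     zero = (\<lambda>x\<in>carrier C. \<zero>\<^bsub>k\<^esub>),
     add = (\<lambda>f g. \<lambda>x\<in>carrier C. f x \<oplus>\<^bsub>k\<^esub> g x),
     smult = (\<lambda>a f. \<lambda>x\<in>carrier C. f (a \<odot>\<^bsub>C\<^esub> x))\<rparr>"

definition dual_map :: "('k, 'l) ring_scheme \<Rightarrow> ('k, 'a, 'y) module_scheme \<Rightarrow>
    ('a, 'b, 'z) module_scheme \<Rightarrow> ('a, 'c, 'w) module_scheme \<Rightarrow>
    ('b \<Rightarrow> 'c) \<Rightarrow> ('c \<Rightarrow> 'k) \<Rightarrow> ('b \<Rightarrow> 'k)" where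
  "dual_map k A B C \<gamma> = (\<lambda>g\<in>carrier (dual k A C). compose (carrier B) g \<gamma>)"


section \<open>Filtered algebras and modules\<close>

record ('a, 'b) filt_module = "('a, 'b) module" +
  Fil :: "int \<Rightarrow> 'b set"

definition filtered_algebra :: "('k, 'l) ring_scheme \<Rightarrow> ('k, 'a, 'y) filt_module_scheme \<Rightarrow> bool" where
  "filtered_algebra k A \<longleftrightarrow> algebra k A \<and>
    (\<forall>m. ideal (Fil A m) A) \<and>
    (\<forall>m. Fil A (m + 1) \<subseteq> Fil A m) \<and>
    (\<forall>m\<le>0. Fil A m = carrier A) \<and>
    (\<forall>m n. \<forall>a\<in>Fil A m. \<forall>b\<in>Fil A n. a \<otimes>\<^bsub>A\<^esub> b \<in> Fil A (m + n))"

definition filtered_module ::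
  "('k, 'a, 'y) filt_module_scheme \<Rightarrow> ('a, 'c, 'z) filt_module_scheme \<Rightarrow> bool" where
  "filtered_module A C \<longleftrightarrow> module A C \<and>
    (\<forall>n. submodule (Fil C n) A C) \<and>
    (\<forall>n. Fil C (n + 1) \<subseteq> Fil C n) \<and>
    (\<forall>m n. \<forall>a\<in>Fil A m. \<forall>x\<in>Fil C n. a \<odot>\<^bsub>C\<^esub> x \<in> Fil C (m + n))"

definition finite_filtration :: "('a, 'c, 'z) filt_module_scheme \<Rightarrow> bool" where
  "finite_filtration C \<longleftrightarrow>
    (\<exists>N. \<forall>n\<le>N. Fil C n = carrier C) \<and> (\<exists>N. \<forall>n\<ge>N. Fil C n = {\<zero>\<^bsub>C\<^esub>})"

definition filt_hom :: "('a, 'r) ring_scheme \<Rightarrow>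
    ('a, 'b, 'y) filt_module_scheme \<Rightarrow> ('a, 'c, 'z) filt_module_scheme \<Rightarrow> ('b \<Rightarrow> 'c) set" where
  "filt_hom A B C = {f \<in> mod_hom A B C. \<forall>n. f ` Fil B n \<subseteq> Fil C n}"

text \<open>The quotient of \<open>Fil C n\<close> by \<open>Fil C (n + 1)\<close>, a module over the ring over which \<open>C\<close> is one.\<close>

definition gr_part :: "('a, 'c, 'z) filt_module_scheme \<Rightarrow> int \<Rightarrow> ('a, 'c set) module" where
  "gr_part C n =
    \<lparr>carrier = {Fil C (n + 1) +>\<^bsub>C\<^esub> x |x. x \<in> Fil C n},
     mult = undefined, one = undefined,
     zero = Fil C (n + 1),
     add = (\<lambda>X Y. X <+>\<^bsub>C\<^esub> Y),
     smult = (\<lambda>a X. Fil C (n + 1) +>\<^bsub>C\<^esub> (a \<odot>\<^bsub>C\<^esub> rep X))\<rparr>"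

definition AF :: "('k, 'l) ring_scheme \<Rightarrow> ('k, 'a, 'y) filt_module_scheme \<Rightarrow>
    ('c, \<lparr>smult :: 'a \<Rightarrow> 'c \<Rightarrow> 'c, Fil :: int \<Rightarrow> 'c set\<rparr>) mod_cat" where
  "AF k A = \<lparr>Obj = {C. filtered_module A C \<and> finite_filtration C \<and>
                       (\<forall>n. locally_free_const_rank k (restrict_scalars A (gr_part C n)))},
             Mor = filt_hom A\<rparr>"

definition filt_dual :: "('k, 'l) ring_scheme \<Rightarrow> ('k, 'a, 'y) module_scheme \<Rightarrow>
    ('a, 'c, 'z) filt_module_scheme \<Rightarrow> ('a, 'c \<Rightarrow> 'k) filt_module" where
  "filt_dual k A C = module.extend (dual k A C)
    \<lparr>Fil = (\<lambda>p. {f \<in> carrier (dual k A C). \<forall>x\<in>Fil C (1 - p). f x = \<zero>\<^bsub>k\<^esub>})\<rparr>"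

definition filt_Hom :: "('a, 'r) ring_scheme \<Rightarrow> ('a, 'b, 'y) filt_module_scheme \<Rightarrow>
    ('a, 'c, 'z) filt_module_scheme \<Rightarrow> ('a, 'b \<Rightarrow> 'c) filt_module" where
  "filt_Hom A B C =
    \<lparr>carrier = mod_hom A B C,
     mult = undefined, one = undefined,
     zero = hom_zero B C,
     add = hom_add B C,
     smult = (\<lambda>a f. \<lambda>x\<in>carrier B. a \<odot>\<^bsub>C\<^esub> f x),
     Fil = (\<lambda>p. {f \<in> mod_hom A B C. \<forall>n. f ` Fil B n \<subseteq> Fil C (n + p)})\<rparr>"


section \<open>Graded modules and associated graded objects\<close>

record ('a, 'b) graded_module = "('a, 'b) module" +
  Deg :: "int \<Rightarrow> 'b set"

definition is_graded_module ::
  "('k, 'r, 'y) graded_module_scheme \<Rightarrow> ('r, 'c, 'z) graded_module_scheme \<Rightarrow> bool" where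
  "is_graded_module R C \<longleftrightarrow> module R C \<and>
    (\<forall>n. additive_subgroup (Deg C n) C) \<and>
    (\<forall>x\<in>carrier C. \<exists>!y. (\<forall>n. y n \<in> Deg C n) \<and> finite {n. y n \<noteq> \<zero>\<^bsub>C\<^esub>} \<and>
       x = (\<Oplus>\<^bsub>C\<^esub>n\<in>{n. y n \<noteq> \<zero>\<^bsub>C\<^esub>}. y n)) \<and>
    (\<forall>m n. \<forall>a\<in>Deg R m. \<forall>x\<in>Deg C n. a \<odot>\<^bsub>C\<^esub> x \<in> Deg C (m + n))"

definition gr_hom :: "('r, 'y) ring_scheme \<Rightarrow>
    ('r, 'b, 'w) graded_module_scheme \<Rightarrow> ('r, 'c, 'z) graded_module_scheme \<Rightarrow> ('b \<Rightarrow> 'c) set" where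
  "gr_hom R B C = {f \<in> mod_hom R B C. \<forall>n. f ` Deg B n \<subseteq> Deg C n}"

definition AG :: "('k, 'l) ring_scheme \<Rightarrow> ('k, 'r, 'y) graded_module_scheme \<Rightarrow>
    ('c, \<lparr>smult :: 'r \<Rightarrow> 'c \<Rightarrow> 'c, Deg :: int \<Rightarrow> 'c set\<rparr>) mod_cat" where
  "AG k R = \<lparr>Obj = {C. is_graded_module R C \<and>
                       (\<forall>n. locally_free_const_rank k
                              ((restrict_scalars R C)\<lparr>carrier := Deg C n\<rparr>)) \<and>
                       finite {n. Deg C n \<noteq> {\<zero>\<^bsub>C\<^esub>}}},
             Mor = gr_hom R\<rparr>"

text \<open>The dual of \<open>Deg C (-q)\<close> is viewed inside the dual of \<open>C\<close> by extending functionals by zero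
  on the other homogeneous components.\<close>

definition gr_dual :: "('k, 'l) ring_scheme \<Rightarrow> ('k, 'r, 'y) module_scheme \<Rightarrow>
    ('r, 'c, 'z) graded_module_scheme \<Rightarrow> ('r, 'c \<Rightarrow> 'k) graded_module" where
  "gr_dual k R C = module.extend (dual k R C)
    \<lparr>Deg = (\<lambda>q. {f \<in> carrier (dual k R C). \<forall>n. n \<noteq> - q \<longrightarrow> (\<forall>x\<in>Deg C n. f x = \<zero>\<^bsub>k\<^esub>)})\<rparr>"

text \<open>Elements of the direct sum of the quotients \<open>gr_part C n\<close> are families of cosets, almost all
  of them zero. The homogeneous components of a product are finite sums of products of cosets.\<close>

definition gr_carrier :: "('a, 'c, 'z) filt_module_scheme \<Rightarrow> (int \<Rightarrow> 'c set) set" where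
  "gr_carrier C = {x. (\<forall>n. x n \<in> carrier (gr_part C n)) \<and>
                      finite {n. x n \<noteq> \<zero>\<^bsub>gr_part C n\<^esub>}}"

definition gr_degree :: "('a, 'c, 'z) filt_module_scheme \<Rightarrow> int \<Rightarrow> (int \<Rightarrow> 'c set) set" where
  "gr_degree C n = {x \<in> gr_carrier C. \<forall>m. m \<noteq> n \<longrightarrow> x m = \<zero>\<^bsub>gr_part C m\<^esub>}"

definition gr_algebra ::
  "('k, 'a, 'y) filt_module_scheme \<Rightarrow> ('k, int \<Rightarrow> 'a set) graded_module" where
  "gr_algebra A =
    \<lparr>carrier = gr_carrier A,
     mult = (\<lambda>x y n. Fil A (n + 1) +>\<^bsub>A\<^esub>
       (\<Oplus>\<^bsub>A\<^esub>i\<in>{i. x i \<noteq> \<zero>\<^bsub>gr_part A i\<^esub>}. rep (x i) \<otimes>\<^bsub>A\<^esub> rep (y (n - i)))),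
     one = (\<lambda>n. if n = 0 then Fil A 1 +>\<^bsub>A\<^esub> \<one>\<^bsub>A\<^esub> else \<zero>\<^bsub>gr_part A n\<^esub>),
     zero = (\<lambda>n. \<zero>\<^bsub>gr_part A n\<^esub>),
     add = (\<lambda>x y n. x n \<oplus>\<^bsub>gr_part A n\<^esub> y n),
     smult = (\<lambda>c x n. c \<odot>\<^bsub>gr_part A n\<^esub> x n),
     Deg = gr_degree A\<rparr>"

definition gr_module :: "('k, 'a, 'y) filt_module_scheme \<Rightarrow> ('a, 'c, 'z) filt_module_scheme \<Rightarrow>
    (int \<Rightarrow> 'a set, int \<Rightarrow> 'c set) graded_module" where
  "gr_module A C =
    \<lparr>carrier = gr_carrier C,
     mult = undefined, one = undefined,
     zero = (\<lambda>n. \<zero>\<^bsub>gr_part C n\<^esub>),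
     add = (\<lambda>x y n. x n \<oplus>\<^bsub>gr_part C n\<^esub> y n),
     smult = (\<lambda>a x n. Fil C (n + 1) +>\<^bsub>C\<^esub>
       (\<Oplus>\<^bsub>C\<^esub>i\<in>{i. a i \<noteq> \<zero>\<^bsub>gr_part A i\<^esub>}. rep (a i) \<odot>\<^bsub>C\<^esub> rep (x (n - i)))),
     Deg = gr_degree C\<rparr>"

definition gr_map :: "('a, 'b, 'y) filt_module_scheme \<Rightarrow> ('a, 'c, 'z) filt_module_scheme \<Rightarrow>
    ('b \<Rightarrow> 'c) \<Rightarrow> (int \<Rightarrow> 'b set) \<Rightarrow> (int \<Rightarrow> 'c set)" where
  "gr_map B C f = (\<lambda>x\<in>gr_carrier B. \<lambda>n. Fil C (n + 1) +>\<^bsub>C\<^esub> f (rep (x n)))"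

text \<open>The canonical map from the associated graded module of the dual to the dual of the associated
  graded module: the class in degree \<open>q\<close> of a functional \<open>f\<close> vanishing on \<open>Fil C (1 - q)\<close> acts on the
  quotient of \<open>Fil C (-q)\<close> by \<open>Fil C (1 - q)\<close>.\<close>

definition gr_dual_comparison :: "('k, 'l) ring_scheme \<Rightarrow> ('k, 'a, 'y) filt_module_scheme \<Rightarrow>
    ('a, 'c, 'z) filt_module_scheme \<Rightarrow> (int \<Rightarrow> ('c \<Rightarrow> 'k) set) \<Rightarrow> (int \<Rightarrow> 'c set) \<Rightarrow> 'k" where
  "gr_dual_comparison k A C =
    (\<lambda>\<phi>\<in>gr_carrier (filt_dual k A C). \<lambda>x\<in>gr_carrier C.
       \<Oplus>\<^bsub>k\<^esub>q\<in>{q. \<phi> q \<noteq> \<zero>\<^bsub>gr_part (filt_dual k A C) q\<^esub>}. rep (\<phi> q) (rep (x (- q))))"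

end

theory Submission
  imports Defs
begin

text \<open>Over a Noetherian ring \<open>k\<close>, a quotient \<open>L / N\<close> of submodules is locally free of rank \<open>r\<close> if and
  only if at every prime it has a basis and a dual basis up to a denominator: elements \<open>e i\<close> of \<open>L\<close> and
  functionals \<open>\<phi> i\<close> on \<open>L\<close> that vanish on \<open>N\<close>, with \<open>\<phi> i (e j) = s \<delta> i j\<close> and \<open>s x - \<Sum>i. \<phi> i x e i\<close> in
  \<open>N\<close> for some \<open>s\<close> outside the prime. The Noetherian hypothesis makes the denominators uniform. For such
  quotients, the scalars \<open>c\<close> for which \<open>c\<close> times a functional on \<open>N\<close> extends to \<open>L\<close>, or \<open>c\<close> times an
  element of the double dual is an evaluation, form an ideal that lies in no prime and so contains \<open>1\<close>.
  Hence functionals extend and evaluation is an isomorphism onto the double dual.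

  Applied to the steps of a filtration, the same facts show that evaluation is strictly compatible with
  filtrations, and that a functional on the quotient of \<open>Fil C (-q)\<close> by \<open>Fil C (1 - q)\<close> comes from one
  on \<open>C\<close>, which gives the comparison isomorphism for associated graded modules. A homomorphism \<open>\<gamma>\<close> from
  the dual of \<open>C\<close> to the dual of \<open>B\<close> is the dual of the map sending \<open>x\<close> to the element at which
  \<open>f \<mapsto> \<gamma> f x\<close> is the evaluation.\<close>

section \<open>Modules, homomorphisms and additive categories\<close>

text \<open>Freeness over the localization of \<open>k\<close> at \<open>f\<close> is restated over
  \<open>k\<close> itself, with a denominator in place of an inverse. This lets data found near one
  prime be combined with data found near another, by the ideal argument of
  \<open>local_global\<close>. A local basis yields coordinates only after multiplying by a power of
  \<open>f\<close> that depends on the element, and they are unique only up to torsion.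
  Quasi-compactness of the spectrum gives finitely many generators, hence one exponent for the first
  defect; the annihilators of the powers of \<open>f\<close> in \<open>k\<close> form an ascending
  chain that stabilizes, which settles the second. Pairs of submodules stand for quotients because
  dualizing turns a pair into the reversed pair of annihilators. The index \<open>1 - p\<close> in
  the filtration of a dual comes from this, and homogeneous parts fit in as steps of a chain of
  kernels of component maps. The associated graded objects are defined by picking representatives of
  cosets. Computations use finitely supported families of elements instead: products become
  convolutions and the comparison map becomes a pairing.\<close>

lemma mod_homI:
  assumes "\<And>x. x \<in> carrier M \<Longrightarrow> f x \<in> carrier N" "f \<in> extensional (carrier M)"
    "\<And>x y. x \<in> carrier M \<Longrightarrow> y \<in> carrier M \<Longrightarrow> f (x \<oplus>\<^bsub>M\<^esub> y) = f x \<oplus>\<^bsub>N\<^esub> f y"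
    "\<And>r x. r \<in> carrier R \<Longrightarrow> x \<in> carrier M \<Longrightarrow> f (r \<odot>\<^bsub>M\<^esub> x) = r \<odot>\<^bsub>N\<^esub> f x"
  shows "f \<in> mod_hom R M N"
  using assms by (auto simp: mod_hom_def PiE_def)

lemma
  assumes "f \<in> mod_hom R M N"
  shows mod_hom_closed: "x \<in> carrier M \<Longrightarrow> f x \<in> carrier N"
    and mod_hom_ext: "f \<in> extensional (carrier M)"
    and mod_hom_add: "x \<in> carrier M \<Longrightarrow> y \<in> carrier M \<Longrightarrow> f (x \<oplus>\<^bsub>M\<^esub> y) = f x \<oplus>\<^bsub>N\<^esub> f y"
    and mod_hom_smult: "r \<in> carrier R \<Longrightarrow> x \<in> carrier M \<Longrightarrow> f (r \<odot>\<^bsub>M\<^esub> x) = r \<odot>\<^bsub>N\<^esub> f x"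
  using assms by (auto simp: mod_hom_def PiE_def)

lemma additive_map_zero:
  assumes "abelian_group M" "abelian_group N" "f \<zero>\<^bsub>M\<^esub> \<in> carrier N"
    "f (\<zero>\<^bsub>M\<^esub> \<oplus>\<^bsub>M\<^esub> \<zero>\<^bsub>M\<^esub>) = f \<zero>\<^bsub>M\<^esub> \<oplus>\<^bsub>N\<^esub> f \<zero>\<^bsub>M\<^esub>"
  shows "f \<zero>\<^bsub>M\<^esub> = \<zero>\<^bsub>N\<^esub>"
proof -
  interpret M: abelian_group M by fact
  interpret N: abelian_group N by fact
  show ?thesis using assms(3,4) by (simp add: N.add.l_cancel_one)
qed

lemma mod_hom_zero:
  assumes "f \<in> mod_hom R M N" "abelian_group M" "abelian_group N"
  shows "f \<zero>\<^bsub>M\<^esub> = \<zero>\<^bsub>N\<^esub>"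
proof -
  interpret M: abelian_group M by fact
  show ?thesis
    using additive_map_zero[OF assms(2,3)] mod_hom_closed[OF assms(1)] mod_hom_add[OF assms(1)]
    by blast
qed

text \<open>Filtered and graded duals, products and zero objects are records extending plain ones.
  Being a module, and the set of homomorphisms, depend only on these four fields, so results about
  \<open>dual\<close> and \<open>prod_module\<close> carry over to the extended records.\<close>

definition same_module ::
  "('a, 'b, 'y) module_scheme \<Rightarrow> ('a, 'b, 'z) module_scheme \<Rightarrow> bool" where
  "same_module M N \<longleftrightarrow> carrier M = carrier N \<and> add M = add N \<and> zero M = zero N \<and> smult M = smult N"

lemma abelian_group_cong:
  assumes "abelian_group M" "carrier N = carrier M" "add N = add M" "zero N = zero M"
  shows "abelian_group N"
  using abelian_groupE[OF assms(1)] by (intro abelian_groupI) (auto simp: assms(2-))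

lemma module_same:
  assumes "module R M" "same_module M N"
  shows "module R N"
proof -
  interpret module R M by fact
  have eq: "carrier N = carrier M" "add N = add M" "zero N = zero M" "smult N = smult M"
    using assms(2) by (auto simp: same_module_def)
  show ?thesis
    by (intro moduleI abelian_group_cong[OF M.abelian_group_axioms])
      (simp_all add: eq R.is_cring smult_l_distr smult_r_distr smult_assoc1)
qed

lemma additive_subgroupI':
  assumes "abelian_group M" "H \<subseteq> carrier M" "\<zero>\<^bsub>M\<^esub> \<in> H"
    "\<And>x y. x \<in> H \<Longrightarrow> y \<in> H \<Longrightarrow> x \<oplus>\<^bsub>M\<^esub> y \<in> H" "\<And>x. x \<in> H \<Longrightarrow> \<ominus>\<^bsub>M\<^esub> x \<in> H"
  shows "additive_subgroup H M"
proof -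
  interpret M: abelian_group M by fact
  show ?thesis
    by (intro additive_subgroupI M.add.subgroupI) (use assms in auto)
qed

lemma submodule_additive_subgroup: "submodule H R M \<Longrightarrow> additive_subgroup H M"
  by (simp add: additive_subgroupI submodule.axioms(1))

text \<open>\<open>fam_hom\<close> treats plain, filtered and graded homomorphisms uniformly, as homomorphisms that
  preserve a family of subgroups: all members of the family are the carrier in the plain case.\<close>

definition fam_hom :: "('a, 'r) ring_scheme \<Rightarrow> (('a, 'b, 'y) module_scheme \<Rightarrow> 'i \<Rightarrow> 'b set) \<Rightarrow>
    (('a, 'c, 'z) module_scheme \<Rightarrow> 'i \<Rightarrow> 'c set) \<Rightarrow>
    ('a, 'b, 'y) module_scheme \<Rightarrow> ('a, 'c, 'z) module_scheme \<Rightarrow> ('b \<Rightarrow> 'c) set" where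
  "fam_hom R S T M N = {f \<in> mod_hom R M N. \<forall>n. f ` S M n \<subseteq> T N n}"

definition carrier_family :: "('a, 'b, 'y) module_scheme \<Rightarrow> int \<Rightarrow> 'b set" where
  "carrier_family M n = carrier M"

lemma mod_hom_eq_fam_hom: "mod_hom R = fam_hom R carrier_family carrier_family"
  by (intro ext) (auto simp: fam_hom_def carrier_family_def mod_hom_def)

lemma filt_hom_eq_fam_hom: "filt_hom R = fam_hom R Fil Fil"
  by (intro ext) (auto simp: fam_hom_def filt_hom_def)

lemma gr_hom_eq_fam_hom: "gr_hom R = fam_hom R Deg Deg"
  by (intro ext) (auto simp: fam_hom_def gr_hom_def)

lemma ident_mod_hom: "module R M \<Longrightarrow> ident M \<in> mod_hom R M M"
  by (auto simp: ident_def mod_hom_def module.smult_closed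
      module.axioms(2) abelian_group.axioms(1) abelian_monoid.a_closed)

lemma compose_mod_hom:
  assumes "f \<in> mod_hom R M N" "g \<in> mod_hom R N P" "module R M"
  shows "compose (carrier M) g f \<in> mod_hom R M P"
proof -
  interpret module R M by fact
  show ?thesis
    by (rule mod_homI) (use assms(1,2) in \<open>auto simp: compose_eq mod_hom_closed mod_hom_add mod_hom_smult\<close>)
qed

lemma hom_add_mod_hom:
  assumes "f \<in> mod_hom R M N" "g \<in> mod_hom R M N" "module R M" "module R N"
  shows "hom_add M N f g \<in> mod_hom R M N"
proof -
  interpret M: module R M by fact
  interpret N: module R N by fact
  show ?thesis
    by (rule mod_homI)
      (use assms(1,2) in \<open>auto simp: hom_add_def mod_hom_closed mod_hom_add mod_hom_smult
         N.smult_r_distr N.a_ac\<close>)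
qed

lemma hom_zero_mod_hom:
  assumes "module R M" "module R N"
  shows "hom_zero M N \<in> mod_hom R M N"
proof -
  interpret M: module R M by fact
  interpret N: module R N by fact
  show ?thesis by (rule mod_homI) (auto simp: hom_zero_def)
qed

lemma hom_minus_mod_hom:
  assumes "f \<in> mod_hom R M N" "module R M" "module R N"
  shows "(\<lambda>x\<in>carrier M. \<ominus>\<^bsub>N\<^esub> f x) \<in> mod_hom R M N"
proof -
  interpret M: module R M by fact
  interpret N: module R N by fact
  show ?thesis
    by (rule mod_homI)
      (use assms(1) in \<open>auto simp: mod_hom_closed mod_hom_add mod_hom_smult N.smult_r_minus N.minus_add\<close>)
qed

text \<open>The closure hypotheses on \<open>H\<close> admit any subgroup of the homomorphisms: the
  lemma serves both the morphism sets of the categories and the full module of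
  homomorphisms.\<close>

lemma abelian_group_mod_hom:
  assumes "module R M" "module R N"
    "H \<subseteq> mod_hom R M N" "hom_zero M N \<in> H"
    "\<And>f g. f \<in> H \<Longrightarrow> g \<in> H \<Longrightarrow> hom_add M N f g \<in> H"
    "\<And>f. f \<in> H \<Longrightarrow> (\<lambda>x\<in>carrier M. \<ominus>\<^bsub>N\<^esub> f x) \<in> H"
  shows "comm_group \<lparr>carrier = H, mult = hom_add M N, one = hom_zero M N\<rparr>"
proof -
  interpret M: module R M by fact
  interpret N: module R N by fact
  have H: "f x \<in> carrier N" "f \<in> extensional (carrier M)" if "f \<in> H" "x \<in> carrier M" for f x
    using assms(3) that mod_hom_closed[of f R M N x] mod_hom_ext[of f R M N] by auto
  have e: "f \<in> extensional (carrier M)" if "f \<in> H" for f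
    using assms(3) that mod_hom_ext by blast
  show ?thesis
  proof (rule comm_groupI; simp)
    fix f g h assume f: "f \<in> H" and g: "g \<in> H"
    show "hom_add M N f g \<in> H" using assms(5) f g .
    show "hom_add M N f g = hom_add M N g f"
      using f g by (auto simp: hom_add_def restrict_def H N.a_comm)
    assume h: "h \<in> H"
    show "hom_add M N (hom_add M N f g) h = hom_add M N f (hom_add M N g h)"
      using f g h by (auto simp: hom_add_def restrict_def H N.a_assoc)
  next
    fix f assume f: "f \<in> H"
    show "hom_add M N (hom_zero M N) f = f"
      by (rule extensionalityI[OF _ e[OF f]]) (use f in \<open>auto simp: hom_add_def hom_zero_def H\<close>)
    show "\<exists>g\<in>H. hom_add M N g f = hom_zero M N"
      by (rule bexI[OF _ assms(6)[OF f]])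
        (use f in \<open>auto simp: hom_add_def hom_zero_def H N.l_neg restrict_def\<close>)
  qed (rule assms(4))
qed

section \<open>Products of modules and the additive structure of the categories\<close>

definition prod_module ::
  "('a, 'b, 'y) module_scheme \<Rightarrow> ('a, 'c, 'z) module_scheme \<Rightarrow> ('a, 'b \<times> 'c) module" where
  "prod_module M N =
    \<lparr>carrier = carrier M \<times> carrier N, mult = undefined, one = undefined,
     zero = (\<zero>\<^bsub>M\<^esub>, \<zero>\<^bsub>N\<^esub>),
     add = (\<lambda>x y. (fst x \<oplus>\<^bsub>M\<^esub> fst y, snd x \<oplus>\<^bsub>N\<^esub> snd y)),
     smult = (\<lambda>a x. (a \<odot>\<^bsub>M\<^esub> fst x, a \<odot>\<^bsub>N\<^esub> snd x))\<rparr>"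

lemma module_prod_module:
  assumes "module R M" "module R N"
  shows "module R (prod_module M N)"
proof -
  interpret M: module R M by fact
  interpret N: module R N by fact
  have neg: "\<exists>y\<in>carrier M \<times> carrier N. fst y \<oplus>\<^bsub>M\<^esub> fst x = \<zero>\<^bsub>M\<^esub> \<and> snd y \<oplus>\<^bsub>N\<^esub> snd x = \<zero>\<^bsub>N\<^esub>"
    if "x \<in> carrier M \<times> carrier N" for x
    by (rule bexI[of _ "(\<ominus>\<^bsub>M\<^esub> fst x, \<ominus>\<^bsub>N\<^esub> snd x)"]) (use that in \<open>auto simp: M.l_neg N.l_neg\<close>)
  show ?thesis
    by (intro moduleI abelian_groupI)
      (use neg in \<open>auto simp: prod_module_def M.R.is_cring M.a_ac N.a_ac M.smult_l_distr N.smult_l_distr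
        M.smult_r_distr N.smult_r_distr M.smult_assoc1 N.smult_assoc1\<close>)
qed

lemma category_fam_hom:
  fixes X :: "('c, \<lparr>smult :: 'a \<Rightarrow> 'c \<Rightarrow> 'c, \<dots> :: 'z\<rparr>) mod_cat"
  assumes "Mor X = fam_hom A S S" "\<And>C. C \<in> Obj X \<Longrightarrow> module A C"
    "\<And>C n. C \<in> Obj X \<Longrightarrow> S C n \<subseteq> carrier C"
  shows "category X"
  unfolding category_def assms(1)
proof (intro conjI ballI)
  fix B C assume "B \<in> Obj X" "C \<in> Obj X"
  show "fam_hom A S S B C \<subseteq> carrier B \<rightarrow>\<^sub>E carrier C"
    by (auto simp: fam_hom_def mod_hom_def)
next
  fix C assume "C \<in> Obj X"
  then show "ident C \<in> fam_hom A S S C C"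
    using ident_mod_hom[OF assms(2)] assms(3) by (auto simp: fam_hom_def ident_def dest: subsetD)
next
  fix B C D f g
  assume "B \<in> Obj X" "C \<in> Obj X" "D \<in> Obj X" "f \<in> fam_hom A S S B C" "g \<in> fam_hom A S S C D"
  moreover from this have "compose (carrier B) g f \<in> mod_hom A B D"
    using compose_mod_hom[OF _ _ assms(2)] by (auto simp: fam_hom_def)
  ultimately show "compose (carrier B) g f \<in> fam_hom A S S B D"
    using assms(3)[of B] by (auto simp: fam_hom_def compose_def image_subset_iff dest: subsetD)
qed

lemma fam_homI: "f \<in> mod_hom R M N \<Longrightarrow> (\<And>n x. x \<in> S M n \<Longrightarrow> f x \<in> T N n) \<Longrightarrow> f \<in> fam_hom R S T M N"
  by (auto simp: fam_hom_def)

lemma fam_hom_mod_hom: "f \<in> fam_hom R S T M N \<Longrightarrow> f \<in> mod_hom R M N"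
  by (simp add: fam_hom_def)

lemma fam_hom_mem: "f \<in> fam_hom R S T M N \<Longrightarrow> x \<in> S M n \<Longrightarrow> f x \<in> T N n"
  by (auto simp: fam_hom_def)

text \<open>The additive structure is pointwise. The biproduct is the product module with the
  product of the two families, which is what makes both injections and both projections preserve the
  families; any one-element module is a zero object, as its family can only consist of zero.\<close>

lemma additive_category_fam_hom:
  fixes X :: "('c, \<lparr>smult :: 'a \<Rightarrow> 'c \<Rightarrow> 'c, \<dots> :: 'z\<rparr>) mod_cat"
    and X2 :: "('c \<times> 'c, \<lparr>smult :: 'a \<Rightarrow> 'c \<times> 'c \<Rightarrow> 'c \<times> 'c, \<dots> :: 'w\<rparr>) mod_cat"
  assumes Mor: "Mor X = fam_hom A S S"
    and mod: "\<And>C. C \<in> Obj X \<Longrightarrow> module A C"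
    and sub: "\<And>C n. C \<in> Obj X \<Longrightarrow> additive_subgroup (S C n) C"
    and zero: "\<exists>Z\<in>Obj X. carrier Z = {\<zero>\<^bsub>Z\<^esub>}"
    and prod: "\<And>B C. B \<in> Obj X \<Longrightarrow> C \<in> Obj X \<Longrightarrow>
      \<exists>P\<in>Obj X2. same_module (prod_module B C) P \<and> (\<forall>n. T P n = S B n \<times> S C n)"
  shows "additive_category X X2 (fam_hom A S T) (fam_hom A T S)"
  unfolding additive_category_def
proof (intro conjI ballI)
  have sub_carrier: "S C n \<subseteq> carrier C" if "C \<in> Obj X" for C n
    using additive_subgroup.a_subset[OF sub[OF that]] .
  show "category X"
    using category_fam_hom[OF Mor mod sub_carrier] .
next
  fix B C assume B: "B \<in> Obj X" and C: "C \<in> Obj X"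
  interpret B: module A B using mod[OF B] .
  interpret C: module A C using mod[OF C] .
  have [simp]: "x \<in> carrier B" if "x \<in> S B n" for x n
    using additive_subgroup.a_subset[OF sub[OF B]] that by blast
  note h = B.module_axioms C.module_axioms
  show "comm_group \<lparr>carrier = Mor X B C, mult = hom_add B C, one = hom_zero B C\<rparr>"
    by (rule abelian_group_mod_hom[OF h])
      (auto simp: Mor fam_hom_def hom_zero_mod_hom[OF h] hom_add_mod_hom[OF _ _ h] hom_minus_mod_hom[OF _ h],
        auto simp: hom_zero_def hom_add_def image_subset_iff
          additive_subgroup.zero_closed[OF sub[OF C]] additive_subgroup.a_closed[OF sub[OF C]]
          additive_subgroup.a_inv_closed[OF sub[OF C]])
next
  fix B C D f f' g g'
  assume obj: "B \<in> Obj X" "C \<in> Obj X" "D \<in> Obj X"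
    and "f \<in> Mor X B C" "f' \<in> Mor X B C" "g \<in> Mor X C D" "g' \<in> Mor X C D"
  then have m: "f \<in> mod_hom A B C" "f' \<in> mod_hom A B C" "g \<in> mod_hom A C D" "g' \<in> mod_hom A C D"
    by (auto simp: Mor fam_hom_def)
  show "compose (carrier B) g (hom_add B C f f') =
         hom_add B D (compose (carrier B) g f) (compose (carrier B) g f')"
    using m by (auto simp: compose_def hom_add_def restrict_def mod_hom_closed mod_hom_add)
  show "compose (carrier B) (hom_add C D g g') f =
         hom_add B D (compose (carrier B) g f) (compose (carrier B) g' f)"
    using m by (auto simp: compose_def hom_add_def restrict_def mod_hom_closed mod_hom_add)
next
  from zero obtain Z where Z: "Z \<in> Obj X" "carrier Z = {\<zero>\<^bsub>Z\<^esub>}" by blast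
  show "\<exists>Z\<in>Obj X. \<forall>C\<in>Obj X. Mor X Z C = {hom_zero Z C} \<and> Mor X C Z = {hom_zero C Z}"
  proof (intro bexI[OF _ Z(1)] ballI conjI)
    fix C assume C: "C \<in> Obj X"
    have SZ: "x = \<zero>\<^bsub>Z\<^esub>" if "x \<in> S Z n" for x n
      using additive_subgroup.a_subset[OF sub[OF Z(1)]] Z(2) that by blast
    have SC: "x \<in> carrier C" if "x \<in> S C n" for x n
      using additive_subgroup.a_subset[OF sub[OF C]] that by blast
    have [simp]: "\<zero>\<^bsub>C\<^esub> \<in> S C n" "\<zero>\<^bsub>Z\<^esub> \<in> S Z n" for n
      using sub[OF C] sub[OF Z(1)] by (simp_all add: additive_subgroup.zero_closed)
    have ab: "abelian_group Z" "abelian_group C"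
      using mod[OF Z(1)] mod[OF C] by (simp_all add: module.axioms)
    have "f = hom_zero Z C" if "f \<in> mod_hom A Z C" for f
      using mod_hom_zero[OF that ab] mod_hom_ext[OF that]
      by (intro extensionalityI[of _ "carrier Z"]) (auto simp: hom_zero_def Z)
    moreover have "hom_zero Z C \<in> fam_hom A S S Z C"
      by (rule fam_homI[OF hom_zero_mod_hom[OF mod[OF Z(1)] mod[OF C]]])
        (simp add: hom_zero_def Z SZ)
    ultimately show "Mor X Z C = {hom_zero Z C}"
      using fam_hom_mod_hom unfolding Mor by blast
    have "f = hom_zero C Z" if "f \<in> mod_hom A C Z" for f
      using mod_hom_ext[OF that] mod_hom_closed[OF that]
      by (intro extensionalityI[of _ "carrier C"]) (auto simp: hom_zero_def Z)
    moreover have "hom_zero C Z \<in> fam_hom A S S C Z"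
      by (rule fam_homI[OF hom_zero_mod_hom[OF mod[OF C] mod[OF Z(1)]]])
        (simp add: hom_zero_def SC)
    ultimately show "Mor X C Z = {hom_zero C Z}"
      using fam_hom_mod_hom unfolding Mor by blast
  qed
next
  fix B C assume B: "B \<in> Obj X" and C: "C \<in> Obj X"
  interpret B: module A B using mod[OF B] .
  interpret C: module A C using mod[OF C] .
  obtain P where P: "P \<in> Obj X2" "same_module (prod_module B C) P" and T: "\<And>n. T P n = S B n \<times> S C n"
    using prod[OF B C] by auto
  have [simp]: "carrier P = carrier B \<times> carrier C"
    "add P = (\<lambda>x y. (fst x \<oplus>\<^bsub>B\<^esub> fst y, snd x \<oplus>\<^bsub>C\<^esub> snd y))"
    "smult P = (\<lambda>a x. (a \<odot>\<^bsub>B\<^esub> fst x, a \<odot>\<^bsub>C\<^esub> snd x))"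
    using P(2) by (auto simp: same_module_def prod_module_def)
  have [simp]: "x \<in> carrier B" if "x \<in> S B n" for x n
    using additive_subgroup.a_subset[OF sub[OF B]] that by blast
  have [simp]: "x \<in> carrier C" if "x \<in> S C n" for x n
    using additive_subgroup.a_subset[OF sub[OF C]] that by blast
  have [simp]: "\<zero>\<^bsub>B\<^esub> \<in> S B n" "\<zero>\<^bsub>C\<^esub> \<in> S C n" for n
    using sub[OF B] sub[OF C] by (simp_all add: additive_subgroup.zero_closed)
  define i j p q where "i = (\<lambda>x\<in>carrier B. (x, \<zero>\<^bsub>C\<^esub>))" and "j = (\<lambda>y\<in>carrier C. (\<zero>\<^bsub>B\<^esub>, y))"
    and "p = (\<lambda>z\<in>carrier P. fst z)" and "q = (\<lambda>z\<in>carrier P. snd z)"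
  note ijpq = i_def j_def p_def q_def
  have maps: "i \<in> fam_hom A S T B P" "j \<in> fam_hom A S T C P" "p \<in> fam_hom A T S P B" "q \<in> fam_hom A T S P C"
    by (intro fam_homI mod_homI; auto simp: ijpq T)+
  show "\<exists>P\<in>Obj X2. \<exists>i\<in>fam_hom A S T B P. \<exists>j\<in>fam_hom A S T C P. \<exists>p\<in>fam_hom A T S P B. \<exists>q\<in>fam_hom A T S P C.
       compose (carrier B) p i = ident B \<and> compose (carrier C) q j = ident C \<and>
       compose (carrier B) q i = hom_zero B C \<and> compose (carrier C) p j = hom_zero C B \<and>
       hom_add P P (compose (carrier P) i p) (compose (carrier P) j q) = ident P"
    by (intro bexI[OF _ P(1)] bexI[OF _ maps(1)] bexI[OF _ maps(2)] bexI[OF _ maps(3)] bexI[OF _ maps(4)] conjI)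
      (auto simp: ijpq compose_def ident_def hom_zero_def hom_add_def restrict_def)
qed

section \<open>Ideals and prime ideals\<close>

context cring
begin

text \<open>Negatives come from multiplying by \<open>\<ominus> \<one>\<close>, so a set of
  admissible denominators only has to be checked for zero, sums and multiples.\<close>

lemma ideal_of_closed:
  assumes "J \<subseteq> carrier R" "\<zero> \<in> J" "\<And>a b. a \<in> J \<Longrightarrow> b \<in> J \<Longrightarrow> a \<oplus> b \<in> J"
    "\<And>c a. c \<in> carrier R \<Longrightarrow> a \<in> J \<Longrightarrow> c \<otimes> a \<in> J"
  shows "ideal J R"
proof (rule idealI)
  have "\<ominus> a \<in> J" if "a \<in> J" for a
    using assms(4)[of "\<ominus> \<one>" a] that assms(1) by (auto simp: l_minus)
  then show "subgroup J (add_monoid R)"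
    using additive_subgroupI'[OF abelian_group_axioms assms(1-3)]
    by (simp add: additive_subgroup.a_subgroup)
  show "c \<otimes> a \<in> J" "a \<otimes> c \<in> J" if "a \<in> J" "c \<in> carrier R" for a c
    using that assms(1,4) m_comm[of a c] by auto
qed (rule ring_axioms)

text \<open>Zorn applies to the ideals above \<open>I\<close> that omit \<open>\<one>\<close>:
  omitting \<open>\<one>\<close> passes to unions of chains and is the same as being proper, so a
  maximal member is a maximal ideal and hence prime.\<close>

lemma prime_containing:
  assumes "ideal I R" "\<one> \<notin> I"
  obtains P where "primeideal P R" "I \<subseteq> P"
proof -
  define X where "X = {J. ideal J R \<and> I \<subseteq> J \<and> \<one> \<notin> J}"
  have "\<exists>M\<in>X. \<forall>J\<in>X. M \<subseteq> J \<longrightarrow> J = M"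
  proof (rule subset_Zorn_nonempty)
    show "X \<noteq> {}" using assms by (auto simp: X_def)
    fix C assume C: "C \<noteq> {}" "subset.chain X C"
    have "subset.chain {I. ideal I R} C"
      using C(2) by (auto simp: pred_on.chain_def X_def)
    from chain_Union_is_ideal[OF this] have "ideal (\<Union>C) R" using C(1) by simp
    then show "\<Union>C \<in> X"
      using C by (auto simp: X_def pred_on.chain_def)
  qed
  then obtain M where M: "M \<in> X" "\<And>J. J \<in> X \<Longrightarrow> M \<subseteq> J \<Longrightarrow> J = M" by blast
  then interpret M: ideal M R by (simp add: X_def)
  have "maximalideal M R"
  proof (rule maximalidealI)
    show "carrier R \<noteq> M" using M(1) by (auto simp: X_def)
    fix J assume J: "ideal J R" "M \<subseteq> J" "J \<subseteq> carrier R"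
    show "J = M \<or> J = carrier R"
    proof (cases "\<one> \<in> J")
      case True
      then show ?thesis using ideal.one_imp_carrier[OF J(1)] by simp
    next
      case False
      then show ?thesis using M J by (auto simp: X_def)
    qed
  qed (rule M.is_ideal)
  then have "primeideal M R" by (rule maximalideal_prime)
  with M(1) show thesis using that by (auto simp: X_def)
qed

text \<open>The local-to-global principle used throughout: \<open>J\<close> is the set of scalars
  for which some statement holds, and one such scalar outside each prime is enough to reach
  \<open>\<one>\<close>, because a proper ideal lies in a prime.\<close>

lemma local_global:
  assumes "J \<subseteq> carrier R" "\<zero> \<in> J" "\<And>a b. a \<in> J \<Longrightarrow> b \<in> J \<Longrightarrow> a \<oplus> b \<in> J"
    "\<And>c a. c \<in> carrier R \<Longrightarrow> a \<in> J \<Longrightarrow> c \<otimes> a \<in> J"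
    "\<And>P. primeideal P R \<Longrightarrow> \<exists>s\<in>J. s \<notin> P"
  shows "\<one> \<in> J"
proof (rule ccontr)
  assume "\<one> \<notin> J"
  then obtain P where "primeideal P R" "J \<subseteq> P"
    using prime_containing[OF ideal_of_closed[OF assms(1-4)]] by blast
  then show False using assms(5) by blast
qed

text \<open>Quasi-compactness of the spectrum: the basic open sets of the members of
  \<open>D\<close> cover it, so \<open>D\<close> generates the unit ideal, and \<open>\<one>\<close>
  already lies in the ideal generated by finitely many members.\<close>

lemma finite_cover_spectrum:
  assumes "D \<subseteq> carrier R" "\<And>P. primeideal P R \<Longrightarrow> \<exists>f\<in>D. f \<notin> P"
  obtains F where "finite F" "F \<subseteq> D" "\<And>P. primeideal P R \<Longrightarrow> \<exists>f\<in>F. f \<notin> P"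
proof -
  \<comment> \<open>Sums stay in \<open>J\<close> because the union of two finite subsets of
    \<open>D\<close> is again finite; no explicit linear combinations have to be written
    down.\<close>
  define J where "J = {a. \<exists>F. finite F \<and> F \<subseteq> D \<and> a \<in> Idl F}"
  have id: "ideal (Idl F) R" if "F \<subseteq> D" for F
    using that assms(1) by (intro genideal_ideal) blast
  have mono: "Idl F \<subseteq> Idl F'" if "F \<subseteq> F'" "F' \<subseteq> D" for F F'
    using that assms(1) by (intro subset_Idl_subset) auto
  have "\<one> \<in> J"
  proof (rule local_global)
    show "J \<subseteq> carrier R"
      using ideal.Icarr[OF id] by (auto simp: J_def)
    have "\<zero> \<in> Idl {}" using id[of "{}"] by (simp add: additive_subgroup.zero_closed ideal.axioms(1))
    then show "\<zero> \<in> J" by (auto simp: J_def)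
    show "a \<oplus> b \<in> J" if ab: "a \<in> J" "b \<in> J" for a b
    proof -
      from ab obtain F F' where F: "finite F" "F \<subseteq> D" "a \<in> Idl F" "finite F'" "F' \<subseteq> D" "b \<in> Idl F'"
        by (auto simp: J_def)
      have "a \<in> Idl (F \<union> F')" "b \<in> Idl (F \<union> F')"
        using mono[of F "F \<union> F'"] mono[of F' "F \<union> F'"] F by auto
      moreover have "ideal (Idl (F \<union> F')) R" using F by (intro id) auto
      ultimately have "a \<oplus> b \<in> Idl (F \<union> F')"
        by (simp add: additive_subgroup.a_closed ideal.axioms(1))
      then show ?thesis unfolding J_def using F by (auto intro!: exI[of _ "F \<union> F'"])
    qed
    show "c \<otimes> a \<in> J" if "c \<in> carrier R" "a \<in> J" for c a
      using that ideal.I_l_closed[OF id] by (auto simp: J_def)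
    fix P assume "primeideal P R"
    then obtain f where f: "f \<in> D" "f \<notin> P" using assms(2) by blast
    then have "f \<in> Idl {f}" using assms(1) by (intro genideal_self') auto
    with f show "\<exists>s\<in>J. s \<notin> P" by (auto simp: J_def intro!: bexI[of _ f] exI[of _ "{f}"])
  qed
  then obtain F where F: "finite F" "F \<subseteq> D" "\<one> \<in> Idl F" by (auto simp: J_def)
  show thesis
  proof (rule that[OF F(1,2)], rule ccontr)
    fix P assume P: "primeideal P R" and "\<not> (\<exists>f\<in>F. f \<notin> P)"
    then have "Idl F \<subseteq> P" by (intro genideal_minimal) (auto simp: primeideal.axioms)
    with F(3) have "\<one> \<in> P" by blast
    then show False
      using P primeideal.I_notcarr ideal.one_imp_carrier[of P R] primeideal.axioms(1) by metis
  qed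
qed

lemma prime_one: "primeideal P R \<Longrightarrow> \<one> \<notin> P"
  using primeideal.I_notcarr ideal.one_imp_carrier[of P R] primeideal.axioms(1) by metis

lemma prime_mult: "primeideal P R \<Longrightarrow> a \<in> carrier R - P \<Longrightarrow> b \<in> carrier R - P \<Longrightarrow> a \<otimes> b \<in> carrier R - P"
  using primeideal.I_prime by fastforce

lemma prime_pow: "primeideal P R \<Longrightarrow> a \<in> carrier R - P \<Longrightarrow> a [^] (n::nat) \<in> carrier R - P"
proof (induction n)
  case (Suc n)
  then show ?case using prime_mult[of P "a [^] n" a] by simp
qed (simp add: prime_one)

end

text \<open>The annihilators of the powers of \<open>f\<close> form an ascending chain of ideals. By
  the Noetherian property its union is a member of the chain, so one exponent kills all
  \<open>f\<close>-power torsion in the ring.\<close>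

lemma (in noetherian_ring) uniform_torsion_exponent:
  assumes "cring R" "f \<in> carrier R"
  obtains N :: nat where
    "\<And>c n. c \<in> carrier R \<Longrightarrow> f [^] (n::nat) \<otimes> c = \<zero> \<Longrightarrow> f [^] N \<otimes> c = \<zero>"
proof -
  interpret cring R by fact
  define T where "T n = {c \<in> carrier R. f [^] n \<otimes> c = \<zero>}" for n :: nat
  have T: "ideal (T n) R" for n
    by (rule ideal_of_closed) (auto simp: T_def assms(2) r_distr m_lcomm)
  have mono: "T m \<subseteq> T n" if "m \<le> n" for m n
  proof -
    have "f [^] n \<otimes> c = f [^] (n - m) \<otimes> (f [^] m \<otimes> c)" if "c \<in> carrier R" for c
      using that assms(2) \<open>m \<le> n\<close> by (simp add: nat_pow_mult m_assoc[symmetric])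
    then show ?thesis by (auto simp: T_def assms(2))
  qed
  have "\<Union>(range T) \<in> range T"
  proof (rule ideal_chain_is_trivial)
    have "T m \<subseteq> T n \<or> T n \<subseteq> T m" for m n
      using mono[of m n] mono[of n m] by linarith
    then show "subset.chain {I. ideal I R} (range T)"
      using T by (auto simp: pred_on.chain_def)
  qed simp
  then obtain N where "\<Union>(range T) = T N" by blast
  then show thesis by (intro that[of N]) (auto simp: T_def)
qed

section \<open>Finite linear combinations\<close>

lemma (in module) finsum_smult_diff:
  assumes "finite I" "e \<in> I \<rightarrow> carrier M" "c \<in> I \<rightarrow> carrier R" "d \<in> I \<rightarrow> carrier R"
  shows "(\<Oplus>\<^bsub>M\<^esub>i\<in>I. (c i \<ominus> d i) \<odot>\<^bsub>M\<^esub> e i) = (\<Oplus>\<^bsub>M\<^esub>i\<in>I. c i \<odot>\<^bsub>M\<^esub> e i) \<ominus>\<^bsub>M\<^esub> (\<Oplus>\<^bsub>M\<^esub>i\<in>I. d i \<odot>\<^bsub>M\<^esub> e i)"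
  using assms
proof (induction I rule: finite_induct)
  case empty
  then show ?case by (simp add: M.r_neg a_minus_def)
next
  case (insert i I)
  then have [simp]: "e i \<in> carrier M" "c i \<in> carrier R" "d i \<in> carrier R" by auto
  have h: "(\<lambda>i. c i \<odot>\<^bsub>M\<^esub> e i) \<in> I \<rightarrow> carrier M" "(\<lambda>i. d i \<odot>\<^bsub>M\<^esub> e i) \<in> I \<rightarrow> carrier M"
    "(\<lambda>i. (c i \<ominus> d i) \<odot>\<^bsub>M\<^esub> e i) \<in> I \<rightarrow> carrier M"
    using insert.prems by (auto simp: Pi_iff)
  have "(c i \<ominus> d i) \<odot>\<^bsub>M\<^esub> e i = c i \<odot>\<^bsub>M\<^esub> e i \<ominus>\<^bsub>M\<^esub> d i \<odot>\<^bsub>M\<^esub> e i"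
    by (simp add: a_minus_def smult_l_distr smult_l_minus)
  then show ?case
    using insert h by (simp add: a_minus_def M.minus_add M.a_ac)
qed

definition lin_span ::
  "('k, 'l) ring_scheme \<Rightarrow> ('k, 'm, 'z) module_scheme \<Rightarrow> ('i \<Rightarrow> 'm) \<Rightarrow> 'i set \<Rightarrow> 'm set" where
  "lin_span k M e I = {\<Oplus>\<^bsub>M\<^esub>i\<in>I. c i \<odot>\<^bsub>M\<^esub> e i |c. c \<in> I \<rightarrow> carrier k}"

context module
begin

lemma lin_span_subset: "e \<in> I \<rightarrow> carrier M \<Longrightarrow> lin_span R M e I \<subseteq> carrier M"
  by (auto simp: lin_span_def intro!: M.finsum_closed)

lemma lin_span_zero: "e \<in> I \<rightarrow> carrier M \<Longrightarrow> \<zero>\<^bsub>M\<^esub> \<in> lin_span R M e I"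
  by (auto simp: lin_span_def Pi_iff intro!: exI[of _ "\<lambda>i. \<zero>"] M.add.finprod_one_eqI[symmetric])

lemma lin_span_add:
  assumes "e \<in> I \<rightarrow> carrier M" "x \<in> lin_span R M e I" "y \<in> lin_span R M e I"
  shows "x \<oplus>\<^bsub>M\<^esub> y \<in> lin_span R M e I"
proof -
  from assms obtain c d where cd: "c \<in> I \<rightarrow> carrier R" "d \<in> I \<rightarrow> carrier R"
    "x = (\<Oplus>\<^bsub>M\<^esub>i\<in>I. c i \<odot>\<^bsub>M\<^esub> e i)" "y = (\<Oplus>\<^bsub>M\<^esub>i\<in>I. d i \<odot>\<^bsub>M\<^esub> e i)"
    by (auto simp: lin_span_def)
  have "x \<oplus>\<^bsub>M\<^esub> y = (\<Oplus>\<^bsub>M\<^esub>i\<in>I. c i \<odot>\<^bsub>M\<^esub> e i \<oplus>\<^bsub>M\<^esub> d i \<odot>\<^bsub>M\<^esub> e i)"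
    unfolding cd by (rule M.finsum_addf[symmetric]) (use assms cd in auto)
  also have "\<dots> = (\<Oplus>\<^bsub>M\<^esub>i\<in>I. (c i \<oplus> d i) \<odot>\<^bsub>M\<^esub> e i)"
    by (rule M.finsum_cong') (use assms cd in \<open>auto simp: smult_l_distr Pi_iff\<close>)
  finally show ?thesis
    using cd by (auto simp: lin_span_def intro!: exI[of _ "\<lambda>i. c i \<oplus> d i"])
qed

lemma lin_span_smult:
  assumes "finite I" "e \<in> I \<rightarrow> carrier M" "x \<in> lin_span R M e I" "a \<in> carrier R"
  shows "a \<odot>\<^bsub>M\<^esub> x \<in> lin_span R M e I"
proof -
  from assms obtain c where c: "c \<in> I \<rightarrow> carrier R" "x = (\<Oplus>\<^bsub>M\<^esub>i\<in>I. c i \<odot>\<^bsub>M\<^esub> e i)"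
    by (auto simp: lin_span_def)
  have "a \<odot>\<^bsub>M\<^esub> x = (\<Oplus>\<^bsub>M\<^esub>i\<in>I. a \<odot>\<^bsub>M\<^esub> (c i \<odot>\<^bsub>M\<^esub> e i))"
    unfolding c by (rule finsum_smult_ldistr) (use assms c in auto)
  also have "\<dots> = (\<Oplus>\<^bsub>M\<^esub>i\<in>I. (a \<otimes> c i) \<odot>\<^bsub>M\<^esub> e i)"
    by (rule M.finsum_cong') (use assms c in \<open>auto simp: smult_assoc1 Pi_iff\<close>)
  finally show ?thesis
    using c assms by (auto simp: lin_span_def intro!: exI[of _ "\<lambda>i. a \<otimes> c i"])
qed

lemma delta_combination:
  assumes "finite I" "e \<in> I \<rightarrow> carrier M" "j \<in> I" "a \<in> carrier R"
  shows "(\<Oplus>\<^bsub>M\<^esub>i\<in>I. (if i = j then a else \<zero>) \<odot>\<^bsub>M\<^esub> e i) = a \<odot>\<^bsub>M\<^esub> e j"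
proof -
  have "(\<Oplus>\<^bsub>M\<^esub>i\<in>I. (if i = j then a else \<zero>) \<odot>\<^bsub>M\<^esub> e i) = (\<Oplus>\<^bsub>M\<^esub>i\<in>I. if i = j then a \<odot>\<^bsub>M\<^esub> e i else \<zero>\<^bsub>M\<^esub>)"
    by (rule M.finsum_cong') (use assms in \<open>auto simp: Pi_iff\<close>)
  also have "\<dots> = a \<odot>\<^bsub>M\<^esub> e j"
    using M.add.finprod_singleton_swap[of j I "\<lambda>i. a \<odot>\<^bsub>M\<^esub> e i"] assms by (auto simp: Pi_iff)
  finally show ?thesis .
qed

lemma lin_span_base:
  assumes "finite I" "e \<in> I \<rightarrow> carrier M" "j \<in> I"
  shows "e j \<in> lin_span R M e I"
  using delta_combination[OF assms R.one_closed] assms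
  by (auto simp: lin_span_def Pi_iff intro!: exI[of _ "\<lambda>i. if i = j then \<one> else \<zero>"])

lemma lin_span_minimal:
  assumes "finite I" "\<And>i. i \<in> I \<Longrightarrow> e i \<in> H" "H \<subseteq> carrier M" "\<zero>\<^bsub>M\<^esub> \<in> H"
    "\<And>x y. x \<in> H \<Longrightarrow> y \<in> H \<Longrightarrow> x \<oplus>\<^bsub>M\<^esub> y \<in> H"
    "\<And>a x. a \<in> carrier R \<Longrightarrow> x \<in> H \<Longrightarrow> a \<odot>\<^bsub>M\<^esub> x \<in> H"
  shows "lin_span R M e I \<subseteq> H"
proof -
  have "(\<Oplus>\<^bsub>M\<^esub>i\<in>I. c i \<odot>\<^bsub>M\<^esub> e i) \<in> H" if "c \<in> I \<rightarrow> carrier R" for c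
    using assms(1,2) that
  proof (induction I rule: finite_induct)
    case (insert i I)
    have "(\<lambda>i. c i \<odot>\<^bsub>M\<^esub> e i) \<in> I \<rightarrow> carrier M" "c i \<odot>\<^bsub>M\<^esub> e i \<in> carrier M"
      using insert assms(3) by (auto intro!: smult_closed)
    then show ?case using insert assms by auto
  qed (simp add: assms)
  then show ?thesis by (auto simp: lin_span_def)
qed

end

section \<open>Linear functionals on submodules\<close>

definition linear_on ::
  "('k, 'l) ring_scheme \<Rightarrow> ('k, 'm, 'z) module_scheme \<Rightarrow> 'm set \<Rightarrow> ('m \<Rightarrow> 'k) \<Rightarrow> bool" where
  "linear_on k M L f \<longleftrightarrow>
    (\<forall>x\<in>L. f x \<in> carrier k) \<and>
    (\<forall>x\<in>L. \<forall>y\<in>L. f (x \<oplus>\<^bsub>M\<^esub> y) = f x \<oplus>\<^bsub>k\<^esub> f y) \<and>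
    (\<forall>c\<in>carrier k. \<forall>x\<in>L. f (c \<odot>\<^bsub>M\<^esub> x) = c \<otimes>\<^bsub>k\<^esub> f x)"

lemma linear_onI:
  assumes "\<And>x. x \<in> L \<Longrightarrow> f x \<in> carrier k"
    "\<And>x y. x \<in> L \<Longrightarrow> y \<in> L \<Longrightarrow> f (x \<oplus>\<^bsub>M\<^esub> y) = f x \<oplus>\<^bsub>k\<^esub> f y"
    "\<And>c x. c \<in> carrier k \<Longrightarrow> x \<in> L \<Longrightarrow> f (c \<odot>\<^bsub>M\<^esub> x) = c \<otimes>\<^bsub>k\<^esub> f x"
  shows "linear_on k M L f"
  using assms by (simp add: linear_on_def)

lemma
  assumes "linear_on k M L f"
  shows linear_on_closed: "x \<in> L \<Longrightarrow> f x \<in> carrier k"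
    and linear_on_add: "x \<in> L \<Longrightarrow> y \<in> L \<Longrightarrow> f (x \<oplus>\<^bsub>M\<^esub> y) = f x \<oplus>\<^bsub>k\<^esub> f y"
    and linear_on_smult: "c \<in> carrier k \<Longrightarrow> x \<in> L \<Longrightarrow> f (c \<odot>\<^bsub>M\<^esub> x) = c \<otimes>\<^bsub>k\<^esub> f x"
  using assms by (auto simp: linear_on_def)

lemma linear_on_subset: "linear_on k M L f \<Longrightarrow> N \<subseteq> L \<Longrightarrow> linear_on k M N f"
  by (simp add: linear_on_def subset_iff)

lemma linear_on_cong:
  assumes "linear_on k M L f" "submodule L k M" "\<And>x. x \<in> L \<Longrightarrow> g x = f x"
  shows "linear_on k M L g"
  using assms(1)
  by (simp add: linear_on_def assms(3) submodule.smult_closed[OF assms(2)]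
      additive_subgroup.a_closed[OF submodule_additive_subgroup[OF assms(2)]])

context module
begin

lemma
  assumes "submodule L R M"
  shows submodule_mem: "x \<in> L \<Longrightarrow> x \<in> carrier M"
    and submodule_zero: "\<zero>\<^bsub>M\<^esub> \<in> L"
    and submodule_add: "x \<in> L \<Longrightarrow> y \<in> L \<Longrightarrow> x \<oplus>\<^bsub>M\<^esub> y \<in> L"
    and submodule_inv: "x \<in> L \<Longrightarrow> \<ominus>\<^bsub>M\<^esub> x \<in> L"
    and submodule_minus: "x \<in> L \<Longrightarrow> y \<in> L \<Longrightarrow> x \<ominus>\<^bsub>M\<^esub> y \<in> L"
    and submodule_smult: "c \<in> carrier R \<Longrightarrow> x \<in> L \<Longrightarrow> c \<odot>\<^bsub>M\<^esub> x \<in> L"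
proof -
  interpret L: additive_subgroup L M by (rule submodule_additive_subgroup[OF assms])
  show "x \<in> L \<Longrightarrow> x \<in> carrier M" using L.a_subset by blast
  show "\<zero>\<^bsub>M\<^esub> \<in> L" "x \<in> L \<Longrightarrow> y \<in> L \<Longrightarrow> x \<oplus>\<^bsub>M\<^esub> y \<in> L" "x \<in> L \<Longrightarrow> \<ominus>\<^bsub>M\<^esub> x \<in> L" by auto
  show "x \<in> L \<Longrightarrow> y \<in> L \<Longrightarrow> x \<ominus>\<^bsub>M\<^esub> y \<in> L" by (simp add: a_minus_def)
  show "c \<in> carrier R \<Longrightarrow> x \<in> L \<Longrightarrow> c \<odot>\<^bsub>M\<^esub> x \<in> L" by (rule submodule.smult_closed[OF assms])
qed

lemma zero_is_submodule: "submodule {\<zero>\<^bsub>M\<^esub>} R M"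
  by (rule submoduleI) (auto simp: M.minus_equality)

lemma submodule_lin_comb:
  assumes "submodule L R M" "finite I" "\<And>i. i \<in> I \<Longrightarrow> e i \<in> L" "c \<in> I \<rightarrow> carrier R"
  shows "(\<Oplus>\<^bsub>M\<^esub>i\<in>I. c i \<odot>\<^bsub>M\<^esub> e i) \<in> L"
proof -
  have "lin_span R M e I \<subseteq> L"
    using assms(1-3) by (intro lin_span_minimal)
      (auto simp: submodule_mem submodule_zero submodule_add submodule_smult)
  then show ?thesis using assms(4) by (auto simp: lin_span_def)
qed

lemma linear_on_zero:
  assumes "linear_on R M L f" "submodule L R M"
  shows "f \<zero>\<^bsub>M\<^esub> = \<zero>"
  using linear_on_smult[OF assms(1) R.zero_closed submodule_zero[OF assms(2)]]
    linear_on_closed[OF assms(1) submodule_zero[OF assms(2)]] by simp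

lemma linear_on_minus:
  assumes f: "linear_on R M L f" and L: "submodule L R M" and x: "x \<in> L" and y: "y \<in> L"
  shows "f (x \<ominus>\<^bsub>M\<^esub> y) = f x \<ominus> f y"
proof -
  have "\<ominus>\<^bsub>M\<^esub> y = (\<ominus> \<one>) \<odot>\<^bsub>M\<^esub> y" using submodule_mem[OF L y] by (simp add: smult_l_minus)
  then have "f (\<ominus>\<^bsub>M\<^esub> y) = \<ominus> f y"
    using linear_on_smult[OF f _ y, of "\<ominus> \<one>"] linear_on_closed[OF f y] by (simp add: l_minus)
  then show ?thesis
    using linear_on_add[OF f x submodule_inv[OF L y]] by (simp add: a_minus_def)
qed

lemma linear_on_lin_comb:
  assumes f: "linear_on R M L f" and L: "submodule L R M"
    and "finite I" "\<And>i. i \<in> I \<Longrightarrow> e i \<in> L" "c \<in> I \<rightarrow> carrier R"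
  shows "f (\<Oplus>\<^bsub>M\<^esub>i\<in>I. c i \<odot>\<^bsub>M\<^esub> e i) = (\<Oplus>i\<in>I. c i \<otimes> f (e i))"
  using assms(3-)
proof (induction I rule: finite_induct)
  case empty
  then show ?case by (simp add: linear_on_zero[OF f L])
next
  case (insert i I)
  have s: "(\<Oplus>\<^bsub>M\<^esub>i\<in>I. c i \<odot>\<^bsub>M\<^esub> e i) \<in> L"
    using insert by (intro submodule_lin_comb[OF L]) auto
  have c: "c i \<odot>\<^bsub>M\<^esub> e i \<in> L" "(\<lambda>i. c i \<odot>\<^bsub>M\<^esub> e i) \<in> I \<rightarrow> carrier M"
    "(\<lambda>i. c i \<otimes> f (e i)) \<in> I \<rightarrow> carrier R" "c i \<otimes> f (e i) \<in> carrier R"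
    using insert submodule_mem[OF L] submodule_smult[OF L] linear_on_closed[OF f]
    by (auto simp: Pi_iff)
  show ?case
    using insert c s linear_on_add[OF f c(1) s] linear_on_smult[OF f, of "c i" "e i"] submodule_mem[OF L]
    by (simp add: Pi_iff)
qed

end

section \<open>Local dual bases\<close>

text \<open>After inverting \<open>s\<close>, the \<open>e i\<close> and the \<open>\<phi> i\<close>
  divided by \<open>s\<close> are mutually dual bases of the quotient of \<open>L\<close> by
  \<open>N\<close>. Keeping \<open>s\<close> as a factor lets all data live over \<open>k\<close>,
  and the last condition is stated modulo \<open>N\<close> without forming the quotient.\<close>

definition dual_basis_at ::
  "('k, 'l) ring_scheme \<Rightarrow> ('k, 'm, 'z) module_scheme \<Rightarrow> 'm set \<Rightarrow> 'm set \<Rightarrow> nat \<Rightarrow>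
    'k \<Rightarrow> (nat \<Rightarrow> 'm) \<Rightarrow> (nat \<Rightarrow> 'm \<Rightarrow> 'k) \<Rightarrow> bool" where
  "dual_basis_at k M L N r s e \<phi> \<longleftrightarrow>
    s \<in> carrier k \<and> (\<forall>i<r. e i \<in> L) \<and>
    (\<forall>i<r. linear_on k M L (\<phi> i) \<and> (\<forall>x\<in>N. \<phi> i x = \<zero>\<^bsub>k\<^esub>)) \<and>
    (\<forall>i<r. \<forall>j<r. \<phi> i (e j) = (if i = j then s else \<zero>\<^bsub>k\<^esub>)) \<and>
    (\<forall>x\<in>L. s \<odot>\<^bsub>M\<^esub> x \<ominus>\<^bsub>M\<^esub> (\<Oplus>\<^bsub>M\<^esub>i\<in>{..<r}. \<phi> i x \<odot>\<^bsub>M\<^esub> e i) \<in> N)"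

text \<open>The quotient of \<open>L\<close> by \<open>N\<close> is free of rank \<open>r\<close> near every point of the spectrum, with a basis
  and a dual basis defined over the whole of \<open>k\<close> up to a denominator \<open>s\<close>.\<close>

definition local_dual_basis ::
  "('k, 'l) ring_scheme \<Rightarrow> ('k, 'm, 'z) module_scheme \<Rightarrow> 'm set \<Rightarrow> 'm set \<Rightarrow> nat \<Rightarrow> bool" where
  "local_dual_basis k M L N r \<longleftrightarrow>
    (\<forall>P. primeideal P k \<longrightarrow> (\<exists>s e \<phi>. s \<notin> P \<and> dual_basis_at k M L N r s e \<phi>))"

lemma (in abelian_group) a_minus_zero [simp]: "x \<in> carrier G \<Longrightarrow> x \<ominus> \<zero> = x"
  by (simp add: a_minus_def minus_equality)

text \<open>Linearity of \<open>h\<close> is known only on the submodule \<open>L\<close>, so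
  differences go through multiplication by \<open>\<ominus> \<one>\<close>, and partial sums are
  kept inside \<open>L\<close> during the induction.\<close>

lemma linear_map_lin_comb:
  fixes M :: "('r, 'm, 'z) module_scheme" and Q :: "('r, 'q, 'w) module_scheme"
    and e :: "'i \<Rightarrow> 'm" and c :: "'i \<Rightarrow> 'r"
  assumes "module R M" "module R Q" "submodule L R M"
    and h: "\<And>x. x \<in> L \<Longrightarrow> h x \<in> carrier Q"
      "\<And>x y. x \<in> L \<Longrightarrow> y \<in> L \<Longrightarrow> h (x \<oplus>\<^bsub>M\<^esub> y) = h x \<oplus>\<^bsub>Q\<^esub> h y"
      "\<And>c x. c \<in> carrier R \<Longrightarrow> x \<in> L \<Longrightarrow> h (c \<odot>\<^bsub>M\<^esub> x) = c \<odot>\<^bsub>Q\<^esub> h x"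
  shows "finite I \<Longrightarrow> (\<And>i. i \<in> I \<Longrightarrow> e i \<in> L) \<Longrightarrow> c \<in> I \<rightarrow> carrier R \<Longrightarrow>
      h (\<Oplus>\<^bsub>M\<^esub>i\<in>I. c i \<odot>\<^bsub>M\<^esub> e i) = (\<Oplus>\<^bsub>Q\<^esub>i\<in>I. c i \<odot>\<^bsub>Q\<^esub> h (e i))"
    and "x \<in> L \<Longrightarrow> y \<in> L \<Longrightarrow> h (x \<ominus>\<^bsub>M\<^esub> y) = h x \<ominus>\<^bsub>Q\<^esub> h y"
    and "h \<zero>\<^bsub>M\<^esub> = \<zero>\<^bsub>Q\<^esub>"
proof -
  interpret M: module R M by fact
  interpret Q: module R Q by fact
  note L = assms(3)
  show zero: "h \<zero>\<^bsub>M\<^esub> = \<zero>\<^bsub>Q\<^esub>"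
    using h(3)[OF M.R.zero_closed M.submodule_zero[OF L]] h(1)[OF M.submodule_zero[OF L]] by simp
  show "h (x \<ominus>\<^bsub>M\<^esub> y) = h x \<ominus>\<^bsub>Q\<^esub> h y" if "x \<in> L" "y \<in> L"
  proof -
    have "\<ominus>\<^bsub>M\<^esub> y = (\<ominus>\<^bsub>R\<^esub> \<one>\<^bsub>R\<^esub>) \<odot>\<^bsub>M\<^esub> y" using M.submodule_mem[OF L] that by (simp add: M.smult_l_minus)
    then have "h (\<ominus>\<^bsub>M\<^esub> y) = \<ominus>\<^bsub>Q\<^esub> h y" using h(3) that h(1) by (simp add: Q.smult_l_minus)
    then show ?thesis using h(2) that M.submodule_inv[OF L] by (simp add: a_minus_def)
  qed
  show "h (\<Oplus>\<^bsub>M\<^esub>i\<in>I. c i \<odot>\<^bsub>M\<^esub> e i) = (\<Oplus>\<^bsub>Q\<^esub>i\<in>I. c i \<odot>\<^bsub>Q\<^esub> h (e i))"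
    if "finite I" "\<And>i. i \<in> I \<Longrightarrow> e i \<in> L" "c \<in> I \<rightarrow> carrier R"
    using that
  proof (induction I rule: finite_induct)
    case empty
    then show ?case by (simp add: zero)
  next
    case (insert i I)
    have s: "(\<Oplus>\<^bsub>M\<^esub>i\<in>I. c i \<odot>\<^bsub>M\<^esub> e i) \<in> L"
      using insert by (intro M.submodule_lin_comb[OF L]) auto
    have c: "c i \<odot>\<^bsub>M\<^esub> e i \<in> L" "(\<lambda>i. c i \<odot>\<^bsub>M\<^esub> e i) \<in> I \<rightarrow> carrier M"
      "(\<lambda>i. c i \<odot>\<^bsub>Q\<^esub> h (e i)) \<in> I \<rightarrow> carrier Q" "c i \<odot>\<^bsub>Q\<^esub> h (e i) \<in> carrier Q"
      using insert M.submodule_mem[OF L] M.submodule_smult[OF L] h(1) by (auto simp: Pi_iff)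
    show ?case
      using insert c s h(2)[OF c(1) s] h(3)[of "c i" "e i"] M.submodule_mem[OF L]
      by (simp add: Pi_iff)
  qed
qed

text \<open>Concatenates two index ranges, the form in which \<open>local_dual_basis_trans\<close>
  joins a basis of a quotient to one of a submodule.\<close>

lemma (in abelian_monoid) finsum_append:
  fixes m n :: nat
  assumes "g \<in> {..<m} \<rightarrow> carrier G" "h \<in> {..<n} \<rightarrow> carrier G"
  shows "(\<Oplus>i\<in>{..<m + n}. if i < m then g i else h (i - m)) = (\<Oplus>i\<in>{..<m}. g i) \<oplus> (\<Oplus>i\<in>{..<n}. h i)"
proof -
  let ?f = "\<lambda>i. if i < m then g i else h (i - m)"
  have un: "{..<m + n} = {..<m} \<union> (\<lambda>i. m + i) ` {..<n}"
  proof (intro Set.set_eqI iffI)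
    fix x assume "x \<in> {..<m + n}"
    then show "x \<in> {..<m} \<union> (\<lambda>i. m + i) ` {..<n}"
      by (cases "x < m") (auto intro: image_eqI[of x _ "x - m"])
  qed auto
  have "finsum G ?f {..<m + n} = finsum G ?f {..<m} \<oplus> finsum G ?f ((\<lambda>i. m + i) ` {..<n})"
    unfolding un by (rule finsum_Un_disjoint) (use assms in auto)
  moreover have "finsum G ?f {..<m} = finsum G g {..<m}"
    by (rule finsum_cong') (use assms in auto)
  moreover have "finsum G ?f ((\<lambda>i. m + i) ` {..<n}) = finsum G h {..<n}"
  proof -
    have "finsum G ?f ((\<lambda>i. m + i) ` {..<n}) = finsum G (\<lambda>i. ?f (m + i)) {..<n}"
      by (rule finsum_reindex) (use assms in auto)
    then show ?thesis by simp
  qed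
  ultimately show ?thesis by simp
qed

lemma (in cring) delta_sum:
  assumes "finite I" "j \<in> I" "c \<in> I \<rightarrow> carrier R" "s \<in> carrier R"
  shows "(\<Oplus>i\<in>I. c i \<otimes> (if j = i then s else \<zero>)) = c j \<otimes> s"
proof -
  have "(\<Oplus>i\<in>I. c i \<otimes> (if j = i then s else \<zero>)) = (\<Oplus>i\<in>I. if j = i then c i \<otimes> s else \<zero>)"
    by (rule finsum_cong') (use assms in \<open>auto simp: Pi_iff\<close>)
  also have "\<dots> = c j \<otimes> s"
    using add.finprod_singleton[of j I "\<lambda>i. c i \<otimes> s"] assms by (auto simp: Pi_iff)
  finally show ?thesis .
qed

lemma local_dual_basisE:
  assumes "local_dual_basis k M L N r" "primeideal P k"
  obtains s e \<phi> where "s \<in> carrier k - P" "dual_basis_at k M L N r s e \<phi>"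
  using assms unfolding local_dual_basis_def by (auto simp: dual_basis_at_def)

lemma
  assumes "dual_basis_at k M L N r s e \<phi>"
  shows dual_basis_scalar: "s \<in> carrier k"
    and dual_basis_mem: "i < r \<Longrightarrow> e i \<in> L"
    and dual_basis_linear: "i < r \<Longrightarrow> linear_on k M L (\<phi> i)"
    and dual_basis_vanish: "i < r \<Longrightarrow> x \<in> N \<Longrightarrow> \<phi> i x = \<zero>\<^bsub>k\<^esub>"
    and dual_basis_delta: "i < r \<Longrightarrow> j < r \<Longrightarrow> \<phi> i (e j) = (if i = j then s else \<zero>\<^bsub>k\<^esub>)"
    and dual_basis_residue: "x \<in> L \<Longrightarrow> s \<odot>\<^bsub>M\<^esub> x \<ominus>\<^bsub>M\<^esub> (\<Oplus>\<^bsub>M\<^esub>i\<in>{..<r}. \<phi> i x \<odot>\<^bsub>M\<^esub> e i) \<in> N"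
  using assms by (auto simp: dual_basis_at_def)

context module
begin

text \<open>Up to the factor \<open>s\<close>, the residue \<rho> is the projection that removes the
  part along the \<open>e i\<close>. For a dual basis of \<open>L\<close> modulo \<open>N\<close> it
  sends \<open>L\<close> into \<open>N\<close> and is multiplication by \<open>s\<close> on
  \<open>N\<close>, which is what extending functionals rests on.\<close>

lemma residue_map_linear:
  fixes r :: nat
  assumes L: "submodule L R M" and s: "s \<in> carrier R" and e: "\<And>i. i < r \<Longrightarrow> e i \<in> L"
    and \<phi>: "\<And>i. i < r \<Longrightarrow> linear_on R M L (\<phi> i)"
  defines "\<rho> \<equiv> \<lambda>x. s \<odot>\<^bsub>M\<^esub> x \<ominus>\<^bsub>M\<^esub> (\<Oplus>\<^bsub>M\<^esub>i\<in>{..<r}. \<phi> i x \<odot>\<^bsub>M\<^esub> e i)"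
  shows "x \<in> L \<Longrightarrow> \<rho> x \<in> L"
    and "x \<in> L \<Longrightarrow> y \<in> L \<Longrightarrow> \<rho> (x \<oplus>\<^bsub>M\<^esub> y) = \<rho> x \<oplus>\<^bsub>M\<^esub> \<rho> y"
    and "c \<in> carrier R \<Longrightarrow> x \<in> L \<Longrightarrow> \<rho> (c \<odot>\<^bsub>M\<^esub> x) = c \<odot>\<^bsub>M\<^esub> \<rho> x"
proof -
  note [simp] = submodule_mem[OF L] e
  define \<sigma> where "\<sigma> x = (\<Oplus>\<^bsub>M\<^esub>i\<in>{..<r}. \<phi> i x \<odot>\<^bsub>M\<^esub> e i)" for x
  have cl: "\<phi> i x \<in> carrier R" if "i < r" "x \<in> L" for i x
    using linear_on_closed[OF \<phi>] that by blast
  have pi: "(\<lambda>i. \<phi> i x \<odot>\<^bsub>M\<^esub> e i) \<in> {..<r} \<rightarrow> carrier M" if "x \<in> L" for x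
    using cl that by auto
  have \<sigma>L: "\<sigma> x \<in> L" if "x \<in> L" for x
    unfolding \<sigma>_def using that cl by (intro submodule_lin_comb[OF L]) auto
  have \<sigma>add: "\<sigma> (x \<oplus>\<^bsub>M\<^esub> y) = \<sigma> x \<oplus>\<^bsub>M\<^esub> \<sigma> y" if x: "x \<in> L" and y: "y \<in> L" for x y
  proof -
    have "\<sigma> (x \<oplus>\<^bsub>M\<^esub> y) = (\<Oplus>\<^bsub>M\<^esub>i\<in>{..<r}. \<phi> i x \<odot>\<^bsub>M\<^esub> e i \<oplus>\<^bsub>M\<^esub> \<phi> i y \<odot>\<^bsub>M\<^esub> e i)"
      unfolding \<sigma>_def using cl x y linear_on_add[OF \<phi> x y]
      by (intro M.finsum_cong') (auto simp: smult_l_distr)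
    then show ?thesis unfolding \<sigma>_def using M.finsum_addf[OF pi[OF x] pi[OF y]] by simp
  qed
  have \<sigma>smult: "\<sigma> (c \<odot>\<^bsub>M\<^esub> x) = c \<odot>\<^bsub>M\<^esub> \<sigma> x" if c: "c \<in> carrier R" and x: "x \<in> L" for c x
  proof -
    have "\<sigma> (c \<odot>\<^bsub>M\<^esub> x) = (\<Oplus>\<^bsub>M\<^esub>i\<in>{..<r}. c \<odot>\<^bsub>M\<^esub> (\<phi> i x \<odot>\<^bsub>M\<^esub> e i))"
      unfolding \<sigma>_def using cl x c linear_on_smult[OF \<phi> c x]
      by (intro M.finsum_cong') (auto simp: smult_assoc1)
    then show ?thesis unfolding \<sigma>_def using finsum_smult_ldistr[OF _ c pi[OF x]] by simp
  qed
  have \<rho>: "\<rho> x = s \<odot>\<^bsub>M\<^esub> x \<ominus>\<^bsub>M\<^esub> \<sigma> x" for x by (simp add: \<rho>_def \<sigma>_def)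
  have s_L: "s \<odot>\<^bsub>M\<^esub> x \<in> L" if "x \<in> L" for x using submodule_smult[OF L s that] .
  show "x \<in> L \<Longrightarrow> \<rho> x \<in> L" unfolding \<rho> by (intro submodule_minus[OF L] s_L \<sigma>L)
  show "x \<in> L \<Longrightarrow> y \<in> L \<Longrightarrow> \<rho> (x \<oplus>\<^bsub>M\<^esub> y) = \<rho> x \<oplus>\<^bsub>M\<^esub> \<rho> y"
    unfolding \<rho> using \<sigma>L s by (simp add: \<sigma>add smult_r_distr a_minus_def M.minus_add M.a_ac)
  show "c \<in> carrier R \<Longrightarrow> x \<in> L \<Longrightarrow> \<rho> (c \<odot>\<^bsub>M\<^esub> x) = c \<odot>\<^bsub>M\<^esub> \<rho> x"
    unfolding \<rho> using \<sigma>L s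
    by (simp add: \<sigma>smult smult_r_distr a_minus_def smult_r_minus smult_assoc1[symmetric] m_comm)
qed

text \<open>The scalars \<open>c\<close> for which \<open>c g\<close> extends form an ideal, and \<open>x \<mapsto> g (s x - \<Sum>i. \<phi> i x e i)\<close>
  extends \<open>s g\<close>.\<close>

lemma extend_functional:
  assumes L: "submodule L R M" and N: "submodule N R M" and "N \<subseteq> L"
    and ldb: "local_dual_basis R M L N r" and g: "linear_on R M N g"
  obtains h where "linear_on R M L h" "\<And>x. x \<in> N \<Longrightarrow> h x = g x"
proof -
  define J where "J = {c \<in> carrier R. \<exists>h. linear_on R M L h \<and> (\<forall>x\<in>N. h x = c \<otimes> g x)}"
  note gc = linear_on_closed[OF g]
  have "\<one> \<in> J"
  proof (rule local_global)
    show "J \<subseteq> carrier R" by (auto simp: J_def)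
    have "linear_on R M L (\<lambda>_. \<zero>)" by (rule linear_onI) auto
    then show "\<zero> \<in> J" using gc by (auto simp: J_def)
  next
    fix a b assume "a \<in> J" "b \<in> J"
    then obtain h h' where h: "a \<in> carrier R" "b \<in> carrier R" "linear_on R M L h" "linear_on R M L h'"
      "\<And>x. x \<in> N \<Longrightarrow> h x = a \<otimes> g x" "\<And>x. x \<in> N \<Longrightarrow> h' x = b \<otimes> g x"
      by (auto simp: J_def)
    have "linear_on R M L (\<lambda>x. h x \<oplus> h' x)"
      using h(3,4) by (intro linear_onI) (auto simp: linear_on_def R.a_ac r_distr)
    then show "a \<oplus> b \<in> J"
      using h gc by (auto simp: J_def l_distr intro!: exI[of _ "\<lambda>x. h x \<oplus> h' x"])
  next
    fix c a assume c: "c \<in> carrier R" and "a \<in> J"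
    then obtain h where h: "a \<in> carrier R" "linear_on R M L h" "\<And>x. x \<in> N \<Longrightarrow> h x = a \<otimes> g x"
      by (auto simp: J_def)
    have "linear_on R M L (\<lambda>x. c \<otimes> h x)"
      using h(2) c by (intro linear_onI) (auto simp: linear_on_def r_distr m_lcomm)
    then show "c \<otimes> a \<in> J"
      using h c gc by (auto simp: J_def m_assoc intro!: exI[of _ "\<lambda>x. c \<otimes> h x"])
  next
    fix P assume "primeideal P R"
    with ldb obtain s e \<phi> where s: "s \<in> carrier R - P" and db: "dual_basis_at R M L N r s e \<phi>"
      by (rule local_dual_basisE)
    let ?\<rho> = "\<lambda>x. s \<odot>\<^bsub>M\<^esub> x \<ominus>\<^bsub>M\<^esub> (\<Oplus>\<^bsub>M\<^esub>i\<in>{..<r}. \<phi> i x \<odot>\<^bsub>M\<^esub> e i)"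
    note \<rho> = residue_map_linear[OF L dual_basis_scalar[OF db] dual_basis_mem[OF db] dual_basis_linear[OF db]]
    note \<rho>N = dual_basis_residue[OF db]
    have lin: "linear_on R M L (\<lambda>x. g (?\<rho> x))"
      by (rule linear_onI)
        (simp_all only: \<rho> linear_on_closed[OF g \<rho>N] linear_on_add[OF g \<rho>N \<rho>N] linear_on_smult[OF g _ \<rho>N])
    \<comment> \<open>The \<open>\<phi> i\<close> vanish on \<open>N\<close>, so the residue of
      \<open>x\<close> is just \<open>s x\<close>.\<close>
    have "g (?\<rho> x) = s \<otimes> g x" if x: "x \<in> N" for x
    proof -
      have "(\<Oplus>\<^bsub>M\<^esub>i\<in>{..<r}. \<phi> i x \<odot>\<^bsub>M\<^esub> e i) = \<zero>\<^bsub>M\<^esub>"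
        using x by (intro M.add.finprod_one_eqI)
          (auto simp: dual_basis_vanish[OF db] submodule_mem[OF L dual_basis_mem[OF db]])
      then have "?\<rho> x = s \<odot>\<^bsub>M\<^esub> x"
        using s submodule_mem[OF N x] by simp
      then show ?thesis using linear_on_smult[OF g _ x] s by simp
    qed
    with lin s show "\<exists>s\<in>J. s \<notin> P" by (auto simp: J_def intro!: bexI[of _ s] exI[of _ "\<lambda>x. g (?\<rho> x)"])
  qed
  then show thesis using that gc by (auto simp: J_def)
qed

text \<open>The scalars carrying \<open>x\<close> into \<open>N\<close> form an ideal. The
  \<open>\<phi> i\<close> vanish on \<open>N\<close> and so, by hypothesis, at \<open>x\<close>; the
  residue condition then puts \<open>s x\<close> in \<open>N\<close>.\<close>

lemma local_dual_basis_torsionless: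
  assumes L: "submodule L R M" and N: "submodule N R M"
    and ldb: "local_dual_basis R M L N r" and x: "x \<in> L"
    and van: "\<And>f. linear_on R M L f \<Longrightarrow> (\<And>y. y \<in> N \<Longrightarrow> f y = \<zero>) \<Longrightarrow> f x = \<zero>"
  shows "x \<in> N"
proof -
  note [simp] = submodule_mem[OF L x]
  have "\<one> \<in> {c \<in> carrier R. c \<odot>\<^bsub>M\<^esub> x \<in> N}"
  proof (rule local_global)
    fix P assume "primeideal P R"
    with ldb obtain s e \<phi> where s: "s \<in> carrier R - P" and db: "dual_basis_at R M L N r s e \<phi>"
      by (rule local_dual_basisE)
    have "(\<Oplus>\<^bsub>M\<^esub>i\<in>{..<r}. \<phi> i x \<odot>\<^bsub>M\<^esub> e i) = \<zero>\<^bsub>M\<^esub>"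
      using van[OF dual_basis_linear[OF db] dual_basis_vanish[OF db]]
      by (intro M.add.finprod_one_eqI) (auto simp: submodule_mem[OF L dual_basis_mem[OF db]])
    with dual_basis_residue[OF db x] s have "s \<odot>\<^bsub>M\<^esub> x \<in> N" by simp
    with s show "\<exists>s\<in>{c \<in> carrier R. c \<odot>\<^bsub>M\<^esub> x \<in> N}. s \<notin> P" by auto
  qed (auto simp: smult_l_distr smult_assoc1 submodule_zero[OF N] submodule_add[OF N] submodule_smult[OF N])
  then show ?thesis by simp
qed

text \<open>Ranks add in extensions. The functionals of the dual basis of \<open>N\<close> modulo
  \<open>K\<close> extend to \<open>L\<close> by \<open>extend_functional\<close>, and the lifted
  basis of \<open>L\<close> modulo \<open>N\<close> is corrected by a residue map so that these
  extensions vanish on it.\<close>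

lemma local_dual_basis_trans:
  assumes L: "submodule L R M" and N: "submodule N R M" and K: "submodule K R M"
    and "K \<subseteq> N" "N \<subseteq> L"
    and LN: "local_dual_basis R M L N r" and NK: "local_dual_basis R M N K r'"
  shows "local_dual_basis R M L K (r + r')"
  unfolding local_dual_basis_def
proof (intro allI impI)
  fix P assume P: "primeideal P R"
  obtain t e' \<psi> where t: "t \<in> carrier R - P" and db': "dual_basis_at R M L N r t e' \<psi>"
    using local_dual_basisE[OF LN P] .
  obtain s e \<phi>\<^sub>0 where s: "s \<in> carrier R - P" and db: "dual_basis_at R M N K r' s e \<phi>\<^sub>0"
    using local_dual_basisE[OF NK P] .
  have st: "s \<otimes> t \<in> carrier R - P" "s \<in> carrier R" "t \<in> carrier R"
    using prime_mult[OF P s t] s t by auto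
  have "\<exists>h. linear_on R M L h \<and> (\<forall>x\<in>N. h x = \<phi>\<^sub>0 i x)" if i: "i < r'" for i
    by (rule extend_functional[OF L N \<open>N \<subseteq> L\<close> LN dual_basis_linear[OF db i]], rule exI, rule conjI) auto
  then obtain \<phi> where \<phi>: "\<And>i. i < r' \<Longrightarrow> linear_on R M L (\<phi> i)"
    "\<And>i x. i < r' \<Longrightarrow> x \<in> N \<Longrightarrow> \<phi> i x = \<phi>\<^sub>0 i x"
    using that[of "\<lambda>i. SOME h. linear_on R M L h \<and> (\<forall>x\<in>N. h x = \<phi>\<^sub>0 i x)"]
    by (smt (verit, best) someI_ex)
  have eN: "e i \<in> N" and eL: "e i \<in> L" if "i < r'" for i
    using dual_basis_mem[OF db that] \<open>N \<subseteq> L\<close> by auto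
  note e'L = dual_basis_mem[OF db']
  \<comment> \<open>The residue map of the extended functionals: on \<open>N\<close> it lands in
    \<open>K\<close>, and the extended functionals vanish on its values.\<close>
  define \<rho> where "\<rho> = (\<lambda>x. s \<odot>\<^bsub>M\<^esub> x \<ominus>\<^bsub>M\<^esub> (\<Oplus>\<^bsub>M\<^esub>i\<in>{..<r'}. \<phi> i x \<odot>\<^bsub>M\<^esub> e i))"
  have \<rho>: "\<And>x. x \<in> L \<Longrightarrow> \<rho> x \<in> L" "\<And>x y. x \<in> L \<Longrightarrow> y \<in> L \<Longrightarrow> \<rho> (x \<oplus>\<^bsub>M\<^esub> y) = \<rho> x \<oplus>\<^bsub>M\<^esub> \<rho> y"
    "\<And>c x. c \<in> carrier R \<Longrightarrow> x \<in> L \<Longrightarrow> \<rho> (c \<odot>\<^bsub>M\<^esub> x) = c \<odot>\<^bsub>M\<^esub> \<rho> x"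
    unfolding \<rho>_def using residue_map_linear[OF L st(2) eL \<phi>(1)] by auto
  have \<rho>C: "\<rho> x \<in> carrier M" if "x \<in> L" for x using \<rho>(1)[OF that] submodule_mem[OF L] by blast
  have \<rho>_minus: "\<rho> (x \<ominus>\<^bsub>M\<^esub> y) = \<rho> x \<ominus>\<^bsub>M\<^esub> \<rho> y" if "x \<in> L" "y \<in> L" for x y
    by (rule linear_map_lin_comb(2)[OF module_axioms module_axioms L]) (use \<rho> \<rho>C that in auto)
  have \<rho>_comb: "\<rho> (\<Oplus>\<^bsub>M\<^esub>i\<in>{..<n}. c i \<odot>\<^bsub>M\<^esub> a i) = (\<Oplus>\<^bsub>M\<^esub>i\<in>{..<n}. c i \<odot>\<^bsub>M\<^esub> \<rho> (a i))"
    if "\<And>i. i < n \<Longrightarrow> a i \<in> L" "\<And>i. i < n \<Longrightarrow> c i \<in> carrier R" for n :: nat and a c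
    by (rule linear_map_lin_comb(1)[OF module_axioms module_axioms L]) (use \<rho> \<rho>C that in auto)
  have \<rho>N: "\<rho> x \<in> K" if x: "x \<in> N" for x
  proof -
    have "(\<Oplus>\<^bsub>M\<^esub>i\<in>{..<r'}. \<phi> i x \<odot>\<^bsub>M\<^esub> e i) = (\<Oplus>\<^bsub>M\<^esub>i\<in>{..<r'}. \<phi>\<^sub>0 i x \<odot>\<^bsub>M\<^esub> e i)"
      using \<phi>(2)[OF _ x] linear_on_closed[OF dual_basis_linear[OF db] x] submodule_mem[OF N eN]
      by (intro M.finsum_cong') auto
    then show ?thesis unfolding \<rho>_def using dual_basis_residue[OF db x] by simp
  qed
  \<comment> \<open>Both blocks must carry the same denominator \<open>s t\<close>. On the values of
    \<rho> the functionals \<psi> acquire the factor \<open>s\<close>, since \<rho> is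
    multiplication by \<open>s\<close> modulo \<open>N\<close>; the extended functionals carry only
    \<open>s\<close> and are therefore multiplied by \<open>t\<close>.\<close>
  define E where "E i = (if i < r then \<rho> (e' i) else e (i - r))" for i
  define \<chi> where "\<chi> i = (if i < r then \<psi> i else (\<lambda>x. t \<otimes> \<phi> (i - r) x))" for i
  have "dual_basis_at R M L K (r + r') (s \<otimes> t) E \<chi>"
    unfolding dual_basis_at_def
  proof (intro conjI allI impI ballI)
    show "s \<otimes> t \<in> carrier R" using st by auto
    show "E i \<in> L" if "i < r + r'" for i using that \<rho>(1)[OF e'L] eL by (auto simp: E_def)
    show "linear_on R M L (\<chi> i)" if "i < r + r'" for i
    proof (cases "i < r")
      case False
      then have "linear_on R M L (\<phi> (i - r))" using that by (intro \<phi>) auto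
      then show ?thesis using False st
        by (intro linear_onI) (auto simp: \<chi>_def linear_on_def r_distr m_lcomm)
    qed (simp add: \<chi>_def dual_basis_linear[OF db'])
    show "\<chi> i x = \<zero>" if "i < r + r'" "x \<in> K" for i x
      using that \<open>K \<subseteq> N\<close> \<phi>(2)[of "i - r" x] dual_basis_vanish[OF db, of "i - r" x]
        dual_basis_vanish[OF db', of i x] st by (auto simp: \<chi>_def)
    show "\<chi> i (E j) = (if i = j then s \<otimes> t else \<zero>)" if ij: "i < r + r'" "j < r + r'" for i j
    proof -
      consider "i < r" "j < r" | "i < r" "\<not> j < r" | "\<not> i < r" "j < r" | "\<not> i < r" "\<not> j < r" by blast
      then show ?thesis
      proof cases
        case 1
        have sum: "(\<Oplus>\<^bsub>M\<^esub>l\<in>{..<r'}. \<phi> l (e' j) \<odot>\<^bsub>M\<^esub> e l) \<in> N"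
          using linear_on_closed[OF \<phi>(1) e'L[OF 1(2)]] eN by (intro submodule_lin_comb[OF N]) auto
        have "\<psi> i (\<rho> (e' j)) = \<psi> i (s \<odot>\<^bsub>M\<^esub> e' j) \<ominus> \<psi> i (\<Oplus>\<^bsub>M\<^esub>l\<in>{..<r'}. \<phi> l (e' j) \<odot>\<^bsub>M\<^esub> e l)"
          unfolding \<rho>_def using sum \<open>N \<subseteq> L\<close> submodule_smult[OF L st(2) e'L[OF 1(2)]]
          by (intro linear_on_minus[OF dual_basis_linear[OF db' 1(1)] L]) auto
        also have "\<dots> = s \<otimes> \<psi> i (e' j)"
          using linear_on_smult[OF dual_basis_linear[OF db' 1(1)] st(2) e'L[OF 1(2)]]
            dual_basis_vanish[OF db' 1(1) sum] linear_on_closed[OF dual_basis_linear[OF db' 1(1)] e'L[OF 1(2)]] st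
          by simp
        finally show ?thesis using 1 st dual_basis_delta[OF db' 1] by (simp add: \<chi>_def E_def)
      next
        case 2
        then show ?thesis using ij dual_basis_vanish[OF db' _ eN[of "j - r"]] by (simp add: \<chi>_def E_def)
      next
        case 3
        define l where "l = i - r"
        have l: "l < r'" using 3 ij by (auto simp: l_def)
        note ej = e'L[OF 3(2)]
        note \<phi>c = linear_on_closed[OF \<phi>(1) ej]
        have sum: "(\<Oplus>\<^bsub>M\<^esub>m\<in>{..<r'}. \<phi> m (e' j) \<odot>\<^bsub>M\<^esub> e m) \<in> L"
          using \<phi>c eL by (intro submodule_lin_comb[OF L]) auto
        have "\<phi> l (\<Oplus>\<^bsub>M\<^esub>m\<in>{..<r'}. \<phi> m (e' j) \<odot>\<^bsub>M\<^esub> e m) = (\<Oplus>m\<in>{..<r'}. \<phi> m (e' j) \<otimes> \<phi> l (e m))"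
          using \<phi>c eL by (intro linear_on_lin_comb[OF \<phi>(1)[OF l] L]) auto
        also have "\<dots> = (\<Oplus>m\<in>{..<r'}. \<phi> m (e' j) \<otimes> (if l = m then s else \<zero>))"
          using \<phi>c l st eN by (intro R.finsum_cong') (auto simp: \<phi>(2) dual_basis_delta[OF db])
        also have "\<dots> = \<phi> l (e' j) \<otimes> s" using \<phi>c l st by (intro delta_sum) auto
        finally have "\<phi> l (\<rho> (e' j)) = \<zero>"
          unfolding \<rho>_def
          using linear_on_minus[OF \<phi>(1)[OF l] L submodule_smult[OF L st(2) ej] sum]
            linear_on_smult[OF \<phi>(1)[OF l] st(2) ej] \<phi>c[OF l] st by (simp add: m_comm R.r_neg a_minus_def)
        then show ?thesis using 3 st by (auto simp: \<chi>_def E_def l_def)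
      next
        case 4
        have "\<phi> (i - r) (e (j - r)) = (if i = j then s else \<zero>)"
          using 4 ij \<phi>(2)[OF _ eN, of "i - r" "j - r"] dual_basis_delta[OF db, of "i - r" "j - r"] by auto
        then show ?thesis using 4 st by (simp add: \<chi>_def E_def m_comm)
      qed
    qed
    fix x assume x: "x \<in> L"
    \<comment> \<open>Applying \<rho> to this element of \<open>N\<close> gives an element of
      \<open>K\<close>; expanded, it is the residue of \<open>x\<close> for the joined
      basis.\<close>
    define y where "y = t \<odot>\<^bsub>M\<^esub> x \<ominus>\<^bsub>M\<^esub> (\<Oplus>\<^bsub>M\<^esub>i\<in>{..<r}. \<psi> i x \<odot>\<^bsub>M\<^esub> e' i)"
    have y: "y \<in> N" unfolding y_def by (rule dual_basis_residue[OF db' x])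
    have \<psi>c: "\<psi> i x \<in> carrier R" if "i < r" for i
      using linear_on_closed[OF dual_basis_linear[OF db' that] x] .
    have \<phi>c: "\<phi> i x \<in> carrier R" if "i < r'" for i
      using linear_on_closed[OF \<phi>(1)[OF that] x] .
    have sumL: "(\<Oplus>\<^bsub>M\<^esub>i\<in>{..<r}. \<psi> i x \<odot>\<^bsub>M\<^esub> e' i) \<in> L"
      using \<psi>c e'L by (intro submodule_lin_comb[OF L]) auto
    have txL: "t \<odot>\<^bsub>M\<^esub> x \<in> L" using submodule_smult[OF L st(3) x] .
    have tsum: "(\<Oplus>\<^bsub>M\<^esub>i\<in>{..<r'}. \<phi> i (t \<odot>\<^bsub>M\<^esub> x) \<odot>\<^bsub>M\<^esub> e i) = (\<Oplus>\<^bsub>M\<^esub>i\<in>{..<r'}. (t \<otimes> \<phi> i x) \<odot>\<^bsub>M\<^esub> e i)"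
      using \<phi>c st submodule_mem[OF L eL] linear_on_smult[OF \<phi>(1) st(3) x] by (intro M.finsum_cong') auto
    define u v where "u = (\<Oplus>\<^bsub>M\<^esub>i\<in>{..<r}. \<psi> i x \<odot>\<^bsub>M\<^esub> \<rho> (e' i))"
      and "v = (\<Oplus>\<^bsub>M\<^esub>i\<in>{..<r'}. (t \<otimes> \<phi> i x) \<odot>\<^bsub>M\<^esub> e i)"
    have uv: "u \<in> carrier M" "v \<in> carrier M"
      unfolding u_def v_def using \<psi>c \<phi>c st \<rho>C[OF e'L] submodule_mem[OF L eL] by (auto intro!: M.finsum_closed)
    have "\<rho> y = \<rho> (t \<odot>\<^bsub>M\<^esub> x) \<ominus>\<^bsub>M\<^esub> \<rho> (\<Oplus>\<^bsub>M\<^esub>i\<in>{..<r}. \<psi> i x \<odot>\<^bsub>M\<^esub> e' i)"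
      unfolding y_def by (rule \<rho>_minus[OF txL sumL])
    also have "\<rho> (\<Oplus>\<^bsub>M\<^esub>i\<in>{..<r}. \<psi> i x \<odot>\<^bsub>M\<^esub> e' i) = u"
      unfolding u_def using \<psi>c e'L by (intro \<rho>_comb) auto
    also have "\<rho> (t \<odot>\<^bsub>M\<^esub> x) = s \<odot>\<^bsub>M\<^esub> (t \<odot>\<^bsub>M\<^esub> x) \<ominus>\<^bsub>M\<^esub> v"
      unfolding \<rho>_def tsum v_def ..
    finally have "\<rho> y = (s \<otimes> t) \<odot>\<^bsub>M\<^esub> x \<ominus>\<^bsub>M\<^esub> (u \<oplus>\<^bsub>M\<^esub> v)"
      using uv st submodule_mem[OF L x] by (simp add: a_minus_def M.minus_add smult_assoc1 M.a_ac)
    also have "u \<oplus>\<^bsub>M\<^esub> v = (\<Oplus>\<^bsub>M\<^esub>i\<in>{..<r + r'}. if i < r then \<psi> i x \<odot>\<^bsub>M\<^esub> \<rho> (e' i) else (t \<otimes> \<phi> (i - r) x) \<odot>\<^bsub>M\<^esub> e (i - r))"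
      unfolding u_def v_def using \<psi>c \<phi>c st \<rho>C[OF e'L] submodule_mem[OF L eL]
      by (intro M.finsum_append[symmetric]) auto
    also have "\<dots> = (\<Oplus>\<^bsub>M\<^esub>i\<in>{..<r + r'}. \<chi> i x \<odot>\<^bsub>M\<^esub> E i)"
      using \<psi>c \<phi>c st \<rho>C[OF e'L] submodule_mem[OF L eL]
      by (intro M.finsum_cong') (auto simp: \<chi>_def E_def)
    finally show "(s \<otimes> t) \<odot>\<^bsub>M\<^esub> x \<ominus>\<^bsub>M\<^esub> (\<Oplus>\<^bsub>M\<^esub>i\<in>{..<r + r'}. \<chi> i x \<odot>\<^bsub>M\<^esub> E i) \<in> K"
      using \<rho>N[OF y] by simp
  qed
  with st(1) show "\<exists>s e \<phi>. s \<notin> P \<and> dual_basis_at R M L K (r + r') s e \<phi>" by blast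
qed

lemma local_dual_basis_refl:
  assumes "submodule L R M"
  shows "local_dual_basis R M L L 0"
  unfolding local_dual_basis_def
proof (intro allI impI)
  fix P assume "primeideal P R"
  then have "\<one> \<notin> P" by (rule prime_one)
  moreover have "dual_basis_at R M L L 0 \<one> (\<lambda>_. \<zero>\<^bsub>M\<^esub>) (\<lambda>_ _. \<zero>)"
    by (simp add: dual_basis_at_def submodule_mem[OF assms])
  ultimately show "\<exists>s e \<phi>. s \<notin> P \<and> dual_basis_at R M L L 0 s e \<phi>" by blast
qed

end

lemma (in abelian_group) minus_eq_zero_imp:
  "x \<in> carrier G \<Longrightarrow> y \<in> carrier G \<Longrightarrow> x \<ominus> y = \<zero> \<Longrightarrow> x = y"
  using minus_equality[of x "\<ominus> y"] by (simp add: a_minus_def)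

text \<open>Such an \<open>h\<close> induces an isomorphism of the quotient of \<open>L\<close> by
  \<open>N\<close> with that of \<open>L'\<close> by \<open>N'\<close>, and local dual bases depend
  only on the quotient. The lemma is applied to coset maps, coordinate projections and component
  maps, also between modules of different types.\<close>

lemma local_dual_basis_transfer:
  assumes "module R M" "module R Q" "submodule L R M" "submodule L' R Q" "submodule N' R Q"
    and h: "\<And>x. x \<in> L \<Longrightarrow> h x \<in> L'"
      "\<And>x y. x \<in> L \<Longrightarrow> y \<in> L \<Longrightarrow> h (x \<oplus>\<^bsub>M\<^esub> y) = h x \<oplus>\<^bsub>Q\<^esub> h y"
      "\<And>c x. c \<in> carrier R \<Longrightarrow> x \<in> L \<Longrightarrow> h (c \<odot>\<^bsub>M\<^esub> x) = c \<odot>\<^bsub>Q\<^esub> h x"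
    and surj: "\<And>y. y \<in> L' \<Longrightarrow> \<exists>x\<in>L. h x = y"
    and ker: "\<And>x. x \<in> L \<Longrightarrow> h x \<in> N' \<longleftrightarrow> x \<in> N"
    and "N \<subseteq> L" "N' \<subseteq> L'"
  shows "local_dual_basis R M L N r \<longleftrightarrow> local_dual_basis R Q L' N' r"
proof -
  interpret M: module R M by fact
  interpret Q: module R Q by fact
  note L = assms(3) and L' = assms(4) and N' = assms(5)
  have hQ: "h x \<in> carrier Q" if "x \<in> L" for x using h(1)[OF that] Q.submodule_mem[OF L'] by blast
  have h_minus: "h (x \<ominus>\<^bsub>M\<^esub> y) = h x \<ominus>\<^bsub>Q\<^esub> h y" if "x \<in> L" "y \<in> L" for x y
    by (rule linear_map_lin_comb(2)[OF assms(1,2) L]) (use h hQ that in auto)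
  have h_comb: "h (\<Oplus>\<^bsub>M\<^esub>i\<in>{..<n}. c i \<odot>\<^bsub>M\<^esub> a i) = (\<Oplus>\<^bsub>Q\<^esub>i\<in>{..<n}. c i \<odot>\<^bsub>Q\<^esub> h (a i))"
    if "\<And>i. i < n \<Longrightarrow> a i \<in> L" "\<And>i. i < n \<Longrightarrow> c i \<in> carrier R" for n :: nat and a c
    by (rule linear_map_lin_comb(1)[OF assms(1,2) L]) (use h hQ that in auto)
  have h_residue: "h (s \<odot>\<^bsub>M\<^esub> x \<ominus>\<^bsub>M\<^esub> (\<Oplus>\<^bsub>M\<^esub>i\<in>{..<r}. \<phi> i \<odot>\<^bsub>M\<^esub> e i)) =
      s \<odot>\<^bsub>Q\<^esub> h x \<ominus>\<^bsub>Q\<^esub> (\<Oplus>\<^bsub>Q\<^esub>i\<in>{..<r}. \<phi> i \<odot>\<^bsub>Q\<^esub> h (e i))"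
    "s \<odot>\<^bsub>M\<^esub> x \<ominus>\<^bsub>M\<^esub> (\<Oplus>\<^bsub>M\<^esub>i\<in>{..<r}. \<phi> i \<odot>\<^bsub>M\<^esub> e i) \<in> L"
    if "s \<in> carrier R" "x \<in> L" "\<And>i. i < r \<Longrightarrow> \<phi> i \<in> carrier R" "\<And>i. i < r \<Longrightarrow> e i \<in> L" for s x \<phi> e
  proof -
    have *: "s \<odot>\<^bsub>M\<^esub> x \<in> L" "(\<Oplus>\<^bsub>M\<^esub>i\<in>{..<r}. \<phi> i \<odot>\<^bsub>M\<^esub> e i) \<in> L"
      using that by (auto intro: M.submodule_lin_comb[OF L] M.submodule_smult[OF L])
    show "h (s \<odot>\<^bsub>M\<^esub> x \<ominus>\<^bsub>M\<^esub> (\<Oplus>\<^bsub>M\<^esub>i\<in>{..<r}. \<phi> i \<odot>\<^bsub>M\<^esub> e i)) =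
      s \<odot>\<^bsub>Q\<^esub> h x \<ominus>\<^bsub>Q\<^esub> (\<Oplus>\<^bsub>Q\<^esub>i\<in>{..<r}. \<phi> i \<odot>\<^bsub>Q\<^esub> h (e i))"
      using that h(3) by (simp add: h_minus[OF *] h_comb)
    show "s \<odot>\<^bsub>M\<^esub> x \<ominus>\<^bsub>M\<^esub> (\<Oplus>\<^bsub>M\<^esub>i\<in>{..<r}. \<phi> i \<odot>\<^bsub>M\<^esub> e i) \<in> L"
      by (rule M.submodule_minus[OF L *])
  qed
  obtain pre where pre: "\<And>y. y \<in> L' \<Longrightarrow> pre y \<in> L" "\<And>y. y \<in> L' \<Longrightarrow> h (pre y) = y"
    using surj by metis
  show ?thesis
  proof
    assume ldb: "local_dual_basis R M L N r"
    show "local_dual_basis R Q L' N' r"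
      unfolding local_dual_basis_def
    proof (intro allI impI)
      fix P assume "primeideal P R"
      with ldb obtain s e \<phi> where s: "s \<in> carrier R - P" and db: "dual_basis_at R M L N r s e \<phi>"
        by (rule local_dual_basisE)
      note lin = dual_basis_linear[OF db] and e = dual_basis_mem[OF db]
      \<comment> \<open>Well defined: two preimages of the same element differ by an element of
        \<open>N\<close>, on which \<open>\<phi> i\<close> vanishes.\<close>
      define \<phi>' where "\<phi>' i y = \<phi> i (pre y)" for i y
      have \<phi>': "\<phi>' i (h x) = \<phi> i x" if i: "i < r" and x: "x \<in> L" for i x
      proof -
        let ?p = "pre (h x)"
        have p: "?p \<in> L" "h ?p = h x" using pre h(1)[OF x] by auto
        have "h (?p \<ominus>\<^bsub>M\<^esub> x) = \<zero>\<^bsub>Q\<^esub>"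
          using h_minus[OF p(1) x] p hQ[OF x] by (simp add: a_minus_def Q.r_neg)
        then have "?p \<ominus>\<^bsub>M\<^esub> x \<in> N"
          using ker[OF M.submodule_minus[OF L p(1) x]] Q.submodule_zero[OF N'] by simp
        then have "\<phi> i ?p \<ominus>\<^bsub>R\<^esub> \<phi> i x = \<zero>\<^bsub>R\<^esub>"
          using dual_basis_vanish[OF db i] M.linear_on_minus[OF lin[OF i] L p(1) x] by simp
        then show ?thesis
          unfolding \<phi>'_def using linear_on_closed[OF lin[OF i]] p(1) x by simp
      qed
      \<comment> \<open>Turning quantifiers over \<open>L'\<close> into quantifiers over images
        removes the choice of preimages from the conditions on the dual basis.\<close>
      have all: "(\<forall>y\<in>L'. P y) \<longleftrightarrow> (\<forall>x\<in>L. P (h x))" for P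
        using pre h(1) by metis
      have "dual_basis_at R Q L' N' r s (\<lambda>i. h (e i)) \<phi>'"
        unfolding dual_basis_at_def linear_on_def all
      proof (intro conjI allI impI ballI)
        show "s \<in> carrier R" using s by simp
        show "h (e i) \<in> L'" if "i < r" for i using h(1)[OF e[OF that]] .
        show "\<phi>' i y = \<zero>\<^bsub>R\<^esub>" if i: "i < r" and y: "y \<in> N'" for i y
        proof -
          obtain x where x: "x \<in> L" "h x = y" using surj y \<open>N' \<subseteq> L'\<close> by blast
          then show ?thesis using ker[OF x(1)] y \<phi>'[OF i x(1)] dual_basis_vanish[OF db i, of x] by simp
        qed
        show "\<phi>' i (h (e j)) = (if i = j then s else \<zero>\<^bsub>R\<^esub>)" if "i < r" "j < r" for i j
          using \<phi>'[OF that(1) e[OF that(2)]] dual_basis_delta[OF db that] by simp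
        fix x assume x: "x \<in> L"
        note cl = linear_on_closed[OF lin x]
        have "(\<Oplus>\<^bsub>Q\<^esub>i\<in>{..<r}. \<phi>' i (h x) \<odot>\<^bsub>Q\<^esub> h (e i)) = (\<Oplus>\<^bsub>Q\<^esub>i\<in>{..<r}. \<phi> i x \<odot>\<^bsub>Q\<^esub> h (e i))"
          using cl hQ[OF e] \<phi>' x by (intro Q.finsum_cong') auto
        then show "s \<odot>\<^bsub>Q\<^esub> h x \<ominus>\<^bsub>Q\<^esub> (\<Oplus>\<^bsub>Q\<^esub>i\<in>{..<r}. \<phi>' i (h x) \<odot>\<^bsub>Q\<^esub> h (e i)) \<in> N'"
          using h_residue[of s x "\<lambda>i. \<phi> i x" e] s x cl e ker[OF h_residue(2)[of s x "\<lambda>i. \<phi> i x" e]]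
            dual_basis_residue[OF db x] by simp
      next
        fix i x assume i: "i < r" and x: "x \<in> L"
        show "\<phi>' i (h x) \<in> carrier R" using \<phi>'[OF i x] linear_on_closed[OF lin[OF i] x] by simp
      next
        fix i x y assume i: "i < r" and x: "x \<in> L" and y: "y \<in> L"
        show "\<phi>' i (h x \<oplus>\<^bsub>Q\<^esub> h y) = \<phi>' i (h x) \<oplus>\<^bsub>R\<^esub> \<phi>' i (h y)"
          using \<phi>'[OF i M.submodule_add[OF L x y]] \<phi>'[OF i] x y h(2)[OF x y] linear_on_add[OF lin[OF i] x y] by simp
      next
        fix i c x assume i: "i < r" and c: "c \<in> carrier R" and x: "x \<in> L"
        show "\<phi>' i (c \<odot>\<^bsub>Q\<^esub> h x) = c \<otimes>\<^bsub>R\<^esub> \<phi>' i (h x)"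
          using \<phi>'[OF i M.submodule_smult[OF L c x]] \<phi>'[OF i x] h(3)[OF c x] linear_on_smult[OF lin[OF i] c x] by simp
      qed
      then show "\<exists>s e \<phi>. s \<notin> P \<and> dual_basis_at R Q L' N' r s e \<phi>" using s by blast
    qed
  next
    assume ldb: "local_dual_basis R Q L' N' r"
    show "local_dual_basis R M L N r"
      unfolding local_dual_basis_def
    proof (intro allI impI)
      fix P assume "primeideal P R"
      with ldb obtain s e \<phi> where s: "s \<in> carrier R - P" and db: "dual_basis_at R Q L' N' r s e \<phi>"
        by (rule local_dual_basisE)
      note lin = dual_basis_linear[OF db] and e = dual_basis_mem[OF db]
      have "dual_basis_at R M L N r s (\<lambda>i. pre (e i)) (\<lambda>i x. \<phi> i (h x))"
        unfolding dual_basis_at_def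
      proof (intro conjI allI impI ballI)
        show "s \<in> carrier R" using s by simp
        show "pre (e i) \<in> L" if "i < r" for i using pre(1)[OF e[OF that]] .
        show "linear_on R M L (\<lambda>x. \<phi> i (h x))" if "i < r" for i
          using linear_on_closed[OF lin[OF that]] linear_on_add[OF lin[OF that]] linear_on_smult[OF lin[OF that]] h
          by (intro linear_onI) auto
        show "\<phi> i (h x) = \<zero>\<^bsub>R\<^esub>" if "i < r" "x \<in> N" for i x
          using ker[of x] that \<open>N \<subseteq> L\<close> dual_basis_vanish[OF db that(1)] by blast
        show "\<phi> i (h (pre (e j))) = (if i = j then s else \<zero>\<^bsub>R\<^esub>)" if "i < r" "j < r" for i j
          using pre(2)[OF e[OF that(2)]] dual_basis_delta[OF db that] by simp
        fix x assume x: "x \<in> L"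
        note cl = linear_on_closed[OF lin h(1)[OF x]]
        have "(\<Oplus>\<^bsub>Q\<^esub>i\<in>{..<r}. \<phi> i (h x) \<odot>\<^bsub>Q\<^esub> h (pre (e i))) = (\<Oplus>\<^bsub>Q\<^esub>i\<in>{..<r}. \<phi> i (h x) \<odot>\<^bsub>Q\<^esub> e i)"
          using cl pre e Q.submodule_mem[OF L'] by (intro Q.finsum_cong') auto
        then show "s \<odot>\<^bsub>M\<^esub> x \<ominus>\<^bsub>M\<^esub> (\<Oplus>\<^bsub>M\<^esub>i\<in>{..<r}. \<phi> i (h x) \<odot>\<^bsub>M\<^esub> pre (e i)) \<in> N"
          using h_residue[of s x "\<lambda>i. \<phi> i (h x)" "\<lambda>i. pre (e i)"] s x cl pre e
            ker[OF h_residue(2)[of s x "\<lambda>i. \<phi> i (h x)" "\<lambda>i. pre (e i)"]] dual_basis_residue[OF db h(1)[OF x]] by simp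
      qed
      then show "\<exists>s e \<phi>. s \<notin> P \<and> dual_basis_at R M L N r s e \<phi>" using s by blast
    qed
  qed
qed

section \<open>Duals, annihilators and reflexivity\<close>

lemma module_self_module: "cring k \<Longrightarrow> module k (self_module k)"
proof -
  assume "cring k"
  then interpret cring k .
  have "abelian_group (self_module k)"
    by (rule abelian_group_cong[OF abelian_group_axioms]) (simp_all add: self_module_def)
  then show ?thesis
    by (intro moduleI) (auto simp: self_module_def l_distr r_distr m_assoc cring_axioms)
qed

text \<open>Only the carrier and the values of sums and multiples are prescribed, so that
  \<open>dual\<close>, \<open>filt_dual\<close> and \<open>gr_dual\<close>, with scalars restricted
  to \<open>k\<close>, all qualify as the \<open>k\<close>-linear dual of the same module.\<close>

definition is_dual_module ::
  "('k, 'l) ring_scheme \<Rightarrow> ('k, 'm, 'y) module_scheme \<Rightarrow> ('k, 'm \<Rightarrow> 'k, 'z) module_scheme \<Rightarrow> bool" where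
  "is_dual_module k M D \<longleftrightarrow> module k D \<and> carrier D = mod_hom k M (self_module k) \<and>
    (\<forall>f\<in>carrier D. \<forall>g\<in>carrier D. \<forall>x\<in>carrier M. (f \<oplus>\<^bsub>D\<^esub> g) x = f x \<oplus>\<^bsub>k\<^esub> g x) \<and>
    (\<forall>c\<in>carrier k. \<forall>f\<in>carrier D. \<forall>x\<in>carrier M. (c \<odot>\<^bsub>D\<^esub> f) x = c \<otimes>\<^bsub>k\<^esub> f x)"

definition annihilator :: "('k, 'l) ring_scheme \<Rightarrow> ('m \<Rightarrow> 'k, 'z) ring_scheme \<Rightarrow> 'm set \<Rightarrow> ('m \<Rightarrow> 'k) set" where
  "annihilator k D X = {f \<in> carrier D. \<forall>x\<in>X. f x = \<zero>\<^bsub>k\<^esub>}"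

lemma mod_hom_self_module_iff:
  "f \<in> mod_hom k M (self_module k) \<longleftrightarrow> f \<in> extensional (carrier M) \<and> linear_on k M (carrier M) f"
  by (auto simp: mod_hom_def self_module_def linear_on_def PiE_def)

locale dual_module = module +
  fixes D :: "('a, 'c \<Rightarrow> 'a, 'e) module_scheme"
  assumes dual: "is_dual_module R M D"
begin

sublocale D: module R D
  using dual by (simp add: is_dual_module_def)

lemma dual_carrier: "f \<in> carrier D \<longleftrightarrow> f \<in> extensional (carrier M) \<and> linear_on R M (carrier M) f"
  using dual by (simp add: is_dual_module_def mod_hom_self_module_iff)

lemma dual_linear: "f \<in> carrier D \<Longrightarrow> linear_on R M (carrier M) f"
  by (simp add: dual_carrier)

lemma eval_linear: "x \<in> carrier M \<Longrightarrow> linear_on R D (carrier D) (\<lambda>f. f x)"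
  using dual by (intro linear_onI) (auto simp: is_dual_module_def mod_hom_self_module_iff linear_on_def)

lemma dual_eqI:
  "f \<in> carrier D \<Longrightarrow> g \<in> carrier D \<Longrightarrow> (\<And>x. x \<in> carrier M \<Longrightarrow> f x = g x) \<Longrightarrow> f = g"
  by (auto simp: dual_carrier intro: extensionalityI)

lemma restrict_dual:
  assumes "linear_on R M (carrier M) f"
  shows "restrict f (carrier M) \<in> carrier D"
  unfolding dual_carrier using linear_on_cong[OF assms carrier_is_submodule] by simp

lemma annihilator_submodule:
  assumes "X \<subseteq> carrier M"
  shows "submodule (annihilator R D X) R D"
proof (rule D.submoduleI)
  note ev = eval_linear[OF subsetD[OF assms]]
  note cs = D.carrier_is_submodule
  show "annihilator R D X \<subseteq> carrier D" by (auto simp: annihilator_def)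
  show "\<zero>\<^bsub>D\<^esub> \<in> annihilator R D X" using D.linear_on_zero[OF ev cs] by (auto simp: annihilator_def)
  show "\<ominus>\<^bsub>D\<^esub> f \<in> annihilator R D X" if f: "f \<in> annihilator R D X" for f
  proof -
    have fD: "f \<in> carrier D" using f by (simp add: annihilator_def)
    have "\<ominus>\<^bsub>D\<^esub> f = \<zero>\<^bsub>D\<^esub> \<ominus>\<^bsub>D\<^esub> f" using fD by (simp add: a_minus_def)
    then show ?thesis using D.linear_on_minus[OF ev cs D.zero_closed fD] D.linear_on_zero[OF ev cs] f
      by (auto simp: annihilator_def a_minus_def)
  qed
  show "f \<oplus>\<^bsub>D\<^esub> g \<in> annihilator R D X" if "f \<in> annihilator R D X" "g \<in> annihilator R D X" for f g
    using that linear_on_add[OF ev] by (auto simp: annihilator_def)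
  show "c \<odot>\<^bsub>D\<^esub> f \<in> annihilator R D X" if "c \<in> carrier R" "f \<in> annihilator R D X" for c f
    using that linear_on_smult[OF ev] by (auto simp: annihilator_def)
qed

text \<open>The dual of the quotient of \<open>L\<close> by \<open>N\<close> is the annihilator of
  \<open>N\<close> modulo that of \<open>L\<close>. The two halves of a dual basis exchange roles:
  the functionals, extended from \<open>L\<close> to the whole module, become the basis, and the
  evaluations at the \<open>e i\<close> become the functionals.\<close>

lemma local_dual_basis_annihilator:
  assumes L: "submodule L R M" and N: "submodule N R M" and "N \<subseteq> L"
    and CL: "local_dual_basis R M (carrier M) L r'" and LN: "local_dual_basis R M L N r"
  shows "local_dual_basis R D (annihilator R D N) (annihilator R D L) r"
  unfolding local_dual_basis_def
proof (intro allI impI)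
  fix P assume "primeideal P R"
  with LN obtain s e \<phi>\<^sub>0 where s: "s \<in> carrier R - P" and db: "dual_basis_at R M L N r s e \<phi>\<^sub>0"
    by (rule local_dual_basisE)
  have LM: "L \<subseteq> carrier M" and NM: "N \<subseteq> carrier M" using submodule_mem[OF L] submodule_mem[OF N] by auto
  have ext: "\<exists>h\<in>carrier D. \<forall>x\<in>L. h x = \<phi>\<^sub>0 i x" if i: "i < r" for i
  proof -
    show ?thesis
      by (rule extend_functional[OF carrier_is_submodule L LM CL dual_basis_linear[OF db i]],
          rule bexI[OF _ restrict_dual]) (use LM in auto)
  qed
  define \<phi> where "\<phi> i = (SOME h. h \<in> carrier D \<and> (\<forall>x\<in>L. h x = \<phi>\<^sub>0 i x))" for i
  have \<phi>: "\<phi> i \<in> carrier D" "x \<in> L \<Longrightarrow> \<phi> i x = \<phi>\<^sub>0 i x" if "i < r" for i x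
    using someI_ex[OF ext[OF that, unfolded Bex_def]] by (auto simp: \<phi>_def)
  note eL = dual_basis_mem[OF db] note eM = subsetD[OF LM eL]
  have NL: "annihilator R D L \<subseteq> annihilator R D N"
    using \<open>N \<subseteq> L\<close> by (auto simp: annihilator_def)
  have "dual_basis_at R D (annihilator R D N) (annihilator R D L) r s \<phi> (\<lambda>i f. f (e i))"
    unfolding dual_basis_at_def
  proof (intro conjI allI impI ballI)
    show "s \<in> carrier R" using s by simp
    show "\<phi> i \<in> annihilator R D N" if "i < r" for i
      using \<phi>[OF that] \<open>N \<subseteq> L\<close> dual_basis_vanish[OF db that] by (auto simp: annihilator_def)
    show "linear_on R D (annihilator R D N) (\<lambda>f. f (e i))" if "i < r" for i
      by (rule linear_on_subset[OF eval_linear[OF eM[OF that]]]) (auto simp: annihilator_def)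
    show "f (e i) = \<zero>" if "i < r" "f \<in> annihilator R D L" for i f
      using that eL by (auto simp: annihilator_def)
    show "\<phi> j (e i) = (if i = j then s else \<zero>)" if "i < r" "j < r" for i j
      using \<phi>(2)[OF that(2) eL[OF that(1)]] dual_basis_delta[OF db that(2,1)] by auto
    fix g assume g: "g \<in> annihilator R D N"
    then have gD: "g \<in> carrier D" by (simp add: annihilator_def)
    note gl = dual_linear[OF gD]
    have gc: "g (e i) \<in> carrier R" if "i < r" for i using linear_on_closed[OF gl eM[OF that]] .
    define \<sigma> where "\<sigma> = (\<Oplus>\<^bsub>D\<^esub>i\<in>{..<r}. g (e i) \<odot>\<^bsub>D\<^esub> \<phi> i)"
    have \<sigma>D: "\<sigma> \<in> carrier D" unfolding \<sigma>_def using gc \<phi>(1) by (intro D.finsum_closed) auto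
    have sgD: "s \<odot>\<^bsub>D\<^esub> g \<in> carrier D" using s gD by simp
    \<comment> \<open>At \<open>x\<close> the value equals \<open>g\<close> applied to the residue
      of \<open>x\<close>; that residue lies in \<open>N\<close>, which \<open>g\<close>
      annihilates.\<close>
    have "(s \<odot>\<^bsub>D\<^esub> g \<ominus>\<^bsub>D\<^esub> \<sigma>) x = \<zero>" if x: "x \<in> L" for x
    proof -
      note xM = subsetD[OF LM x]
      note ev = eval_linear[OF xM]
      have \<phi>c: "\<phi>\<^sub>0 i x \<in> carrier R" if "i < r" for i
        using linear_on_closed[OF dual_basis_linear[OF db that] x] .
      define y where "y = (\<Oplus>\<^bsub>M\<^esub>i\<in>{..<r}. \<phi>\<^sub>0 i x \<odot>\<^bsub>M\<^esub> e i)"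
      have yM: "y \<in> carrier M" unfolding y_def using \<phi>c eM by (intro M.finsum_closed) auto
      have "(s \<odot>\<^bsub>D\<^esub> g \<ominus>\<^bsub>D\<^esub> \<sigma>) x = s \<otimes> g x \<ominus> \<sigma> x"
        using D.linear_on_minus[OF ev D.carrier_is_submodule sgD \<sigma>D] linear_on_smult[OF ev _ gD] s by simp
      also have "s \<otimes> g x = g (s \<odot>\<^bsub>M\<^esub> x)" using linear_on_smult[OF gl _ xM] s by simp
      also have "\<sigma> x = (\<Oplus>i\<in>{..<r}. g (e i) \<otimes> \<phi> i x)"
        unfolding \<sigma>_def using gc \<phi>(1) by (intro D.linear_on_lin_comb[OF ev D.carrier_is_submodule]) auto
      also have "\<dots> = (\<Oplus>i\<in>{..<r}. \<phi>\<^sub>0 i x \<otimes> g (e i))"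
        using gc \<phi>c \<phi>(2) x by (intro R.finsum_cong') (auto simp: m_comm)
      also have "\<dots> = g y"
        unfolding y_def using \<phi>c eM by (intro linear_on_lin_comb[OF gl carrier_is_submodule, symmetric]) auto
      also have "g (s \<odot>\<^bsub>M\<^esub> x) \<ominus> g y = g (s \<odot>\<^bsub>M\<^esub> x \<ominus>\<^bsub>M\<^esub> y)"
        using s xM yM by (intro linear_on_minus[OF gl carrier_is_submodule, symmetric]) auto
      also have "\<dots> = \<zero>"
        using g dual_basis_residue[OF db x] by (simp add: annihilator_def y_def)
      finally show ?thesis .
    qed
    then show "s \<odot>\<^bsub>D\<^esub> g \<ominus>\<^bsub>D\<^esub> (\<Oplus>\<^bsub>D\<^esub>i\<in>{..<r}. g (e i) \<odot>\<^bsub>D\<^esub> \<phi> i) \<in> annihilator R D L"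
      using sgD \<sigma>D unfolding \<sigma>_def by (simp add: annihilator_def)
  qed
  then show "\<exists>s e \<phi>. s \<notin> P \<and> dual_basis_at R D (annihilator R D N) (annihilator R D L) r s e \<phi>"
    using s by blast
qed

text \<open>The scalars \<open>c\<close> for which \<open>c \<Phi>\<close> is the evaluation at some element form an ideal.\<close>

lemma reflexive:
  assumes ldb: "local_dual_basis R M (carrier M) {\<zero>\<^bsub>M\<^esub>} r" and \<Phi>: "linear_on R D (carrier D) \<Phi>"
  obtains x where "x \<in> carrier M" "\<And>f. f \<in> carrier D \<Longrightarrow> \<Phi> f = f x"
proof -
  define J where "J = {c \<in> carrier R. \<exists>x\<in>carrier M. \<forall>f\<in>carrier D. c \<otimes> \<Phi> f = f x}"
  note \<Phi>c = linear_on_closed[OF \<Phi>]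
  have fc: "f x \<in> carrier R" if "f \<in> carrier D" "x \<in> carrier M" for f x
    using linear_on_closed[OF dual_linear] that by blast
  have "\<one> \<in> J"
  proof (rule local_global)
    show "J \<subseteq> carrier R" by (auto simp: J_def)
    have "\<zero> \<otimes> \<Phi> f = f \<zero>\<^bsub>M\<^esub>" if "f \<in> carrier D" for f
      using \<Phi>c[OF that] linear_on_zero[OF dual_linear[OF that] carrier_is_submodule] by simp
    then show "\<zero> \<in> J" unfolding J_def by blast
  next
    fix a b assume "a \<in> J" "b \<in> J"
    then obtain x y where xy: "a \<in> carrier R" "b \<in> carrier R" "x \<in> carrier M" "y \<in> carrier M"
      "\<And>f. f \<in> carrier D \<Longrightarrow> a \<otimes> \<Phi> f = f x" "\<And>f. f \<in> carrier D \<Longrightarrow> b \<otimes> \<Phi> f = f y"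
      by (auto simp: J_def)
    then show "a \<oplus> b \<in> J"
      using linear_on_add[OF dual_linear xy(3,4)] \<Phi>c
      by (auto simp: J_def l_distr intro!: bexI[of _ "x \<oplus>\<^bsub>M\<^esub> y"])
  next
    fix c a assume c: "c \<in> carrier R" and "a \<in> J"
    then obtain x where x: "a \<in> carrier R" "x \<in> carrier M" "\<And>f. f \<in> carrier D \<Longrightarrow> a \<otimes> \<Phi> f = f x"
      by (auto simp: J_def)
    then show "c \<otimes> a \<in> J"
      using linear_on_smult[OF dual_linear c x(2)] \<Phi>c c
      by (auto simp: J_def m_assoc intro!: bexI[of _ "c \<odot>\<^bsub>M\<^esub> x"])
  next
    fix P assume "primeideal P R"
    with ldb obtain s e \<phi>\<^sub>0 where s: "s \<in> carrier R - P"
      and db: "dual_basis_at R M (carrier M) {\<zero>\<^bsub>M\<^esub>} r s e \<phi>\<^sub>0"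
      by (rule local_dual_basisE)
    note e = dual_basis_mem[OF db]
    define \<phi> where "\<phi> i = restrict (\<phi>\<^sub>0 i) (carrier M)" for i
    have \<phi>: "\<phi> i \<in> carrier D" if "i < r" for i
      unfolding \<phi>_def by (rule restrict_dual[OF dual_basis_linear[OF db that]])
    \<comment> \<open>Since \<open>s f\<close> is the sum of the \<open>f (e i) \<phi> i\<close>,
      applying \<Phi> shows that \<open>s \<Phi>\<close> is the evaluation at this element.\<close>
    define x where "x = (\<Oplus>\<^bsub>M\<^esub>i\<in>{..<r}. \<Phi> (\<phi> i) \<odot>\<^bsub>M\<^esub> e i)"
    have xM: "x \<in> carrier M" unfolding x_def using \<Phi>c[OF \<phi>] e by (intro M.finsum_closed) auto
    have "s \<otimes> \<Phi> f = f x" if f: "f \<in> carrier D" for f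
    proof -
      note fl = dual_linear[OF f]
      have sf: "s \<odot>\<^bsub>D\<^esub> f = (\<Oplus>\<^bsub>D\<^esub>i\<in>{..<r}. f (e i) \<odot>\<^bsub>D\<^esub> \<phi> i)"
      proof (rule dual_eqI)
        show "s \<odot>\<^bsub>D\<^esub> f \<in> carrier D" using s f by simp
        show "(\<Oplus>\<^bsub>D\<^esub>i\<in>{..<r}. f (e i) \<odot>\<^bsub>D\<^esub> \<phi> i) \<in> carrier D"
          using fc[OF f e] \<phi> by (intro D.finsum_closed) auto
        fix y assume y: "y \<in> carrier M"
        have \<phi>c: "\<phi>\<^sub>0 i y \<in> carrier R" if "i < r" for i
          using linear_on_closed[OF dual_basis_linear[OF db that] y] .
        define z where "z = (\<Oplus>\<^bsub>M\<^esub>i\<in>{..<r}. \<phi>\<^sub>0 i y \<odot>\<^bsub>M\<^esub> e i)"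
        have zM: "z \<in> carrier M" unfolding z_def using \<phi>c e by (intro M.finsum_closed) auto
        have "s \<odot>\<^bsub>M\<^esub> y \<ominus>\<^bsub>M\<^esub> z = \<zero>\<^bsub>M\<^esub>" using dual_basis_residue[OF db y] by (simp add: z_def)
        then have sy: "s \<odot>\<^bsub>M\<^esub> y = z" using s y zM M.minus_eq_zero_imp by simp
        have "(\<Oplus>\<^bsub>D\<^esub>i\<in>{..<r}. f (e i) \<odot>\<^bsub>D\<^esub> \<phi> i) y = (\<Oplus>i\<in>{..<r}. f (e i) \<otimes> \<phi> i y)"
          using fc[OF f e] \<phi> by (intro D.linear_on_lin_comb[OF eval_linear[OF y] D.carrier_is_submodule]) auto
        also have "\<dots> = (\<Oplus>i\<in>{..<r}. \<phi>\<^sub>0 i y \<otimes> f (e i))"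
          using fc[OF f e] \<phi>c y by (intro R.finsum_cong') (auto simp: m_comm \<phi>_def)
        also have "\<dots> = f z"
          unfolding z_def using \<phi>c e by (intro linear_on_lin_comb[OF fl carrier_is_submodule, symmetric]) auto
        also have "\<dots> = (s \<odot>\<^bsub>D\<^esub> f) y"
          using sy[symmetric] linear_on_smult[OF fl _ y] linear_on_smult[OF eval_linear[OF y] _ f] s by simp
        finally show "(s \<odot>\<^bsub>D\<^esub> f) y = (\<Oplus>\<^bsub>D\<^esub>i\<in>{..<r}. f (e i) \<odot>\<^bsub>D\<^esub> \<phi> i) y" by simp
      qed
      have "s \<otimes> \<Phi> f = \<Phi> (s \<odot>\<^bsub>D\<^esub> f)" using linear_on_smult[OF \<Phi> _ f] s by simp
      also have "\<dots> = (\<Oplus>i\<in>{..<r}. f (e i) \<otimes> \<Phi> (\<phi> i))"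
        unfolding sf using fc[OF f e] \<phi> by (intro D.linear_on_lin_comb[OF \<Phi> D.carrier_is_submodule]) auto
      also have "\<dots> = (\<Oplus>i\<in>{..<r}. \<Phi> (\<phi> i) \<otimes> f (e i))"
        using fc[OF f e] \<Phi>c[OF \<phi>] by (intro R.finsum_cong') (auto simp: m_comm)
      also have "\<dots> = f x"
        unfolding x_def using \<Phi>c[OF \<phi>] e by (intro linear_on_lin_comb[OF fl carrier_is_submodule, symmetric]) auto
      finally show ?thesis .
    qed
    with s xM show "\<exists>s\<in>J. s \<notin> P" by (auto simp: J_def)
  qed
  then show thesis using that \<Phi>c by (auto simp: J_def)
qed

end

section \<open>Modules of fractions\<close>

locale fraction_module = module +
  fixes S
  assumes S_subset: "S \<subseteq> carrier R" and S_one: "\<one> \<in> S" and S_mult: "s \<in> S \<Longrightarrow> t \<in> S \<Longrightarrow> s \<otimes> t \<in> S"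
begin

lemma S_carrier [simp]: "s \<in> S \<Longrightarrow> s \<in> carrier R" using S_subset by blast

lemma loc_rel_iff:
  "((x, s), (y, t)) \<in> loc_rel S M \<longleftrightarrow> x \<in> carrier M \<and> y \<in> carrier M \<and> s \<in> S \<and> t \<in> S \<and>
     (\<exists>u\<in>S. (u \<otimes> t) \<odot>\<^bsub>M\<^esub> x = (u \<otimes> s) \<odot>\<^bsub>M\<^esub> y)"
  by (auto simp: loc_rel_def smult_assoc1)

lemma equiv_loc_rel: "equiv (carrier M \<times> S) (loc_rel S M)"
proof (rule equivI)
  show "loc_rel S M \<subseteq> (carrier M \<times> S) \<times> (carrier M \<times> S)" by (auto simp: loc_rel_def)
  show "refl_on (carrier M \<times> S) (loc_rel S M)" by (auto simp: refl_on_def loc_rel_iff intro: S_one)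
  show "sym (loc_rel S M)" by (rule symI) (auto simp: loc_rel_iff, metis)
  show "trans (loc_rel S M)"
  proof (rule transI, clarify)
    fix x s y t z r
    assume "((x, s), (y, t)) \<in> loc_rel S M" "((y, t), (z, r)) \<in> loc_rel S M"
    then obtain u v where uv: "x \<in> carrier M" "y \<in> carrier M" "z \<in> carrier M" "s \<in> S" "t \<in> S" "r \<in> S" "u \<in> S" "v \<in> S"
      "(u \<otimes> t) \<odot>\<^bsub>M\<^esub> x = (u \<otimes> s) \<odot>\<^bsub>M\<^esub> y" "(v \<otimes> r) \<odot>\<^bsub>M\<^esub> y = (v \<otimes> t) \<odot>\<^bsub>M\<^esub> z"
      by (auto simp: loc_rel_iff)
    \<comment> \<open>Multiplying the first relation by \<open>v r\<close> and the second by
      \<open>u s\<close> makes them meet; the new multiplier is \<open>u v t\<close>.\<close>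
    have "((u \<otimes> v \<otimes> t) \<otimes> r) \<odot>\<^bsub>M\<^esub> x = (v \<otimes> r) \<odot>\<^bsub>M\<^esub> ((u \<otimes> t) \<odot>\<^bsub>M\<^esub> x)"
      using uv(1-8) by (simp add: smult_assoc1[symmetric] m_ac)
    also have "\<dots> = (u \<otimes> s) \<odot>\<^bsub>M\<^esub> ((v \<otimes> r) \<odot>\<^bsub>M\<^esub> y)"
      unfolding uv(9) using uv(1-8) by (simp add: smult_assoc1[symmetric] m_ac)
    also have "\<dots> = ((u \<otimes> v \<otimes> t) \<otimes> s) \<odot>\<^bsub>M\<^esub> z"
      unfolding uv(10) using uv(1-8) by (simp add: smult_assoc1[symmetric] m_ac)
    finally show "((x, s), (z, r)) \<in> loc_rel S M"
      using uv(1-8) by (auto simp: loc_rel_iff S_mult intro!: bexI[of _ "u \<otimes> v \<otimes> t"])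
  qed
qed

lemma frac_eq_iff:
  assumes "x \<in> carrier M" "y \<in> carrier M" "s \<in> S" "t \<in> S"
  shows "frac S M x s = frac S M y t \<longleftrightarrow> (\<exists>u\<in>S. (u \<otimes> t) \<odot>\<^bsub>M\<^esub> x = (u \<otimes> s) \<odot>\<^bsub>M\<^esub> y)"
  using eq_equiv_class_iff[OF equiv_loc_rel, of "(x, s)" "(y, t)"] assms
  by (simp add: frac_def loc_rel_iff)

lemma frac_expand:
  assumes "x \<in> carrier M" "s \<in> S" "t \<in> S"
  shows "frac S M x s = frac S M (t \<odot>\<^bsub>M\<^esub> x) (t \<otimes> s)"
  using assms by (auto simp: frac_eq_iff S_mult smult_assoc1[symmetric] m_ac intro!: bexI[OF _ S_one])

abbreviation "MS \<equiv> loc_module R S M"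

lemma loc_carrierE:
  assumes "X \<in> carrier MS"
  obtains x s where "x \<in> carrier M" "s \<in> S" "X = frac S M x s"
  using assms by (auto simp: loc_module_def frac_def elim!: quotientE)

lemma frac_carrier: "x \<in> carrier M \<Longrightarrow> s \<in> S \<Longrightarrow> frac S M x s \<in> carrier MS"
  by (auto simp: loc_module_def frac_def intro!: quotientI)

text \<open>The operations of \<open>loc_module\<close> are computed on representatives picked by
  \<open>rep\<close>. About the pair picked one knows only that it is a fraction equal to the given
  one.\<close>

lemma rep_frac:
  assumes "x \<in> carrier M" "s \<in> S"
  obtains y t where "rep (frac S M x s) = (y, t)" "y \<in> carrier M" "t \<in> S" "frac S M y t = frac S M x s"
proof -
  have "(x, s) \<in> frac S M x s"
    using equiv_class_self[OF equiv_loc_rel, of "(x, s)"] assms by (simp add: frac_def)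
  then have r: "rep (frac S M x s) \<in> frac S M x s" unfolding rep_def by (rule someI)
  obtain y t where yt: "rep (frac S M x s) = (y, t)" by force
  with r have rel: "((x, s), (y, t)) \<in> loc_rel S M" by (simp add: frac_def)
  then have "y \<in> carrier M" "t \<in> S" by (auto simp: loc_rel_def)
  moreover have "frac S M y t = frac S M x s"
    using equiv_class_eq[OF equiv_loc_rel rel] by (simp add: frac_def)
  ultimately show thesis using that yt by blast
qed

text \<open>Independence of the picked representatives: the product of the two witnesses of equality
  clears all denominators at once.\<close>

lemma frac_add:
  assumes "x \<in> carrier M" "y \<in> carrier M" "s \<in> S" "t \<in> S"
  shows "frac S M x s \<oplus>\<^bsub>MS\<^esub> frac S M y t = frac S M (t \<odot>\<^bsub>M\<^esub> x \<oplus>\<^bsub>M\<^esub> s \<odot>\<^bsub>M\<^esub> y) (s \<otimes> t)"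
proof -
  obtain x' s' where x': "rep (frac S M x s) = (x', s')" "x' \<in> carrier M" "s' \<in> S" "frac S M x' s' = frac S M x s"
    using rep_frac[OF assms(1,3)] .
  obtain y' t' where y': "rep (frac S M y t) = (y', t')" "y' \<in> carrier M" "t' \<in> S" "frac S M y' t' = frac S M y t"
    using rep_frac[OF assms(2,4)] .
  note [simp] = x'(2,3) y'(2,3) assms
  obtain u where u: "u \<in> S" "(u \<otimes> s) \<odot>\<^bsub>M\<^esub> x' = (u \<otimes> s') \<odot>\<^bsub>M\<^esub> x" using x'(4) by (auto simp: frac_eq_iff)
  obtain v where v: "v \<in> S" "(v \<otimes> t) \<odot>\<^bsub>M\<^esub> y' = (v \<otimes> t') \<odot>\<^bsub>M\<^esub> y" using y'(4) by (auto simp: frac_eq_iff)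
  have "((u \<otimes> v) \<otimes> (s \<otimes> t)) \<odot>\<^bsub>M\<^esub> (t' \<odot>\<^bsub>M\<^esub> x' \<oplus>\<^bsub>M\<^esub> s' \<odot>\<^bsub>M\<^esub> y')
      = (v \<otimes> t \<otimes> t') \<odot>\<^bsub>M\<^esub> ((u \<otimes> s) \<odot>\<^bsub>M\<^esub> x') \<oplus>\<^bsub>M\<^esub> (u \<otimes> s \<otimes> s') \<odot>\<^bsub>M\<^esub> ((v \<otimes> t) \<odot>\<^bsub>M\<^esub> y')"
    using u(1) v(1) by (simp add: smult_r_distr smult_assoc1[symmetric] m_ac)
  also have "\<dots> = ((u \<otimes> v) \<otimes> (s' \<otimes> t')) \<odot>\<^bsub>M\<^esub> (t \<odot>\<^bsub>M\<^esub> x \<oplus>\<^bsub>M\<^esub> s \<odot>\<^bsub>M\<^esub> y)"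
    unfolding u(2) v(2) using u(1) v(1) by (simp add: smult_r_distr smult_assoc1[symmetric] m_ac)
  finally have "frac S M (t' \<odot>\<^bsub>M\<^esub> x' \<oplus>\<^bsub>M\<^esub> s' \<odot>\<^bsub>M\<^esub> y') (s' \<otimes> t') = frac S M (t \<odot>\<^bsub>M\<^esub> x \<oplus>\<^bsub>M\<^esub> s \<odot>\<^bsub>M\<^esub> y) (s \<otimes> t)"
    using u(1) v(1) by (subst frac_eq_iff) (auto simp: S_mult intro!: bexI[of _ "u \<otimes> v"])
  then show ?thesis by (simp add: loc_module_def x'(1) y'(1))
qed

lemma frac_add_same:
  assumes "x \<in> carrier M" "y \<in> carrier M" "s \<in> S"
  shows "frac S M x s \<oplus>\<^bsub>MS\<^esub> frac S M y s = frac S M (x \<oplus>\<^bsub>M\<^esub> y) s"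
  using assms frac_expand[of "x \<oplus>\<^bsub>M\<^esub> y" s s] by (simp add: frac_add smult_r_distr)

lemma frac_zero: "s \<in> S \<Longrightarrow> frac S M \<zero>\<^bsub>M\<^esub> s = \<zero>\<^bsub>MS\<^esub>"
  using S_one by (auto simp: loc_module_def frac_eq_iff)

text \<open>With one denominator for finitely many fractions, addition is addition of numerators,
  and statements about finite sums in the localization become statements in
  \<open>M\<close>.\<close>

lemma common_denominator:
  assumes "finite I" "\<And>i. i \<in> I \<Longrightarrow> X i \<in> carrier MS"
  shows "\<exists>s\<in>S. \<exists>x. \<forall>i\<in>I. x i \<in> carrier M \<and> X i = frac S M (x i) s"
  using assms
proof (induction I rule: finite_induct)
  case empty
  then show ?case using S_one by auto
next
  case (insert j I)
  have "\<exists>s\<in>S. \<exists>x. \<forall>i\<in>I. x i \<in> carrier M \<and> X i = frac S M (x i) s"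
    by (rule insert.IH) (rule insert.prems, simp)
  then obtain s x where sx: "s \<in> S" "\<And>i. i \<in> I \<Longrightarrow> x i \<in> carrier M \<and> X i = frac S M (x i) s"
    by blast
  obtain y t where yt: "y \<in> carrier M" "t \<in> S" "X j = frac S M y t"
    using loc_carrierE[OF insert.prems[OF insertI1]] .
  have "\<forall>i\<in>insert j I. (if i = j then s \<odot>\<^bsub>M\<^esub> y else t \<odot>\<^bsub>M\<^esub> x i) \<in> carrier M \<and>
     X i = frac S M (if i = j then s \<odot>\<^bsub>M\<^esub> y else t \<odot>\<^bsub>M\<^esub> x i) (s \<otimes> t)"
    using sx yt insert.hyps frac_expand[OF yt(1,2) sx(1)] frac_expand[OF _ sx(1) yt(2)]
    by (auto simp: m_comm)
  then show ?case using S_mult[OF sx(1) yt(2)]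
    by (intro bexI[of _ "s \<otimes> t"] exI[of _ "\<lambda>i. if i = j then s \<odot>\<^bsub>M\<^esub> y else t \<odot>\<^bsub>M\<^esub> x i"])
qed

lemma abelian_monoid_loc: "abelian_monoid MS"
proof (rule abelian_monoidI)
  show "\<zero>\<^bsub>MS\<^esub> \<in> carrier MS" using frac_zero[OF S_one] frac_carrier[OF M.zero_closed S_one] by simp
  fix X Y assume XYZ: "X \<in> carrier MS" "Y \<in> carrier MS"
  \<comment> \<open>The list serves as a family indexed by \<open>{..<2}\<close>, to which the
    common denominator applies.\<close>
  have mem: "[X, Y] ! i \<in> carrier MS" if "i \<in> {..<2::nat}" for i
    using that XYZ by (auto simp: lessThan_Suc numeral_2_eq_2)
  have "\<exists>s\<in>S. \<exists>x. \<forall>i\<in>{..<2::nat}. x i \<in> carrier M \<and> [X, Y] ! i = frac S M (x i) s"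
    by (rule common_denominator[OF finite_lessThan]) (rule mem)
  then obtain s x where x: "s \<in> S" "\<forall>i\<in>{..<2::nat}. x i \<in> carrier M \<and> [X, Y] ! i = frac S M (x i) s"
    by (elim bexE exE)
  have c: "x 0 \<in> carrier M" "x 1 \<in> carrier M" "X = frac S M (x 0) s" "Y = frac S M (x 1) s"
    using bspec[OF x(2), of 0] bspec[OF x(2), of 1] by auto
  show "X \<oplus>\<^bsub>MS\<^esub> Y \<in> carrier MS" "X \<oplus>\<^bsub>MS\<^esub> Y = Y \<oplus>\<^bsub>MS\<^esub> X"
    using c(1,2) x(1) by (simp_all add: c(3,4) frac_add_same frac_carrier M.a_comm)
next
  fix X assume "X \<in> carrier MS"
  then obtain x s where x: "x \<in> carrier M" "s \<in> S" "X = frac S M x s" by (rule loc_carrierE)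
  then show "\<zero>\<^bsub>MS\<^esub> \<oplus>\<^bsub>MS\<^esub> X = X" by (simp add: frac_zero[OF x(2), symmetric] frac_add_same)
next
  fix X Y Z assume XYZ: "X \<in> carrier MS" "Y \<in> carrier MS" "Z \<in> carrier MS"
  have mem: "[X, Y, Z] ! i \<in> carrier MS" if "i \<in> {..<3::nat}" for i
    using that XYZ by (auto simp: lessThan_Suc numeral_3_eq_3)
  have "\<exists>s\<in>S. \<exists>x. \<forall>i\<in>{..<3::nat}. x i \<in> carrier M \<and> [X, Y, Z] ! i = frac S M (x i) s"
    by (rule common_denominator[OF finite_lessThan]) (rule mem)
  then obtain s x where x: "s \<in> S" "\<forall>i\<in>{..<3::nat}. x i \<in> carrier M \<and> [X, Y, Z] ! i = frac S M (x i) s"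
    by (elim bexE exE)
  have c: "x 0 \<in> carrier M" "x 1 \<in> carrier M" "x 2 \<in> carrier M"
    "X = frac S M (x 0) s" "Y = frac S M (x 1) s" "Z = frac S M (x 2) s"
    using bspec[OF x(2), of 0] bspec[OF x(2), of 1] bspec[OF x(2), of 2] by auto
  show "X \<oplus>\<^bsub>MS\<^esub> Y \<oplus>\<^bsub>MS\<^esub> Z = X \<oplus>\<^bsub>MS\<^esub> (Y \<oplus>\<^bsub>MS\<^esub> Z)"
    using c(1-3) x(1) by (simp add: c(4-6) frac_add_same M.a_assoc)
qed

lemma finsum_frac:
  assumes "finite I" "\<And>i. i \<in> I \<Longrightarrow> x i \<in> carrier M" "s \<in> S"
  shows "(\<Oplus>\<^bsub>MS\<^esub>i\<in>I. frac S M (x i) s) = frac S M (\<Oplus>\<^bsub>M\<^esub>i\<in>I. x i) s"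
proof -
  interpret L: abelian_monoid MS by (rule abelian_monoid_loc)
  show ?thesis using assms(1,2)
  proof (induction I rule: finite_induct)
    case empty
    then show ?case by (simp add: frac_zero assms(3))
  next
    case (insert i I)
    have "(\<lambda>i. frac S M (x i) s) \<in> I \<rightarrow> carrier MS" "frac S M (x i) s \<in> carrier MS" "x \<in> I \<rightarrow> carrier M"
      using insert.prems assms(3) by (auto simp: frac_carrier)
    then show ?case using insert assms(3) by (simp add: frac_add_same)
  qed
qed

lemma fraction_module_self: "fraction_module R (self_module R) S"
  by (intro fraction_module.intro module_self_module fraction_module_axioms.intro S_subset S_one S_mult)
    (rule R.is_cring)

lemma frac_smult:
  assumes "a \<in> carrier R" "y \<in> carrier M" "s \<in> S" "t \<in> S"
  shows "frac S (self_module R) a s \<odot>\<^bsub>MS\<^esub> frac S M y t = frac S M (a \<odot>\<^bsub>M\<^esub> y) (s \<otimes> t)"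
proof -
  interpret K: fraction_module R "self_module R" S by (rule fraction_module_self)
  obtain a' s' where a': "rep (frac S (self_module R) a s) = (a', s')" "a' \<in> carrier R" "s' \<in> S"
    "frac S (self_module R) a' s' = frac S (self_module R) a s"
    using K.rep_frac[of a s] assms by (auto simp: self_module_def)
  obtain y' t' where y': "rep (frac S M y t) = (y', t')" "y' \<in> carrier M" "t' \<in> S" "frac S M y' t' = frac S M y t"
    using rep_frac[OF assms(2,4)] .
  note [simp] = a'(2,3) y'(2,3) assms
  obtain u where u: "u \<in> S" "(u \<otimes> s) \<otimes> a' = (u \<otimes> s') \<otimes> a"
    using a'(4) by (subst (asm) K.frac_eq_iff) (auto simp: self_module_def)
  obtain v where v: "v \<in> S" "(v \<otimes> t) \<odot>\<^bsub>M\<^esub> y' = (v \<otimes> t') \<odot>\<^bsub>M\<^esub> y" using y'(4) by (auto simp: frac_eq_iff)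
  have "((u \<otimes> v) \<otimes> (s \<otimes> t)) \<odot>\<^bsub>M\<^esub> (a' \<odot>\<^bsub>M\<^esub> y') = ((u \<otimes> s) \<otimes> a') \<odot>\<^bsub>M\<^esub> ((v \<otimes> t) \<odot>\<^bsub>M\<^esub> y')"
    using u(1) v(1) by (simp add: smult_assoc1[symmetric] m_ac)
  also have "\<dots> = ((u \<otimes> v) \<otimes> (s' \<otimes> t')) \<odot>\<^bsub>M\<^esub> (a \<odot>\<^bsub>M\<^esub> y)"
    unfolding u(2) v(2) using u(1) v(1) by (simp add: smult_assoc1[symmetric] m_ac)
  finally have "frac S M (a' \<odot>\<^bsub>M\<^esub> y') (s' \<otimes> t') = frac S M (a \<odot>\<^bsub>M\<^esub> y) (s \<otimes> t)"
    using u(1) v(1) by (subst frac_eq_iff) (auto simp: S_mult intro!: bexI[of _ "u \<otimes> v"])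
  then show ?thesis by (simp add: loc_module_def a'(1) y'(1))
qed

text \<open>A product of finitely many individual multipliers kills all the elements
  simultaneously.\<close>

lemma uniform_multiple:
  assumes "finite I" "\<And>i. i \<in> I \<Longrightarrow> \<exists>u\<in>S. u \<odot>\<^bsub>M\<^esub> x i = \<zero>\<^bsub>M\<^esub>" "x \<in> I \<rightarrow> carrier M"
  shows "\<exists>u\<in>S. \<forall>i\<in>I. u \<odot>\<^bsub>M\<^esub> x i = \<zero>\<^bsub>M\<^esub>"
  using assms
proof (induction I rule: finite_induct)
  case empty
  then show ?case using S_one by auto
next
  case (insert j I)
  then obtain u where u: "u \<in> S" "\<forall>i\<in>I. u \<odot>\<^bsub>M\<^esub> x i = \<zero>\<^bsub>M\<^esub>" by auto
  obtain v where v: "v \<in> S" "v \<odot>\<^bsub>M\<^esub> x j = \<zero>\<^bsub>M\<^esub>" using insert.prems by blast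
  have "(u \<otimes> v) \<odot>\<^bsub>M\<^esub> x i = \<zero>\<^bsub>M\<^esub>" if "i \<in> insert j I" for i
  proof (cases "i = j")
    case True
    then show ?thesis using u v insert.prems by (simp add: smult_assoc1)
  next
    case False
    then have "(v \<otimes> u) \<odot>\<^bsub>M\<^esub> x i = \<zero>\<^bsub>M\<^esub>" using that u v insert.prems by (subst smult_assoc1) auto
    then show ?thesis using u v by (simp add: m_comm)
  qed
  then show ?case using S_mult[OF u(1) v(1)] by blast
qed

text \<open>Clearing denominators: the numerators of a basis over a common denominator can replace
  the basis, and the two conditions say that they generate and are independent up to multipliers
  from \<open>S\<close>.\<close>

lemma free_of_rank_loc_iff:
  "free_of_rank (loc_ring R S) MS r \<longleftrightarrow>
    (\<exists>e\<in>{..<r} \<rightarrow> carrier M.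
       (\<forall>x\<in>carrier M. \<exists>s\<in>S. s \<odot>\<^bsub>M\<^esub> x \<in> lin_span R M e {..<r}) \<and>
       (\<forall>c\<in>{..<r} \<rightarrow> carrier R. (\<Oplus>\<^bsub>M\<^esub>i\<in>{..<r}. c i \<odot>\<^bsub>M\<^esub> e i) = \<zero>\<^bsub>M\<^esub> \<longrightarrow>
          (\<exists>s\<in>S. \<forall>i<r. s \<otimes> c i = \<zero>)))" (is "_ \<longleftrightarrow> (\<exists>e\<in>_. ?gen e \<and> ?indep e)")
proof
  interpret K: fraction_module R "self_module R" S by (rule fraction_module_self)
  interpret L: abelian_monoid MS by (rule abelian_monoid_loc)
  let ?k = "frac S (self_module R)" and ?C = "carrier (loc_ring R S)"
  have self: "carrier (self_module R) = carrier R" "\<zero>\<^bsub>self_module R\<^esub> = \<zero>" "smult (self_module R) = mult R"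
    by (simp_all add: self_module_def)
  have C: "?C = carrier (loc_module R S (self_module R))" by (simp add: loc_ring_def Let_def)
  have kC: "?k a s \<in> ?C" if "a \<in> carrier R" "s \<in> S" for a s
    using that K.frac_carrier by (simp add: C self)
  have comb: "(\<Oplus>\<^bsub>MS\<^esub>i\<in>{..<r}. ?k (c i) t \<odot>\<^bsub>MS\<^esub> frac S M (e i) s) = frac S M (\<Oplus>\<^bsub>M\<^esub>i\<in>{..<r}. c i \<odot>\<^bsub>M\<^esub> e i) (t \<otimes> s)"
    if "\<And>i. i < r \<Longrightarrow> c i \<in> carrier R" "\<And>i. i < r \<Longrightarrow> e i \<in> carrier M" "s \<in> S" "t \<in> S" for c e s t
  proof -
    have "(\<Oplus>\<^bsub>MS\<^esub>i\<in>{..<r}. ?k (c i) t \<odot>\<^bsub>MS\<^esub> frac S M (e i) s) = (\<Oplus>\<^bsub>MS\<^esub>i\<in>{..<r}. frac S M (c i \<odot>\<^bsub>M\<^esub> e i) (t \<otimes> s))"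
      using that by (intro L.finsum_cong') (auto simp: frac_smult frac_carrier S_mult)
    then show ?thesis
      using finsum_frac[of "{..<r}" "\<lambda>i. c i \<odot>\<^bsub>M\<^esub> e i" "t \<otimes> s"] that by (simp add: S_mult)
  qed
  have comb_cong: "(\<Oplus>\<^bsub>MS\<^esub>i\<in>{..<r}. c i \<odot>\<^bsub>MS\<^esub> E i) = (\<Oplus>\<^bsub>MS\<^esub>i\<in>{..<r}. d i \<odot>\<^bsub>MS\<^esub> E' i)"
    if "\<And>i. i < r \<Longrightarrow> c i = d i \<and> E i = E' i" "\<And>i. i < r \<Longrightarrow> d i \<odot>\<^bsub>MS\<^esub> E' i \<in> carrier MS" for c d E E'
    using that by (intro L.finsum_cong') auto
  have smult_cl: "?k a t \<odot>\<^bsub>MS\<^esub> frac S M y s \<in> carrier MS"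
    if "a \<in> carrier R" "y \<in> carrier M" "s \<in> S" "t \<in> S" for a y s t
    using that by (simp add: frac_smult frac_carrier S_mult)
  {
    assume "free_of_rank (loc_ring R S) MS r"
    then obtain E where E: "E \<in> {..<r} \<rightarrow> carrier MS"
      and free: "\<And>X. X \<in> carrier MS \<Longrightarrow> \<exists>!c. c \<in> {..<r} \<rightarrow>\<^sub>E ?C \<and> X = (\<Oplus>\<^bsub>MS\<^esub>i\<in>{..<r}. c i \<odot>\<^bsub>MS\<^esub> E i)"
      by (auto simp: free_of_rank_def)
    have "\<exists>s\<in>S. \<exists>e. \<forall>i\<in>{..<r}. e i \<in> carrier M \<and> E i = frac S M (e i) s"
      by (rule common_denominator[OF finite_lessThan]) (rule funcset_mem[OF E])
    then obtain s e where s: "s \<in> S" and e_all: "\<forall>i\<in>{..<r}. e i \<in> carrier M \<and> E i = frac S M (e i) s"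
      by (elim bexE exE)
    have e: "e i \<in> carrier M" and Ee: "E i = frac S M (e i) s" if "i < r" for i
      using bspec[OF e_all, of i] that by simp_all
    have "?gen e"
    proof
      fix x assume x: "x \<in> carrier M"
      from free[OF frac_carrier[OF x S_one]] obtain c
        where c: "c \<in> {..<r} \<rightarrow>\<^sub>E ?C" "frac S M x \<one> = (\<Oplus>\<^bsub>MS\<^esub>i\<in>{..<r}. c i \<odot>\<^bsub>MS\<^esub> E i)" by blast
      have "\<exists>t\<in>S. \<exists>d. \<forall>i\<in>{..<r}. d i \<in> carrier (self_module R) \<and> c i = ?k (d i) t"
        by (rule K.common_denominator[OF finite_lessThan]) (use c(1) in \<open>auto simp: C\<close>)
      then obtain t d where t: "t \<in> S" and d_all: "\<forall>i\<in>{..<r}. d i \<in> carrier (self_module R) \<and> c i = ?k (d i) t"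
        by (elim bexE exE)
      have d: "d i \<in> carrier R" and cd: "c i = ?k (d i) t" if "i < r" for i
        using bspec[OF d_all, of i] that by (simp_all add: self)
      have "frac S M x \<one> = (\<Oplus>\<^bsub>MS\<^esub>i\<in>{..<r}. ?k (d i) t \<odot>\<^bsub>MS\<^esub> frac S M (e i) s)"
        unfolding c(2) using cd Ee d e s t by (intro comb_cong) (auto simp: smult_cl)
      also have "\<dots> = frac S M (\<Oplus>\<^bsub>M\<^esub>i\<in>{..<r}. d i \<odot>\<^bsub>M\<^esub> e i) (t \<otimes> s)" by (rule comb[OF d e s t])
      finally obtain u where u: "u \<in> S" "(u \<otimes> (t \<otimes> s)) \<odot>\<^bsub>M\<^esub> x = u \<odot>\<^bsub>M\<^esub> (\<Oplus>\<^bsub>M\<^esub>i\<in>{..<r}. d i \<odot>\<^bsub>M\<^esub> e i)"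
        using x d e s t S_one by (subst (asm) frac_eq_iff) (auto intro!: M.finsum_closed simp: S_mult)
      have "(\<Oplus>\<^bsub>M\<^esub>i\<in>{..<r}. d i \<odot>\<^bsub>M\<^esub> e i) \<in> lin_span R M e {..<r}" using d by (auto simp: lin_span_def)
      then show "\<exists>s\<in>S. s \<odot>\<^bsub>M\<^esub> x \<in> lin_span R M e {..<r}"
        using u s t e lin_span_smult[of "{..<r}" e _ u] by (intro bexI[of _ "u \<otimes> (t \<otimes> s)"]) (auto simp: S_mult)
    qed
    moreover have "?indep e"
    proof (intro ballI impI)
      fix c assume c: "c \<in> {..<r} \<rightarrow> carrier R" and z: "(\<Oplus>\<^bsub>M\<^esub>i\<in>{..<r}. c i \<odot>\<^bsub>M\<^esub> e i) = \<zero>\<^bsub>M\<^esub>"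
      \<comment> \<open>Both tuples represent zero, so uniqueness of coordinates forces every
        \<open>c i / 1\<close> to equal \<open>0 / 1\<close>.\<close>
      let ?c = "\<lambda>i\<in>{..<r}. ?k (c i) \<one>" and ?z = "\<lambda>i\<in>{..<r}. ?k \<zero> \<one>"
      have c': "c i \<in> carrier R" if "i < r" for i using c that by auto
      have "(\<Oplus>\<^bsub>MS\<^esub>i\<in>{..<r}. ?c i \<odot>\<^bsub>MS\<^esub> E i) = (\<Oplus>\<^bsub>MS\<^esub>i\<in>{..<r}. ?k (c i) \<one> \<odot>\<^bsub>MS\<^esub> frac S M (e i) s)"
        using Ee c' e s S_one by (intro comb_cong) (auto simp: smult_cl)
      also have "\<dots> = \<zero>\<^bsub>MS\<^esub>" using comb[OF c' e s S_one] s by (simp add: z frac_zero)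
      finally have 1: "\<zero>\<^bsub>MS\<^esub> = (\<Oplus>\<^bsub>MS\<^esub>i\<in>{..<r}. ?c i \<odot>\<^bsub>MS\<^esub> E i)" by simp
      have "(\<Oplus>\<^bsub>MS\<^esub>i\<in>{..<r}. ?z i \<odot>\<^bsub>MS\<^esub> E i) = (\<Oplus>\<^bsub>MS\<^esub>i\<in>{..<r}. ?k \<zero> \<one> \<odot>\<^bsub>MS\<^esub> frac S M (e i) s)"
        using Ee e s S_one by (intro comb_cong) (auto simp: smult_cl)
      also have "\<dots> = frac S M (\<Oplus>\<^bsub>M\<^esub>i\<in>{..<r}. \<zero> \<odot>\<^bsub>M\<^esub> e i) (\<one> \<otimes> s)" by (rule comb[OF _ e s S_one]) auto
      also have "(\<Oplus>\<^bsub>M\<^esub>i\<in>{..<r}. \<zero> \<odot>\<^bsub>M\<^esub> e i) = \<zero>\<^bsub>M\<^esub>" using e by (intro M.add.finprod_one_eqI) auto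
      finally have 2: "\<zero>\<^bsub>MS\<^esub> = (\<Oplus>\<^bsub>MS\<^esub>i\<in>{..<r}. ?z i \<odot>\<^bsub>MS\<^esub> E i)" using s by (simp add: frac_zero)
      have mem: "?c \<in> {..<r} \<rightarrow>\<^sub>E ?C" "?z \<in> {..<r} \<rightarrow>\<^sub>E ?C" using c' S_one kC by auto
      have eq: "?c = ?z" using free[OF L.zero_closed] 1 2 mem by blast
      have "?k (c i) \<one> = ?k \<zero> \<one>" if "i < r" for i
        using fun_cong[OF eq, of i] that by simp
      then have "\<exists>u\<in>S. u \<odot>\<^bsub>self_module R\<^esub> c i = \<zero>\<^bsub>self_module R\<^esub>" if "i \<in> {..<r}" for i
        using that K.frac_eq_iff[of "c i" \<zero> \<one> \<one>] c' S_one by (auto simp: self)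
      then show "\<exists>s\<in>S. \<forall>i<r. s \<otimes> c i = \<zero>"
        using K.uniform_multiple[of "{..<r}" c] c' by (auto simp: self)
    qed
    ultimately show "\<exists>e\<in>{..<r} \<rightarrow> carrier M. ?gen e \<and> ?indep e" using e by blast
  next
    assume "\<exists>e\<in>{..<r} \<rightarrow> carrier M. ?gen e \<and> ?indep e"
    then obtain e where e': "e \<in> {..<r} \<rightarrow> carrier M" and gen: "?gen e" and indep: "?indep e" by blast
    have e: "e i \<in> carrier M" if "i < r" for i using e' that by auto
    define E where "E i = frac S M (e i) \<one>" for i
    have "\<exists>!c. c \<in> {..<r} \<rightarrow>\<^sub>E ?C \<and> X = (\<Oplus>\<^bsub>MS\<^esub>i\<in>{..<r}. c i \<odot>\<^bsub>MS\<^esub> E i)" if X: "X \<in> carrier MS" for X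
    proof (rule ex_ex1I)
      obtain x s where x: "x \<in> carrier M" "s \<in> S" "X = frac S M x s" using loc_carrierE[OF X] .
      obtain t d where t: "t \<in> S" and d': "d \<in> {..<r} \<rightarrow> carrier R" and td: "t \<odot>\<^bsub>M\<^esub> x = (\<Oplus>\<^bsub>M\<^esub>i\<in>{..<r}. d i \<odot>\<^bsub>M\<^esub> e i)"
        using gen x(1) by (auto simp: lin_span_def)
      have d: "d i \<in> carrier R" if "i < r" for i using d' that by auto
      let ?c = "\<lambda>i\<in>{..<r}. ?k (d i) (t \<otimes> s)"
      have "(\<Oplus>\<^bsub>MS\<^esub>i\<in>{..<r}. ?c i \<odot>\<^bsub>MS\<^esub> E i) = (\<Oplus>\<^bsub>MS\<^esub>i\<in>{..<r}. ?k (d i) (t \<otimes> s) \<odot>\<^bsub>MS\<^esub> frac S M (e i) \<one>)"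
        using d e S_one t x by (intro comb_cong) (auto simp: smult_cl S_mult E_def)
      also have "\<dots> = X" using comb[OF d e S_one S_mult[OF t x(2)]] frac_expand[OF x(1,2) t] t x
        by (simp add: td[symmetric] S_mult)
      finally have "X = (\<Oplus>\<^bsub>MS\<^esub>i\<in>{..<r}. ?c i \<odot>\<^bsub>MS\<^esub> E i)" by simp
      moreover have "?c \<in> {..<r} \<rightarrow>\<^sub>E ?C" using d kC S_mult[OF t x(2)] by auto
      ultimately show "\<exists>c. c \<in> {..<r} \<rightarrow>\<^sub>E ?C \<and> X = (\<Oplus>\<^bsub>MS\<^esub>i\<in>{..<r}. c i \<odot>\<^bsub>MS\<^esub> E i)" by blast
    next
      fix c c'
      assume cc': "c \<in> {..<r} \<rightarrow>\<^sub>E ?C \<and> X = (\<Oplus>\<^bsub>MS\<^esub>i\<in>{..<r}. c i \<odot>\<^bsub>MS\<^esub> E i)"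
        "c' \<in> {..<r} \<rightarrow>\<^sub>E ?C \<and> X = (\<Oplus>\<^bsub>MS\<^esub>i\<in>{..<r}. c' i \<odot>\<^bsub>MS\<^esub> E i)"
      \<comment> \<open>Both coordinate tuples are packed into one family, indexed by a Boolean and
        an index, so that a single denominator serves all of them.\<close>
      define cs where "cs p = (if fst p then c (snd p) else c' (snd p))" for p
      have "cs p \<in> carrier (loc_module R S (self_module R))" if "p \<in> UNIV \<times> {..<r}" for p
        using cc' that by (cases p) (auto simp: cs_def C PiE_def)
      then have "\<exists>t\<in>S. \<exists>ds. \<forall>p\<in>UNIV \<times> {..<r}. ds p \<in> carrier (self_module R) \<and> cs p = ?k (ds p) t"
        by (intro K.common_denominator) auto
      then obtain t ds where t: "t \<in> S"
        and ds: "\<forall>p\<in>UNIV \<times> {..<r}. ds p \<in> carrier (self_module R) \<and> cs p = ?k (ds p) t"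
        by (elim bexE exE)
      define d d' where "d i = ds (True, i)" and "d' i = ds (False, i)" for i
      have d: "d i \<in> carrier R" "c i = ?k (d i) t" "d' i \<in> carrier R" "c' i = ?k (d' i) t" if "i < r" for i
        using bspec[OF ds, of "(True, i)"] bspec[OF ds, of "(False, i)"] that
        by (simp_all add: d_def d'_def cs_def self)
      have "X = (\<Oplus>\<^bsub>MS\<^esub>i\<in>{..<r}. ?k (d i) t \<odot>\<^bsub>MS\<^esub> frac S M (e i) \<one>)"
        using conjunct2[OF cc'(1)] d e t S_one
        by (simp only:) (intro comb_cong, auto simp: smult_cl E_def)
      then have X1: "X = frac S M (\<Oplus>\<^bsub>M\<^esub>i\<in>{..<r}. d i \<odot>\<^bsub>M\<^esub> e i) t"
        using comb[OF d(1) e S_one t] t by simp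
      have "X = (\<Oplus>\<^bsub>MS\<^esub>i\<in>{..<r}. ?k (d' i) t \<odot>\<^bsub>MS\<^esub> frac S M (e i) \<one>)"
        using conjunct2[OF cc'(2)] d e t S_one
        by (simp only:) (intro comb_cong, auto simp: smult_cl E_def)
      then have X2: "X = frac S M (\<Oplus>\<^bsub>M\<^esub>i\<in>{..<r}. d' i \<odot>\<^bsub>M\<^esub> e i) t"
        using comb[OF d(3) e S_one t] t by simp
      define y y' where "y = (\<Oplus>\<^bsub>M\<^esub>i\<in>{..<r}. d i \<odot>\<^bsub>M\<^esub> e i)" and "y' = (\<Oplus>\<^bsub>M\<^esub>i\<in>{..<r}. d' i \<odot>\<^bsub>M\<^esub> e i)"
      have yM: "y \<in> carrier M" "y' \<in> carrier M"
        unfolding y_def y'_def using d e by (auto intro!: M.finsum_closed)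
      obtain u where u: "u \<in> S" "(u \<otimes> t) \<odot>\<^bsub>M\<^esub> y = (u \<otimes> t) \<odot>\<^bsub>M\<^esub> y'"
        using X1 X2 t yM frac_eq_iff[OF yM t t] by (auto simp: y_def y'_def)
      let ?w = "u \<otimes> t"
      have w: "?w \<in> S" "?w \<in> carrier R" using S_mult[OF u(1) t] by simp_all
      \<comment> \<open>Independence is applied to the differences of the numerators, multiplied by
        \<open>u t\<close> because the two sums agree only after that multiplication.\<close>
      have "(\<Oplus>\<^bsub>M\<^esub>i\<in>{..<r}. (?w \<otimes> (d i \<ominus> d' i)) \<odot>\<^bsub>M\<^esub> e i) = (\<Oplus>\<^bsub>M\<^esub>i\<in>{..<r}. ?w \<odot>\<^bsub>M\<^esub> ((d i \<ominus> d' i) \<odot>\<^bsub>M\<^esub> e i))"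
        using d e w by (intro M.finsum_cong') (auto simp: smult_assoc1)
      also have "\<dots> = ?w \<odot>\<^bsub>M\<^esub> (\<Oplus>\<^bsub>M\<^esub>i\<in>{..<r}. (d i \<ominus> d' i) \<odot>\<^bsub>M\<^esub> e i)"
        using d e w by (intro finsum_smult_ldistr[symmetric]) auto
      also have "\<dots> = ?w \<odot>\<^bsub>M\<^esub> (y \<ominus>\<^bsub>M\<^esub> y')"
        unfolding y_def y'_def using d e by (subst finsum_smult_diff) auto
      also have "\<dots> = \<zero>\<^bsub>M\<^esub>"
        using yM w u(2) by (simp add: a_minus_def smult_r_distr smult_r_minus M.r_neg)
      finally obtain v where v: "v \<in> S" "\<forall>i<r. v \<otimes> (?w \<otimes> (d i \<ominus> d' i)) = \<zero>"
        using bspec[OF indep, of "\<lambda>i. ?w \<otimes> (d i \<ominus> d' i)"] d w by auto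
      have "c i = c' i" if i: "i < r" for i
      proof -
        define w where "w = v \<otimes> (u \<otimes> t)"
        have wS: "w \<in> S" "w \<in> carrier R" using S_mult[OF v(1) w(1)] by (simp_all add: w_def)
        note di = d(1)[OF i] d(3)[OF i]
        have "w \<otimes> (d i \<ominus> d' i) = \<zero>"
          unfolding w_def using v i di w(2) by (subst m_assoc) auto
        then have "w \<otimes> d i \<ominus> w \<otimes> d' i = \<zero>"
          using wS(2) di by (simp add: a_minus_def r_distr r_minus)
        then have eq: "w \<otimes> d i = w \<otimes> d' i"
          using wS(2) di by (intro R.minus_eq_zero_imp[of "w \<otimes> d i" "w \<otimes> d' i"] m_closed)
        have "(w \<otimes> t) \<otimes> d i = t \<otimes> (w \<otimes> d i)" "(w \<otimes> t) \<otimes> d' i = t \<otimes> (w \<otimes> d' i)"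
          using wS(2) di t by (simp_all add: m_ac)
        with eq have "(w \<otimes> t) \<otimes> d i = (w \<otimes> t) \<otimes> d' i" by simp
        then have "?k (d i) t = ?k (d' i) t"
          using di t wS(1) by (subst K.frac_eq_iff) (auto simp: self)
        then show ?thesis using d[OF i] by simp
      qed
      then show "c = c'"
        by (intro PiE_ext[OF conjunct1[OF cc'(1)] conjunct1[OF cc'(2)]]) simp
    qed
    then have "\<forall>X\<in>carrier MS. \<exists>!c. c \<in> {..<r} \<rightarrow>\<^sub>E ?C \<and> X = (\<Oplus>\<^bsub>MS\<^esub>i\<in>{..<r}. c i \<odot>\<^bsub>MS\<^esub> E i)" by (rule ballI)
    moreover have "E \<in> {..<r} \<rightarrow> carrier MS" using e S_one by (auto simp: E_def frac_carrier)
    ultimately show "free_of_rank (loc_ring R S) MS r" unfolding free_of_rank_def by (rule bexI)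
  }
qed

end

section \<open>Local freeness over a Noetherian ring in terms of dual bases\<close>

lemma (in module) fraction_module_powers:
  assumes "f \<in> carrier R"
  shows "fraction_module R M (powers R f)"
proof (intro fraction_module.intro module_axioms fraction_module_axioms.intro)
  show "powers R f \<subseteq> carrier R" using assms by (auto simp: powers_def)
  have "\<one> = f [^] (0::nat)" by simp
  then show "\<one> \<in> powers R f" unfolding powers_def by blast
  show "s \<otimes> t \<in> powers R f" if "s \<in> powers R f" "t \<in> powers R f" for s t
    using that assms nat_pow_mult by (auto simp: powers_def)
qed

text \<open>Over a Noetherian ring the exponents in \<open>f\<close> needed to write elements of \<open>M\<close> in a local basis
  and to compare coefficients can be chosen uniformly, so that the coordinate functionals of the
  local basis become functionals on \<open>M\<close> itself.\<close>

lemma (in module) local_basis_dual_basis: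
  assumes noeth: "noetherian_ring R" and f: "f \<in> carrier R" and e: "\<And>i. i < r \<Longrightarrow> e i \<in> carrier M"
    and span: "\<And>x. x \<in> carrier M \<Longrightarrow> f [^] (n::nat) \<odot>\<^bsub>M\<^esub> x \<in> lin_span R M e {..<r}"
    and indep: "\<And>c. c \<in> {..<r} \<rightarrow> carrier R \<Longrightarrow> (\<Oplus>\<^bsub>M\<^esub>i\<in>{..<r}. c i \<odot>\<^bsub>M\<^esub> e i) = \<zero>\<^bsub>M\<^esub> \<Longrightarrow>
      \<exists>m::nat. \<forall>i<r. f [^] m \<otimes> c i = \<zero>"
  shows "\<exists>m::nat. \<exists>\<phi>. dual_basis_at R M (carrier M) {\<zero>\<^bsub>M\<^esub>} r (f [^] m) e \<phi>"
proof -
  interpret noetherian_ring R by fact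
  obtain N :: nat where N: "\<And>c n. c \<in> carrier R \<Longrightarrow> f [^] (n::nat) \<otimes> c = \<zero> \<Longrightarrow> f [^] N \<otimes> c = \<zero>"
    using uniform_torsion_exponent[OF R.is_cring f] by blast
  let ?lc = "\<lambda>c. \<Oplus>\<^bsub>M\<^esub>i\<in>{..<r}. c i \<odot>\<^bsub>M\<^esub> e i"
  have e': "e \<in> {..<r} \<rightarrow> carrier M" using e by auto
  \<comment> \<open>The coefficients of an element are unique only up to \<open>f\<close>-power
    torsion; the uniform exponent \<open>N\<close> removes this ambiguity.\<close>
  have uniq: "f [^] N \<otimes> c i = f [^] N \<otimes> d i"
    if c: "c \<in> {..<r} \<rightarrow> carrier R" and d: "d \<in> {..<r} \<rightarrow> carrier R" and eq: "?lc c = ?lc d" and i: "i < r" for c d i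
  proof -
    have "?lc (\<lambda>i. c i \<ominus> d i) = ?lc c \<ominus>\<^bsub>M\<^esub> ?lc d"
      using finsum_smult_diff[OF _ e' c d] by simp
    also have "\<dots> = \<zero>\<^bsub>M\<^esub>"
      unfolding eq a_minus_def using d e by (intro M.r_neg M.finsum_closed) auto
    finally obtain m :: nat where "f [^] m \<otimes> (c i \<ominus> d i) = \<zero>"
      using indep[of "\<lambda>i. c i \<ominus> d i"] c d i by auto
    moreover have cd: "c i \<in> carrier R" "d i \<in> carrier R" using c d i by auto
    ultimately have "f [^] N \<otimes> (c i \<ominus> d i) = \<zero>" by (intro N) auto
    then have "f [^] N \<otimes> c i \<ominus> f [^] N \<otimes> d i = \<zero>"
      using cd f by (simp add: a_minus_def r_distr r_minus)
    then show ?thesis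
      using cd f by (intro R.minus_eq_zero_imp[of "f [^] N \<otimes> c i" "f [^] N \<otimes> d i"]) simp_all
  qed
  have "\<forall>x\<in>carrier M. \<exists>c. c \<in> {..<r} \<rightarrow> carrier R \<and> f [^] n \<odot>\<^bsub>M\<^esub> x = ?lc c"
    using span by (auto simp: lin_span_def)
  then obtain C where C: "\<And>x. x \<in> carrier M \<Longrightarrow> C x \<in> {..<r} \<rightarrow> carrier R"
    "\<And>x. x \<in> carrier M \<Longrightarrow> f [^] n \<odot>\<^bsub>M\<^esub> x = ?lc (C x)"
    by metis
  have Cc: "C x i \<in> carrier R" if "x \<in> carrier M" "i < r" for x i using C(1) that by auto
  \<comment> \<open>The factor \<open>f [^] N\<close> makes the value independent of the chosen
    coefficients \<open>C x\<close>. Linearity follows by comparing with the obvious coefficients of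
    a sum or a multiple.\<close>
  define \<phi> where "\<phi> i x = f [^] N \<otimes> C x i" for i x
  have \<phi>: "\<phi> i x = f [^] N \<otimes> c i"
    if "x \<in> carrier M" "c \<in> {..<r} \<rightarrow> carrier R" "f [^] n \<odot>\<^bsub>M\<^esub> x = ?lc c" "i < r" for i x c
    unfolding \<phi>_def using uniq[OF C(1)[OF that(1)] that(2) _ that(4)] C(2)[OF that(1)] that(3) by simp
  have \<phi>c: "\<phi> i x \<in> carrier R" if "i < r" "x \<in> carrier M" for i x
    using Cc that f by (simp add: \<phi>_def)
  \<comment> \<open>The exponent is a sum: \<open>n\<close> brings every element into the span, and
    \<open>N\<close> makes its coefficients well defined.\<close>
  have "dual_basis_at R M (carrier M) {\<zero>\<^bsub>M\<^esub>} r (f [^] (N + n)) e \<phi>"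
    unfolding dual_basis_at_def
  proof (intro conjI allI impI ballI)
    show "f [^] (N + n) \<in> carrier R" using f by simp
    show "e i \<in> carrier M" if "i < r" for i using e that .
    show lin: "linear_on R M (carrier M) (\<phi> i)" if i: "i < r" for i
    proof (rule linear_onI)
      fix x assume x: "x \<in> carrier M"
      show "\<phi> i x \<in> carrier R" using \<phi>c i x .
      {
        fix y assume y: "y \<in> carrier M"
        have "?lc (\<lambda>i. C x i \<oplus> C y i) = (\<Oplus>\<^bsub>M\<^esub>i\<in>{..<r}. C x i \<odot>\<^bsub>M\<^esub> e i \<oplus>\<^bsub>M\<^esub> C y i \<odot>\<^bsub>M\<^esub> e i)"
          using Cc x y e by (intro M.finsum_cong') (auto simp: smult_l_distr)
        also have "\<dots> = ?lc (C x) \<oplus>\<^bsub>M\<^esub> ?lc (C y)"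
          using Cc x y e by (intro M.finsum_addf) auto
        finally have "f [^] n \<odot>\<^bsub>M\<^esub> (x \<oplus>\<^bsub>M\<^esub> y) = ?lc (\<lambda>i. C x i \<oplus> C y i)"
          using x y f C(2) by (simp add: smult_r_distr)
        then have "\<phi> i (x \<oplus>\<^bsub>M\<^esub> y) = f [^] N \<otimes> (C x i \<oplus> C y i)"
          using x y Cc i by (intro \<phi>) auto
        then show "\<phi> i (x \<oplus>\<^bsub>M\<^esub> y) = \<phi> i x \<oplus> \<phi> i y"
          using Cc x y i f by (simp add: \<phi>_def r_distr)
      }
      fix a assume a: "a \<in> carrier R"
      have "?lc (\<lambda>i. a \<otimes> C x i) = (\<Oplus>\<^bsub>M\<^esub>i\<in>{..<r}. a \<odot>\<^bsub>M\<^esub> (C x i \<odot>\<^bsub>M\<^esub> e i))"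
        using Cc x a e by (intro M.finsum_cong') (auto simp: smult_assoc1)
      also have "\<dots> = a \<odot>\<^bsub>M\<^esub> ?lc (C x)"
        using Cc x a e by (intro finsum_smult_ldistr[symmetric]) auto
      also have "\<dots> = f [^] n \<odot>\<^bsub>M\<^esub> (a \<odot>\<^bsub>M\<^esub> x)"
        using x a f by (simp add: C(2)[symmetric] smult_assoc1[symmetric] m_comm)
      finally have "\<phi> i (a \<odot>\<^bsub>M\<^esub> x) = f [^] N \<otimes> (a \<otimes> C x i)"
        using x a Cc i by (intro \<phi>) auto
      then show "\<phi> i (a \<odot>\<^bsub>M\<^esub> x) = a \<otimes> \<phi> i x"
        using Cc x i f a by (simp add: \<phi>_def m_lcomm)
    qed
    show "\<phi> i x = \<zero>" if "i < r" "x \<in> {\<zero>\<^bsub>M\<^esub>}" for i x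
      using linear_on_zero[OF lin[OF that(1)] carrier_is_submodule] that by simp
    show "\<phi> i (e j) = (if i = j then f [^] (N + n) else \<zero>)" if ij: "i < r" "j < r" for i j
    proof -
      have "f [^] n \<odot>\<^bsub>M\<^esub> e j = ?lc (\<lambda>i. if i = j then f [^] n else \<zero>)"
        using delta_combination[of "{..<r}" e j "f [^] n"] e' ij f by simp
      then have "\<phi> i (e j) = f [^] N \<otimes> (if i = j then f [^] n else \<zero>)"
        using ij e f by (intro \<phi>) auto
      then show ?thesis using f by (simp add: nat_pow_mult)
    qed
    fix x assume x: "x \<in> carrier M"
    have "?lc (\<lambda>i. \<phi> i x) = (\<Oplus>\<^bsub>M\<^esub>i\<in>{..<r}. f [^] N \<odot>\<^bsub>M\<^esub> (C x i \<odot>\<^bsub>M\<^esub> e i))"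
      using Cc x f e by (intro M.finsum_cong') (auto simp: smult_assoc1 \<phi>_def)
    also have "\<dots> = f [^] N \<odot>\<^bsub>M\<^esub> ?lc (C x)"
      using Cc x f e by (intro finsum_smult_ldistr[symmetric]) auto
    also have "\<dots> = f [^] (N + n) \<odot>\<^bsub>M\<^esub> x"
      using x f by (simp add: C(2)[symmetric] smult_assoc1[symmetric] nat_pow_mult)
    finally show "f [^] (N + n) \<odot>\<^bsub>M\<^esub> x \<ominus>\<^bsub>M\<^esub> ?lc (\<lambda>i. \<phi> i x) \<in> {\<zero>\<^bsub>M\<^esub>}"
      using x f by (simp add: a_minus_def M.r_neg)
  qed
  then show ?thesis by blast
qed

text \<open>Forwards, a local basis gives each element an exponent of its own. Quasi-compactness
  provides finitely many generators, so that one exponent serves all elements and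
  \<open>local_basis_dual_basis\<close> applies. Backwards, the denominator \<open>s\<close> itself
  defines a neighbourhood on which the \<open>e i\<close> are a basis.\<close>

theorem (in module) locally_free_const_rank_iff:
  assumes noeth: "noetherian_ring R"
  shows "locally_free_const_rank R M \<longleftrightarrow> (\<exists>r. local_dual_basis R M (carrier M) {\<zero>\<^bsub>M\<^esub>} r)"
proof
  assume "locally_free_const_rank R M"
  then obtain r where lf: "\<And>P. primeideal P R \<Longrightarrow>
      \<exists>f\<in>carrier R - P. free_of_rank (loc_ring R (powers R f)) (loc_module R (powers R f) M) r"
    by (auto simp: locally_free_const_rank_def)
  define basis where "basis f e \<longleftrightarrow> e \<in> {..<r} \<rightarrow> carrier M \<and>
       (\<forall>x\<in>carrier M. \<exists>s\<in>powers R f. s \<odot>\<^bsub>M\<^esub> x \<in> lin_span R M e {..<r}) \<and>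
       (\<forall>c\<in>{..<r} \<rightarrow> carrier R. (\<Oplus>\<^bsub>M\<^esub>i\<in>{..<r}. c i \<odot>\<^bsub>M\<^esub> e i) = \<zero>\<^bsub>M\<^esub> \<longrightarrow>
          (\<exists>s\<in>powers R f. \<forall>i<r. s \<otimes> c i = \<zero>))" for f e
  \<comment> \<open>The elements over whose basic open sets a basis from \<open>M\<close> exists;
    local freeness says that these open sets cover the spectrum.\<close>
  define D where "D = {f \<in> carrier R. \<exists>e. basis f e}"
  have D: "\<exists>f\<in>D. f \<notin> P" if P: "primeideal P R" for P
  proof -
    obtain f where f: "f \<in> carrier R - P" "free_of_rank (loc_ring R (powers R f)) (loc_module R (powers R f) M) r"
      using lf[OF P] by (elim bexE)
    from f(1) interpret F: fraction_module R M "powers R f" by (intro fraction_module_powers) simp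
    have "\<exists>e. basis f e" using f(2) unfolding F.free_of_rank_loc_iff basis_def by (elim bexE) (rule exI, simp)
    with f(1) show ?thesis by (auto simp: D_def)
  qed
  define E where "E f = (SOME e. basis f e)" for f
  have E: "basis f (E f)" if "f \<in> D" for f
    using that unfolding D_def E_def by (auto intro: someI_ex[of "basis f"])
  have EM: "E f i \<in> carrier M" if "f \<in> D" "i < r" for f i using E[OF that(1)] that(2) by (auto simp: basis_def)
  have ED: "\<exists>n::nat. f [^] n \<odot>\<^bsub>M\<^esub> x \<in> lin_span R M (E f) {..<r}" if "f \<in> D" "x \<in> carrier M" for f x
    using E[OF that(1)] that(2) unfolding basis_def powers_def by blast
  have DR: "D \<subseteq> carrier R" by (auto simp: D_def)
  obtain F where F: "finite F" "F \<subseteq> D" "\<And>P. primeideal P R \<Longrightarrow> \<exists>f\<in>F. f \<notin> P"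
    using finite_cover_spectrum[OF DR D] by blast
  \<comment> \<open>The local bases over a finite cover together generate the module: the scalars
    that bring a given element into their span form an ideal contained in no prime.\<close>
  define G where "G = (\<Union>f\<in>F. E f ` {..<r})"
  have G: "finite G" "(\<lambda>g. g) \<in> G \<rightarrow> carrier M" using F EM by (auto simp: G_def)
  let ?sp = "lin_span R M (\<lambda>g. g) G"
  have gen: "x \<in> ?sp" if x: "x \<in> carrier M" for x
  proof -
    have "\<one> \<in> {c \<in> carrier R. c \<odot>\<^bsub>M\<^esub> x \<in> ?sp}"
    proof (rule local_global)
      fix P assume P: "primeideal P R"
      obtain f where f: "f \<in> F" "f \<notin> P" using F(3)[OF P] by blast
      obtain n :: nat where n: "f [^] n \<odot>\<^bsub>M\<^esub> x \<in> lin_span R M (E f) {..<r}" using ED x f F by blast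
      have "lin_span R M (E f) {..<r} \<subseteq> ?sp"
      proof (rule lin_span_minimal)
        fix i assume "i \<in> {..<r}"
        then have "E f i \<in> G" using f by (auto simp: G_def)
        then show "E f i \<in> ?sp" using lin_span_base[OF G] by simp
      qed (simp_all add: lin_span_subset[OF G(2)] lin_span_zero[OF G(2)] lin_span_add[OF G(2)] lin_span_smult[OF G])
      moreover have "f [^] n \<in> carrier R - P" using prime_pow[OF P] f F(2) DR by blast
      ultimately show "\<exists>s\<in>{c \<in> carrier R. c \<odot>\<^bsub>M\<^esub> x \<in> ?sp}. s \<notin> P"
        using n by (intro bexI[of _ "f [^] n"]) auto
    qed (use x in \<open>auto simp: lin_span_zero[OF G(2)] lin_span_add[OF G(2)] lin_span_smult[OF G] smult_l_distr smult_assoc1\<close>)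
    then show ?thesis using x by simp
  qed
  have "local_dual_basis R M (carrier M) {\<zero>\<^bsub>M\<^esub>} r"
    unfolding local_dual_basis_def
  proof (intro allI impI)
    fix P assume P: "primeideal P R"
    obtain f where f: "f \<in> D" "f \<notin> P" using D[OF P] by blast
    have fR: "f \<in> carrier R" using f DR by blast
    let ?spf = "lin_span R M (E f) {..<r}"
    have Ef: "E f \<in> {..<r} \<rightarrow> carrier M" using EM f by auto
    have "\<forall>g\<in>G. \<exists>n::nat. f [^] n \<odot>\<^bsub>M\<^esub> g \<in> ?spf" using ED f G by auto
    then obtain n where n: "\<And>g. g \<in> G \<Longrightarrow> f [^] (n g :: nat) \<odot>\<^bsub>M\<^esub> g \<in> ?spf" by metis
    \<comment> \<open>The sum bounds each exponent and is also defined when \<open>G\<close> is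
      empty, unlike a maximum.\<close>
    define m where "m = sum n G"
    have up: "f [^] b \<odot>\<^bsub>M\<^esub> x \<in> ?spf" if "f [^] a \<odot>\<^bsub>M\<^esub> x \<in> ?spf" "a \<le> b" "x \<in> carrier M" for a b :: nat and x
    proof -
      have "f [^] b \<odot>\<^bsub>M\<^esub> x = f [^] (b - a) \<odot>\<^bsub>M\<^esub> (f [^] a \<odot>\<^bsub>M\<^esub> x)"
        using that fR by (simp add: smult_assoc1[symmetric] nat_pow_mult)
      then show ?thesis using lin_span_smult[OF _ Ef that(1)] fR by simp
    qed
    have "?sp \<subseteq> {x \<in> carrier M. f [^] m \<odot>\<^bsub>M\<^esub> x \<in> ?spf}"
    proof (rule lin_span_minimal[OF G(1)])
      fix g assume g: "g \<in> G"
      then have "n g \<le> m" unfolding m_def using G(1) by (intro member_le_sum) auto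
      then show "g \<in> {x \<in> carrier M. f [^] m \<odot>\<^bsub>M\<^esub> x \<in> ?spf}" using up[OF n[OF g]] g G(2) by auto
    next
      fix a x assume a: "a \<in> carrier R" and x: "x \<in> {x \<in> carrier M. f [^] m \<odot>\<^bsub>M\<^esub> x \<in> ?spf}"
      then have "f [^] m \<odot>\<^bsub>M\<^esub> (a \<odot>\<^bsub>M\<^esub> x) = a \<odot>\<^bsub>M\<^esub> (f [^] m \<odot>\<^bsub>M\<^esub> x)"
        using fR by (simp add: smult_assoc1[symmetric] m_comm)
      then show "a \<odot>\<^bsub>M\<^esub> x \<in> {x \<in> carrier M. f [^] m \<odot>\<^bsub>M\<^esub> x \<in> ?spf}"
        using a x lin_span_smult[OF _ Ef] by auto
    qed (use fR Ef in \<open>auto simp: lin_span_zero[OF Ef] lin_span_add[OF Ef] smult_r_distr\<close>)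
    then have all: "f [^] m \<odot>\<^bsub>M\<^esub> x \<in> ?spf" if "x \<in> carrier M" for x using gen[OF that] by blast
    have "\<exists>m::nat. \<exists>\<phi>. dual_basis_at R M (carrier M) {\<zero>\<^bsub>M\<^esub>} r (f [^] m) (E f) \<phi>"
    proof (rule local_basis_dual_basis[OF noeth fR _ all])
      fix c assume "c \<in> {..<r} \<rightarrow> carrier R" "(\<Oplus>\<^bsub>M\<^esub>i\<in>{..<r}. c i \<odot>\<^bsub>M\<^esub> E f i) = \<zero>\<^bsub>M\<^esub>"
      then show "\<exists>m::nat. \<forall>i<r. f [^] m \<otimes> c i = \<zero>"
        using E[OF f(1)] unfolding basis_def powers_def by blast
    qed (use EM f in auto)
    moreover have "f [^] m \<notin> P" for m :: nat using prime_pow[OF P] f fR by blast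
    ultimately show "\<exists>s e \<phi>. s \<notin> P \<and> dual_basis_at R M (carrier M) {\<zero>\<^bsub>M\<^esub>} r s e \<phi>" by blast
  qed
  then show "\<exists>r. local_dual_basis R M (carrier M) {\<zero>\<^bsub>M\<^esub>} r" by blast
next
  assume "\<exists>r. local_dual_basis R M (carrier M) {\<zero>\<^bsub>M\<^esub>} r"
  then obtain r where ldb: "local_dual_basis R M (carrier M) {\<zero>\<^bsub>M\<^esub>} r" by blast
  show "locally_free_const_rank R M"
    unfolding locally_free_const_rank_def
  proof (intro exI[of _ r] allI impI)
    fix P assume "primeideal P R"
    with ldb obtain s e \<phi> where s: "s \<in> carrier R - P"
      and db: "dual_basis_at R M (carrier M) {\<zero>\<^bsub>M\<^esub>} r s e \<phi>"
      by (rule local_dual_basisE)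
    note e = dual_basis_mem[OF db] and lin = dual_basis_linear[OF db]
    have sR: "s \<in> carrier R" using s by simp
    interpret F: fraction_module R M "powers R s" by (rule fraction_module_powers[OF sR])
    have "s [^] (1::nat) = s" using sR by simp
    then have sp: "s \<in> powers R s" unfolding powers_def by (metis (mono_tags, lifting) mem_Collect_eq)
    have "s \<odot>\<^bsub>M\<^esub> x \<in> lin_span R M e {..<r}" if x: "x \<in> carrier M" for x
    proof -
      have cl: "\<phi> i x \<in> carrier R" if "i < r" for i using linear_on_closed[OF lin[OF that] x] .
      have "(\<Oplus>\<^bsub>M\<^esub>i\<in>{..<r}. \<phi> i x \<odot>\<^bsub>M\<^esub> e i) \<in> carrier M" using cl e by (intro M.finsum_closed) auto
      then have "s \<odot>\<^bsub>M\<^esub> x = (\<Oplus>\<^bsub>M\<^esub>i\<in>{..<r}. \<phi> i x \<odot>\<^bsub>M\<^esub> e i)"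
        using dual_basis_residue[OF db x] sR x
          M.minus_eq_zero_imp[of "s \<odot>\<^bsub>M\<^esub> x" "\<Oplus>\<^bsub>M\<^esub>i\<in>{..<r}. \<phi> i x \<odot>\<^bsub>M\<^esub> e i"] by simp
      then show ?thesis using cl by (auto simp: lin_span_def intro!: exI[of _ "\<lambda>i. \<phi> i x"])
    qed
    \<comment> \<open>Applying \<open>\<phi> j\<close> to the linear relation isolates
      \<open>c j\<close> times \<open>s\<close>.\<close>
    moreover have "s \<otimes> c j = \<zero>"
      if c: "c \<in> {..<r} \<rightarrow> carrier R" and z: "(\<Oplus>\<^bsub>M\<^esub>i\<in>{..<r}. c i \<odot>\<^bsub>M\<^esub> e i) = \<zero>\<^bsub>M\<^esub>" and j: "j < r" for c j
    proof -
      have "\<zero> = \<phi> j (\<Oplus>\<^bsub>M\<^esub>i\<in>{..<r}. c i \<odot>\<^bsub>M\<^esub> e i)"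
        unfolding z using linear_on_zero[OF lin[OF j] carrier_is_submodule] by simp
      also have "\<dots> = (\<Oplus>i\<in>{..<r}. c i \<otimes> \<phi> j (e i))"
        using c e by (intro linear_on_lin_comb[OF lin[OF j] carrier_is_submodule]) auto
      also have "\<dots> = (\<Oplus>i\<in>{..<r}. c i \<otimes> (if j = i then s else \<zero>))"
        using c sR j by (intro R.finsum_cong') (auto simp: dual_basis_delta[OF db j])
      also have "\<dots> = c j \<otimes> s" using c sR j by (intro delta_sum) auto
      finally show ?thesis using m_comm[of s "c j"] c j sR by auto
    qed
    ultimately have "free_of_rank (loc_ring R (powers R s)) (loc_module R (powers R s) M) r"
      unfolding F.free_of_rank_loc_iff using sp e by (intro bexI[of _ e]) auto
    with s show "\<exists>f\<in>carrier R - P. free_of_rank (loc_ring R (powers R f)) (loc_module R (powers R f) M) r"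
      by blast
  qed
qed

section \<open>Products and restriction of scalars\<close>

lemma submodule_prod:
  assumes "module k M" "module k N" "module k P" "same_module (prod_module M N) P"
    and H: "submodule H k M" and H': "submodule H' k N"
  shows "submodule (H \<times> H') k P"
proof -
  interpret M: module k M by fact
  interpret N: module k N by fact
  interpret P: module k P by fact
  have P: "carrier P = carrier M \<times> carrier N" "add P = (\<lambda>x y. (fst x \<oplus>\<^bsub>M\<^esub> fst y, snd x \<oplus>\<^bsub>N\<^esub> snd y))"
    "smult P = (\<lambda>a x. (a \<odot>\<^bsub>M\<^esub> fst x, a \<odot>\<^bsub>N\<^esub> snd x))" "zero P = (\<zero>\<^bsub>M\<^esub>, \<zero>\<^bsub>N\<^esub>)"
    using assms(4) by (auto simp: same_module_def prod_module_def)
  have neg: "\<ominus>\<^bsub>P\<^esub> x = (\<ominus>\<^bsub>M\<^esub> fst x, \<ominus>\<^bsub>N\<^esub> snd x)" if "x \<in> carrier P" for x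
    by (rule P.minus_equality) (use that in \<open>auto simp: P M.l_neg N.l_neg\<close>)
  show ?thesis
    using M.submodule_mem[OF H] M.submodule_zero[OF H] M.submodule_add[OF H]
      M.submodule_smult[OF H] M.submodule_inv[OF H]
      N.submodule_mem[OF H'] N.submodule_zero[OF H'] N.submodule_add[OF H']
      N.submodule_smult[OF H'] N.submodule_inv[OF H']
    by (intro P.submoduleI) (auto simp: P neg)
qed

text \<open>The chain from \<open>K \<times> K'\<close> through \<open>K \<times> L'\<close> to
  \<open>L \<times> L'\<close> has successive quotients that the projections identify with those of
  the factors, and ranks add along it.\<close>

lemma local_dual_basis_prod:
  assumes "module k M" "module k N" "module k P" "same_module (prod_module M N) P"
    and L: "submodule L k M" "submodule K k M" "K \<subseteq> L" and L': "submodule L' k N" "submodule K' k N" "K' \<subseteq> L'"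
    and "local_dual_basis k M L K r" "local_dual_basis k N L' K' r'"
  shows "local_dual_basis k P (L \<times> L') (K \<times> K') (r + r')"
proof -
  interpret M: module k M by fact
  interpret N: module k N by fact
  interpret P: module k P by fact
  have P: "carrier P = carrier M \<times> carrier N" "add P = (\<lambda>x y. (fst x \<oplus>\<^bsub>M\<^esub> fst y, snd x \<oplus>\<^bsub>N\<^esub> snd y))"
    "smult P = (\<lambda>a x. (a \<odot>\<^bsub>M\<^esub> fst x, a \<odot>\<^bsub>N\<^esub> snd x))" "zero P = (\<zero>\<^bsub>M\<^esub>, \<zero>\<^bsub>N\<^esub>)"
    using assms(4) by (auto simp: same_module_def prod_module_def)
  note sub = submodule_prod[OF assms(1-4)]
  have "local_dual_basis k P (L \<times> L') (K \<times> L') r \<longleftrightarrow> local_dual_basis k M L K r"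
    by (rule local_dual_basis_transfer[where h = fst])
      (use assms sub N.submodule_zero[OF L'(1)] in \<open>auto simp: P\<close>)
  moreover have "local_dual_basis k P (K \<times> L') (K \<times> K') r' \<longleftrightarrow> local_dual_basis k N L' K' r'"
    by (rule local_dual_basis_transfer[where h = snd])
      (use assms sub M.submodule_zero[OF L(2)] in \<open>auto simp: P\<close>)
  ultimately show ?thesis
    by (intro P.local_dual_basis_trans[of "L \<times> L'" "K \<times> L'" "K \<times> K'"]) (use assms sub in auto)
qed

lemma restrict_scalars_simps [simp]:
  "carrier (restrict_scalars A C) = carrier C" "add (restrict_scalars A C) = add C"
  "zero (restrict_scalars A C) = zero C"
  "smult (restrict_scalars A C) c x = (c \<odot>\<^bsub>A\<^esub> \<one>\<^bsub>A\<^esub>) \<odot>\<^bsub>C\<^esub> x"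
  by (simp_all add: restrict_scalars_def)

lemma module_restrict_scalars:
  assumes "algebra k A" "module A C"
  shows "module k (restrict_scalars A C)"
proof -
  interpret A: algebra k A by fact
  interpret C: module A C by fact
  show ?thesis
  proof (intro moduleI)
    show "abelian_group (restrict_scalars A C)"
      by (rule abelian_group_cong[OF C.M.abelian_group_axioms]) simp_all
    fix c d x assume cd: "c \<in> carrier k" "d \<in> carrier k" "x \<in> carrier (restrict_scalars A C)"
    have "(c \<otimes>\<^bsub>k\<^esub> d) \<odot>\<^bsub>A\<^esub> \<one>\<^bsub>A\<^esub> = (c \<odot>\<^bsub>A\<^esub> \<one>\<^bsub>A\<^esub>) \<otimes>\<^bsub>A\<^esub> (d \<odot>\<^bsub>A\<^esub> \<one>\<^bsub>A\<^esub>)"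
      using cd by (simp add: A.smult_assoc1 A.smult_assoc2)
    then show "(c \<otimes>\<^bsub>k\<^esub> d) \<odot>\<^bsub>restrict_scalars A C\<^esub> x =
        c \<odot>\<^bsub>restrict_scalars A C\<^esub> (d \<odot>\<^bsub>restrict_scalars A C\<^esub> x)"
      using cd by (simp add: C.smult_assoc1)
  qed (auto simp: A.R.is_cring A.smult_l_distr C.smult_l_distr C.smult_r_distr)
qed

text \<open>A negative is formed in the additive monoid of its own record, so the negatives of the
  two records are first identified by uniqueness of inverses.\<close>

lemma submodule_restrict_scalars:
  assumes "algebra k A" "module A C" "submodule H A C"
  shows "submodule H k (restrict_scalars A C)"
proof -
  interpret A: algebra k A by fact
  interpret C: module A C by fact
  interpret K: module k "restrict_scalars A C" by (rule module_restrict_scalars[OF assms(1,2)])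
  have neg: "\<ominus>\<^bsub>restrict_scalars A C\<^esub> x = \<ominus>\<^bsub>C\<^esub> x" if "x \<in> carrier C" for x
    by (rule K.minus_equality) (use that in \<open>auto simp: C.l_neg\<close>)
  show ?thesis
    using C.submodule_mem[OF assms(3)] C.submodule_zero[OF assms(3)] C.submodule_add[OF assms(3)]
      C.submodule_inv[OF assms(3)] C.submodule_smult[OF assms(3)]
    by (intro K.submoduleI) (auto simp: neg)
qed

text \<open>Every type has the element \<open>undefined\<close>, which provides a zero object with
  carrier in any prescribed type.\<close>

definition zero_module :: "('a, 'b) module" where
  "zero_module = \<lparr>carrier = {undefined}, mult = undefined, one = undefined, zero = undefined,
     add = (\<lambda>_ _. undefined), smult = (\<lambda>_ _. undefined)\<rparr>"

lemma module_zero_module: "cring R \<Longrightarrow> module R zero_module"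
  by (intro moduleI abelian_groupI) (auto simp: zero_module_def)

section \<open>The dual of a module over an algebra\<close>

lemma dual_mem:
  "f \<in> carrier (dual k A C) \<longleftrightarrow>
    f \<in> extensional (carrier C) \<and> linear_on k (restrict_scalars A C) (carrier C) f"
  by (simp add: dual_def mod_hom_self_module_iff)

lemma dual_simps [simp]:
  "\<zero>\<^bsub>dual k A C\<^esub> = (\<lambda>x\<in>carrier C. \<zero>\<^bsub>k\<^esub>)"
  "f \<oplus>\<^bsub>dual k A C\<^esub> g = (\<lambda>x\<in>carrier C. f x \<oplus>\<^bsub>k\<^esub> g x)"
  "a \<odot>\<^bsub>dual k A C\<^esub> f = (\<lambda>x\<in>carrier C. f (a \<odot>\<^bsub>C\<^esub> x))"
  by (simp_all add: dual_def)

lemma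
  assumes "f \<in> carrier (dual k A C)"
  shows dual_closed: "x \<in> carrier C \<Longrightarrow> f x \<in> carrier k"
    and dual_add: "x \<in> carrier C \<Longrightarrow> y \<in> carrier C \<Longrightarrow> f (x \<oplus>\<^bsub>C\<^esub> y) = f x \<oplus>\<^bsub>k\<^esub> f y"
    and dual_smult: "c \<in> carrier k \<Longrightarrow> x \<in> carrier C \<Longrightarrow> f ((c \<odot>\<^bsub>A\<^esub> \<one>\<^bsub>A\<^esub>) \<odot>\<^bsub>C\<^esub> x) = c \<otimes>\<^bsub>k\<^esub> f x"
    and dual_extensional: "f \<in> extensional (carrier C)"
  using assms unfolding dual_mem linear_on_def by auto

lemma dualI:
  assumes "f \<in> extensional (carrier C)" "\<And>x. x \<in> carrier C \<Longrightarrow> f x \<in> carrier k"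
    "\<And>x y. x \<in> carrier C \<Longrightarrow> y \<in> carrier C \<Longrightarrow> f (x \<oplus>\<^bsub>C\<^esub> y) = f x \<oplus>\<^bsub>k\<^esub> f y"
    "\<And>c x. c \<in> carrier k \<Longrightarrow> x \<in> carrier C \<Longrightarrow> f ((c \<odot>\<^bsub>A\<^esub> \<one>\<^bsub>A\<^esub>) \<odot>\<^bsub>C\<^esub> x) = c \<otimes>\<^bsub>k\<^esub> f x"
  shows "f \<in> carrier (dual k A C)"
  using assms by (simp add: dual_mem linear_on_def)

lemma dual_same: "same_module C D \<Longrightarrow> dual k A C = dual k A D"
  by (auto simp: same_module_def dual_def mod_hom_def)

lemma mod_hom_same:
  "same_module M M' \<Longrightarrow> same_module N N' \<Longrightarrow> mod_hom R M N = mod_hom R M' N'"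
  by (auto simp: same_module_def mod_hom_def)

lemma module_dual:
  assumes "algebra k A" "module A C"
  shows "module A (dual k A C)"
proof -
  interpret A: algebra k A by fact
  interpret C: module A C by fact
  have add: "f \<oplus>\<^bsub>dual k A C\<^esub> g \<in> carrier (dual k A C)"
    if "f \<in> carrier (dual k A C)" "g \<in> carrier (dual k A C)" for f g
    using dual_closed[OF that(1)] dual_closed[OF that(2)] that
    by (intro dualI) (auto simp: dual_add dual_smult A.R.a_ac A.R.r_distr)
  have zero: "\<zero>\<^bsub>dual k A C\<^esub> \<in> carrier (dual k A C)" by (rule dualI) auto
  have smult: "a \<odot>\<^bsub>dual k A C\<^esub> f \<in> carrier (dual k A C)"
    if "a \<in> carrier A" "f \<in> carrier (dual k A C)" for a f
  proof (rule dualI)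
    fix c x assume c: "c \<in> carrier k" and x: "x \<in> carrier C"
    \<comment> \<open>Commutativity of \<open>A\<close> moves the scalar past \<open>a\<close>; it
      also gives the right order in the associativity of the action on functionals.\<close>
    have "a \<odot>\<^bsub>C\<^esub> ((c \<odot>\<^bsub>A\<^esub> \<one>\<^bsub>A\<^esub>) \<odot>\<^bsub>C\<^esub> x) = (c \<odot>\<^bsub>A\<^esub> \<one>\<^bsub>A\<^esub>) \<odot>\<^bsub>C\<^esub> (a \<odot>\<^bsub>C\<^esub> x)"
      using c x that by (simp add: C.smult_assoc1[symmetric] A.m_comm)
    then show "(a \<odot>\<^bsub>dual k A C\<^esub> f) ((c \<odot>\<^bsub>A\<^esub> \<one>\<^bsub>A\<^esub>) \<odot>\<^bsub>C\<^esub> x) = c \<otimes>\<^bsub>k\<^esub> (a \<odot>\<^bsub>dual k A C\<^esub> f) x"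
      using c x that by (simp add: dual_smult)
  qed (use that in \<open>auto simp: dual_closed dual_add C.smult_r_distr\<close>)
  have inv: "\<exists>g\<in>carrier (dual k A C). g \<oplus>\<^bsub>dual k A C\<^esub> f = \<zero>\<^bsub>dual k A C\<^esub>"
    if "f \<in> carrier (dual k A C)" for f
  proof (rule bexI[of _ "\<lambda>x\<in>carrier C. \<ominus>\<^bsub>k\<^esub> f x"])
    show "(\<lambda>x\<in>carrier C. \<ominus>\<^bsub>k\<^esub> f x) \<in> carrier (dual k A C)"
      using that by (intro dualI) (auto simp: dual_closed dual_add dual_smult A.R.minus_add A.R.r_minus)
  qed (use that in \<open>auto simp: dual_closed A.R.l_neg restrict_def\<close>)
  have r: "restrict f (carrier C) = f" if "f \<in> carrier (dual k A C)" for f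
    using dual_extensional[OF that] by (rule extensional_restrict)
  show ?thesis
  proof (intro moduleI abelian_groupI)
    fix f assume f: "f \<in> carrier (dual k A C)"
    show "\<zero>\<^bsub>dual k A C\<^esub> \<oplus>\<^bsub>dual k A C\<^esub> f = f"
      using r[OF f] dual_closed[OF f] by (simp cong: restrict_cong)
    show "\<one>\<^bsub>A\<^esub> \<odot>\<^bsub>dual k A C\<^esub> f = f" using r[OF f] by (simp cong: restrict_cong)
    show "\<exists>g\<in>carrier (dual k A C). g \<oplus>\<^bsub>dual k A C\<^esub> f = \<zero>\<^bsub>dual k A C\<^esub>" by (rule inv[OF f])
    fix a assume a: "a \<in> carrier A"
    show "a \<odot>\<^bsub>dual k A C\<^esub> f \<in> carrier (dual k A C)" by (rule smult[OF a f])
    fix b assume b: "b \<in> carrier A"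
    show "(a \<oplus>\<^bsub>A\<^esub> b) \<odot>\<^bsub>dual k A C\<^esub> f = a \<odot>\<^bsub>dual k A C\<^esub> f \<oplus>\<^bsub>dual k A C\<^esub> b \<odot>\<^bsub>dual k A C\<^esub> f"
      using a b f by (simp add: C.smult_l_distr dual_add cong: restrict_cong)
    show "(a \<otimes>\<^bsub>A\<^esub> b) \<odot>\<^bsub>dual k A C\<^esub> f = a \<odot>\<^bsub>dual k A C\<^esub> (b \<odot>\<^bsub>dual k A C\<^esub> f)"
      using a b f by (simp add: A.m_comm[of a b] C.smult_assoc1 cong: restrict_cong)
  next
    fix f g assume f: "f \<in> carrier (dual k A C)" and g: "g \<in> carrier (dual k A C)"
    show "f \<oplus>\<^bsub>dual k A C\<^esub> g \<in> carrier (dual k A C)" by (rule add[OF f g])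
    show "f \<oplus>\<^bsub>dual k A C\<^esub> g = g \<oplus>\<^bsub>dual k A C\<^esub> f"
      using f g by (simp add: dual_closed A.R.a_comm cong: restrict_cong)
    fix a assume a: "a \<in> carrier A"
    show "a \<odot>\<^bsub>dual k A C\<^esub> (f \<oplus>\<^bsub>dual k A C\<^esub> g) = a \<odot>\<^bsub>dual k A C\<^esub> f \<oplus>\<^bsub>dual k A C\<^esub> a \<odot>\<^bsub>dual k A C\<^esub> g"
      using a by (simp cong: restrict_cong)
  next
    fix f g h assume "f \<in> carrier (dual k A C)" "g \<in> carrier (dual k A C)" "h \<in> carrier (dual k A C)"
    then show "f \<oplus>\<^bsub>dual k A C\<^esub> g \<oplus>\<^bsub>dual k A C\<^esub> h = f \<oplus>\<^bsub>dual k A C\<^esub> (g \<oplus>\<^bsub>dual k A C\<^esub> h)"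
      by (simp add: dual_closed A.R.a_assoc cong: restrict_cong)
  qed (rule A.M_cring, rule zero)
qed

lemma dual_module_restrict_scalars:
  assumes "algebra k A" "module A C" "same_module (dual k A C) D"
  shows "dual_module k (restrict_scalars A C) (restrict_scalars A D)"
proof -
  interpret A: algebra k A by fact
  have D: "carrier D = carrier (dual k A C)" "add D = add (dual k A C)" "smult D = smult (dual k A C)"
    using assms(3) by (simp_all add: same_module_def)
  have "module A D" by (rule module_same[OF module_dual[OF assms(1,2)] assms(3)])
  then have "module k (restrict_scalars A D)" by (rule module_restrict_scalars[OF assms(1)])
  then have "is_dual_module k (restrict_scalars A C) (restrict_scalars A D)"
    unfolding is_dual_module_def by (auto simp: D dual_smult) (auto simp: dual_def)
  then show ?thesis
    by (intro dual_module.intro module_restrict_scalars[OF assms(1,2)] dual_module_axioms.intro)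
qed

definition double_dual_map :: "('k, 'l) ring_scheme \<Rightarrow> ('k, 'a, 'y) module_scheme \<Rightarrow>
    ('a, 'c, 'z) module_scheme \<Rightarrow> 'c \<Rightarrow> ('c \<Rightarrow> 'k) \<Rightarrow> 'k" where
  "double_dual_map k A C = (\<lambda>x\<in>carrier C. \<lambda>f\<in>carrier (dual k A C). f x)"

lemma double_dual_map_mod_hom:
  assumes "algebra k A" "module A C"
  shows "double_dual_map k A C \<in> mod_hom A C (dual k A (dual k A C))"
proof -
  interpret A: algebra k A by fact
  interpret C: module A C by fact
  interpret D: module A "dual k A C" by (rule module_dual[OF assms])
  note [simp] = double_dual_map_def
  have sm: "(\<lambda>x\<in>carrier C. f (a \<odot>\<^bsub>C\<^esub> x)) \<in> carrier (dual k A C)"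
    if "a \<in> carrier A" "f \<in> carrier (dual k A C)" for a f
    using D.smult_closed[OF that] by simp
  have ad: "(\<lambda>x\<in>carrier C. f x \<oplus>\<^bsub>k\<^esub> g x) \<in> carrier (dual k A C)"
    if "f \<in> carrier (dual k A C)" "g \<in> carrier (dual k A C)" for f g
    using D.a_closed[OF that] by simp
  have mem: "double_dual_map k A C x \<in> carrier (dual k A (dual k A C))" if "x \<in> carrier C" for x
    by (rule dualI) (use that sm ad in \<open>auto simp: dual_closed dual_smult\<close>)
  show ?thesis
  proof (rule mod_homI)
    fix x y assume "x \<in> carrier C" "y \<in> carrier C"
    then show "double_dual_map k A C (x \<oplus>\<^bsub>C\<^esub> y) =
      double_dual_map k A C x \<oplus>\<^bsub>dual k A (dual k A C)\<^esub> double_dual_map k A C y"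
      by (simp add: dual_add cong: restrict_cong)
  next
    fix a x assume "a \<in> carrier A" "x \<in> carrier C"
    then show "double_dual_map k A C (a \<odot>\<^bsub>C\<^esub> x) = a \<odot>\<^bsub>dual k A (dual k A C)\<^esub> double_dual_map k A C x"
      using sm by (simp cong: restrict_cong)
  qed (use mem in auto)
qed

text \<open>Injectivity is \<open>local_dual_basis_torsionless\<close> for the zero submodule,
  applied to a difference; surjectivity is \<open>reflexive\<close>.\<close>

lemma double_dual_map_bij:
  assumes "algebra k A" "module A C"
    and ldb: "local_dual_basis k (restrict_scalars A C) (carrier C) {\<zero>\<^bsub>C\<^esub>} r"
  shows "bij_betw (double_dual_map k A C) (carrier C) (carrier (dual k A (dual k A C)))"
proof -
  interpret A: algebra k A by fact
  interpret C: module A C by fact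
  interpret D: dual_module k "restrict_scalars A C" "restrict_scalars A (dual k A C)"
    by (rule dual_module_restrict_scalars[OF assms(1,2)]) (simp add: same_module_def)
  note hom = double_dual_map_mod_hom[OF assms(1,2)]
  have ker: "x = \<zero>\<^bsub>C\<^esub>" if x: "x \<in> carrier C" and van: "\<And>f. f \<in> carrier (dual k A C) \<Longrightarrow> f x = \<zero>\<^bsub>k\<^esub>" for x
  proof -
    have "x \<in> {\<zero>\<^bsub>restrict_scalars A C\<^esub>}"
    proof (rule D.local_dual_basis_torsionless[OF D.carrier_is_submodule D.zero_is_submodule])
      fix f assume "linear_on k (restrict_scalars A C) (carrier (restrict_scalars A C)) f"
      from D.restrict_dual[OF this] van[of "restrict f (carrier C)"] x show "f x = \<zero>\<^bsub>k\<^esub>" by simp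
    qed (use x ldb in auto)
    then show ?thesis by simp
  qed
  show ?thesis
  proof (rule bij_betw_imageI)
    show "inj_on (double_dual_map k A C) (carrier C)"
    proof (rule inj_onI)
      fix x y assume x: "x \<in> carrier C" and y: "y \<in> carrier C"
        and eq: "double_dual_map k A C x = double_dual_map k A C y"
      have "f (x \<ominus>\<^bsub>C\<^esub> y) = \<zero>\<^bsub>k\<^esub>" if f: "f \<in> carrier (dual k A C)" for f
      proof -
        have "f x = f y" using fun_cong[OF eq, of f] x y f by (simp add: double_dual_map_def)
        moreover have "f (x \<ominus>\<^bsub>C\<^esub> y) \<oplus>\<^bsub>k\<^esub> f y = f x"
          using dual_add[OF f, of "x \<ominus>\<^bsub>C\<^esub> y" y] x y by (simp add: a_minus_def C.a_assoc C.l_neg)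
        ultimately show ?thesis
          using dual_closed[OF f] x y by (metis A.R.add.r_cancel_one C.minus_closed)
      qed
      then have "x \<ominus>\<^bsub>C\<^esub> y = \<zero>\<^bsub>C\<^esub>" using x y by (intro ker) auto
      then show "x = y" using C.minus_eq_zero_imp[OF x y] by simp
    qed
    show "double_dual_map k A C ` carrier C = carrier (dual k A (dual k A C))"
    proof (intro equalityI subsetI)
      fix \<Phi> assume \<Phi>: "\<Phi> \<in> carrier (dual k A (dual k A C))"
      then have "linear_on k (restrict_scalars A (dual k A C)) (carrier (restrict_scalars A (dual k A C))) \<Phi>"
        by (simp add: dual_mem)
      then obtain x where x: "x \<in> carrier C" "\<And>f. f \<in> carrier (dual k A C) \<Longrightarrow> \<Phi> f = f x"
        using D.reflexive[of r \<Phi>] ldb by auto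
      have "\<Phi> = double_dual_map k A C x"
        using dual_extensional[OF \<Phi>] x
        by (intro extensionalityI[of _ "carrier (dual k A C)"]) (auto simp: double_dual_map_def)
      with x show "\<Phi> \<in> double_dual_map k A C ` carrier C" by blast
    qed (use mod_hom_closed[OF hom] in auto)
  qed
qed

section \<open>Functoriality of the dual and the passage to dualities of categories\<close>

lemma compose_dual:
  assumes "algebra k A" "module A B" "\<gamma> \<in> mod_hom A B C" "g \<in> carrier (dual k A C)"
  shows "compose (carrier B) g \<gamma> \<in> carrier (dual k A B)"
proof -
  interpret A: algebra k A by fact
  interpret B: module A B by fact
  show ?thesis
    by (rule dualI)
      (use mod_hom_closed[OF assms(3)] dual_closed[OF assms(4)] mod_hom_add[OF assms(3)] dual_add[OF assms(4)]
         mod_hom_smult[OF assms(3)] dual_smult[OF assms(4)] in \<open>auto simp: compose_eq\<close>)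
qed

lemma dual_map_mod_hom:
  assumes "algebra k A" "module A B" "module A C" "\<gamma> \<in> mod_hom A B C"
  shows "dual_map k A B C \<gamma> \<in> mod_hom A (dual k A C) (dual k A B)"
proof -
  interpret A: algebra k A by fact
  interpret B: module A B by fact
  interpret C: module A C by fact
  interpret D: module A "dual k A C" by (rule module_dual[OF assms(1,3)])
  note cl = mod_hom_closed[OF assms(4)]
  have sm: "(\<lambda>x\<in>carrier C. f (a \<odot>\<^bsub>C\<^esub> x)) \<in> carrier (dual k A C)"
    if "a \<in> carrier A" "f \<in> carrier (dual k A C)" for a f
    using D.smult_closed[OF that] by simp
  have ad: "(\<lambda>x\<in>carrier C. f x \<oplus>\<^bsub>k\<^esub> g x) \<in> carrier (dual k A C)"
    if "f \<in> carrier (dual k A C)" "g \<in> carrier (dual k A C)" for f g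
    using D.a_closed[OF that] by simp
  show ?thesis
    by (rule mod_homI)
      (use compose_dual[OF assms(1,2,4)] sm ad cl mod_hom_smult[OF assms(4)] in
        \<open>auto simp: dual_map_def compose_def cong: restrict_cong\<close>)
qed

text \<open>The inverse of a bijective homomorphism is a homomorphism. The equivalence in
  \<open>mem\<close>, as opposed to an implication, says that \<open>f\<close> is strict, and
  strictness is what makes the inverse preserve the families.\<close>

lemma iso_via_fam_hom:
  assumes f: "f \<in> mod_hom R M N" and bij: "bij_betw f (carrier M) (carrier N)"
    and mem: "\<And>x n. x \<in> carrier M \<Longrightarrow> f x \<in> T N n \<longleftrightarrow> x \<in> S M n"
    and sub: "\<And>n. S M n \<subseteq> carrier M" "\<And>n. T N n \<subseteq> carrier N" and M: "module R M"
  shows "iso_via (fam_hom R S T) (fam_hom R T S) M N f"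
proof -
  interpret M: module R M by fact
  define g where "g = (\<lambda>y\<in>carrier N. inv_into (carrier M) f y)"
  have inj: "inj_on f (carrier M)" and im: "f ` carrier M = carrier N"
    using bij by (auto simp: bij_betw_def)
  have gf: "g (f x) = x" if "x \<in> carrier M" for x
    using that mod_hom_closed[OF f] inv_into_f_f[OF inj] by (simp add: g_def)
  have ex: "\<exists>x\<in>carrier M. y = f x" if "y \<in> carrier N" for y using im that by auto
  have ind: "P y" if "y \<in> carrier N" "\<And>x. x \<in> carrier M \<Longrightarrow> P (f x)" for y P
    using ex[OF that(1)] that(2) by auto
  have gm: "g \<in> mod_hom R N M"
  proof (rule mod_homI)
    show "g \<in> extensional (carrier N)" by (simp add: g_def)
    show "g y \<in> carrier M" if "y \<in> carrier N" for y using that by (rule ind) (simp add: gf)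
    show "g (y \<oplus>\<^bsub>N\<^esub> z) = g y \<oplus>\<^bsub>M\<^esub> g z" if y: "y \<in> carrier N" and z: "z \<in> carrier N" for y z
    proof -
      obtain a b where "a \<in> carrier M" "y = f a" "b \<in> carrier M" "z = f b" using ex[OF y] ex[OF z] by blast
      then show ?thesis by (simp add: gf mod_hom_add[OF f, symmetric])
    qed
    show "g (r \<odot>\<^bsub>N\<^esub> y) = r \<odot>\<^bsub>M\<^esub> g y" if r: "r \<in> carrier R" and y: "y \<in> carrier N" for r y
    proof -
      obtain a where "a \<in> carrier M" "y = f a" using ex[OF y] by blast
      then show ?thesis using r by (simp add: gf mod_hom_smult[OF f, symmetric])
    qed
  qed
  have "f \<in> fam_hom R S T M N" using mem sub by (intro fam_homI[OF f]) blast
  moreover have "g \<in> fam_hom R T S N M"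
  proof (rule fam_homI[OF gm])
    fix n y assume y: "y \<in> T N n"
    then obtain x where "x \<in> carrier M" "y = f x" using ex sub(2) by blast
    with y show "g y \<in> S M n" using mem by (simp add: gf)
  qed
  moreover have "compose (carrier M) g f = ident M"
    using gf by (auto simp: compose_def ident_def restrict_def)
  moreover have "compose (carrier N) f g = ident N"
  proof -
    have "f (g y) = y" if "y \<in> carrier N" for y using that by (rule ind) (simp add: gf)
    then show ?thesis by (auto simp: compose_def ident_def restrict_def)
  qed
  ultimately show ?thesis unfolding iso_via_def by blast
qed

text \<open>One argument covers all three dualities: \<open>Do C\<close> differs from
  \<open>dual k A C\<close> only in fields that \<open>dual_map\<close> ignores, so each case has
  only to show that its objects are preserved and that precomposition respects the families.\<close>

lemma contravariant_functor_dual: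
  fixes X :: "('b, \<lparr>smult :: 'a \<Rightarrow> 'b \<Rightarrow> 'b, \<dots> :: 'z\<rparr>) mod_cat"
    and X1 :: "('b \<Rightarrow> 'k, \<lparr>smult :: 'a \<Rightarrow> ('b \<Rightarrow> 'k) \<Rightarrow> 'b \<Rightarrow> 'k, \<dots> :: 'w\<rparr>) mod_cat"
  assumes alg: "algebra k A"
    and Mor: "Mor X = fam_hom A S S" "Mor X1 = fam_hom A T T"
    and mod: "\<And>C. C \<in> Obj X \<Longrightarrow> module A C"
    and obj: "\<And>C. C \<in> Obj X \<Longrightarrow> Do C \<in> Obj X1"
    and same: "\<And>C. C \<in> Obj X \<Longrightarrow> same_module (dual k A C) (Do C)"
    and pres: "\<And>B C f g n. B \<in> Obj X \<Longrightarrow> C \<in> Obj X \<Longrightarrow> f \<in> fam_hom A S S B C \<Longrightarrow> g \<in> T (Do C) n \<Longrightarrow>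
      g \<in> carrier (dual k A C) \<and> compose (carrier B) g f \<in> T (Do B) n"
  shows "contravariant_functor X X1 Do (dual_map k A)"
  unfolding contravariant_functor_def
proof (intro conjI ballI)
  have carr: "carrier (Do C) = carrier (dual k A C)" if "C \<in> Obj X" for C
    using same[OF that] by (simp add: same_module_def)
  show "Do C \<in> Obj X1" if "C \<in> Obj X" for C using obj that .
  fix B C f assume B: "B \<in> Obj X" and C: "C \<in> Obj X" and f: "f \<in> Mor X B C"
  then have fm: "f \<in> mod_hom A B C" by (simp add: Mor fam_hom_def)
  have "dual_map k A B C f \<in> mod_hom A (Do C) (Do B)"
    using dual_map_mod_hom[OF alg mod[OF B] mod[OF C] fm] mod_hom_same[OF same[OF C] same[OF B]] by metis
  then show "dual_map k A B C f \<in> Mor X1 (Do C) (Do B)"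
    unfolding Mor using pres[OF B C f[unfolded Mor]] by (intro fam_homI) (auto simp: dual_map_def)
next
  have carr: "carrier (Do C) = carrier (dual k A C)" if "C \<in> Obj X" for C
    using same[OF that] by (simp add: same_module_def)
  fix C assume C: "C \<in> Obj X"
  have "compose (carrier C) g (ident C) = g" if "g \<in> carrier (dual k A C)" for g
    using dual_extensional[OF that] by (intro extensionalityI[of _ "carrier C"]) (auto simp: compose_def ident_def)
  then show "dual_map k A C C (ident C) = ident (Do C)"
    by (auto simp: dual_map_def ident_def carr[OF C] restrict_def)
next
  have carr: "carrier (Do C) = carrier (dual k A C)" if "C \<in> Obj X" for C
    using same[OF that] by (simp add: same_module_def)
  fix B C D f g assume B: "B \<in> Obj X" and C: "C \<in> Obj X" and D: "D \<in> Obj X"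
    and f: "f \<in> Mor X B C" and g: "g \<in> Mor X C D"
  have fm: "f \<in> mod_hom A B C" and gm: "g \<in> mod_hom A C D" using f g by (auto simp: Mor fam_hom_def)
  have "compose (carrier B) h (compose (carrier B) g f) = compose (carrier B) (compose (carrier C) h g) f" for h
    using mod_hom_closed[OF fm] by (auto simp: compose_def restrict_def)
  then show "dual_map k A B D (compose (carrier B) g f) =
      compose (carrier (Do D)) (dual_map k A B C f) (dual_map k A C D g)"
    using compose_dual[OF alg mod[OF C] gm]
    by (intro extensionalityI[of _ "carrier (dual k A D)"])
      (auto simp: carr[OF D] dual_map_def compose_eq compose_def[of "carrier (dual k A D)"])
qed

text \<open>The natural isomorphism is evaluation. What distinguishes the categories is
  \<open>mem\<close>: an element lies in a member of the family exactly when its evaluation lies in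
  the corresponding member for the double dual.\<close>

lemma dualizing_functor_dual:
  fixes X :: "('b, \<lparr>smult :: 'a \<Rightarrow> 'b \<Rightarrow> 'b, \<dots> :: 'z\<rparr>) mod_cat"
    and X1 :: "('b \<Rightarrow> 'k, \<lparr>smult :: 'a \<Rightarrow> ('b \<Rightarrow> 'k) \<Rightarrow> 'b \<Rightarrow> 'k, \<dots> :: 'w\<rparr>) mod_cat"
    and X2 :: "(('b \<Rightarrow> 'k) \<Rightarrow> 'k, \<lparr>smult :: 'a \<Rightarrow> (('b \<Rightarrow> 'k) \<Rightarrow> 'k) \<Rightarrow> ('b \<Rightarrow> 'k) \<Rightarrow> 'k, \<dots> :: 'v\<rparr>) mod_cat"
  assumes alg: "algebra k A"
    and Mor: "Mor X = fam_hom A S S"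
    and mod: "\<And>C. C \<in> Obj X \<Longrightarrow> module A C"
    and obj: "\<And>C. C \<in> Obj X \<Longrightarrow> Do C \<in> Obj X1"
    and same: "\<And>C. C \<in> Obj X \<Longrightarrow> same_module (dual k A C) (Do C)"
    and same': "\<And>C. C \<in> Obj X1 \<Longrightarrow> same_module (dual k A C) (Do' C)"
    and F: "contravariant_functor X X1 Do (dual_map k A)" "contravariant_functor X1 X2 Do' (dual_map k A)"
    and sub: "\<And>C n. C \<in> Obj X \<Longrightarrow> S C n \<subseteq> carrier C"
    and sub2: "\<And>C n. C \<in> Obj X \<Longrightarrow> U (Do' (Do C)) n \<subseteq> carrier (Do' (Do C))"
    and ldb: "\<And>C. C \<in> Obj X \<Longrightarrow> \<exists>r. local_dual_basis k (restrict_scalars A C) (carrier C) {\<zero>\<^bsub>C\<^esub>} r"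
    and mem: "\<And>C x n. C \<in> Obj X \<Longrightarrow> x \<in> carrier C \<Longrightarrow>
      double_dual_map k A C x \<in> U (Do' (Do C)) n \<longleftrightarrow> x \<in> S C n"
  shows "dualizing_functor X X1 X2 (fam_hom A S U) (fam_hom A U S) Do (dual_map k A) Do' (dual_map k A)"
  unfolding dualizing_functor_def
proof (intro conjI F exI[of _ "double_dual_map k A"])
  show "nat_iso_covariant X (fam_hom A S U) (fam_hom A U S) (\<lambda>C. C) (\<lambda>B C f. f) (\<lambda>C. Do' (Do C))
     (\<lambda>B C f. dual_map k A (Do C) (Do B) (dual_map k A B C f)) (double_dual_map k A)"
    unfolding nat_iso_covariant_def
  proof (intro conjI ballI)
    fix C assume C: "C \<in> Obj X"
    have sm: "same_module (dual k A (dual k A C)) (Do' (Do C))"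
      using same'[OF obj[OF C]] dual_same[OF same[OF C]] by metis
    have "double_dual_map k A C \<in> mod_hom A C (Do' (Do C))"
      using double_dual_map_mod_hom[OF alg mod[OF C]] mod_hom_same[OF _ sm] by (metis same_module_def)
    moreover have "bij_betw (double_dual_map k A C) (carrier C) (carrier (Do' (Do C)))"
      using double_dual_map_bij[OF alg mod[OF C]] ldb[OF C] sm by (auto simp: same_module_def)
    ultimately show "iso_via (fam_hom A S U) (fam_hom A U S) C (Do' (Do C)) (double_dual_map k A C)"
      using mem[OF C] sub[OF C] sub2[OF C] mod[OF C] by (rule iso_via_fam_hom)
  next
    fix B C f assume B: "B \<in> Obj X" and C: "C \<in> Obj X" and f: "f \<in> Mor X B C"
    then have fm: "f \<in> mod_hom A B C" by (simp add: Mor fam_hom_def)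
    have eq: "dual k A (Do C) = dual k A (dual k A C)" "dual k A (Do B) = dual k A (dual k A B)"
      by (simp_all only: dual_same[OF same[OF C]] dual_same[OF same[OF B]])
    have carr: "carrier (Do C) = carrier (dual k A C)" "carrier (Do B) = carrier (dual k A B)"
      using same[OF C] same[OF B] by (simp_all add: same_module_def)
    have ev: "double_dual_map k A B x \<in> carrier (dual k A (dual k A B))" if "x \<in> carrier B" for x
      using mod_hom_closed[OF double_dual_map_mod_hom[OF alg mod[OF B]] that] .
    show "compose (carrier B) (double_dual_map k A C) f =
       compose (carrier B) (dual_map k A (Do C) (Do B) (dual_map k A B C f)) (double_dual_map k A B)"
    proof (rule extensionalityI[of _ "carrier B"])
      fix x assume x: "x \<in> carrier B"
      \<comment> \<open>Naturality: evaluation at \<open>f x\<close> is evaluation at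
        \<open>x\<close> composed with the dual of \<open>f\<close>.\<close>
      have "double_dual_map k A C (f x) = compose (carrier (dual k A C)) (double_dual_map k A B x) (dual_map k A B C f)"
        using mod_hom_closed[OF fm x] compose_dual[OF alg mod[OF B] fm] x
        by (auto simp: double_dual_map_def dual_map_def compose_def restrict_def fun_eq_iff)
      then show "compose (carrier B) (double_dual_map k A C) f x =
         compose (carrier B) (dual_map k A (Do C) (Do B) (dual_map k A B C f)) (double_dual_map k A B) x"
        using x ev[OF x] by (simp add: compose_eq dual_map_def[of k A "Do C"] eq carr)
    qed (simp_all add: compose_def)
  qed
qed

section \<open>The category of \<open>A\<close>-modules locally free over \<open>k\<close>\<close>

locale noetherian_algebra =
  fixes k :: "('k, 'l) ring_scheme" and A :: "('k, 'a, 'y) module_scheme"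
  assumes noeth: "noetherian_ring k" and alg: "algebra k A"
begin

sublocale A: algebra k A by (rule alg)

lemma locally_free_iff:
  assumes "module k M"
  shows "locally_free_const_rank k M \<longleftrightarrow> (\<exists>r. local_dual_basis k M (carrier M) {\<zero>\<^bsub>M\<^esub>} r)"
  using module.locally_free_const_rank_iff[OF assms noeth] .

lemma zero_submodule_restrict: "module A C \<Longrightarrow> submodule {\<zero>\<^bsub>C\<^esub>} k (restrict_scalars A C)"
  using module.zero_is_submodule[OF module_restrict_scalars[OF alg]] by simp

lemma carrier_submodule_restrict: "module A C \<Longrightarrow> submodule (carrier C) k (restrict_scalars A C)"
  using module.carrier_is_submodule[OF module_restrict_scalars[OF alg]] by simp

lemma AM_obj_iff:
  "C \<in> Obj (AM k A) \<longleftrightarrow>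
    module A C \<and> (\<exists>r. local_dual_basis k (restrict_scalars A C) (carrier C) {\<zero>\<^bsub>C\<^esub>} r)"
  using locally_free_iff[OF module_restrict_scalars[OF alg]] by (auto simp: AM_def)

lemma zero_module_local_dual_basis:
  assumes "module A Z" "carrier Z = {\<zero>\<^bsub>Z\<^esub>}"
  shows "local_dual_basis k (restrict_scalars A Z) {\<zero>\<^bsub>Z\<^esub>} {\<zero>\<^bsub>Z\<^esub>} 0"
  by (rule module.local_dual_basis_refl[OF module_restrict_scalars[OF alg assms(1)] zero_submodule_restrict[OF assms(1)]])

lemma prod_local_dual_basis:
  assumes "module A B" "module A C" "same_module (prod_module B C) P"
    and "submodule L k (restrict_scalars A B)" "submodule N k (restrict_scalars A B)" "N \<subseteq> L"
    and "submodule L' k (restrict_scalars A C)" "submodule N' k (restrict_scalars A C)" "N' \<subseteq> L'"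
    and "local_dual_basis k (restrict_scalars A B) L N r" "local_dual_basis k (restrict_scalars A C) L' N' r'"
  shows "local_dual_basis k (restrict_scalars A P) (L \<times> L') (N \<times> N') (r + r')"
proof (rule local_dual_basis_prod)
  have "module A P" using module_same[OF module_prod_module[OF assms(1,2)] assms(3)] .
  then show "module k (restrict_scalars A P)" by (rule module_restrict_scalars[OF alg])
  have "carrier P = carrier B \<times> carrier C" "add P = (\<lambda>x y. (fst x \<oplus>\<^bsub>B\<^esub> fst y, snd x \<oplus>\<^bsub>C\<^esub> snd y))"
    "smult P = (\<lambda>a x. (a \<odot>\<^bsub>B\<^esub> fst x, a \<odot>\<^bsub>C\<^esub> snd x))" "zero P = (\<zero>\<^bsub>B\<^esub>, \<zero>\<^bsub>C\<^esub>)"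
    using assms(3) by (auto simp: same_module_def prod_module_def)
  then show "same_module (prod_module (restrict_scalars A B) (restrict_scalars A C)) (restrict_scalars A P)"
    by (auto simp: same_module_def prod_module_def restrict_scalars_def)
qed (use assms module_restrict_scalars[OF alg] in auto)

lemma annihilator_carrier:
  assumes "module A C" "same_module (dual k A C) D"
  shows "annihilator k (restrict_scalars A D) (carrier C) = {\<zero>\<^bsub>D\<^esub>}"
proof -
  have D: "carrier D = carrier (dual k A C)" "zero D = zero (dual k A C)"
    using assms(2) by (simp_all add: same_module_def)
  have z: "f = \<zero>\<^bsub>D\<^esub>" if "f \<in> carrier D" "\<forall>x\<in>carrier C. f x = \<zero>\<^bsub>k\<^esub>" for f
    using that dual_extensional[of f k A C]
    by (intro extensionalityI[of _ "carrier C"]) (auto simp: D)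
  have "\<zero>\<^bsub>D\<^esub> \<in> carrier D" using module_same[OF module_dual[OF alg assms(1)] assms(2)]
    by (simp add: module_def abelian_group_def abelian_monoid.zero_closed)
  moreover have "\<zero>\<^bsub>D\<^esub> x = \<zero>\<^bsub>k\<^esub>" if "x \<in> carrier C" for x using that by (simp add: D)
  ultimately show ?thesis using z unfolding annihilator_def restrict_scalars_simps by blast
qed

text \<open>The case of \<open>local_dual_basis_annihilator\<close> for zero inside the whole
  module, whose annihilators are the whole dual and zero.\<close>

lemma local_dual_basis_dual:
  assumes "module A C" "same_module (dual k A C) D"
    and ldb: "local_dual_basis k (restrict_scalars A C) (carrier C) {\<zero>\<^bsub>C\<^esub>} r"
  shows "local_dual_basis k (restrict_scalars A D) (carrier D) {\<zero>\<^bsub>D\<^esub>} r"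
proof -
  interpret dual_module k "restrict_scalars A C" "restrict_scalars A D"
    by (rule dual_module_restrict_scalars[OF alg assms(1,2)])
  have D: "carrier D = carrier (dual k A C)" "zero D = zero (dual k A C)"
    using assms(2) by (simp_all add: same_module_def)
  have "annihilator k (restrict_scalars A D) {\<zero>\<^bsub>C\<^esub>} = carrier D"
    using linear_on_zero[OF dual_linear carrier_is_submodule] by (auto simp: annihilator_def)
  moreover note annihilator_carrier[OF assms(1,2)]
  moreover have "local_dual_basis k (restrict_scalars A D)
      (annihilator k (restrict_scalars A D) {\<zero>\<^bsub>C\<^esub>}) (annihilator k (restrict_scalars A D) (carrier C)) r"
    using carrier_is_submodule zero_is_submodule M.zero_closed local_dual_basis_refl[OF carrier_is_submodule] ldb
    by (intro local_dual_basis_annihilator[where r' = 0]) (simp_all del: carrier_is_submodule)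
  ultimately show ?thesis by simp
qed

lemma AM_additive:
  "additive_category (AM k A :: ('c, \<lparr>smult :: 'a \<Rightarrow> 'c \<Rightarrow> 'c\<rparr>) mod_cat)
     (AM k A) (mod_hom A) (mod_hom A)"
  unfolding mod_hom_eq_fam_hom
proof (rule additive_category_fam_hom)
  show "Mor (AM k A) = fam_hom A carrier_family carrier_family"
    by (simp add: AM_def mod_hom_eq_fam_hom)
  show mod: "module A C" if "C \<in> Obj (AM k A)" for C :: "('a, 'c) module"
    using that by (simp add: AM_def)
  show "additive_subgroup (carrier_family C n) C" if "C \<in> Obj (AM k A)" for C :: "('a, 'c) module" and n
    using submodule_additive_subgroup[OF module.carrier_is_submodule[OF mod[OF that]]]
    by (simp add: carrier_family_def)
  have Z: "module A (zero_module :: ('a, 'c) module)" by (rule module_zero_module[OF A.M_cring])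
  have cz: "carrier (zero_module :: ('a, 'c) module) = {\<zero>\<^bsub>zero_module :: ('a, 'c) module\<^esub>}"
    by (simp add: zero_module_def)
  show "\<exists>Z\<in>Obj (AM k A :: ('c, \<lparr>smult :: 'a \<Rightarrow> 'c \<Rightarrow> 'c\<rparr>) mod_cat). carrier Z = {\<zero>\<^bsub>Z\<^esub>}"
    using zero_module_local_dual_basis[OF Z cz] Z cz
    by (intro bexI[of _ zero_module]) (auto simp: AM_obj_iff)
  fix B C :: "('a, 'c) module" assume "B \<in> Obj (AM k A)" "C \<in> Obj (AM k A)"
  then obtain r r' where B: "module A B" "local_dual_basis k (restrict_scalars A B) (carrier B) {\<zero>\<^bsub>B\<^esub>} r"
    and C: "module A C" "local_dual_basis k (restrict_scalars A C) (carrier C) {\<zero>\<^bsub>C\<^esub>} r'"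
    by (auto simp: AM_obj_iff)
  have "local_dual_basis k (restrict_scalars A (prod_module B C)) (carrier B \<times> carrier C) ({\<zero>\<^bsub>B\<^esub>} \<times> {\<zero>\<^bsub>C\<^esub>}) (r + r')"
    using B C carrier_submodule_restrict zero_submodule_restrict module.carrier_is_submodule
    by (intro prod_local_dual_basis) (auto simp: same_module_def module_def abelian_group_def abelian_monoid.zero_closed)
  then have "prod_module B C \<in> Obj (AM k A)"
    using module_prod_module[OF B(1) C(1)] by (auto simp: AM_obj_iff) (auto simp: prod_module_def)
  then show "\<exists>P\<in>Obj (AM k A). same_module (prod_module B C) P \<and>
      (\<forall>n. carrier_family P n = carrier_family B n \<times> carrier_family C n)"
    by (intro bexI[of _ "prod_module B C"]) (auto simp: same_module_def carrier_family_def prod_module_def)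
qed

lemma AM_contravariant:
  "contravariant_functor (AM k A :: ('c, \<lparr>smult :: 'a \<Rightarrow> 'c \<Rightarrow> 'c\<rparr>) mod_cat) (AM k A)
     (dual k A) (dual_map k A)"
proof (rule contravariant_functor_dual[OF alg, where S = carrier_family and T = carrier_family])
  fix C :: "('a, 'c) module" assume C: "C \<in> Obj (AM k A)"
  then obtain r where r: "module A C" "local_dual_basis k (restrict_scalars A C) (carrier C) {\<zero>\<^bsub>C\<^esub>} r"
    by (auto simp: AM_obj_iff)
  show "module A C" by fact
  show sm: "same_module (dual k A C) (dual k A C)" by (simp add: same_module_def)
  show "dual k A C \<in> Obj (AM k A)"
    using module_dual[OF alg r(1)] local_dual_basis_dual[OF r(1) sm r(2)] by (auto simp: AM_obj_iff)
next
  fix B C :: "('a, 'c) module" and f g n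
  assume "B \<in> Obj (AM k A)" "C \<in> Obj (AM k A)" "f \<in> fam_hom A carrier_family carrier_family B C"
    "g \<in> carrier_family (dual k A C) n"
  then show "g \<in> carrier (dual k A C) \<and> compose (carrier B) g f \<in> carrier_family (dual k A B) n"
    using compose_dual[OF alg, of B f C g] by (auto simp: carrier_family_def AM_obj_iff fam_hom_def)
qed (simp_all add: AM_def mod_hom_eq_fam_hom)

lemma AM_dualizing:
  "dualizing_functor (AM k A :: ('c, \<lparr>smult :: 'a \<Rightarrow> 'c \<Rightarrow> 'c\<rparr>) mod_cat)
     (AM k A) (AM k A) (mod_hom A) (mod_hom A)
     (dual k A) (dual_map k A) (dual k A) (dual_map k A)"
  unfolding mod_hom_eq_fam_hom
proof (rule dualizing_functor_dual[OF alg _ _ _ _ _ AM_contravariant AM_contravariant])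
  fix C :: "('a, 'c) module" and x n assume C: "C \<in> Obj (AM k A)" "x \<in> carrier C"
  then show "double_dual_map k A C x \<in> carrier_family (dual k A (dual k A C)) n \<longleftrightarrow> x \<in> carrier_family C n"
    using mod_hom_closed[OF double_dual_map_mod_hom[OF alg]] by (auto simp: carrier_family_def AM_obj_iff)
next
  fix C :: "('a, 'c) module" assume "C \<in> Obj (AM k A)"
  then show "dual k A C \<in> Obj (AM k A)" using AM_contravariant unfolding contravariant_functor_def by blast
qed (auto simp: AM_obj_iff same_module_def carrier_family_def, auto simp: AM_def mod_hom_eq_fam_hom)

end

section \<open>Filtered modules\<close>

text \<open>The scalars are arbitrary: the locale is used for filtered modules over \<open>A\<close>
  and also for \<open>A\<close> itself over \<open>k\<close>. Compatibility with a filtration of the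
  scalars enters in \<open>filtered_pair\<close>.\<close>

locale filtration = module R M for R and M :: "('a, 'b, 'z) filt_module_scheme" (structure) +
  assumes Fil_submodule: "submodule (Fil M n) R M" and Fil_step: "Fil M (n + 1) \<subseteq> Fil M n"
begin

abbreviation cls :: "int \<Rightarrow> 'b \<Rightarrow> 'b set" where "cls n x \<equiv> Fil M (n + 1) +>\<^bsub>M\<^esub> x"

lemma Fil_carrier [simp]: "x \<in> Fil M n \<Longrightarrow> x \<in> carrier M"
  using submodule_mem[OF Fil_submodule] .

lemma Fil_zero [simp]: "\<zero>\<^bsub>M\<^esub> \<in> Fil M n" by (rule submodule_zero[OF Fil_submodule])
lemma Fil_add: "x \<in> Fil M n \<Longrightarrow> y \<in> Fil M n \<Longrightarrow> x \<oplus>\<^bsub>M\<^esub> y \<in> Fil M n" by (rule submodule_add[OF Fil_submodule])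
lemma Fil_inv: "x \<in> Fil M n \<Longrightarrow> \<ominus>\<^bsub>M\<^esub> x \<in> Fil M n" by (rule submodule_inv[OF Fil_submodule])
lemma Fil_smult: "a \<in> carrier R \<Longrightarrow> x \<in> Fil M n \<Longrightarrow> a \<odot>\<^bsub>M\<^esub> x \<in> Fil M n" by (rule submodule_smult[OF Fil_submodule])

lemma Fil_antimono: "m \<le> n \<Longrightarrow> Fil M n \<subseteq> Fil M m"
proof (induction n rule: int_ge_induct)
  case (step i)
  then show ?case using Fil_step[of i] by blast
qed simp

lemma Fil_subgroup: "subgroup (Fil M n) (add_monoid M)"
  by (rule submodule.axioms(1)[OF Fil_submodule])

lemma cls_eq_iff:
  assumes "x \<in> carrier M" "y \<in> carrier M"
  shows "cls n x = cls n y \<longleftrightarrow> x \<ominus>\<^bsub>M\<^esub> y \<in> Fil M (n + 1)"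
proof
  have sub: "Fil M (n + 1) \<subseteq> carrier M" by auto
  assume "cls n x = cls n y"
  then have "Fil M (n + 1) +>\<^bsub>M\<^esub> (x \<oplus>\<^bsub>M\<^esub> (\<ominus>\<^bsub>M\<^esub> y)) = Fil M (n + 1)" by (rule M.a_coset_add_inv2[OF _ assms sub])
  then show "x \<ominus>\<^bsub>M\<^esub> y \<in> Fil M (n + 1)"
    using M.a_coset_join1[OF _ _ Fil_subgroup] assms by (simp add: a_minus_def)
next
  have sub: "Fil M (n + 1) \<subseteq> carrier M" by auto
  assume "x \<ominus>\<^bsub>M\<^esub> y \<in> Fil M (n + 1)"
  then have "Fil M (n + 1) +>\<^bsub>M\<^esub> (x \<oplus>\<^bsub>M\<^esub> (\<ominus>\<^bsub>M\<^esub> y)) = Fil M (n + 1)"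
    using assms by (intro M.a_coset_join2 Fil_subgroup) (simp_all add: a_minus_def)
  then show "cls n x = cls n y" by (rule M.a_coset_add_inv1[OF _ assms sub])
qed

lemma cls_eq_zero_iff: "x \<in> carrier M \<Longrightarrow> cls n x = cls n \<zero>\<^bsub>M\<^esub> \<longleftrightarrow> x \<in> Fil M (n + 1)"
  by (simp add: cls_eq_iff)

text \<open>The coset of an element of \<open>Fil M n\<close> stays inside \<open>Fil M n\<close>,
  because the deeper step \<open>Fil M (n + 1)\<close> does; hence so does the representative
  picked.\<close>

lemma rep_cls:
  assumes "x \<in> Fil M n"
  shows "rep (cls n x) \<in> Fil M n" "cls n (rep (cls n x)) = cls n x"
proof -
  have sub: "Fil M (n + 1) \<subseteq> carrier M" by auto
  have "\<zero>\<^bsub>M\<^esub> \<oplus>\<^bsub>M\<^esub> x \<in> cls n x" using assms by (intro M.a_rcosI[OF _ sub]) auto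
  then have r: "rep (cls n x) \<in> cls n x" unfolding rep_def by (rule someI)
  then obtain h where h: "h \<in> Fil M (n + 1)" "rep (cls n x) = h \<oplus>\<^bsub>M\<^esub> x"
    by (auto simp: a_r_coset_def r_coset_def)
  then show "rep (cls n x) \<in> Fil M n" using assms Fil_step[of n] by (auto intro: Fil_add)
  show "cls n (rep (cls n x)) = cls n x"
    using M.a_repr_independence[OF r _ Fil_subgroup] assms by simp
qed

lemma gr_part_carrier: "carrier (gr_part M n) = cls n ` Fil M n"
  by (auto simp: gr_part_def)

lemma gr_part_zero: "\<zero>\<^bsub>gr_part M n\<^esub> = cls n \<zero>\<^bsub>M\<^esub>"
proof -
  have "Fil M (n + 1) \<subseteq> carrier M" by auto
  then show ?thesis by (simp add: gr_part_def)
qed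

lemma rep_gr_part:
  assumes "X \<in> carrier (gr_part M n)"
  shows "rep X \<in> Fil M n" "cls n (rep X) = X"
  using assms rep_cls by (auto simp: gr_part_carrier)

lemma gr_part_add:
  "x \<in> carrier M \<Longrightarrow> y \<in> carrier M \<Longrightarrow> cls n x \<oplus>\<^bsub>gr_part M n\<^esub> cls n y = cls n (x \<oplus>\<^bsub>M\<^esub> y)"
proof -
  have "abelian_subgroup (Fil M (n + 1)) M"
    using submodule_additive_subgroup[OF Fil_submodule] M.abelian_group_axioms by (rule abelian_subgroupI3)
  then show "x \<in> carrier M \<Longrightarrow> y \<in> carrier M \<Longrightarrow> cls n x \<oplus>\<^bsub>gr_part M n\<^esub> cls n y = cls n (x \<oplus>\<^bsub>M\<^esub> y)"
    by (simp add: gr_part_def abelian_subgroup.a_rcos_sum)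
qed

lemma gr_part_smult:
  assumes "a \<in> carrier R" "x \<in> Fil M n"
  shows "a \<odot>\<^bsub>gr_part M n\<^esub> cls n x = cls n (a \<odot>\<^bsub>M\<^esub> x)"
proof -
  have "rep (cls n x) \<ominus>\<^bsub>M\<^esub> x \<in> Fil M (n + 1)"
    using rep_cls[OF assms(2)] assms(2) by (subst cls_eq_iff[symmetric]) auto
  then have "a \<odot>\<^bsub>M\<^esub> (rep (cls n x) \<ominus>\<^bsub>M\<^esub> x) \<in> Fil M (n + 1)" by (rule Fil_smult[OF assms(1)])
  moreover have "a \<odot>\<^bsub>M\<^esub> (rep (cls n x) \<ominus>\<^bsub>M\<^esub> x) = a \<odot>\<^bsub>M\<^esub> rep (cls n x) \<ominus>\<^bsub>M\<^esub> a \<odot>\<^bsub>M\<^esub> x"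
    using rep_cls(1)[OF assms(2)] assms by (simp add: a_minus_def smult_r_distr smult_r_minus)
  ultimately have "cls n (a \<odot>\<^bsub>M\<^esub> rep (cls n x)) = cls n (a \<odot>\<^bsub>M\<^esub> x)"
    using rep_cls(1)[OF assms(2)] assms by (subst cls_eq_iff) auto
  then show ?thesis by (simp add: gr_part_def)
qed

lemma gr_part_ind:
  assumes "X \<in> carrier (gr_part M n)" "\<And>x. x \<in> Fil M n \<Longrightarrow> P (cls n x)"
  shows "P X"
  using assms by (auto simp: gr_part_carrier)

lemma module_gr_part: "module R (gr_part M n)"
proof (intro moduleI abelian_groupI)
  fix X assume X: "X \<in> carrier (gr_part M n)"
  show "\<exists>Y\<in>carrier (gr_part M n). Y \<oplus>\<^bsub>gr_part M n\<^esub> X = \<zero>\<^bsub>gr_part M n\<^esub>"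
    using X by (rule gr_part_ind)
      (auto simp: gr_part_carrier gr_part_add gr_part_zero M.l_neg intro!: bexI[of _ "\<ominus>\<^bsub>M\<^esub> _"] Fil_inv)
next
  fix X Y assume "X \<in> carrier (gr_part M n)" "Y \<in> carrier (gr_part M n)"
  then show "X \<oplus>\<^bsub>gr_part M n\<^esub> Y \<in> carrier (gr_part M n)" "X \<oplus>\<^bsub>gr_part M n\<^esub> Y = Y \<oplus>\<^bsub>gr_part M n\<^esub> X"
    by (auto simp: gr_part_carrier gr_part_add M.a_comm intro: Fil_add)
qed (auto simp: R.is_cring gr_part_carrier gr_part_zero gr_part_add gr_part_smult M.a_assoc
    Fil_smult Fil_add smult_l_distr smult_r_distr smult_assoc1)

end

lemma filtered_module_filtration: "filtered_module A C \<Longrightarrow> filtration A C"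
  by (simp add: filtered_module_def filtration_def filtration_axioms_def)

context noetherian_algebra
begin

text \<open>The coset map on \<open>Fil C n\<close> has kernel \<open>Fil C (n + 1)\<close>, so the
  condition on the quotient module becomes one on a pair of submodules of \<open>C\<close>.\<close>

lemma gr_part_locally_free_iff:
  assumes "filtration A C"
  shows "locally_free_const_rank k (restrict_scalars A (gr_part C n)) \<longleftrightarrow>
    (\<exists>r. local_dual_basis k (restrict_scalars A C) (Fil C n) (Fil C (n + 1)) r)"
proof -
  interpret filtration A C by fact
  have G: "module k (restrict_scalars A (gr_part C n))"
    by (rule module_restrict_scalars[OF alg module_gr_part])
  have "local_dual_basis k (restrict_scalars A C) (Fil C n) (Fil C (n + 1)) r \<longleftrightarrow>
      local_dual_basis k (restrict_scalars A (gr_part C n)) (carrier (gr_part C n)) {\<zero>\<^bsub>gr_part C n\<^esub>} r" for r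
    by (rule local_dual_basis_transfer[where h = "cls n"])
      (use submodule_restrict_scalars[OF alg module_axioms Fil_submodule] Fil_step
        G carrier_submodule_restrict[OF module_gr_part] zero_submodule_restrict[OF module_gr_part]
        module_restrict_scalars[OF alg module_axioms]
        in \<open>auto simp: gr_part_carrier gr_part_add gr_part_smult gr_part_zero cls_eq_zero_iff\<close>)
  then show ?thesis using locally_free_iff[OF G] by simp
qed

end

section \<open>The category of filtered modules\<close>

context noetherian_algebra
begin

text \<open>Local freeness of consecutive quotients propagates to any interval of the filtration by
  induction on its upper index, with ranks adding by \<open>local_dual_basis_trans\<close>.\<close>

lemma filtration_interval_local_dual_basis:
  assumes "filtration A C" "\<And>n. \<exists>r. local_dual_basis k (restrict_scalars A C) (Fil C n) (Fil C (n + 1)) r"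
    and "p \<le> q"
  shows "\<exists>r. local_dual_basis k (restrict_scalars A C) (Fil C p) (Fil C q) r"
proof -
  interpret filtration A C by fact
  interpret K: module k "restrict_scalars A C" by (rule module_restrict_scalars[OF alg module_axioms])
  have sub: "submodule (Fil C n) k (restrict_scalars A C)" for n
    by (rule submodule_restrict_scalars[OF alg module_axioms Fil_submodule])
  from \<open>p \<le> q\<close> show ?thesis
  proof (induction q rule: int_ge_induct)
    case base
    then show ?case using K.local_dual_basis_refl[OF sub] by blast
  next
    case (step i)
    then show ?case
      using K.local_dual_basis_trans[OF sub sub sub Fil_step Fil_antimono] assms(2) by blast
  qed
qed

definition filtered_locally_free :: "('a, 'c, 'z) filt_module_scheme \<Rightarrow> bool" where
  "filtered_locally_free C \<longleftrightarrow> filtration A C \<and> finite_filtration C \<and>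
    (\<forall>n. \<exists>r. local_dual_basis k (restrict_scalars A C) (Fil C n) (Fil C (n + 1)) r)"

lemma filtered_locally_free_carrier:
  assumes "filtered_locally_free C"
  shows "\<exists>r. local_dual_basis k (restrict_scalars A C) (carrier C) (Fil C n) r"
    and "\<exists>r. local_dual_basis k (restrict_scalars A C) (carrier C) {\<zero>\<^bsub>C\<^esub>} r"
proof -
  interpret filtration A C using assms by (simp add: filtered_locally_free_def)
  obtain a b where a: "\<And>n. n \<le> a \<Longrightarrow> Fil C n = carrier C" and b: "\<And>n. n \<ge> b \<Longrightarrow> Fil C n = {\<zero>\<^bsub>C\<^esub>}"
    using assms by (auto simp: filtered_locally_free_def finite_filtration_def)
  have int: "\<exists>r. local_dual_basis k (restrict_scalars A C) (Fil C p) (Fil C q) r" if "p \<le> q" for p q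
    using filtration_interval_local_dual_basis[OF filtration_axioms _ that] assms
    by (simp add: filtered_locally_free_def)
  \<comment> \<open>Starting at \<open>min a n\<close> keeps the lower index at most
    \<open>n\<close> while the step there is still all of \<open>C\<close>.\<close>
  show "\<exists>r. local_dual_basis k (restrict_scalars A C) (carrier C) (Fil C n) r" for n
    using int[of "min a n" n] a[of "min a n"] by simp
  from this[of b] b[of b] show "\<exists>r. local_dual_basis k (restrict_scalars A C) (carrier C) {\<zero>\<^bsub>C\<^esub>} r"
    by simp
qed

end

locale filtered_noetherian_algebra = noetherian_algebra k A
  for k :: "('k, 'l) ring_scheme" and A :: "('k, 'a, 'y) filt_module_scheme" +
  assumes filt: "filtered_algebra k A"
begin

lemma Fil_algebra:
  shows "a \<in> Fil A m \<Longrightarrow> a \<in> carrier A" and "Fil A 0 = carrier A"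
proof -
  have "ideal (Fil A m) A" "\<forall>m\<le>0. Fil A m = carrier A" using filt by (simp_all add: filtered_algebra_def)
  then show "a \<in> Fil A m \<Longrightarrow> a \<in> carrier A" "Fil A 0 = carrier A" by (auto dest: ideal.Icarr)
qed

lemma AF_obj_iff: "C \<in> Obj (AF k A) \<longleftrightarrow> filtered_module A C \<and> filtered_locally_free C"
  using gr_part_locally_free_iff[OF filtered_module_filtration]
  by (auto simp: AF_def filtered_locally_free_def filtered_module_filtration)

definition filt_zero :: "('a, 'c) filt_module" where
  "filt_zero = module.extend zero_module \<lparr>Fil = (\<lambda>_. {undefined})\<rparr>"

lemma same_filt_zero: "same_module zero_module filt_zero"
  by (simp add: same_module_def filt_zero_def module.defs)

lemma filt_zero_obj: "(filt_zero :: ('a, 'c) filt_module) \<in> Obj (AF k A)"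
proof -
  let ?Z = "filt_zero :: ('a, 'c) filt_module"
  have Z: "module A ?Z" by (rule module_same[OF module_zero_module[OF A.M_cring] same_filt_zero])
  have F: "Fil ?Z n = {\<zero>\<^bsub>?Z\<^esub>}" "carrier ?Z = {\<zero>\<^bsub>?Z\<^esub>}" for n
    by (simp_all add: filt_zero_def zero_module_def module.defs)
  have "filtered_module A ?Z"
    unfolding filtered_module_def F(1)
    using Z module.zero_is_submodule[OF Z] module.smult_r_null[OF Z] Fil_algebra(1) by auto
  then show ?thesis
    unfolding AF_obj_iff filtered_locally_free_def
    using filtered_module_filtration zero_module_local_dual_basis[OF Z F(2)] F
    by (auto simp: finite_filtration_def F)
qed

definition filt_prod ::
  "('a, 'b, 'u) filt_module_scheme \<Rightarrow> ('a, 'c, 'v) filt_module_scheme \<Rightarrow> ('a, 'b \<times> 'c) filt_module" where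
  "filt_prod B C = module.extend (prod_module B C) \<lparr>Fil = (\<lambda>n. Fil B n \<times> Fil C n)\<rparr>"

lemma same_filt_prod: "same_module (prod_module B C) (filt_prod B C)"
  by (simp add: same_module_def filt_prod_def module.defs)

lemma filt_prod_obj:
  assumes B: "B \<in> Obj (AF k A)" and C: "C \<in> Obj (AF k A)"
  shows "filt_prod B C \<in> Obj (AF k A)"
proof -
  let ?P = "filt_prod B C"
  have fB: "filtered_module A B" "filtered_locally_free B" and fC: "filtered_module A C" "filtered_locally_free C"
    using B C by (auto simp: AF_obj_iff)
  interpret B: filtration A B by (rule filtered_module_filtration[OF fB(1)])
  interpret C: filtration A C by (rule filtered_module_filtration[OF fC(1)])
  have F: "Fil ?P n = Fil B n \<times> Fil C n" "carrier ?P = carrier B \<times> carrier C" "\<zero>\<^bsub>?P\<^esub> = (\<zero>\<^bsub>B\<^esub>, \<zero>\<^bsub>C\<^esub>)"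
    "smult ?P = (\<lambda>a x. (a \<odot>\<^bsub>B\<^esub> fst x, a \<odot>\<^bsub>C\<^esub> snd x))" for n
    by (simp_all add: filt_prod_def prod_module_def module.defs)
  have P: "module A ?P"
    by (rule module_same[OF module_prod_module[OF B.module_axioms C.module_axioms] same_filt_prod])
  have "filtered_module A ?P"
    unfolding filtered_module_def F(1)
    using P submodule_prod[OF B.module_axioms C.module_axioms P same_filt_prod B.Fil_submodule C.Fil_submodule]
      Sigma_mono[OF B.Fil_step C.Fil_step] fB fC by (simp add: filtered_module_def F(4))
  moreover have "finite_filtration ?P"
  proof -
    obtain a b a' b' where "\<And>n. n \<le> a \<Longrightarrow> Fil B n = carrier B" "\<And>n. n \<ge> b \<Longrightarrow> Fil B n = {\<zero>\<^bsub>B\<^esub>}"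
      "\<And>n. n \<le> a' \<Longrightarrow> Fil C n = carrier C" "\<And>n. n \<ge> b' \<Longrightarrow> Fil C n = {\<zero>\<^bsub>C\<^esub>}"
      using fB(2) fC(2) by (auto simp: filtered_locally_free_def finite_filtration_def)
    then have "\<forall>n\<le>min a a'. Fil ?P n = carrier ?P" "\<forall>n\<ge>max b b'. Fil ?P n = {\<zero>\<^bsub>?P\<^esub>}"
      by (simp_all add: F)
    then show ?thesis unfolding finite_filtration_def by blast
  qed
  moreover have "\<exists>r. local_dual_basis k (restrict_scalars A ?P) (Fil ?P n) (Fil ?P (n + 1)) r" for n
  proof -
    obtain r where "local_dual_basis k (restrict_scalars A B) (Fil B n) (Fil B (n + 1)) r"
      using fB(2) unfolding filtered_locally_free_def by blast
    moreover obtain r' where "local_dual_basis k (restrict_scalars A C) (Fil C n) (Fil C (n + 1)) r'"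
      using fC(2) unfolding filtered_locally_free_def by blast
    ultimately have "local_dual_basis k (restrict_scalars A ?P) (Fil B n \<times> Fil C n) (Fil B (n + 1) \<times> Fil C (n + 1)) (r + r')"
      by (intro prod_local_dual_basis[OF B.module_axioms C.module_axioms same_filt_prod]
          submodule_restrict_scalars[OF alg] B.module_axioms C.module_axioms B.Fil_submodule C.Fil_submodule
          B.Fil_step C.Fil_step)
    then show ?thesis unfolding F(1) by blast
  qed
  ultimately show ?thesis
    by (simp add: AF_obj_iff filtered_locally_free_def filtered_module_filtration)
qed

lemma AF_additive:
  "additive_category (AF k A :: ('c, \<lparr>smult :: 'a \<Rightarrow> 'c \<Rightarrow> 'c, Fil :: int \<Rightarrow> 'c set\<rparr>) mod_cat)
     (AF k A) (filt_hom A) (filt_hom A)"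
  unfolding filt_hom_eq_fam_hom
proof (rule additive_category_fam_hom)
  show "Mor (AF k A) = fam_hom A Fil Fil"
    by (simp add: AF_def filt_hom_eq_fam_hom)
  show "module A C" if "C \<in> Obj (AF k A)" for C :: "('a, 'c) filt_module"
    using that by (simp add: AF_def filtered_module_def)
  show "additive_subgroup (Fil C n) C" if "C \<in> Obj (AF k A)" for C :: "('a, 'c) filt_module" and n
    using that submodule_additive_subgroup by (auto simp: AF_def filtered_module_def)
  show "\<exists>Z\<in>Obj (AF k A :: ('c, \<lparr>smult :: 'a \<Rightarrow> 'c \<Rightarrow> 'c, Fil :: int \<Rightarrow> 'c set\<rparr>) mod_cat). carrier Z = {\<zero>\<^bsub>Z\<^esub>}"
    by (intro bexI[OF _ filt_zero_obj]) (simp add: filt_zero_def zero_module_def module.defs)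
  fix B C :: "('a, 'c) filt_module" assume "B \<in> Obj (AF k A)" "C \<in> Obj (AF k A)"
  then show "\<exists>P\<in>Obj (AF k A). same_module (prod_module B C) P \<and> (\<forall>n. Fil P n = Fil B n \<times> Fil C n)"
    by (intro bexI[OF _ filt_prod_obj[of B C]]) (simp_all add: same_filt_prod, simp add: filt_prod_def module.defs)
qed

section \<open>The dual of a filtered module\<close>

lemma same_filt_dual: "same_module (dual k A C) (filt_dual k A C)"
  by (simp add: same_module_def filt_dual_def module.defs)

lemma filt_dual_simps [simp]:
  "carrier (filt_dual k A C) = carrier (dual k A C)"
  "add (filt_dual k A C) = add (dual k A C)"
  "zero (filt_dual k A C) = zero (dual k A C)"
  "smult (filt_dual k A C) = smult (dual k A C)"
  "Fil (filt_dual k A C) p = {f \<in> carrier (dual k A C). \<forall>x\<in>Fil C (1 - p). f x = \<zero>\<^bsub>k\<^esub>}"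
  by (simp_all add: filt_dual_def module.defs)

lemma Fil_filt_dual: "Fil (filt_dual k A C) p = annihilator k (restrict_scalars A (filt_dual k A C)) (Fil C (1 - p))"
  by (simp add: annihilator_def)

lemma filtered_module_dual:
  assumes "filtered_module A C"
  shows "filtered_module A (filt_dual k A C)"
proof -
  interpret C: filtration A C by (rule filtered_module_filtration[OF assms])
  have D: "module A (filt_dual k A C)"
    by (rule module_same[OF module_dual[OF alg C.module_axioms] same_filt_dual])
  interpret D: module A "filt_dual k A C" by (rule D)
  interpret K: dual_module k "restrict_scalars A C" "restrict_scalars A (filt_dual k A C)"
    by (rule dual_module_restrict_scalars[OF alg C.module_axioms same_filt_dual])
  have sm: "a \<odot>\<^bsub>filt_dual k A C\<^esub> f \<in> Fil (filt_dual k A C) (m + n)"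
    if a: "a \<in> Fil A m" "a \<in> carrier A" and f: "f \<in> Fil (filt_dual k A C) n" for a f m n
  proof -
    have "f (a \<odot>\<^bsub>C\<^esub> x) = \<zero>\<^bsub>k\<^esub>" if x: "x \<in> Fil C (1 - (m + n))" for x
    proof -
      \<comment> \<open>The index count behind the dual filtration: \<open>a\<close> takes
        \<open>Fil C (1 - (m + n))\<close> into \<open>Fil C (1 - n)\<close>, where \<open>f\<close>
        vanishes.\<close>
      have "a \<odot>\<^bsub>C\<^esub> x \<in> Fil C (m + (1 - (m + n)))" using assms a x unfolding filtered_module_def by blast
      then have "a \<odot>\<^bsub>C\<^esub> x \<in> Fil C (1 - n)" by (simp add: algebra_simps)
      then show ?thesis using f by simp
    qed
    moreover have "a \<odot>\<^bsub>filt_dual k A C\<^esub> f \<in> carrier (filt_dual k A C)" using a f by (intro D.smult_closed) auto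
    ultimately show ?thesis by simp
  qed
  note A0 = Fil_algebra(2,1)
  have S: "submodule (Fil (filt_dual k A C) n) A (filt_dual k A C)" for n
  proof (rule D.submoduleI)
    let ?F = "Fil (filt_dual k A C) n"
    have "submodule ?F k (restrict_scalars A (filt_dual k A C))"
      unfolding Fil_filt_dual by (rule K.annihilator_submodule) auto
    note s = K.D.submodule_mem[OF this] K.D.submodule_zero[OF this] K.D.submodule_add[OF this]
    show "?F \<subseteq> carrier (filt_dual k A C)" by auto
    show "\<zero>\<^bsub>filt_dual k A C\<^esub> \<in> ?F" using s(2) by (simp only: restrict_scalars_simps)
    show "f \<oplus>\<^bsub>filt_dual k A C\<^esub> g \<in> ?F" if "f \<in> ?F" "g \<in> ?F" for f g
      using s(3)[OF that] by (simp only: restrict_scalars_simps)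
    show *: "a \<odot>\<^bsub>filt_dual k A C\<^esub> f \<in> ?F" if "a \<in> carrier A" "f \<in> ?F" for a f
      \<comment> \<open>Step zero of the filtration of \<open>A\<close> is all of \<open>A\<close>,
        so the action in step zero is the full action of \<open>A\<close>.\<close>
      using sm[of a 0 f n] that A0 by simp
    show "\<ominus>\<^bsub>filt_dual k A C\<^esub> f \<in> ?F" if "f \<in> ?F" for f
    proof -
      have "\<ominus>\<^bsub>filt_dual k A C\<^esub> f = (\<ominus>\<^bsub>A\<^esub> \<one>\<^bsub>A\<^esub>) \<odot>\<^bsub>filt_dual k A C\<^esub> f"
      proof -
        have f: "f \<in> carrier (filt_dual k A C)" using that by simp
        show ?thesis by (simp only: D.smult_l_minus[OF A.one_closed f] D.smult_one[OF f])
      qed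
      then show ?thesis using *[of "\<ominus>\<^bsub>A\<^esub> \<one>\<^bsub>A\<^esub>" f] that by simp
    qed
  qed
  have "Fil (filt_dual k A C) (n + 1) \<subseteq> Fil (filt_dual k A C) n" for n
    using C.Fil_antimono[of "- n" "1 - n"] by auto
  then show ?thesis unfolding filtered_module_def using D S sm A0 by blast
qed

text \<open>Step \<open>n\<close> of the dual modulo step \<open>n + 1\<close> is the annihilator of
  \<open>Fil C (1 - n)\<close> modulo that of \<open>Fil C (- n)\<close>, hence dual to the quotient
  in degree \<open>- n\<close>. Extending functionals from \<open>Fil C (- n)\<close> to
  \<open>C\<close> uses that the quotient of \<open>C\<close> by this step is locally free as
  well.\<close>

lemma filt_dual_obj:
  assumes "C \<in> Obj (AF k A)"
  shows "filt_dual k A C \<in> Obj (AF k A)"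
proof -
  have fC: "filtered_module A C" "filtered_locally_free C" using assms by (auto simp: AF_obj_iff)
  interpret C: filtration A C by (rule filtered_module_filtration[OF fC(1)])
  interpret K: dual_module k "restrict_scalars A C" "restrict_scalars A (filt_dual k A C)"
    by (rule dual_module_restrict_scalars[OF alg C.module_axioms same_filt_dual])
  have zero: "f \<zero>\<^bsub>C\<^esub> = \<zero>\<^bsub>k\<^esub>" if "f \<in> carrier (dual k A C)" for f
    using K.linear_on_zero[OF _ K.carrier_is_submodule, of f] that by (simp add: dual_mem)
  obtain a b where a: "\<And>n. n \<le> a \<Longrightarrow> Fil C n = carrier C" and b: "\<And>n. n \<ge> b \<Longrightarrow> Fil C n = {\<zero>\<^bsub>C\<^esub>}"
    using fC(2) by (auto simp: filtered_locally_free_def finite_filtration_def)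
  \<comment> \<open>For such \<open>n\<close> the condition concerns \<open>Fil C (1 - n)\<close>,
    which is zero since \<open>1 - n \<ge> b\<close>.\<close>
  have "\<forall>n\<le>1 - b. Fil (filt_dual k A C) n = carrier (filt_dual k A C)"
    using b zero by auto
  moreover have "\<forall>n\<ge>1 - a. Fil (filt_dual k A C) n = {\<zero>\<^bsub>filt_dual k A C\<^esub>}"
  proof (intro allI impI)
    fix n assume "n \<ge> 1 - a"
    then have F: "Fil C (1 - n) = carrier C" by (intro a) simp
    have "f = \<zero>\<^bsub>dual k A C\<^esub>" if "f \<in> carrier (dual k A C)" "\<forall>x\<in>carrier C. f x = \<zero>\<^bsub>k\<^esub>" for f
      using that dual_extensional[of f k A C] by (intro extensionalityI[of _ "carrier C"]) auto
    moreover have "\<zero>\<^bsub>dual k A C\<^esub> \<in> carrier (dual k A C)" using K.D.zero_closed by (simp del: dual_simps)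
    moreover have "\<zero>\<^bsub>dual k A C\<^esub> x = \<zero>\<^bsub>k\<^esub>" if "x \<in> carrier C" for x using that by simp
    ultimately show "Fil (filt_dual k A C) n = {\<zero>\<^bsub>filt_dual k A C\<^esub>}"
      unfolding filt_dual_simps F by blast
  qed
  ultimately have "finite_filtration (filt_dual k A C)" unfolding finite_filtration_def by blast
  moreover have "\<exists>r. local_dual_basis k (restrict_scalars A (filt_dual k A C))
      (Fil (filt_dual k A C) n) (Fil (filt_dual k A C) (n + 1)) r" for n
  proof -
    have sub: "submodule (Fil C n) k (restrict_scalars A C)" for n
      by (rule submodule_restrict_scalars[OF alg C.module_axioms C.Fil_submodule])
    obtain r' where r': "local_dual_basis k (restrict_scalars A C) (carrier C) (Fil C (- n)) r'"
      using filtered_locally_free_carrier(1)[OF fC(2)] by blast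
    obtain r where r: "local_dual_basis k (restrict_scalars A C) (Fil C (- n)) (Fil C (- n + 1)) r"
      using fC(2) unfolding filtered_locally_free_def by blast
    have "local_dual_basis k (restrict_scalars A (filt_dual k A C))
      (annihilator k (restrict_scalars A (filt_dual k A C)) (Fil C (- n + 1)))
      (annihilator k (restrict_scalars A (filt_dual k A C)) (Fil C (- n))) r"
      using r' by (intro K.local_dual_basis_annihilator[OF sub sub C.Fil_step _ r]) simp
    then show ?thesis unfolding Fil_filt_dual by (auto simp: algebra_simps)
  qed
  ultimately show ?thesis
    using filtered_module_dual[OF fC(1)] by (simp add: AF_obj_iff filtered_locally_free_def filtered_module_filtration)
qed

lemma AF_contravariant:
  "contravariant_functor (AF k A :: ('c, \<lparr>smult :: 'a \<Rightarrow> 'c \<Rightarrow> 'c, Fil :: int \<Rightarrow> 'c set\<rparr>) mod_cat) (AF k A)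
     (filt_dual k A) (dual_map k A)"
proof (rule contravariant_functor_dual[OF alg, where S = Fil and T = Fil])
  fix B C :: "('a, 'c) filt_module" and f g n
  assume B: "B \<in> Obj (AF k A)" and C: "C \<in> Obj (AF k A)" and f: "f \<in> fam_hom A Fil Fil B C"
    and g: "g \<in> Fil (filt_dual k A C) n"
  have "filtered_module A B" using B by (simp add: AF_obj_iff)
  then interpret B: filtration A B by (rule filtered_module_filtration)
  show "g \<in> carrier (dual k A C) \<and> compose (carrier B) g f \<in> Fil (filt_dual k A B) n"
    using compose_dual[OF alg B.module_axioms fam_hom_mod_hom[OF f], of g] g fam_hom_mem[OF f]
    by (auto simp: compose_eq)
qed (auto simp: filt_dual_obj same_filt_dual, auto simp: AF_def filt_hom_eq_fam_hom filtered_module_def)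

text \<open>The two shifts cancel, \<open>1 - (1 - n) = n\<close>: step \<open>n\<close> of the
  double dual tests \<open>x\<close> on the functionals vanishing on \<open>Fil C n\<close>. That
  these detect membership in \<open>Fil C n\<close> is \<open>local_dual_basis_torsionless\<close>
  for the quotient of \<open>C\<close> by that step.\<close>

lemma double_dual_map_Fil_iff:
  assumes "C \<in> Obj (AF k A)" "x \<in> carrier C"
  shows "double_dual_map k A C x \<in> Fil (filt_dual k A (filt_dual k A C)) n \<longleftrightarrow> x \<in> Fil C n"
proof -
  have fC: "filtered_module A C" "filtered_locally_free C" using assms by (auto simp: AF_obj_iff)
  interpret C: filtration A C by (rule filtered_module_filtration[OF fC(1)])
  interpret K: dual_module k "restrict_scalars A C" "restrict_scalars A (filt_dual k A C)"
    by (rule dual_module_restrict_scalars[OF alg C.module_axioms same_filt_dual])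
  have "double_dual_map k A C x \<in> carrier (dual k A (dual k A C))"
    using mod_hom_closed[OF double_dual_map_mod_hom[OF alg C.module_axioms] assms(2)] .
  then have "double_dual_map k A C x \<in> Fil (filt_dual k A (filt_dual k A C)) n \<longleftrightarrow>
      (\<forall>f\<in>carrier (dual k A C). (\<forall>y\<in>Fil C n. f y = \<zero>\<^bsub>k\<^esub>) \<longrightarrow> f x = \<zero>\<^bsub>k\<^esub>)"
    using dual_same[OF same_filt_dual[of C], where k = k and A = A, symmetric] assms(2) by (auto simp: double_dual_map_def)
  also have "\<dots> \<longleftrightarrow> x \<in> Fil C n"
  proof
    assume van: "\<forall>f\<in>carrier (dual k A C). (\<forall>y\<in>Fil C n. f y = \<zero>\<^bsub>k\<^esub>) \<longrightarrow> f x = \<zero>\<^bsub>k\<^esub>"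
    obtain r where r: "local_dual_basis k (restrict_scalars A C) (carrier (restrict_scalars A C)) (Fil C n) r"
      using filtered_locally_free_carrier(1)[OF fC(2), of n] by auto
    show "x \<in> Fil C n"
    proof (rule K.local_dual_basis_torsionless[OF K.carrier_is_submodule _ r])
      show "submodule (Fil C n) k (restrict_scalars A C)"
        by (rule submodule_restrict_scalars[OF alg C.module_axioms C.Fil_submodule])
      fix f assume f: "linear_on k (restrict_scalars A C) (carrier (restrict_scalars A C)) f"
        and z: "\<And>y. y \<in> Fil C n \<Longrightarrow> f y = \<zero>\<^bsub>k\<^esub>"
      from K.restrict_dual[OF f] have "restrict f (carrier C) \<in> carrier (dual k A C)" by simp
      from bspec[OF van this] z assms(2) show "f x = \<zero>\<^bsub>k\<^esub>" by simp
    qed (use assms in simp)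
  qed auto
  finally show ?thesis .
qed

lemma AF_dualizing:
  "dualizing_functor (AF k A :: ('c, \<lparr>smult :: 'a \<Rightarrow> 'c \<Rightarrow> 'c, Fil :: int \<Rightarrow> 'c set\<rparr>) mod_cat)
     (AF k A) (AF k A) (filt_hom A) (filt_hom A)
     (filt_dual k A) (dual_map k A) (filt_dual k A) (dual_map k A)"
  unfolding filt_hom_eq_fam_hom
proof (rule dualizing_functor_dual[OF alg _ _ _ _ _ AF_contravariant AF_contravariant])
  fix C :: "('a, 'c) filt_module" and n assume C: "C \<in> Obj (AF k A)"
  have fC: "filtered_module A C" "filtered_locally_free C" using C by (auto simp: AF_obj_iff)
  interpret C: filtration A C by (rule filtered_module_filtration[OF fC(1)])
  show "module A C" by (rule C.module_axioms)
  show "Fil C n \<subseteq> carrier C" by auto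
  show "filt_dual k A C \<in> Obj (AF k A)" by (rule filt_dual_obj[OF C])
  show "\<exists>r. local_dual_basis k (restrict_scalars A C) (carrier C) {\<zero>\<^bsub>C\<^esub>} r"
    by (rule filtered_locally_free_carrier(2)[OF fC(2)])
  show "double_dual_map k A C x \<in> Fil (filt_dual k A (filt_dual k A C)) n \<longleftrightarrow> x \<in> Fil C n"
    if "x \<in> carrier C" for x
    by (rule double_dual_map_Fil_iff[OF C that])
qed (auto simp: same_filt_dual, auto simp: AF_def filt_hom_eq_fam_hom)

end

section \<open>Associated graded modules\<close>

text \<open>Finite sums read only the additive fields, so sums in \<open>self_filt A\<close> can be
  rewritten as sums in \<open>A\<close>.\<close>

lemma finsum_cong_fields:
  assumes "carrier N = carrier M" "add N = add M" "zero N = zero M"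
  shows "finsum N f I = finsum M f I"
  unfolding finsum_def finprod_def monoid.simps partial_object.simps assms by (rule refl)

lemma (in abelian_monoid) finsum_swap:
  assumes "finite I" "finite J" "\<And>i j. i \<in> I \<Longrightarrow> j \<in> J \<Longrightarrow> f i j \<in> carrier G"
  shows "(\<Oplus>i\<in>I. \<Oplus>j\<in>J. f i j) = (\<Oplus>j\<in>J. \<Oplus>i\<in>I. f i j)"
  using assms(1,3)
proof (induction I rule: finite_induct)
  case empty
  then show ?case by (simp add: finsum_zero)
next
  case (insert a I)
  have c: "(\<lambda>i. \<Oplus>j\<in>J. f i j) \<in> I \<rightarrow> carrier G" "(\<Oplus>j\<in>J. f a j) \<in> carrier G"
    "(\<lambda>j. \<Oplus>i\<in>I. f i j) \<in> J \<rightarrow> carrier G" "(\<lambda>j. f a j) \<in> J \<rightarrow> carrier G"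
    using insert.prems by (auto intro!: finsum_closed)
  have "(\<Oplus>j\<in>J. \<Oplus>i\<in>insert a I. f i j) = (\<Oplus>j\<in>J. f a j \<oplus> (\<Oplus>i\<in>I. f i j))"
    using insert by (intro finsum_cong') (auto intro!: finsum_insert finsum_closed)
  also have "\<dots> = (\<Oplus>j\<in>J. f a j) \<oplus> (\<Oplus>j\<in>J. \<Oplus>i\<in>I. f i j)"
    by (rule finsum_addf[OF c(4,3)])
  finally show ?case using insert c by simp
qed

lemma (in abelian_monoid) finsum_superset:
  assumes "finite J" "I \<subseteq> J" "\<And>i. i \<in> I \<Longrightarrow> f i \<in> carrier G" "\<And>i. i \<in> J - I \<Longrightarrow> f i = \<zero>"
  shows "finsum G f I = finsum G f J"
proof -
  have "f i \<in> carrier G" if "i \<in> J" for i using assms that by (cases "i \<in> I") auto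
  then show ?thesis using assms by (intro add.finprod_mono_neutral_cong_left) auto
qed

lemma (in abelian_monoid) finsum_single:
  assumes "finite J" "n \<in> J" "f n \<in> carrier G" "\<And>i. i \<in> J - {n} \<Longrightarrow> f i = \<zero>"
  shows "finsum G f J = f n"
proof -
  have "finsum G f {n} = finsum G f J" using assms by (intro finsum_superset) auto
  moreover have "finsum G f {n} = f n" using finsum_insert[of "{}" n f] assms(3) by simp
  ultimately show ?thesis by simp
qed

text \<open>For an infinite index set both sums are zero by convention, and \<open>h\<close>
  preserves zero.\<close>

lemma additive_finsum:
  assumes "abelian_group M" "abelian_group N"
    and h: "\<And>x. x \<in> carrier M \<Longrightarrow> h x \<in> carrier N"
      "\<And>x y. x \<in> carrier M \<Longrightarrow> y \<in> carrier M \<Longrightarrow> h (x \<oplus>\<^bsub>M\<^esub> y) = h x \<oplus>\<^bsub>N\<^esub> h y"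
    and f: "f \<in> I \<rightarrow> carrier M"
  shows "h (\<Oplus>\<^bsub>M\<^esub>i\<in>I. f i) = (\<Oplus>\<^bsub>N\<^esub>i\<in>I. h (f i))"
proof -
  interpret M: abelian_group M by fact
  interpret N: abelian_group N by fact
  have z: "h \<zero>\<^bsub>M\<^esub> = \<zero>\<^bsub>N\<^esub>"
    by (rule additive_map_zero[OF assms(1,2) h(1)[OF M.zero_closed] h(2)[OF M.zero_closed M.zero_closed]])
  show ?thesis using f
  proof (induction I rule: infinite_finite_induct)
    case (insert i I)
    then have "(\<lambda>i. h (f i)) \<in> I \<rightarrow> carrier N" using h by auto
    then show ?case using insert h by (auto simp: M.finsum_closed)
  qed (simp_all add: z)
qed

section \<open>Finitely supported families as representatives of graded elements\<close>

definition support :: "('b, 'z) ring_scheme \<Rightarrow> (int \<Rightarrow> 'b) \<Rightarrow> int set" where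
  "support M \<xi> = {n. \<xi> n \<noteq> \<zero>\<^bsub>M\<^esub>}"

text \<open>Elements of the associated graded module are the classes of the finitely supported families
  \<open>\<xi>\<close> with \<open>\<xi> n \<in> Fil M n\<close>, and the product of classes is the class of the convolution.\<close>

definition families :: "('a, 'b, 'z) filt_module_scheme \<Rightarrow> (int \<Rightarrow> 'b) set" where
  "families M = {\<xi>. (\<forall>n. \<xi> n \<in> Fil M n) \<and> finite (support M \<xi>)}"

definition cls_fam :: "('a, 'b, 'z) filt_module_scheme \<Rightarrow> (int \<Rightarrow> 'b) \<Rightarrow> int \<Rightarrow> 'b set" where
  "cls_fam M \<xi> = (\<lambda>n. Fil M (n + 1) +>\<^bsub>M\<^esub> \<xi> n)"

context filtration
begin

lemma families_mem: "\<xi> \<in> families M \<Longrightarrow> \<xi> n \<in> Fil M n"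
  by (simp add: families_def)

lemma families_carrier: "\<xi> \<in> families M \<Longrightarrow> \<xi> n \<in> carrier M"
  by (rule Fil_carrier[OF families_mem])

lemma families_finite: "\<xi> \<in> families M \<Longrightarrow> finite (support M \<xi>)"
  by (simp add: families_def)

lemma familiesI: "(\<And>n. \<xi> n \<in> Fil M n) \<Longrightarrow> finite J \<Longrightarrow> (\<And>n. n \<notin> J \<Longrightarrow> \<xi> n = \<zero>\<^bsub>M\<^esub>) \<Longrightarrow> \<xi> \<in> families M"
  unfolding families_def support_def by (auto intro: finite_subset[of _ J])

lemma cls_fam_gr_carrier: "\<xi> \<in> families M \<Longrightarrow> cls_fam M \<xi> \<in> gr_carrier M"
proof -
  assume \<xi>: "\<xi> \<in> families M"
  have "{n. cls_fam M \<xi> n \<noteq> \<zero>\<^bsub>gr_part M n\<^esub>} \<subseteq> support M \<xi>"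
    by (auto simp: cls_fam_def gr_part_zero support_def)
  from finite_subset[OF this families_finite[OF \<xi>]] families_mem[OF \<xi>] show "cls_fam M \<xi> \<in> gr_carrier M"
    by (simp add: gr_carrier_def) (simp add: cls_fam_def gr_part_carrier)
qed

lemma gr_carrierE:
  assumes "x \<in> gr_carrier M"
  obtains \<xi> where "\<xi> \<in> families M" "x = cls_fam M \<xi>"
proof
  \<comment> \<open>A zero class is represented by zero, since \<open>rep\<close> may pick a nonzero
    element of it and destroy the finiteness of the support.\<close>
  define \<xi> where "\<xi> n = (if x n = \<zero>\<^bsub>gr_part M n\<^esub> then \<zero>\<^bsub>M\<^esub> else rep (x n))" for n
  have x: "x n \<in> carrier (gr_part M n)" for n using assms by (simp add: gr_carrier_def)
  show "\<xi> \<in> families M"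
    by (rule familiesI[of _ "{n. x n \<noteq> \<zero>\<^bsub>gr_part M n\<^esub>}"])
      (use assms rep_gr_part[OF x] in \<open>auto simp: \<xi>_def gr_carrier_def\<close>)
  show "x = cls_fam M \<xi>"
  proof
    fix n show "x n = cls_fam M \<xi> n"
      using rep_gr_part[OF x] by (cases "x n = \<zero>\<^bsub>gr_part M n\<^esub>") (simp_all add: cls_fam_def \<xi>_def gr_part_zero)
  qed
qed

lemma gr_carrier_rep:
  assumes "x \<in> gr_carrier M"
  shows "rep (x n) \<in> Fil M n" "cls n (rep (x n)) = x n"
  using assms rep_gr_part[of "x n" n] by (auto simp: gr_carrier_def)

lemma cls_fam_eqI:
  assumes "\<And>n. \<xi> n \<ominus>\<^bsub>M\<^esub> \<eta> n \<in> Fil M (n + 1)" "\<And>n. \<xi> n \<in> carrier M" "\<And>n. \<eta> n \<in> carrier M"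
  shows "cls_fam M \<xi> = cls_fam M \<eta>"
  unfolding cls_fam_def by (intro ext) (simp add: cls_eq_iff assms)

lemma families_add: "\<xi> \<in> families M \<Longrightarrow> \<eta> \<in> families M \<Longrightarrow> (\<lambda>n. \<xi> n \<oplus>\<^bsub>M\<^esub> \<eta> n) \<in> families M"
  by (rule familiesI[of _ "support M \<xi> \<union> support M \<eta>"])
    (auto simp: families_finite Fil_add families_mem, auto simp: support_def)

lemma families_smult: "a \<in> carrier R \<Longrightarrow> \<xi> \<in> families M \<Longrightarrow> (\<lambda>n. a \<odot>\<^bsub>M\<^esub> \<xi> n) \<in> families M"
  by (rule familiesI[of _ "support M \<xi>"]) (auto simp: families_finite Fil_smult families_mem, auto simp: support_def)

lemma families_zero: "(\<lambda>n. \<zero>\<^bsub>M\<^esub>) \<in> families M"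
  by (rule familiesI[of _ "{}"]) auto

lemma families_single: "x \<in> Fil M n \<Longrightarrow> (\<lambda>m. if m = n then x else \<zero>\<^bsub>M\<^esub>) \<in> families M"
  by (rule familiesI[of _ "{n}"]) auto

lemma cls_fam_add: "\<xi> \<in> families M \<Longrightarrow> \<eta> \<in> families M \<Longrightarrow>
    (\<lambda>n. cls_fam M \<xi> n \<oplus>\<^bsub>gr_part M n\<^esub> cls_fam M \<eta> n) = cls_fam M (\<lambda>n. \<xi> n \<oplus>\<^bsub>M\<^esub> \<eta> n)"
  by (simp add: cls_fam_def gr_part_add families_carrier)

lemma cls_fam_zero: "cls_fam M (\<lambda>n. \<zero>\<^bsub>M\<^esub>) = (\<lambda>n. \<zero>\<^bsub>gr_part M n\<^esub>)"
  by (simp add: cls_fam_def gr_part_zero)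

lemma cls_fam_smult: "a \<in> carrier R \<Longrightarrow> \<xi> \<in> families M \<Longrightarrow>
    (\<lambda>n. a \<odot>\<^bsub>gr_part M n\<^esub> cls_fam M \<xi> n) = cls_fam M (\<lambda>n. a \<odot>\<^bsub>M\<^esub> \<xi> n)"
  by (simp add: cls_fam_def gr_part_smult families_mem)

lemma cls_finsum_cong:
  assumes "finite I" "\<And>i. i \<in> I \<Longrightarrow> f i \<in> carrier M" "\<And>i. i \<in> I \<Longrightarrow> g i \<in> carrier M"
    "\<And>i. i \<in> I \<Longrightarrow> cls n (f i) = cls n (g i)"
  shows "cls n (\<Oplus>\<^bsub>M\<^esub>i\<in>I. f i) = cls n (\<Oplus>\<^bsub>M\<^esub>i\<in>I. g i)"
  using assms
proof (induction I rule: finite_induct)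
  case (insert i I)
  have c: "f \<in> I \<rightarrow> carrier M" "g \<in> I \<rightarrow> carrier M" "f i \<in> carrier M" "g i \<in> carrier M" using insert.prems(1,2) by auto
  have "cls n (finsum M f I) = cls n (finsum M g I)"
    by (rule insert.IH) (simp_all add: insert.prems)
  moreover have "cls n (f i) = cls n (g i)" by (rule insert.prems(3)) simp
  ultimately have "cls n (f i \<oplus>\<^bsub>M\<^esub> finsum M f I) = cls n (g i \<oplus>\<^bsub>M\<^esub> finsum M g I)"
    using c by (simp only: gr_part_add[symmetric] M.finsum_closed)
  then show ?case using insert.hyps c by simp
qed simp

lemma Fil_finsum: "finite I \<Longrightarrow> (\<And>i. i \<in> I \<Longrightarrow> f i \<in> Fil M n) \<Longrightarrow> (\<Oplus>\<^bsub>M\<^esub>i\<in>I. f i) \<in> Fil M n"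
proof (induction I rule: finite_induct)
  case (insert i I)
  have "f j \<in> carrier M" if "j \<in> insert i I" for j by (rule Fil_carrier[OF insert.prems[OF that]])
  then have "f \<in> I \<rightarrow> carrier M" "f i \<in> carrier M" by simp_all
  then show ?case using insert by (simp add: Fil_add)
qed simp

text \<open>Only the additive fields are prescribed, so that the lemma applies to
  \<open>gr_algebra\<close> and to \<open>gr_module\<close> alike.\<close>

lemma gr_abelian_group:
  assumes "carrier G = gr_carrier M" "zero G = (\<lambda>n. \<zero>\<^bsub>gr_part M n\<^esub>)"
    "add G = (\<lambda>x y n. x n \<oplus>\<^bsub>gr_part M n\<^esub> y n)"
  shows "abelian_group G"
proof (rule abelian_groupI; unfold assms)
  fix x y assume "x \<in> gr_carrier M" "y \<in> gr_carrier M"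
  then obtain \<xi> \<eta> where "\<xi> \<in> families M" "\<eta> \<in> families M" "x = cls_fam M \<xi>" "y = cls_fam M \<eta>"
    by (metis gr_carrierE)
  then show "(\<lambda>n. x n \<oplus>\<^bsub>gr_part M n\<^esub> y n) \<in> gr_carrier M" "(\<lambda>n. x n \<oplus>\<^bsub>gr_part M n\<^esub> y n) = (\<lambda>n. y n \<oplus>\<^bsub>gr_part M n\<^esub> x n)"
    using cls_fam_gr_carrier[OF families_add] by (simp_all add: cls_fam_add M.a_comm families_carrier)
next
  show "(\<lambda>n. \<zero>\<^bsub>gr_part M n\<^esub>) \<in> gr_carrier M"
    using cls_fam_gr_carrier[OF families_zero] by (simp add: cls_fam_zero)
  fix x y z assume "x \<in> gr_carrier M" "y \<in> gr_carrier M" "z \<in> gr_carrier M"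
  then obtain \<xi> \<eta> \<zeta> where "\<xi> \<in> families M" "\<eta> \<in> families M" "\<zeta> \<in> families M"
    "x = cls_fam M \<xi>" "y = cls_fam M \<eta>" "z = cls_fam M \<zeta>"
    by (metis gr_carrierE)
  then show "(\<lambda>n. (x n \<oplus>\<^bsub>gr_part M n\<^esub> y n) \<oplus>\<^bsub>gr_part M n\<^esub> z n) = (\<lambda>n. x n \<oplus>\<^bsub>gr_part M n\<^esub> (y n \<oplus>\<^bsub>gr_part M n\<^esub> z n))"
    by (simp add: cls_fam_def gr_part_add M.a_assoc families_carrier)
next
  fix x assume "x \<in> gr_carrier M"
  then obtain \<xi> where \<xi>: "\<xi> \<in> families M" "x = cls_fam M \<xi>" by (rule gr_carrierE)
  then show "(\<lambda>n. \<zero>\<^bsub>gr_part M n\<^esub> \<oplus>\<^bsub>gr_part M n\<^esub> x n) = x"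
    by (simp add: cls_fam_def gr_part_zero gr_part_add families_carrier)
  have inv: "(\<lambda>n. \<ominus>\<^bsub>M\<^esub> \<xi> n) \<in> families M"
    by (rule familiesI[of _ "support M \<xi>"])
      (use \<xi> in \<open>auto simp: families_finite Fil_inv families_mem, auto simp: support_def M.minus_equality\<close>)
  show "\<exists>y\<in>gr_carrier M. (\<lambda>n. y n \<oplus>\<^bsub>gr_part M n\<^esub> x n) = (\<lambda>n. \<zero>\<^bsub>gr_part M n\<^esub>)"
    by (rule bexI[OF _ cls_fam_gr_carrier[OF inv]])
      (use families_carrier[OF \<xi>(1)] families_carrier[OF inv] in
        \<open>simp add: \<xi>(2) cls_fam_def gr_part_zero gr_part_add M.l_neg\<close>)
qed

end

text \<open>Viewing \<open>A\<close> as a filtered module over itself turns the product of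
  \<open>gr_algebra\<close> into the scalar multiplication of \<open>gr_module\<close>. The laws of
  the product and of the action then come from the same lemmas on convolutions.\<close>

definition self_filt :: "('k, 'a, 'y) filt_module_scheme \<Rightarrow> ('a, 'a) filt_module" where
  "self_filt A = \<lparr>carrier = carrier A, mult = mult A, one = one A, zero = zero A, add = add A,
     smult = mult A, Fil = Fil A\<rparr>"

lemma self_filt_simps [simp]:
  "carrier (self_filt A) = carrier A" "zero (self_filt A) = zero A" "add (self_filt A) = add A"
  "smult (self_filt A) = mult A" "Fil (self_filt A) = Fil A"
  by (simp_all add: self_filt_def)

lemma filtered_algebra_filtration:
  assumes "filtered_algebra k A"
  shows "filtration k A"
proof -
  interpret A: algebra k A using assms by (simp add: filtered_algebra_def)
  have id: "ideal (Fil A n) A" "Fil A (n + 1) \<subseteq> Fil A n" for n using assms by (simp_all add: filtered_algebra_def)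
  have "submodule (Fil A n) k A" for n
  proof (rule A.submoduleI)
    interpret I: ideal "Fil A n" A by (rule id)
    show "Fil A n \<subseteq> carrier A" by (rule I.a_subset)
    show "c \<odot>\<^bsub>A\<^esub> x \<in> Fil A n" if "c \<in> carrier k" "x \<in> Fil A n" for c x
    proof -
      \<comment> \<open>The algebra axiom turns scaling by \<open>c\<close> into multiplication by a
        multiple of the unit, so ideals are \<open>k\<close>-submodules.\<close>
      have "c \<odot>\<^bsub>A\<^esub> x = (c \<odot>\<^bsub>A\<^esub> \<one>\<^bsub>A\<^esub>) \<otimes>\<^bsub>A\<^esub> x" using that by (simp add: A.smult_assoc2)
      then show ?thesis using that by (simp add: I.I_l_closed)
    qed
  qed (simp_all add: additive_subgroup.zero_closed additive_subgroup.a_closed additive_subgroup.a_inv_closed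
      ideal.axioms(1)[OF id(1)])
  then show ?thesis
    using id(2) by (simp add: filtration_def filtration_axioms_def A.module)
qed

lemma filtered_module_self_filt:
  assumes "filtered_algebra k A"
  shows "filtered_module A (self_filt A)"
proof -
  interpret A: algebra k A using assms by (simp add: filtered_algebra_def)
  have m: "module A (self_filt A)"
    by (intro moduleI abelian_group_cong[OF A.M.abelian_group_axioms])
      (simp_all add: A.M_cring A.l_distr A.r_distr A.m_assoc)
  interpret S: module A "self_filt A" by (rule m)
  have neg: "\<ominus>\<^bsub>self_filt A\<^esub> x = \<ominus>\<^bsub>A\<^esub> x" if "x \<in> carrier A" for x
    by (rule S.minus_equality) (use that in \<open>auto simp: A.M.l_neg\<close>)
  have "submodule (Fil A n) A (self_filt A)" for n
  proof -
    interpret I: ideal "Fil A n" A using assms by (simp add: filtered_algebra_def)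
    show ?thesis by (rule S.submoduleI) (auto simp: neg I.I_l_closed dest: I.Icarr)
  qed
  with m show ?thesis using assms by (simp add: filtered_module_def filtered_algebra_def)
qed

locale filtered_pair =
  fixes k :: "('k, 'l) ring_scheme" and A :: "('k, 'a, 'y) filt_module_scheme"
    and C :: "('a, 'c, 'z) filt_module_scheme"
  assumes filtA: "filtered_algebra k A" and filtC: "filtered_module A C"
begin

sublocale A: filtration k A by (rule filtered_algebra_filtration[OF filtA])
sublocale C: filtration A C by (rule filtered_module_filtration[OF filtC])

definition conv :: "(int \<Rightarrow> 'a) \<Rightarrow> (int \<Rightarrow> 'c) \<Rightarrow> int \<Rightarrow> 'c" where
  "conv \<alpha> \<xi> n = (\<Oplus>\<^bsub>C\<^esub>i\<in>support A \<alpha>. \<alpha> i \<odot>\<^bsub>C\<^esub> \<xi> (n - i))"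

lemma smult_Fil: "a \<in> Fil A m \<Longrightarrow> x \<in> Fil C n \<Longrightarrow> m + n = l \<Longrightarrow> a \<odot>\<^bsub>C\<^esub> x \<in> Fil C l"
  using filtC unfolding filtered_module_def by blast

lemma conv_superset:
  assumes "\<alpha> \<in> families A" "\<xi> \<in> families C" "finite I" "support A \<alpha> \<subseteq> I"
  shows "conv \<alpha> \<xi> n = (\<Oplus>\<^bsub>C\<^esub>i\<in>I. \<alpha> i \<odot>\<^bsub>C\<^esub> \<xi> (n - i))"
  unfolding conv_def
proof (rule C.M.finsum_superset[OF assms(3,4)])
  show "\<alpha> i \<odot>\<^bsub>C\<^esub> \<xi> (n - i) \<in> carrier C" for i
    by (rule C.smult_closed[OF A.families_carrier[OF assms(1)] C.families_carrier[OF assms(2)]])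
  show "\<alpha> i \<odot>\<^bsub>C\<^esub> \<xi> (n - i) = \<zero>\<^bsub>C\<^esub>" if "i \<in> I - support A \<alpha>" for i
    using that C.smult_l_null[OF C.families_carrier[OF assms(2)]] by (simp add: support_def)
qed

text \<open>A convolution is supported on the set of sums of two supports; its finiteness keeps
  convolutions among the families.\<close>

lemma conv_eq_zero:
  assumes "\<xi> \<in> families C" "\<alpha> \<in> families A"
    and n: "n \<notin> (\<lambda>(i, j). i + j) ` (support A \<alpha> \<times> support C \<xi>)"
  shows "conv \<alpha> \<xi> n = \<zero>\<^bsub>C\<^esub>"
  unfolding conv_def
proof (rule C.M.add.finprod_one_eqI)
  fix i assume i: "i \<in> support A \<alpha>"
  have "n - i \<notin> support C \<xi>"
  proof
    assume "n - i \<in> support C \<xi>"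
    then have "(i, n - i) \<in> support A \<alpha> \<times> support C \<xi>" using i by blast
    then have "(\<lambda>(i, j). i + j) (i, n - i) \<in> (\<lambda>(i, j). i + j) ` (support A \<alpha> \<times> support C \<xi>)" by (rule imageI)
    then show False using n by simp
  qed
  then show "\<alpha> i \<odot>\<^bsub>C\<^esub> \<xi> (n - i) = \<zero>\<^bsub>C\<^esub>"
    using A.families_carrier[OF assms(2)] by (simp add: support_def)
qed

lemma conv_families:
  assumes "\<alpha> \<in> families A" "\<xi> \<in> families C"
  shows "conv \<alpha> \<xi> \<in> families C"
proof (rule C.familiesI)
  show "conv \<alpha> \<xi> n \<in> Fil C n" for n
  proof -
    have t: "\<alpha> i \<odot>\<^bsub>C\<^esub> \<xi> (n - i) \<in> Fil C n" for i
      by (rule smult_Fil[OF A.families_mem[OF assms(1)] C.families_mem[OF assms(2)]]) simp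
    show ?thesis unfolding conv_def by (rule C.Fil_finsum[OF A.families_finite[OF assms(1)] t])
  qed
  let ?J = "(\<lambda>(i, j). i + j) ` (support A \<alpha> \<times> support C \<xi>)"
  show "finite ?J" using assms A.families_finite C.families_finite by blast
  show "conv \<alpha> \<xi> n = \<zero>\<^bsub>C\<^esub>" if "n \<notin> ?J" for n
    by (rule conv_eq_zero[OF assms(2,1) that])
qed

text \<open>Products in \<open>gr_module\<close> are formed from representatives picked by
  \<open>rep\<close>. Changing either factor by an element one step deeper changes the product by an
  element of \<open>Fil C (n + 1)\<close>, so arbitrary representing families may be used
  instead.\<close>

lemma gr_smult_cls_fam:
  assumes \<alpha>: "\<alpha> \<in> families A" and \<xi>: "\<xi> \<in> families C"
  shows "cls_fam A \<alpha> \<odot>\<^bsub>gr_module A C\<^esub> cls_fam C \<xi> = cls_fam C (conv \<alpha> \<xi>)"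
proof
  fix n
  let ?a = "cls_fam A \<alpha>" and ?x = "cls_fam C \<xi>"
  let ?S = "{i. ?a i \<noteq> \<zero>\<^bsub>gr_part A i\<^esub>}"
  have ra: "rep (?a i) \<in> Fil A i" "A.cls i (rep (?a i)) = A.cls i (\<alpha> i)" for i
    using A.gr_carrier_rep[OF A.cls_fam_gr_carrier[OF \<alpha>]] by (auto simp: cls_fam_def)
  have rx: "rep (?x i) \<in> Fil C i" "C.cls i (rep (?x i)) = C.cls i (\<xi> i)" for i
    using C.gr_carrier_rep[OF C.cls_fam_gr_carrier[OF \<xi>]] by (auto simp: cls_fam_def)
  have S: "?S \<subseteq> support A \<alpha>" by (auto simp: support_def cls_fam_def A.gr_part_zero)
  \<comment> \<open>The definition sums over the nonzero classes, possibly fewer than the nonzero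
    entries of \<alpha>; zeros pad the sum to the support of \<alpha>.\<close>
  define t where "t i = (if i \<in> ?S then rep (?a i) \<odot>\<^bsub>C\<^esub> rep (?x (n - i)) else \<zero>\<^bsub>C\<^esub>)" for i
  have tc: "t i \<in> carrier C" for i
    using A.Fil_carrier[OF ra(1)] C.Fil_carrier[OF rx(1)] by (simp add: t_def)
  have "(\<Oplus>\<^bsub>C\<^esub>i\<in>?S. rep (?a i) \<odot>\<^bsub>C\<^esub> rep (?x (n - i))) = finsum C t ?S"
    by (rule C.M.finsum_cong') (use tc in \<open>auto simp: t_def\<close>)
  also have "\<dots> = finsum C t (support A \<alpha>)"
    by (rule C.M.finsum_superset[OF A.families_finite[OF \<alpha>] S tc]) (simp add: t_def)
  also have "C.cls n \<dots> = C.cls n (conv \<alpha> \<xi> n)"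
    unfolding conv_def
  proof (rule C.cls_finsum_cong[OF A.families_finite[OF \<alpha>]])
    fix i
    let ?b = "rep (?a i)" and ?y = "rep (?x (n - i))"
    have b: "?b \<in> Fil A i" "\<alpha> i \<in> Fil A i" "?b \<in> carrier A" "\<alpha> i \<in> carrier A"
      using ra(1) A.families_mem[OF \<alpha>] A.Fil_carrier[OF ra(1)] A.families_carrier[OF \<alpha>] by simp_all
    have y: "?y \<in> Fil C (n - i)" "\<xi> (n - i) \<in> Fil C (n - i)" "?y \<in> carrier C" "\<xi> (n - i) \<in> carrier C"
      using rx(1) C.families_mem[OF \<xi>] C.Fil_carrier[OF rx(1)] C.families_carrier[OF \<xi>] by simp_all
    show "\<alpha> i \<odot>\<^bsub>C\<^esub> \<xi> (n - i) \<in> carrier C" using b y by simp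
    show "C.cls n (t i) = C.cls n (\<alpha> i \<odot>\<^bsub>C\<^esub> \<xi> (n - i))"
    proof (cases "i \<in> ?S")
      case True
      have d1: "?b \<ominus>\<^bsub>A\<^esub> \<alpha> i \<in> Fil A (i + 1)" using ra(2)[of i] b by (simp add: A.cls_eq_iff)
      have d2: "?y \<ominus>\<^bsub>C\<^esub> \<xi> (n - i) \<in> Fil C (n - i + 1)" using rx(2)[of "n - i"] y by (simp add: C.cls_eq_iff)
      \<comment> \<open>The difference of the two products is split into a change of the scalar and
        a change of the module element, each of which lies one step deeper than
        \<open>n\<close>.\<close>
      have "(?b \<ominus>\<^bsub>A\<^esub> \<alpha> i) \<odot>\<^bsub>C\<^esub> ?y \<in> Fil C (n + 1)" "\<alpha> i \<odot>\<^bsub>C\<^esub> (?y \<ominus>\<^bsub>C\<^esub> \<xi> (n - i)) \<in> Fil C (n + 1)"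
        by (rule smult_Fil[OF d1 y(1)], simp) (rule smult_Fil[OF b(2) d2], simp)
      then have "(?b \<ominus>\<^bsub>A\<^esub> \<alpha> i) \<odot>\<^bsub>C\<^esub> ?y \<oplus>\<^bsub>C\<^esub> \<alpha> i \<odot>\<^bsub>C\<^esub> (?y \<ominus>\<^bsub>C\<^esub> \<xi> (n - i)) \<in> Fil C (n + 1)"
        by (rule C.Fil_add)
      also have "(?b \<ominus>\<^bsub>A\<^esub> \<alpha> i) \<odot>\<^bsub>C\<^esub> ?y \<oplus>\<^bsub>C\<^esub> \<alpha> i \<odot>\<^bsub>C\<^esub> (?y \<ominus>\<^bsub>C\<^esub> \<xi> (n - i)) =
          ?b \<odot>\<^bsub>C\<^esub> ?y \<ominus>\<^bsub>C\<^esub> \<alpha> i \<odot>\<^bsub>C\<^esub> \<xi> (n - i)"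
        using b y by (simp add: a_minus_def C.smult_l_distr C.smult_r_distr C.smult_l_minus C.smult_r_minus
            C.M.a_assoc C.M.add.inv_solve_left')
      finally show ?thesis using b y True by (simp add: t_def C.cls_eq_iff)
    next
      case False
      \<comment> \<open>A zero class with a possibly nonzero entry: \<open>\<alpha> i\<close> lies
        one step deeper, and so does its product.\<close>
      then have "\<alpha> i \<in> Fil A (i + 1)" using b by (simp add: cls_fam_def A.gr_part_zero A.cls_eq_zero_iff)
      then have "\<alpha> i \<odot>\<^bsub>C\<^esub> \<xi> (n - i) \<in> Fil C (n + 1)" using smult_Fil[OF _ y(2)] by simp
      then show ?thesis using False C.cls_eq_zero_iff[of "\<alpha> i \<odot>\<^bsub>C\<^esub> \<xi> (n - i)" n] b y by (auto simp: t_def)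
    qed
  qed (rule tc)
  finally show "(?a \<odot>\<^bsub>gr_module A C\<^esub> ?x) n = cls_fam C (conv \<alpha> \<xi>) n"
    by (simp add: gr_module_def cls_fam_def)
qed

lemma conv_add_left:
  assumes "\<alpha> \<in> families A" "\<beta> \<in> families A" "\<xi> \<in> families C"
  shows "conv (\<lambda>n. \<alpha> n \<oplus>\<^bsub>A\<^esub> \<beta> n) \<xi> = (\<lambda>n. conv \<alpha> \<xi> n \<oplus>\<^bsub>C\<^esub> conv \<beta> \<xi> n)"
proof
  fix n
  note c [simp] = A.families_carrier[OF assms(1)] A.families_carrier[OF assms(2)] C.families_carrier[OF assms(3)]
  let ?I = "support A \<alpha> \<union> support A \<beta>"
  have I: "finite ?I" "support A (\<lambda>n. \<alpha> n \<oplus>\<^bsub>A\<^esub> \<beta> n) \<subseteq> ?I" "support A \<alpha> \<subseteq> ?I" "support A \<beta> \<subseteq> ?I"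
    using A.families_finite[OF assms(1)] A.families_finite[OF assms(2)] by (auto simp: support_def)
  have "(\<Oplus>\<^bsub>C\<^esub>i\<in>?I. (\<alpha> i \<oplus>\<^bsub>A\<^esub> \<beta> i) \<odot>\<^bsub>C\<^esub> \<xi> (n - i)) = (\<Oplus>\<^bsub>C\<^esub>i\<in>?I. \<alpha> i \<odot>\<^bsub>C\<^esub> \<xi> (n - i) \<oplus>\<^bsub>C\<^esub> \<beta> i \<odot>\<^bsub>C\<^esub> \<xi> (n - i))"
    by (intro C.M.finsum_cong') (auto simp: C.smult_l_distr)
  also have "\<dots> = (\<Oplus>\<^bsub>C\<^esub>i\<in>?I. \<alpha> i \<odot>\<^bsub>C\<^esub> \<xi> (n - i)) \<oplus>\<^bsub>C\<^esub> (\<Oplus>\<^bsub>C\<^esub>i\<in>?I. \<beta> i \<odot>\<^bsub>C\<^esub> \<xi> (n - i))"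
    by (intro C.M.finsum_addf) auto
  finally show "conv (\<lambda>n. \<alpha> n \<oplus>\<^bsub>A\<^esub> \<beta> n) \<xi> n = conv \<alpha> \<xi> n \<oplus>\<^bsub>C\<^esub> conv \<beta> \<xi> n"
    using assms I A.families_add by (simp add: conv_superset[of _ _ ?I])
qed

lemma conv_add_right:
  assumes "\<alpha> \<in> families A" "\<xi> \<in> families C" "\<eta> \<in> families C"
  shows "conv \<alpha> (\<lambda>n. \<xi> n \<oplus>\<^bsub>C\<^esub> \<eta> n) = (\<lambda>n. conv \<alpha> \<xi> n \<oplus>\<^bsub>C\<^esub> conv \<alpha> \<eta> n)"
proof
  fix n
  note c [simp] = A.families_carrier[OF assms(1)] C.families_carrier[OF assms(2)] C.families_carrier[OF assms(3)]
  have "conv \<alpha> (\<lambda>n. \<xi> n \<oplus>\<^bsub>C\<^esub> \<eta> n) n = (\<Oplus>\<^bsub>C\<^esub>i\<in>support A \<alpha>. \<alpha> i \<odot>\<^bsub>C\<^esub> \<xi> (n - i) \<oplus>\<^bsub>C\<^esub> \<alpha> i \<odot>\<^bsub>C\<^esub> \<eta> (n - i))"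
    unfolding conv_def by (intro C.M.finsum_cong') (auto simp: C.smult_r_distr)
  also have "\<dots> = conv \<alpha> \<xi> n \<oplus>\<^bsub>C\<^esub> conv \<alpha> \<eta> n"
    unfolding conv_def by (intro C.M.finsum_addf) auto
  finally show "conv \<alpha> (\<lambda>n. \<xi> n \<oplus>\<^bsub>C\<^esub> \<eta> n) n = conv \<alpha> \<xi> n \<oplus>\<^bsub>C\<^esub> conv \<alpha> \<eta> n" .
qed

lemma conv_single:
  assumes "a \<in> Fil A m" "\<xi> \<in> families C"
  shows "conv (\<lambda>i. if i = m then a else \<zero>\<^bsub>A\<^esub>) \<xi> = (\<lambda>n. a \<odot>\<^bsub>C\<^esub> \<xi> (n - m))"
proof
  fix n
  have "conv (\<lambda>i. if i = m then a else \<zero>\<^bsub>A\<^esub>) \<xi> n = (\<Oplus>\<^bsub>C\<^esub>i\<in>{m}. (if i = m then a else \<zero>\<^bsub>A\<^esub>) \<odot>\<^bsub>C\<^esub> \<xi> (n - i))"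
    using assms A.families_single by (intro conv_superset) (auto simp: support_def)
  also have "\<dots> = a \<odot>\<^bsub>C\<^esub> \<xi> (n - m)"
    using assms(1) C.families_carrier[OF assms(2)] by (subst C.M.finsum_single[where n = m]) auto
  finally show "conv (\<lambda>i. if i = m then a else \<zero>\<^bsub>A\<^esub>) \<xi> n = a \<odot>\<^bsub>C\<^esub> \<xi> (n - m)" .
qed

end

lemma coset_self_filt: "H +>\<^bsub>self_filt A\<^esub> x = H +>\<^bsub>A\<^esub> x"
  by (simp add: a_r_coset_def r_coset_def)

lemma self_filt_gr:
  "carrier (gr_part (self_filt A) n) = carrier (gr_part A n)"
  "zero (gr_part (self_filt A) n) = zero (gr_part A n)"
  "families (self_filt A) = families A" "cls_fam (self_filt A) = cls_fam A"
  "gr_carrier (self_filt A) = gr_carrier A"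
  by (auto simp: gr_part_def coset_self_filt families_def support_def cls_fam_def gr_carrier_def)

lemma gr_algebra_mult: "mult (gr_algebra A) = smult (gr_module A (self_filt A))"
  by (intro ext) (simp add: gr_algebra_def gr_module_def coset_self_filt finsum_cong_fields[of "self_filt A" A]
      self_filt_gr)

section \<open>Ring and module laws of the associated graded objects\<close>

context filtered_pair
begin

lemma self_pair: "filtered_pair k A (self_filt A)"
  by (intro filtered_pair.intro filtA filtered_module_self_filt[OF filtA])

abbreviation mconv where "mconv \<equiv> filtered_pair.conv A (self_filt A)"

lemma algebra_pair: "algebra k A"
  using filtA by (simp add: filtered_algebra_def)

lemma mconv_eq: "mconv \<alpha> \<beta> n = (\<Oplus>\<^bsub>A\<^esub>i\<in>support A \<alpha>. \<alpha> i \<otimes>\<^bsub>A\<^esub> \<beta> (n - i))"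
  by (simp add: filtered_pair.conv_def[OF self_pair] finsum_cong_fields[of "self_filt A" A])

lemma mconv_families: "\<alpha> \<in> families A \<Longrightarrow> \<beta> \<in> families A \<Longrightarrow> mconv \<alpha> \<beta> \<in> families A"
  using filtered_pair.conv_families[OF self_pair] by (simp add: self_filt_gr)

lemma mult_cls_fam:
  "\<alpha> \<in> families A \<Longrightarrow> \<beta> \<in> families A \<Longrightarrow>
    cls_fam A \<alpha> \<otimes>\<^bsub>gr_algebra A\<^esub> cls_fam A \<beta> = cls_fam A (mconv \<alpha> \<beta>)"
  using filtered_pair.gr_smult_cls_fam[OF self_pair] by (simp add: self_filt_gr gr_algebra_mult)

text \<open>Both sides are the double sum over \<open>i\<close> and \<open>j\<close> of
  \<open>\<alpha> i \<beta> j \<xi> (n - i - j)\<close>; the left one is organized by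
  \<open>m = i + j\<close>. With \<open>C\<close> the algebra itself this is also the associativity
  of the graded product.\<close>

lemma conv_assoc:
  assumes \<alpha>: "\<alpha> \<in> families A" and \<beta>: "\<beta> \<in> families A" and \<xi>: "\<xi> \<in> families C"
  shows "conv (mconv \<alpha> \<beta>) \<xi> = conv \<alpha> (conv \<beta> \<xi>)"
proof
  fix n
  interpret alg: algebra k A by (rule algebra_pair)
  let ?I = "support A \<alpha>" and ?J = "support A \<beta>"
  let ?K = "(\<lambda>(i, j). i + j) ` (?I \<times> ?J)"
  note [simp] = A.families_carrier[OF \<alpha>] A.families_carrier[OF \<beta>] C.families_carrier[OF \<xi>]
  have fin: "finite ?I" "finite ?J" "finite ?K" using A.families_finite[OF \<alpha>] A.families_finite[OF \<beta>] by auto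
  have K: "support A (mconv \<alpha> \<beta>) \<subseteq> ?K"
    using filtered_pair.conv_eq_zero[OF self_pair, of \<beta> \<alpha>] \<alpha> \<beta>
    by (auto simp: support_def self_filt_gr simp del: Product_Type.split_paired_Ex)
  have cl: "(\<alpha> i \<otimes>\<^bsub>A\<^esub> \<beta> j) \<odot>\<^bsub>C\<^esub> \<xi> l \<in> carrier C" for i j l by simp
  have "conv (mconv \<alpha> \<beta>) \<xi> n = (\<Oplus>\<^bsub>C\<^esub>m\<in>?K. mconv \<alpha> \<beta> m \<odot>\<^bsub>C\<^esub> \<xi> (n - m))"
    by (rule conv_superset[OF mconv_families[OF \<alpha> \<beta>] \<xi> fin(3) K])
  also have "\<dots> = (\<Oplus>\<^bsub>C\<^esub>m\<in>?K. \<Oplus>\<^bsub>C\<^esub>i\<in>?I. (\<alpha> i \<otimes>\<^bsub>A\<^esub> \<beta> (m - i)) \<odot>\<^bsub>C\<^esub> \<xi> (n - m))"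
  proof (rule C.M.finsum_cong')
    fix m
    show "mconv \<alpha> \<beta> m \<odot>\<^bsub>C\<^esub> \<xi> (n - m) = (\<Oplus>\<^bsub>C\<^esub>i\<in>?I. (\<alpha> i \<otimes>\<^bsub>A\<^esub> \<beta> (m - i)) \<odot>\<^bsub>C\<^esub> \<xi> (n - m))"
      unfolding mconv_eq
      by (rule additive_finsum[where h = "\<lambda>a. a \<odot>\<^bsub>C\<^esub> \<xi> (n - m)", OF A.M.abelian_group_axioms C.M.abelian_group_axioms])
        (auto simp: C.smult_l_distr)
  qed (auto intro!: C.M.finsum_closed)
  also have "\<dots> = (\<Oplus>\<^bsub>C\<^esub>i\<in>?I. \<Oplus>\<^bsub>C\<^esub>m\<in>?K. (\<alpha> i \<otimes>\<^bsub>A\<^esub> \<beta> (m - i)) \<odot>\<^bsub>C\<^esub> \<xi> (n - m))"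
    by (rule C.M.finsum_swap[OF fin(3,1)]) simp
  also have "\<dots> = (\<Oplus>\<^bsub>C\<^esub>i\<in>?I. \<alpha> i \<odot>\<^bsub>C\<^esub> conv \<beta> \<xi> (n - i))"
  proof (rule C.M.finsum_cong')
    fix i assume i: "i \<in> ?I"
    let ?g = "\<lambda>m. (\<alpha> i \<otimes>\<^bsub>A\<^esub> \<beta> (m - i)) \<odot>\<^bsub>C\<^esub> \<xi> (n - m)"
    \<comment> \<open>For fixed \<open>i\<close> only those \<open>m\<close> contribute for which
      \<open>m - i\<close> lies in the support of \<beta>, so the sum over \<open>?K\<close> reduces
      to a translate of that support.\<close>
    have "finsum C ?g ((\<lambda>j. i + j) ` ?J) = finsum C ?g ?K"
    proof (rule C.M.finsum_superset[OF fin(3)])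
      show "(\<lambda>j. i + j) ` ?J \<subseteq> ?K" using i by force
      fix m assume m: "m \<in> ?K - (\<lambda>j. i + j) ` ?J"
      have "m - i \<notin> ?J"
      proof
        assume "m - i \<in> ?J"
        then have "i + (m - i) \<in> (\<lambda>j. i + j) ` ?J" by (rule imageI)
        then show False using m by simp
      qed
      then show "?g m = \<zero>\<^bsub>C\<^esub>" by (simp add: support_def)
    qed simp
    moreover have "finsum C ?g ((\<lambda>j. i + j) ` ?J) = (\<Oplus>\<^bsub>C\<^esub>j\<in>?J. ?g (i + j))"
      by (rule C.M.finsum_reindex) auto
    moreover have "\<dots> = (\<Oplus>\<^bsub>C\<^esub>j\<in>?J. \<alpha> i \<odot>\<^bsub>C\<^esub> (\<beta> j \<odot>\<^bsub>C\<^esub> \<xi> (n - i - j)))"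
      by (rule C.M.finsum_cong') (auto simp: C.smult_assoc1 algebra_simps)
    moreover have "\<dots> = \<alpha> i \<odot>\<^bsub>C\<^esub> conv \<beta> \<xi> (n - i)"
      unfolding conv_def by (rule C.finsum_smult_ldistr[symmetric, OF fin(2)]) auto
    ultimately show "finsum C ?g ?K = \<alpha> i \<odot>\<^bsub>C\<^esub> conv \<beta> \<xi> (n - i)" by simp
  qed (use C.families_carrier[OF conv_families[OF \<beta> \<xi>]] in auto)
  finally show "conv (mconv \<alpha> \<beta>) \<xi> n = conv \<alpha> (conv \<beta> \<xi>) n" by (simp add: conv_def)
qed

lemma mconv_comm:
  assumes \<alpha>: "\<alpha> \<in> families A" and \<beta>: "\<beta> \<in> families A"
  shows "mconv \<alpha> \<beta> = mconv \<beta> \<alpha>"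
proof
  fix n
  interpret alg: algebra k A by (rule algebra_pair)
  note [simp] = A.families_carrier[OF \<alpha>] A.families_carrier[OF \<beta>]
  \<comment> \<open>The index set contains the support of \<alpha> and the reflection of the support
    of \<beta>. Its own reflection then contains the support of \<beta>, and reindexing by
    \<open>n - i\<close> exchanges the factors.\<close>
  let ?U = "support A \<alpha> \<union> (\<lambda>j. n - j) ` support A \<beta>"
  let ?V = "(\<lambda>i. n - i) ` ?U"
  have fin: "finite ?U" "finite ?V" using A.families_finite[OF \<alpha>] A.families_finite[OF \<beta>] by auto
  have "j \<in> ?V" if "j \<in> support A \<beta>" for j
  proof -
    have "n - (n - j) \<in> ?V" using that by (intro imageI UnI2)
    then show ?thesis by simp
  qed
  then have sub: "support A \<alpha> \<subseteq> ?U" "support A \<beta> \<subseteq> ?V" by blast+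
  have "mconv \<alpha> \<beta> n = (\<Oplus>\<^bsub>A\<^esub>i\<in>?U. \<alpha> i \<otimes>\<^bsub>A\<^esub> \<beta> (n - i))"
    unfolding mconv_eq by (rule A.M.finsum_superset[OF fin(1) sub(1)]) (auto simp: support_def)
  also have "\<dots> = (\<Oplus>\<^bsub>A\<^esub>i\<in>?U. \<beta> (n - i) \<otimes>\<^bsub>A\<^esub> \<alpha> (n - (n - i)))"
    by (rule A.M.finsum_cong') (auto simp: C.m_comm)
  also have "\<dots> = (\<Oplus>\<^bsub>A\<^esub>j\<in>?V. \<beta> j \<otimes>\<^bsub>A\<^esub> \<alpha> (n - j))"
    by (rule A.M.finsum_reindex[symmetric]) (auto simp: inj_on_def)
  also have "\<dots> = mconv \<beta> \<alpha> n"
    unfolding mconv_eq by (rule A.M.finsum_superset[OF fin(2) sub(2), symmetric]) (auto simp: support_def)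
  finally show "mconv \<alpha> \<beta> n = mconv \<beta> \<alpha> n" .
qed

text \<open>Scalars from \<open>k\<close> act through multiples of the unit. For \<open>A\<close>
  itself this yields the algebra axiom of the graded algebra, and for \<open>C\<close> the action of
  \<open>k\<close> on the graded module.\<close>

lemma conv_scalar:
  assumes c: "c \<in> carrier k" and \<alpha>: "\<alpha> \<in> families A" and \<xi>: "\<xi> \<in> families C"
  shows "conv (\<lambda>n. c \<odot>\<^bsub>A\<^esub> \<alpha> n) \<xi> = (\<lambda>n. (c \<odot>\<^bsub>A\<^esub> \<one>\<^bsub>A\<^esub>) \<odot>\<^bsub>C\<^esub> conv \<alpha> \<xi> n)"
proof
  fix n
  interpret alg: algebra k A by (rule algebra_pair)
  note [simp] = A.families_carrier[OF \<alpha>] C.families_carrier[OF \<xi>]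
  have s: "support A (\<lambda>n. c \<odot>\<^bsub>A\<^esub> \<alpha> n) \<subseteq> support A \<alpha>" using c by (auto simp: support_def)
  have "conv (\<lambda>n. c \<odot>\<^bsub>A\<^esub> \<alpha> n) \<xi> n = (\<Oplus>\<^bsub>C\<^esub>i\<in>support A \<alpha>. (c \<odot>\<^bsub>A\<^esub> \<alpha> i) \<odot>\<^bsub>C\<^esub> \<xi> (n - i))"
    by (rule conv_superset[OF A.families_smult[OF c \<alpha>] \<xi> A.families_finite[OF \<alpha>] s])
  also have "\<dots> = (\<Oplus>\<^bsub>C\<^esub>i\<in>support A \<alpha>. (c \<odot>\<^bsub>A\<^esub> \<one>\<^bsub>A\<^esub>) \<odot>\<^bsub>C\<^esub> (\<alpha> i \<odot>\<^bsub>C\<^esub> \<xi> (n - i)))"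
  proof (rule C.M.finsum_cong')
    fix i
    have "c \<odot>\<^bsub>A\<^esub> \<alpha> i = (c \<odot>\<^bsub>A\<^esub> \<one>\<^bsub>A\<^esub>) \<otimes>\<^bsub>A\<^esub> \<alpha> i" using c by (simp add: alg.smult_assoc2)
    then show "(c \<odot>\<^bsub>A\<^esub> \<alpha> i) \<odot>\<^bsub>C\<^esub> \<xi> (n - i) = (c \<odot>\<^bsub>A\<^esub> \<one>\<^bsub>A\<^esub>) \<odot>\<^bsub>C\<^esub> (\<alpha> i \<odot>\<^bsub>C\<^esub> \<xi> (n - i))"
      using c by (simp add: C.smult_assoc1)
  qed (use c in auto)
  also have "\<dots> = (c \<odot>\<^bsub>A\<^esub> \<one>\<^bsub>A\<^esub>) \<odot>\<^bsub>C\<^esub> conv \<alpha> \<xi> n"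
    unfolding conv_def using c by (intro C.finsum_smult_ldistr[symmetric] A.families_finite[OF \<alpha>]) auto
  finally show "conv (\<lambda>n. c \<odot>\<^bsub>A\<^esub> \<alpha> n) \<xi> n = (c \<odot>\<^bsub>A\<^esub> \<one>\<^bsub>A\<^esub>) \<odot>\<^bsub>C\<^esub> conv \<alpha> \<xi> n" .
qed

lemma one_Fil: "\<one>\<^bsub>A\<^esub> \<in> Fil A 0"
proof -
  interpret alg: algebra k A by (rule algebra_pair)
  have "Fil A 0 = carrier A" using filtA by (simp add: filtered_algebra_def)
  then show ?thesis by simp
qed

abbreviation delta :: "int \<Rightarrow> 'a" where "delta \<equiv> (\<lambda>n. if n = 0 then \<one>\<^bsub>A\<^esub> else \<zero>\<^bsub>A\<^esub>)"

lemma delta_families: "delta \<in> families A"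
  using A.families_single[OF one_Fil] .

lemma conv_delta: "\<xi> \<in> families C \<Longrightarrow> conv delta \<xi> = \<xi>"
  using conv_single[OF one_Fil, of \<xi>] C.families_carrier[of \<xi>] by simp

lemma gr_one: "\<one>\<^bsub>gr_algebra A\<^esub> = cls_fam A delta"
proof
  show "\<one>\<^bsub>gr_algebra A\<^esub> n = cls_fam A delta n" for n
    by (cases "n = 0") (simp_all add: gr_algebra_def cls_fam_def A.gr_part_zero)
qed

lemma gr_algebra_simps:
  "carrier (gr_algebra A) = gr_carrier A"
  "zero (gr_algebra A) = (\<lambda>n. \<zero>\<^bsub>gr_part A n\<^esub>)"
  "add (gr_algebra A) = (\<lambda>x y n. x n \<oplus>\<^bsub>gr_part A n\<^esub> y n)"
  "smult (gr_algebra A) = (\<lambda>c x n. c \<odot>\<^bsub>gr_part A n\<^esub> x n)"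
  "Deg (gr_algebra A) = gr_degree A"
  by (simp_all add: gr_algebra_def)

lemma gr_module_simps:
  "carrier (gr_module A C) = gr_carrier C"
  "zero (gr_module A C) = (\<lambda>n. \<zero>\<^bsub>gr_part C n\<^esub>)"
  "add (gr_module A C) = (\<lambda>x y n. x n \<oplus>\<^bsub>gr_part C n\<^esub> y n)"
  "Deg (gr_module A C) = gr_degree C"
  by (simp_all add: gr_module_def)

lemma gr_algebra_is_algebra: "algebra k (gr_algebra A)"
proof -
  interpret alg: algebra k A by (rule algebra_pair)
  interpret S: filtered_pair k A "self_filt A" by (rule self_pair)
  have carr: "\<exists>\<alpha>\<in>families A. x = cls_fam A \<alpha>" if "x \<in> carrier (gr_algebra A)" for x
    using that by (auto simp: gr_algebra_simps elim: A.gr_carrierE)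
  have ind1: "P x" if "x \<in> carrier (gr_algebra A)" "\<And>\<alpha>. \<alpha> \<in> families A \<Longrightarrow> P (cls_fam A \<alpha>)" for P x
    using carr[OF that(1)] that(2) by auto
  have mem: "cls_fam A \<alpha> \<in> carrier (gr_algebra A)" if "\<alpha> \<in> families A" for \<alpha>
    using A.cls_fam_gr_carrier[OF that] by (simp add: gr_algebra_simps)
  have add: "cls_fam A \<alpha> \<oplus>\<^bsub>gr_algebra A\<^esub> cls_fam A \<beta> = cls_fam A (\<lambda>n. \<alpha> n \<oplus>\<^bsub>A\<^esub> \<beta> n)"
    if "\<alpha> \<in> families A" "\<beta> \<in> families A" for \<alpha> \<beta> using A.cls_fam_add[OF that] by (simp add: gr_algebra_simps)
  have smult: "c \<odot>\<^bsub>gr_algebra A\<^esub> cls_fam A \<alpha> = cls_fam A (\<lambda>n. c \<odot>\<^bsub>A\<^esub> \<alpha> n)"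
    if "c \<in> carrier k" "\<alpha> \<in> families A" for c \<alpha> using A.cls_fam_smult[OF that] by (simp add: gr_algebra_simps)
  note ops = mult_cls_fam add smult mem mconv_families A.families_add A.families_smult
  have sf: "families (self_filt A) = families A" by (simp add: self_filt_gr)
  have grp: "abelian_group (gr_algebra A)" by (rule A.gr_abelian_group) (simp_all add: gr_algebra_simps)
  have mult_comm: "x \<otimes>\<^bsub>gr_algebra A\<^esub> y = y \<otimes>\<^bsub>gr_algebra A\<^esub> x"
    if "x \<in> carrier (gr_algebra A)" "y \<in> carrier (gr_algebra A)" for x y
    using carr[OF that(1)] carr[OF that(2)] by (auto simp: mult_cls_fam mconv_comm)
  have cring: "cring (gr_algebra A)"
  proof (rule cringI[OF grp])
    show "comm_monoid (gr_algebra A)"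
    proof (rule comm_monoidI)
      fix x y assume "x \<in> carrier (gr_algebra A)" "y \<in> carrier (gr_algebra A)"
      then show "x \<otimes>\<^bsub>gr_algebra A\<^esub> y \<in> carrier (gr_algebra A)"
        using carr[of x] carr[of y] by (auto simp: ops)
    next
      show "\<one>\<^bsub>gr_algebra A\<^esub> \<in> carrier (gr_algebra A)" unfolding gr_one by (rule mem[OF delta_families])
    next
      fix x y z assume "x \<in> carrier (gr_algebra A)" "y \<in> carrier (gr_algebra A)" "z \<in> carrier (gr_algebra A)"
      then obtain \<alpha> \<beta> \<gamma> where f: "\<alpha> \<in> families A" "\<beta> \<in> families A" "\<gamma> \<in> families A"
        and eq: "x = cls_fam A \<alpha>" "y = cls_fam A \<beta>" "z = cls_fam A \<gamma>"
        using carr by metis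
      show "x \<otimes>\<^bsub>gr_algebra A\<^esub> y \<otimes>\<^bsub>gr_algebra A\<^esub> z = x \<otimes>\<^bsub>gr_algebra A\<^esub> (y \<otimes>\<^bsub>gr_algebra A\<^esub> z)"
        using f S.conv_assoc[of \<alpha> \<beta> \<gamma>] by (simp add: eq ops sf)
    next
      fix x assume "x \<in> carrier (gr_algebra A)"
      then obtain \<alpha> where "\<alpha> \<in> families A" "x = cls_fam A \<alpha>" using carr by blast
      then show "\<one>\<^bsub>gr_algebra A\<^esub> \<otimes>\<^bsub>gr_algebra A\<^esub> x = x"
        using S.conv_delta[of \<alpha>] delta_families by (simp add: gr_one ops sf)
    qed (rule mult_comm)
    fix x y z assume "x \<in> carrier (gr_algebra A)" "y \<in> carrier (gr_algebra A)" "z \<in> carrier (gr_algebra A)"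
    then obtain \<alpha> \<beta> \<gamma> where f: "\<alpha> \<in> families A" "\<beta> \<in> families A" "\<gamma> \<in> families A"
      and eq: "x = cls_fam A \<alpha>" "y = cls_fam A \<beta>" "z = cls_fam A \<gamma>"
      using carr by metis
    show "(x \<oplus>\<^bsub>gr_algebra A\<^esub> y) \<otimes>\<^bsub>gr_algebra A\<^esub> z = x \<otimes>\<^bsub>gr_algebra A\<^esub> z \<oplus>\<^bsub>gr_algebra A\<^esub> y \<otimes>\<^bsub>gr_algebra A\<^esub> z"
      using f S.conv_add_left[of \<alpha> \<beta> \<gamma>] by (simp add: eq ops sf)
  qed
  show ?thesis
  proof (rule algebraI[OF alg.R_cring cring])
    fix c x assume c: "c \<in> carrier k" and x: "x \<in> carrier (gr_algebra A)"
    then obtain \<alpha> where \<alpha>: "\<alpha> \<in> families A" "x = cls_fam A \<alpha>" using carr by blast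
    note [simp] = A.families_carrier[OF \<alpha>(1)]
    show "c \<odot>\<^bsub>gr_algebra A\<^esub> x \<in> carrier (gr_algebra A)" using c \<alpha> by (simp add: ops)
    fix y assume "y \<in> carrier (gr_algebra A)"
    then obtain \<beta> where \<beta>: "\<beta> \<in> families A" "y = cls_fam A \<beta>" using carr by blast
    show "c \<odot>\<^bsub>gr_algebra A\<^esub> (x \<oplus>\<^bsub>gr_algebra A\<^esub> y) = c \<odot>\<^bsub>gr_algebra A\<^esub> x \<oplus>\<^bsub>gr_algebra A\<^esub> c \<odot>\<^bsub>gr_algebra A\<^esub> y"
      using c \<alpha> \<beta> A.families_carrier[OF \<beta>(1)] by (simp add: ops A.smult_r_distr)
    show "(c \<odot>\<^bsub>gr_algebra A\<^esub> x) \<otimes>\<^bsub>gr_algebra A\<^esub> y = c \<odot>\<^bsub>gr_algebra A\<^esub> (x \<otimes>\<^bsub>gr_algebra A\<^esub> y)"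
      using c \<alpha> \<beta> S.conv_scalar[of c \<alpha> \<beta>] A.families_carrier[OF mconv_families[OF \<alpha>(1) \<beta>(1)]]
      by (simp add: ops sf alg.smult_assoc2)
  next
    fix x assume "x \<in> carrier (gr_algebra A)"
    then obtain \<alpha> where \<alpha>: "\<alpha> \<in> families A" "x = cls_fam A \<alpha>" using carr by blast
    then show "\<one>\<^bsub>k\<^esub> \<odot>\<^bsub>gr_algebra A\<^esub> x = x" by (simp add: ops A.families_carrier)
  next
    fix c d x assume c: "c \<in> carrier k" "d \<in> carrier k" and x: "x \<in> carrier (gr_algebra A)"
    then obtain \<alpha> where \<alpha>: "\<alpha> \<in> families A" "x = cls_fam A \<alpha>" using carr by blast
    note [simp] = A.families_carrier[OF \<alpha>(1)]
    show "(c \<oplus>\<^bsub>k\<^esub> d) \<odot>\<^bsub>gr_algebra A\<^esub> x = c \<odot>\<^bsub>gr_algebra A\<^esub> x \<oplus>\<^bsub>gr_algebra A\<^esub> d \<odot>\<^bsub>gr_algebra A\<^esub> x"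
      using c \<alpha> by (simp add: ops A.smult_l_distr)
    show "(c \<otimes>\<^bsub>k\<^esub> d) \<odot>\<^bsub>gr_algebra A\<^esub> x = c \<odot>\<^bsub>gr_algebra A\<^esub> (d \<odot>\<^bsub>gr_algebra A\<^esub> x)"
      using c \<alpha> by (simp add: ops A.smult_assoc1)
  qed
qed

lemma module_gr_module: "module (gr_algebra A) (gr_module A C)"
proof -
  have cA: "\<exists>\<alpha>\<in>families A. x = cls_fam A \<alpha>" if "x \<in> carrier (gr_algebra A)" for x
    using that by (auto simp: gr_algebra_simps elim: A.gr_carrierE)
  have cC: "\<exists>\<alpha>\<in>families C. x = cls_fam C \<alpha>" if "x \<in> carrier (gr_module A C)" for x
    using that by (auto simp: gr_module_simps elim: C.gr_carrierE)
  have mem: "cls_fam C \<alpha> \<in> carrier (gr_module A C)" if "\<alpha> \<in> families C" for \<alpha>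
    using C.cls_fam_gr_carrier[OF that] by (simp add: gr_module_simps)
  have addA: "cls_fam A \<alpha> \<oplus>\<^bsub>gr_algebra A\<^esub> cls_fam A \<beta> = cls_fam A (\<lambda>n. \<alpha> n \<oplus>\<^bsub>A\<^esub> \<beta> n)"
    if "\<alpha> \<in> families A" "\<beta> \<in> families A" for \<alpha> \<beta> using A.cls_fam_add[OF that] by (simp add: gr_algebra_simps)
  have addC: "cls_fam C \<alpha> \<oplus>\<^bsub>gr_module A C\<^esub> cls_fam C \<beta> = cls_fam C (\<lambda>n. \<alpha> n \<oplus>\<^bsub>C\<^esub> \<beta> n)"
    if "\<alpha> \<in> families C" "\<beta> \<in> families C" for \<alpha> \<beta> using C.cls_fam_add[OF that] by (simp add: gr_module_simps)
  note ops = mult_cls_fam addA addC mem mconv_families conv_families A.families_add C.families_add gr_smult_cls_fam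
  show ?thesis
  proof (rule moduleI)
    show "cring (gr_algebra A)" using gr_algebra_is_algebra by (rule algebra.M_cring)
    show "abelian_group (gr_module A C)" by (rule C.gr_abelian_group) (simp_all add: gr_module_simps)
    fix x assume "x \<in> carrier (gr_module A C)"
    then obtain \<xi> where \<xi>: "\<xi> \<in> families C" "x = cls_fam C \<xi>" using cC by blast
    show "\<one>\<^bsub>gr_algebra A\<^esub> \<odot>\<^bsub>gr_module A C\<^esub> x = x"
      using \<xi> conv_delta delta_families by (simp add: gr_one ops)
    fix a assume "a \<in> carrier (gr_algebra A)"
    then obtain \<alpha> where \<alpha>: "\<alpha> \<in> families A" "a = cls_fam A \<alpha>" using cA by blast
    show "a \<odot>\<^bsub>gr_module A C\<^esub> x \<in> carrier (gr_module A C)" using \<alpha> \<xi> by (simp add: ops)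
    {
      fix b assume "b \<in> carrier (gr_algebra A)"
      then obtain \<beta> where \<beta>: "\<beta> \<in> families A" "b = cls_fam A \<beta>" using cA by blast
      show "(a \<oplus>\<^bsub>gr_algebra A\<^esub> b) \<odot>\<^bsub>gr_module A C\<^esub> x = a \<odot>\<^bsub>gr_module A C\<^esub> x \<oplus>\<^bsub>gr_module A C\<^esub> b \<odot>\<^bsub>gr_module A C\<^esub> x"
        using \<alpha> \<beta> \<xi> by (simp add: ops conv_add_left)
      show "(a \<otimes>\<^bsub>gr_algebra A\<^esub> b) \<odot>\<^bsub>gr_module A C\<^esub> x = a \<odot>\<^bsub>gr_module A C\<^esub> (b \<odot>\<^bsub>gr_module A C\<^esub> x)"
        using \<alpha> \<beta> \<xi> by (simp add: ops conv_assoc)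
    }
    fix y assume "y \<in> carrier (gr_module A C)"
    then obtain \<eta> where \<eta>: "\<eta> \<in> families C" "y = cls_fam C \<eta>" using cC by blast
    show "a \<odot>\<^bsub>gr_module A C\<^esub> (x \<oplus>\<^bsub>gr_module A C\<^esub> y) = a \<odot>\<^bsub>gr_module A C\<^esub> x \<oplus>\<^bsub>gr_module A C\<^esub> a \<odot>\<^bsub>gr_module A C\<^esub> y"
      using \<alpha> \<xi> \<eta> by (simp add: ops conv_add_right)
  qed
qed

text \<open>Restricting scalars along the structure map of the graded algebra acts entry by entry,
  through the structure map of \<open>A\<close>. This links local freeness of homogeneous parts with
  that of the quotients of the filtration.\<close>

lemma gr_scalar:
  assumes "c \<in> carrier k" "\<xi> \<in> families C"
  shows "(c \<odot>\<^bsub>gr_algebra A\<^esub> \<one>\<^bsub>gr_algebra A\<^esub>) \<odot>\<^bsub>gr_module A C\<^esub> cls_fam C \<xi> =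
    cls_fam C (\<lambda>n. (c \<odot>\<^bsub>A\<^esub> \<one>\<^bsub>A\<^esub>) \<odot>\<^bsub>C\<^esub> \<xi> n)"
proof -
  have "c \<odot>\<^bsub>gr_algebra A\<^esub> \<one>\<^bsub>gr_algebra A\<^esub> = cls_fam A (\<lambda>n. c \<odot>\<^bsub>A\<^esub> delta n)"
    using A.cls_fam_smult[OF assms(1) delta_families] by (simp only: gr_algebra_simps gr_one)
  then show ?thesis
    using gr_smult_cls_fam[OF A.families_smult[OF assms(1) delta_families] assms(2)]
      conv_scalar[OF assms(1) delta_families assms(2)] conv_delta[OF assms(2)] by simp
qed

end

section \<open>Graded modules\<close>

definition component :: "('r, 'c, 'z) graded_module_scheme \<Rightarrow> 'c \<Rightarrow> int \<Rightarrow> 'c" where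
  "component C x = (THE y. (\<forall>n. y n \<in> Deg C n) \<and> finite (support C y) \<and> x = (\<Oplus>\<^bsub>C\<^esub>n\<in>support C y. y n))"

text \<open>The grading is described by its projections \<open>p\<close>. Existence of
  decompositions is \<open>p_sum\<close>; for uniqueness, applying the additive projection to degree
  \<open>m\<close> to any decomposition returns its summand of degree \<open>m\<close>.\<close>

lemma is_graded_moduleI:
  assumes mod: "module R C" and sub: "\<And>n. additive_subgroup (Deg C n) C"
    and act: "\<And>m n a x. a \<in> Deg R m \<Longrightarrow> x \<in> Deg C n \<Longrightarrow> a \<odot>\<^bsub>C\<^esub> x \<in> Deg C (m + n)"
    and p: "\<And>x n. x \<in> carrier C \<Longrightarrow> p x n \<in> Deg C n"
    and p_add: "\<And>x y n. x \<in> carrier C \<Longrightarrow> y \<in> carrier C \<Longrightarrow> p (x \<oplus>\<^bsub>C\<^esub> y) n = p x n \<oplus>\<^bsub>C\<^esub> p y n"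
    and p_Deg: "\<And>x m n. x \<in> Deg C m \<Longrightarrow> p x n = (if n = m then x else \<zero>\<^bsub>C\<^esub>)"
    and p_sum: "\<And>x. x \<in> carrier C \<Longrightarrow>
      \<exists>J. finite J \<and> (\<forall>n. n \<notin> J \<longrightarrow> p x n = \<zero>\<^bsub>C\<^esub>) \<and> x = (\<Oplus>\<^bsub>C\<^esub>n\<in>J. p x n)"
  shows "is_graded_module R C"
proof -
  interpret module R C by fact
  have DC: "x \<in> carrier C" if "x \<in> Deg C n" for x n
    using additive_subgroup.a_subset[OF sub] that by blast
  have "\<exists>!y. (\<forall>n. y n \<in> Deg C n) \<and> finite {n. y n \<noteq> \<zero>\<^bsub>C\<^esub>} \<and> x = (\<Oplus>\<^bsub>C\<^esub>n\<in>{n. y n \<noteq> \<zero>\<^bsub>C\<^esub>}. y n)"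
    if x: "x \<in> carrier C" for x
  proof (rule ex1I[of _ "p x"])
    obtain J where J: "finite J" "\<And>n. n \<notin> J \<Longrightarrow> p x n = \<zero>\<^bsub>C\<^esub>" "x = (\<Oplus>\<^bsub>C\<^esub>n\<in>J. p x n)"
      using p_sum[OF x] by blast
    have sub: "{n. p x n \<noteq> \<zero>\<^bsub>C\<^esub>} \<subseteq> J" using J(2) by blast
    have "finsum C (p x) {n. p x n \<noteq> \<zero>\<^bsub>C\<^esub>} = finsum C (p x) J"
      by (rule M.finsum_superset[OF J(1) sub]) (use DC[OF p[OF x]] in auto)
    then show "(\<forall>n. p x n \<in> Deg C n) \<and> finite {n. p x n \<noteq> \<zero>\<^bsub>C\<^esub>} \<and> x = (\<Oplus>\<^bsub>C\<^esub>n\<in>{n. p x n \<noteq> \<zero>\<^bsub>C\<^esub>}. p x n)"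
      using p[OF x] finite_subset[OF sub J(1)] J(3) by simp
  next
    fix y assume y: "(\<forall>n. y n \<in> Deg C n) \<and> finite {n. y n \<noteq> \<zero>\<^bsub>C\<^esub>} \<and> x = (\<Oplus>\<^bsub>C\<^esub>n\<in>{n. y n \<noteq> \<zero>\<^bsub>C\<^esub>}. y n)"
    let ?S = "{n. y n \<noteq> \<zero>\<^bsub>C\<^esub>}"
    show "y = p x"
    proof
      fix m
      have yD: "y n \<in> Deg C n" for n using y by blast
      have "p x m = p (\<Oplus>\<^bsub>C\<^esub>n\<in>?S. y n) m" using y by simp
      also have "\<dots> = (\<Oplus>\<^bsub>C\<^esub>n\<in>?S. p (y n) m)"
        by (rule additive_finsum[where h = "\<lambda>x. p x m", OF M.abelian_group_axioms M.abelian_group_axioms DC[OF p] p_add])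
          (use DC[OF yD] in auto)
      also have "\<dots> = (\<Oplus>\<^bsub>C\<^esub>n\<in>?S. if m = n then y n else \<zero>\<^bsub>C\<^esub>)"
        by (rule M.finsum_cong') (use p_Deg[OF yD] DC[OF yD] in auto)
      also have "\<dots> = y m"
      proof (cases "m \<in> ?S")
        case True
        then show ?thesis using y DC[OF yD]
          by (subst M.finsum_single[where n = m]) auto
      next
        case False
        then have "(\<Oplus>\<^bsub>C\<^esub>n\<in>?S. if m = n then y n else \<zero>\<^bsub>C\<^esub>) = \<zero>\<^bsub>C\<^esub>"
          by (intro M.add.finprod_one_eqI) auto
        then show ?thesis using False by simp
      qed
      finally show "y m = p x m" by simp
    qed
  qed
  then show ?thesis unfolding is_graded_module_def using mod sub act by blast
qed

locale graded = module R C for R :: "('k, 'r, 'y) graded_module_scheme"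
    and C :: "('r, 'c, 'z) graded_module_scheme" +
  assumes graded: "is_graded_module R C"
begin

lemma Deg_subgroup: "additive_subgroup (Deg C n) C"
  using graded by (simp add: is_graded_module_def)

lemma Deg_carrier: "x \<in> Deg C n \<Longrightarrow> x \<in> carrier C"
  using additive_subgroup.a_subset[OF Deg_subgroup] by blast

lemma Deg_zero: "\<zero>\<^bsub>C\<^esub> \<in> Deg C n"
  by (rule additive_subgroup.zero_closed[OF Deg_subgroup])

lemma Deg_smult: "a \<in> Deg R m \<Longrightarrow> x \<in> Deg C n \<Longrightarrow> a \<odot>\<^bsub>C\<^esub> x \<in> Deg C (m + n)"
  using graded unfolding is_graded_module_def by blast

lemma decomposition:
  assumes "x \<in> carrier C"
  shows "\<exists>!y. (\<forall>n. y n \<in> Deg C n) \<and> finite (support C y) \<and> x = (\<Oplus>\<^bsub>C\<^esub>n\<in>support C y. y n)"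
  using graded assms unfolding is_graded_module_def support_def by blast

lemma
  assumes "x \<in> carrier C"
  shows component_Deg: "component C x n \<in> Deg C n"
    and component_finite: "finite (support C (component C x))"
    and component_sum: "x = (\<Oplus>\<^bsub>C\<^esub>n\<in>support C (component C x). component C x n)"
  using theI'[OF decomposition[OF assms]] unfolding component_def[symmetric] by auto

lemma component_carrier: "x \<in> carrier C \<Longrightarrow> component C x n \<in> carrier C"
  by (rule Deg_carrier[OF component_Deg])

lemma component_sum_superset:
  assumes "x \<in> carrier C" "finite J" "\<And>n. n \<notin> J \<Longrightarrow> component C x n = \<zero>\<^bsub>C\<^esub>"
  shows "x = (\<Oplus>\<^bsub>C\<^esub>n\<in>J. component C x n)"
proof -
  have "finsum C (component C x) (support C (component C x)) = finsum C (component C x) J"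
    by (rule M.finsum_superset[OF assms(2)])
      (use assms(3) component_carrier[OF assms(1)] in \<open>auto simp: support_def\<close>)
  then show ?thesis using component_sum[OF assms(1)] by simp
qed

lemma component_unique:
  assumes "\<And>n. y n \<in> Deg C n" "finite J" "\<And>n. n \<notin> J \<Longrightarrow> y n = \<zero>\<^bsub>C\<^esub>" "x = (\<Oplus>\<^bsub>C\<^esub>n\<in>J. y n)"
  shows "component C x = y"
proof -
  have sub: "support C y \<subseteq> J" using assms(3) by (auto simp: support_def)
  have "finsum C y (support C y) = finsum C y J"
    by (rule M.finsum_superset[OF assms(2) sub]) (use Deg_carrier[OF assms(1)] in \<open>auto simp: support_def\<close>)
  moreover have "x \<in> carrier C" unfolding assms(4) using Deg_carrier[OF assms(1)] by (intro M.finsum_closed) auto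
  ultimately show ?thesis
    unfolding component_def using decomposition assms(1,4) finite_subset[OF sub assms(2)]
    by (intro the1_equality) auto
qed

lemma component_of_Deg: "x \<in> Deg C m \<Longrightarrow> component C x n = (if n = m then x else \<zero>\<^bsub>C\<^esub>)"
proof -
  assume x: "x \<in> Deg C m"
  have "component C x = (\<lambda>n. if n = m then x else \<zero>\<^bsub>C\<^esub>)"
    by (rule component_unique[of _ "{m}"])
      (use x Deg_zero Deg_carrier[OF x] M.finsum_single[of "{m}" m] in auto)
  then show ?thesis by simp
qed

lemma component_zero: "component C \<zero>\<^bsub>C\<^esub> n = \<zero>\<^bsub>C\<^esub>"
  using component_of_Deg[OF Deg_zero[of n]] by simp

end

lemma is_graded_module_graded: "is_graded_module R C \<Longrightarrow> graded R C"
  by (simp add: graded_def graded_axioms_def is_graded_module_def)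

text \<open>An additive map preserving degrees carries the decomposition of \<open>x\<close> to a
  decomposition of \<open>h x\<close>, and the latter is unique.\<close>

lemma component_hom:
  assumes "graded R C" "graded R' C'"
    and h: "\<And>x. x \<in> carrier C \<Longrightarrow> h x \<in> carrier C'"
      "\<And>x y. x \<in> carrier C \<Longrightarrow> y \<in> carrier C \<Longrightarrow> h (x \<oplus>\<^bsub>C\<^esub> y) = h x \<oplus>\<^bsub>C'\<^esub> h y"
      "\<And>x n. x \<in> Deg C n \<Longrightarrow> h x \<in> Deg C' n"
    and x: "x \<in> carrier C"
  shows "component C' (h x) n = h (component C x n)"
proof -
  interpret C: graded R C by fact
  interpret C': graded R' C' by fact
  have z: "h \<zero>\<^bsub>C\<^esub> = \<zero>\<^bsub>C'\<^esub>"
    by (rule additive_map_zero[OF C.M.abelian_group_axioms C'.M.abelian_group_axioms h(1)[OF C.M.zero_closed]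
        h(2)[OF C.M.zero_closed C.M.zero_closed]])
  have "component C' (h x) = (\<lambda>n. h (component C x n))"
  proof (rule C'.component_unique[OF h(3)[OF C.component_Deg[OF x]] C.component_finite[OF x]])
    show "h (component C x n) = \<zero>\<^bsub>C'\<^esub>" if "n \<notin> support C (component C x)" for n
      using that z by (simp add: support_def)
    have "h (\<Oplus>\<^bsub>C\<^esub>n\<in>support C (component C x). component C x n) =
        (\<Oplus>\<^bsub>C'\<^esub>n\<in>support C (component C x). h (component C x n))"
      by (rule additive_finsum[OF C.M.abelian_group_axioms C'.M.abelian_group_axioms h(1,2)])
        (use C.component_carrier[OF x] in auto)
    then show "h x = (\<Oplus>\<^bsub>C'\<^esub>n\<in>support C (component C x). h (component C x n))"
      using C.component_sum[OF x] by simp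
  qed
  then show ?thesis by simp
qed

lemma (in graded) component_add:
  assumes "x \<in> carrier C" "y \<in> carrier C"
  shows "component C (x \<oplus>\<^bsub>C\<^esub> y) n = component C x n \<oplus>\<^bsub>C\<^esub> component C y n"
proof -
  let ?J = "support C (component C x) \<union> support C (component C y)"
  note c = component_carrier[OF assms(1)] component_carrier[OF assms(2)]
  have fin: "finite ?J" using component_finite assms by blast
  have "component C (x \<oplus>\<^bsub>C\<^esub> y) = (\<lambda>n. component C x n \<oplus>\<^bsub>C\<^esub> component C y n)"
  proof (rule component_unique[OF _ fin])
    show "component C x n \<oplus>\<^bsub>C\<^esub> component C y n \<in> Deg C n" for n
      by (rule additive_subgroup.a_closed[OF Deg_subgroup component_Deg[OF assms(1)] component_Deg[OF assms(2)]])
    show "component C x n \<oplus>\<^bsub>C\<^esub> component C y n = \<zero>\<^bsub>C\<^esub>" if "n \<notin> ?J" for n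
      using that by (simp add: support_def)
    have "x = (\<Oplus>\<^bsub>C\<^esub>n\<in>?J. component C x n)" "y = (\<Oplus>\<^bsub>C\<^esub>n\<in>?J. component C y n)"
      by (rule component_sum_superset[OF assms(1) fin], simp add: support_def)
        (rule component_sum_superset[OF assms(2) fin], simp add: support_def)
    moreover have "(\<Oplus>\<^bsub>C\<^esub>n\<in>?J. component C x n \<oplus>\<^bsub>C\<^esub> component C y n) =
        (\<Oplus>\<^bsub>C\<^esub>n\<in>?J. component C x n) \<oplus>\<^bsub>C\<^esub> (\<Oplus>\<^bsub>C\<^esub>n\<in>?J. component C y n)"
      using c by (intro M.finsum_addf) auto
    ultimately show "x \<oplus>\<^bsub>C\<^esub> y = (\<Oplus>\<^bsub>C\<^esub>n\<in>?J. component C x n \<oplus>\<^bsub>C\<^esub> component C y n)" by simp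
  qed
  then show ?thesis by simp
qed

section \<open>The category of graded modules\<close>

text \<open>\<open>scalar_Deg\<close> makes \<open>k\<close> act on each homogeneous part, so that
  degrees are \<open>k\<close>-submodules. Both assumptions are later verified for the associated
  graded algebra.\<close>

locale graded_noetherian_algebra = noetherian_algebra k R
  for k :: "('k, 'l) ring_scheme" and R :: "('k, 'r, 'y) graded_module_scheme" +
  assumes scalar_Deg: "c \<in> carrier k \<Longrightarrow> c \<odot>\<^bsub>R\<^esub> \<one>\<^bsub>R\<^esub> \<in> Deg R 0"
    and Deg_algebra: "a \<in> Deg R n \<Longrightarrow> a \<in> carrier R"
begin

lemma Deg_submodule:
  assumes "graded R C"
  shows "submodule (Deg C n) k (restrict_scalars R C)"
proof -
  interpret C: graded R C by fact
  interpret K: module k "restrict_scalars R C" by (rule module_restrict_scalars[OF alg C.module_axioms])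
  have neg: "\<ominus>\<^bsub>restrict_scalars R C\<^esub> x = \<ominus>\<^bsub>C\<^esub> x" if "x \<in> carrier C" for x
    by (rule K.minus_equality) (use that in \<open>auto simp: C.l_neg\<close>)
  show ?thesis
    using C.Deg_carrier C.Deg_zero C.Deg_smult[OF scalar_Deg] additive_subgroup.a_closed[OF C.Deg_subgroup]
      additive_subgroup.a_inv_closed[OF C.Deg_subgroup]
    by (intro K.submoduleI) (auto simp: neg)
qed

lemma Deg_locally_free_iff:
  assumes "graded R C"
  shows "locally_free_const_rank k ((restrict_scalars R C)\<lparr>carrier := Deg C n\<rparr>) \<longleftrightarrow>
    (\<exists>r. local_dual_basis k (restrict_scalars R C) (Deg C n) {\<zero>\<^bsub>C\<^esub>} r)"
proof -
  interpret C: graded R C by fact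
  let ?K = "restrict_scalars R C" and ?D = "(restrict_scalars R C)\<lparr>carrier := Deg C n\<rparr>"
  interpret K: module k ?K by (rule module_restrict_scalars[OF alg C.module_axioms])
  have D: "module k ?D"
    by (rule submodule.submodule_is_module[OF Deg_submodule[OF assms] K.module_axioms])
  interpret D: module k ?D by (rule D)
  have "local_dual_basis k ?K (Deg C n) {\<zero>\<^bsub>C\<^esub>} r \<longleftrightarrow> local_dual_basis k ?D (carrier ?D) {\<zero>\<^bsub>?D\<^esub>} r" for r
    by (rule local_dual_basis_transfer[OF K.module_axioms D Deg_submodule[OF assms] D.carrier_is_submodule D.zero_is_submodule,
        where h = "\<lambda>x. x"]) (use C.Deg_zero in auto)
  then show ?thesis using locally_free_iff[OF D] by simp
qed

lemma AG_obj_iff: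
  "C \<in> Obj (AG k R) \<longleftrightarrow> graded R C \<and> finite {n. Deg C n \<noteq> {\<zero>\<^bsub>C\<^esub>}} \<and>
    (\<forall>n. \<exists>r. local_dual_basis k (restrict_scalars R C) (Deg C n) {\<zero>\<^bsub>C\<^esub>} r)"
  using Deg_locally_free_iff is_graded_module_graded graded.graded by (auto simp: AG_def)

text \<open>For growing finite \<open>J\<close> these kernels form a chain from the whole module
  down to zero whose successive quotients are the homogeneous parts, which brings gradings within
  reach of \<open>local_dual_basis_trans\<close>.\<close>

definition off_degree :: "('r, 'c, 'z) graded_module_scheme \<Rightarrow> int set \<Rightarrow> 'c set" where
  "off_degree C J = {x \<in> carrier C. \<forall>n\<in>J. component C x n = \<zero>\<^bsub>C\<^esub>}"

lemma component_scalar: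
  assumes "graded R C" "c \<in> carrier k" "x \<in> carrier C"
  shows "component C ((c \<odot>\<^bsub>R\<^esub> \<one>\<^bsub>R\<^esub>) \<odot>\<^bsub>C\<^esub> x) n = (c \<odot>\<^bsub>R\<^esub> \<one>\<^bsub>R\<^esub>) \<odot>\<^bsub>C\<^esub> component C x n"
proof -
  interpret C: graded R C by fact
  have c: "c \<odot>\<^bsub>R\<^esub> \<one>\<^bsub>R\<^esub> \<in> carrier R" using assms(2) by simp
  show ?thesis
    by (rule component_hom[where h = "\<lambda>x. (c \<odot>\<^bsub>R\<^esub> \<one>\<^bsub>R\<^esub>) \<odot>\<^bsub>C\<^esub> x", OF assms(1,1)])
      (use assms c C.Deg_smult[OF scalar_Deg[OF assms(2)]] in \<open>auto simp: C.smult_r_distr\<close>)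
qed

lemma off_degree_submodule:
  assumes "graded R C"
  shows "submodule (off_degree C J) k (restrict_scalars R C)"
proof -
  interpret C: graded R C by fact
  interpret K: module k "restrict_scalars R C" by (rule module_restrict_scalars[OF alg C.module_axioms])
  have smult: "c \<odot>\<^bsub>restrict_scalars R C\<^esub> x \<in> off_degree C J" if "c \<in> carrier k" "x \<in> off_degree C J" for c x
    using that component_scalar[OF assms that(1), of x] by (auto simp: off_degree_def)
  show ?thesis
  proof (rule K.submoduleI[OF _ _ _ _ smult])
    show "\<ominus>\<^bsub>restrict_scalars R C\<^esub> x \<in> off_degree C J" if x: "x \<in> off_degree C J" for x
    proof -
      have "\<ominus>\<^bsub>restrict_scalars R C\<^esub> x = (\<ominus>\<^bsub>k\<^esub> \<one>\<^bsub>k\<^esub>) \<odot>\<^bsub>restrict_scalars R C\<^esub> x"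
        using K.smult_l_minus[of "\<one>\<^bsub>k\<^esub>" x] x K.smult_one[of x] by (simp add: off_degree_def del: restrict_scalars_simps(4))
      then show ?thesis using smult[OF _ x] by simp
    qed
  qed (auto simp: off_degree_def C.component_zero C.component_add)
qed

text \<open>The component in degree \<open>j\<close> maps \<open>off_degree C J\<close> onto
  \<open>Deg C j\<close>, and its kernel is cut out by the one new condition.\<close>

lemma off_degree_local_dual_basis:
  assumes C: "graded R C" and "j \<notin> J"
    and ldb: "local_dual_basis k (restrict_scalars R C) (Deg C j) {\<zero>\<^bsub>C\<^esub>} r"
  shows "local_dual_basis k (restrict_scalars R C) (off_degree C J) (off_degree C (insert j J)) r"
proof -
  interpret C: graded R C by fact
  interpret K: module k "restrict_scalars R C" by (rule module_restrict_scalars[OF alg C.module_axioms])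
  have "local_dual_basis k (restrict_scalars R C) (off_degree C J) (off_degree C (insert j J)) r \<longleftrightarrow>
      local_dual_basis k (restrict_scalars R C) (Deg C j) {\<zero>\<^bsub>C\<^esub>} r"
  proof (rule local_dual_basis_transfer[where h = "\<lambda>x. component C x j"])
    fix y assume y: "y \<in> Deg C j"
    then have "y \<in> off_degree C J" "component C y j = y"
      using C.Deg_carrier[OF y] C.component_of_Deg[OF y] \<open>j \<notin> J\<close> by (auto simp: off_degree_def)
    then show "\<exists>x\<in>off_degree C J. component C x j = y" by blast
  qed (use K.module_axioms off_degree_submodule[OF C] Deg_submodule[OF C] K.zero_is_submodule C.Deg_zero in
      \<open>auto simp: off_degree_def C.component_Deg C.component_add component_scalar[OF C]\<close>)
  then show ?thesis using ldb by simp
qed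

lemma off_degree_empty: "off_degree C {} = carrier C"
  by (simp add: off_degree_def)

lemma off_degree_all:
  assumes "graded R C"
  shows "off_degree C {n. Deg C n \<noteq> {\<zero>\<^bsub>C\<^esub>}} = {\<zero>\<^bsub>C\<^esub>}"
proof -
  interpret C: graded R C by fact
  have "x = \<zero>\<^bsub>C\<^esub>" if "x \<in> off_degree C {n. Deg C n \<noteq> {\<zero>\<^bsub>C\<^esub>}}" for x
  proof -
    have x: "x \<in> carrier C" using that by (simp add: off_degree_def)
    have "component C x n = \<zero>\<^bsub>C\<^esub>" for n
      using that C.component_Deg[OF x, of n] by (cases "Deg C n = {\<zero>\<^bsub>C\<^esub>}") (auto simp: off_degree_def)
    then show ?thesis using C.component_sum_superset[OF x, of "{}"] by simp
  qed
  then show ?thesis by (auto simp: off_degree_def C.component_zero)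
qed

lemma graded_local_dual_basis:
  assumes "C \<in> Obj (AG k R)"
  shows "\<exists>r. local_dual_basis k (restrict_scalars R C) (carrier C) {\<zero>\<^bsub>C\<^esub>} r"
proof -
  have C: "graded R C" and fin: "finite {n. Deg C n \<noteq> {\<zero>\<^bsub>C\<^esub>}}"
    and ldb: "\<And>n. \<exists>r. local_dual_basis k (restrict_scalars R C) (Deg C n) {\<zero>\<^bsub>C\<^esub>} r"
    using assms by (auto simp: AG_obj_iff)
  interpret C: graded R C by (rule C)
  interpret K: module k "restrict_scalars R C" by (rule module_restrict_scalars[OF alg C.module_axioms])
  have "\<exists>r. local_dual_basis k (restrict_scalars R C) (carrier C) (off_degree C J) r" if "finite J" for J
    using that
  proof (induction J rule: finite_induct)
    case empty
    then show ?case using K.local_dual_basis_refl[OF off_degree_submodule[OF C, of "{}"]] by (auto simp: off_degree_empty)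
  next
    case (insert j J)
    then obtain r where r: "local_dual_basis k (restrict_scalars R C) (off_degree C {}) (off_degree C J) r"
      by (auto simp: off_degree_empty)
    obtain r' where "local_dual_basis k (restrict_scalars R C) (Deg C j) {\<zero>\<^bsub>C\<^esub>} r'" using ldb by blast
    from off_degree_local_dual_basis[OF C insert.hyps(2) this]
    have "local_dual_basis k (restrict_scalars R C) (off_degree C {}) (off_degree C (insert j J)) (r + r')"
      by (intro K.local_dual_basis_trans[OF _ _ _ _ _ r] off_degree_submodule[OF C]) (auto simp: off_degree_def)
    then show ?case by (auto simp: off_degree_empty)
  qed
  from this[OF fin] show ?thesis unfolding off_degree_all[OF C] .
qed

section \<open>The dual of a graded module\<close>

lemma same_gr_dual: "same_module (dual k R C) (gr_dual k R C)"
  by (simp add: same_module_def gr_dual_def module.defs)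

lemma gr_dual_simps [simp]:
  "carrier (gr_dual k R C) = carrier (dual k R C)"
  "add (gr_dual k R C) = add (dual k R C)"
  "zero (gr_dual k R C) = zero (dual k R C)"
  "smult (gr_dual k R C) = smult (dual k R C)"
  "Deg (gr_dual k R C) q = {f \<in> carrier (dual k R C). \<forall>n. n \<noteq> - q \<longrightarrow> (\<forall>x\<in>Deg C n. f x = \<zero>\<^bsub>k\<^esub>)}"
  by (simp_all add: gr_dual_def module.defs)

lemma dual_zero:
  assumes "module R C" "f \<in> carrier (dual k R C)"
  shows "f \<zero>\<^bsub>C\<^esub> = \<zero>\<^bsub>k\<^esub>"
proof -
  interpret K: module k "restrict_scalars R C" by (rule module_restrict_scalars[OF alg assms(1)])
  show ?thesis using K.linear_on_zero[OF _ K.carrier_is_submodule, of f] assms(2) by (simp add: dual_mem)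
qed

lemma dual_component_sum:
  assumes C: "graded R C" and f: "f \<in> carrier (dual k R C)" and x: "x \<in> carrier C"
    and J: "finite J" "\<And>n. n \<notin> J \<Longrightarrow> component C x n = \<zero>\<^bsub>C\<^esub>"
  shows "f x = (\<Oplus>\<^bsub>k\<^esub>n\<in>J. f (component C x n))"
proof -
  interpret C: graded R C by fact
  have "f (\<Oplus>\<^bsub>C\<^esub>n\<in>J. component C x n) = (\<Oplus>\<^bsub>k\<^esub>n\<in>J. f (component C x n))"
    by (rule additive_finsum[OF C.M.abelian_group_axioms A.R.abelian_group_axioms dual_closed[OF f] dual_add[OF f]])
      (use C.component_carrier[OF x] in auto)
  then show ?thesis using C.component_sum_superset[OF x J] by simp
qed

lemma dual_single_component:
  assumes C: "graded R C" and f: "f \<in> carrier (dual k R C)" and x: "x \<in> carrier C"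
    and "\<And>n. n \<noteq> m \<Longrightarrow> f (component C x n) = \<zero>\<^bsub>k\<^esub>"
  shows "f x = f (component C x m)"
proof -
  interpret C: graded R C by fact
  let ?J = "insert m (support C (component C x))"
  have "f x = (\<Oplus>\<^bsub>k\<^esub>n\<in>?J. f (component C x n))"
    by (rule dual_component_sum[OF C f x]) (use C.component_finite[OF x] in \<open>auto simp: support_def\<close>)
  also have "\<dots> = f (component C x m)"
    by (rule A.R.finsum_single[where n = m])
      (use C.component_finite[OF x] assms(4) dual_closed[OF f C.component_carrier[OF x]] in auto)
  finally show ?thesis .
qed

text \<open>Vanishing on all degrees but \<open>- q\<close> means factoring through the component in
  degree \<open>- q\<close>. Written as an annihilator, the degree falls under
  \<open>local_dual_basis_annihilator\<close>.\<close>

lemma Deg_gr_dual: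
  assumes C: "graded R C"
  shows "Deg (gr_dual k R C) q = annihilator k (restrict_scalars R (gr_dual k R C)) (off_degree C {- q})"
proof (intro equalityI subsetI)
  interpret C: graded R C by fact
  fix f
  {
    assume f: "f \<in> Deg (gr_dual k R C) q"
    have "f x = \<zero>\<^bsub>k\<^esub>" if x: "x \<in> off_degree C {- q}" for x
    proof -
      have xC: "x \<in> carrier C" "component C x (- q) = \<zero>\<^bsub>C\<^esub>" using x by (auto simp: off_degree_def)
      have "f x = f (component C x (- q))"
        by (rule dual_single_component[OF C _ xC(1)]) (use f C.component_Deg[OF xC(1)] in auto)
      then show ?thesis using xC(2) dual_zero[OF C.module_axioms, of f] f by simp
    qed
    then show "f \<in> annihilator k (restrict_scalars R (gr_dual k R C)) (off_degree C {- q})"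
      using f by (simp add: annihilator_def)
  }
  assume f: "f \<in> annihilator k (restrict_scalars R (gr_dual k R C)) (off_degree C {- q})"
  have "x \<in> off_degree C {- q}" if "x \<in> Deg C n" "n \<noteq> - q" for x n
    using that C.Deg_carrier C.component_of_Deg[OF that(1)] by (auto simp: off_degree_def)
  then show "f \<in> Deg (gr_dual k R C) q" using f by (auto simp: annihilator_def)
qed

lemma dual_compose_component:
  assumes C: "graded R C" and f: "f \<in> carrier (dual k R C)"
  shows "(\<lambda>x\<in>carrier C. f (component C x n)) \<in> Deg (gr_dual k R C) (- n)"
proof -
  interpret C: graded R C by fact
  have "(\<lambda>x\<in>carrier C. f (component C x n)) \<in> carrier (dual k R C)"
    by (rule dualI)
      (use f C.component_carrier in \<open>auto simp: dual_closed C.component_add dual_add component_scalar[OF C] dual_smult\<close>)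
  then show ?thesis
    using C.component_of_Deg dual_zero[OF C.module_axioms f] C.Deg_carrier by auto
qed

text \<open>The projection to degree \<open>q\<close> composes a functional with the component in
  degree \<open>- q\<close>. Since \<open>C\<close> has finitely many nonzero degrees, the
  decomposition of every functional is finite, over the same index set for all of them.\<close>

lemma graded_dual:
  assumes "C \<in> Obj (AG k R)"
  shows "graded R (gr_dual k R C)"
proof (rule is_graded_module_graded, rule is_graded_moduleI[where p = "\<lambda>f q. \<lambda>x\<in>carrier C. f (component C x (- q))"])
  have C: "graded R C" and fin: "finite {n. Deg C n \<noteq> {\<zero>\<^bsub>C\<^esub>}}"
    using assms by (auto simp: AG_obj_iff)
  interpret C: graded R C by (rule C)
  show D: "module R (gr_dual k R C)"
    by (rule module_same[OF module_dual[OF alg C.module_axioms] same_gr_dual])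
  interpret D: module R "gr_dual k R C" by (rule D)
  interpret K: dual_module k "restrict_scalars R C" "restrict_scalars R (gr_dual k R C)"
    by (rule dual_module_restrict_scalars[OF alg C.module_axioms same_gr_dual])
  have sub: "submodule (Deg (gr_dual k R C) q) k (restrict_scalars R (gr_dual k R C))" for q
    unfolding Deg_gr_dual[OF C] by (rule K.annihilator_submodule) (auto simp: off_degree_def)
  show "additive_subgroup (Deg (gr_dual k R C) q) (gr_dual k R C)" for q
    using submodule_additive_subgroup[OF sub[of q]]
    by (simp add: additive_subgroup_def subgroup_def m_inv_def del: gr_dual_simps(5))
  show "a \<odot>\<^bsub>gr_dual k R C\<^esub> f \<in> Deg (gr_dual k R C) (m + n)"
    if a: "a \<in> Deg R m" and f: "f \<in> Deg (gr_dual k R C) n" for m n a f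
  proof -
    have "a \<odot>\<^bsub>gr_dual k R C\<^esub> f \<in> carrier (gr_dual k R C)" using a f by (intro D.smult_closed Deg_algebra) auto
    moreover have "f (a \<odot>\<^bsub>C\<^esub> x) = \<zero>\<^bsub>k\<^esub>" if "l \<noteq> - (m + n)" "x \<in> Deg C l" for l x
    proof -
      have "m + l \<noteq> - n" using that(1) by linarith
      then show ?thesis using C.Deg_smult[OF a that(2)] f by simp
    qed
    ultimately show ?thesis using C.Deg_carrier by auto
  qed
  show "(\<lambda>x\<in>carrier C. f (component C x (- q))) \<in> Deg (gr_dual k R C) q" if "f \<in> carrier (gr_dual k R C)" for f q
    using dual_compose_component[OF C, of f "- q"] that by simp
  show "(\<lambda>x\<in>carrier C. (f \<oplus>\<^bsub>gr_dual k R C\<^esub> g) (component C x (- q))) =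
      (\<lambda>x\<in>carrier C. f (component C x (- q))) \<oplus>\<^bsub>gr_dual k R C\<^esub> (\<lambda>x\<in>carrier C. g (component C x (- q)))" for f g q
    using C.component_carrier by (auto simp: restrict_def)
  show "(\<lambda>x\<in>carrier C. f (component C x (- q))) = (if q = m then f else \<zero>\<^bsub>gr_dual k R C\<^esub>)"
    if f: "f \<in> Deg (gr_dual k R C) m" for f m q
  proof (rule extensionalityI[of _ "carrier C"])
    fix x assume x: "x \<in> carrier C"
    have "f x = f (component C x (- m))"
      by (rule dual_single_component[OF C _ x]) (use f C.component_Deg[OF x] in auto)
    moreover have "f (component C x (- q)) = \<zero>\<^bsub>k\<^esub>" if "q \<noteq> m"
    proof -
      have "- q \<noteq> - m" using that by simp
      then show ?thesis using f C.component_Deg[OF x, of "- q"] unfolding gr_dual_simps by blast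
    qed
    ultimately show "(\<lambda>x\<in>carrier C. f (component C x (- q))) x = (if q = m then f else \<zero>\<^bsub>gr_dual k R C\<^esub>) x"
      using x by auto
  qed (use f dual_extensional[of f k R C] in auto)
  show "\<exists>J. finite J \<and> (\<forall>q. q \<notin> J \<longrightarrow> (\<lambda>x\<in>carrier C. f (component C x (- q))) = \<zero>\<^bsub>gr_dual k R C\<^esub>) \<and>
      f = (\<Oplus>\<^bsub>gr_dual k R C\<^esub>q\<in>J. (\<lambda>x\<in>carrier C. f (component C x (- q))))"
    if f: "f \<in> carrier (gr_dual k R C)" for f
  proof (intro exI conjI allI impI)
    let ?S = "{n. Deg C n \<noteq> {\<zero>\<^bsub>C\<^esub>}}"
    let ?J = "uminus ` ?S"
    show finJ: "finite ?J" using fin by simp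
    have fD: "f \<in> carrier (dual k R C)" using f by simp
    have z: "component C x n = \<zero>\<^bsub>C\<^esub>" if "n \<notin> ?S" "x \<in> carrier C" for x n
      using C.component_Deg[OF that(2), of n] that(1) by auto
    show "(\<lambda>x\<in>carrier C. f (component C x (- q))) = \<zero>\<^bsub>gr_dual k R C\<^esub>" if q: "q \<notin> ?J" for q
    proof -
      have "- q \<notin> ?S" using q by (metis (no_types, lifting) imageI minus_minus)
      then show ?thesis using z dual_zero[OF C.module_axioms fD] by (auto simp: restrict_def)
    qed
    have mem: "(\<lambda>x\<in>carrier C. f (component C x (- q))) \<in> carrier (gr_dual k R C)" for q
      using dual_compose_component[OF C fD, of "- q"] by simp
    show "f = (\<Oplus>\<^bsub>gr_dual k R C\<^esub>q\<in>?J. (\<lambda>x\<in>carrier C. f (component C x (- q))))" (is "f = ?g")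
    proof (rule extensionalityI[of _ "carrier C"])
      show "f \<in> extensional (carrier C)" using dual_extensional[OF fD] .
      have "?g \<in> carrier (gr_dual k R C)" using mem by (intro D.M.finsum_closed) auto
      then show "?g \<in> extensional (carrier C)" using dual_extensional[of ?g k R C] by simp
      fix x assume x: "x \<in> carrier C"
      have "?g x = (\<Oplus>\<^bsub>k\<^esub>q\<in>?J. (\<lambda>x\<in>carrier C. f (component C x (- q))) x)"
        by (rule additive_finsum[where h = "\<lambda>f. f x", OF D.M.abelian_group_axioms A.R.abelian_group_axioms])
          (use x mem in \<open>auto simp: dual_closed\<close>)
      also have "\<dots> = (\<Oplus>\<^bsub>k\<^esub>n\<in>?S. f (component C x n))"
        using x dual_closed[OF fD C.component_carrier[OF x]]
        by (subst A.R.finsum_reindex) (auto simp: inj_on_def)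
      also have "\<dots> = f x" using dual_component_sum[OF C fD x fin] z x by simp
      finally show "f x = ?g x" by simp
    qed
  qed
qed

text \<open>The module modulo the kernel of its component in degree \<open>- q\<close> is
  \<open>Deg C (- q)\<close>; dually, the annihilator of that kernel is the part of degree
  \<open>q\<close>, and the annihilator of the whole module is zero.\<close>

lemma gr_dual_obj:
  assumes "C \<in> Obj (AG k R)"
  shows "gr_dual k R C \<in> Obj (AG k R)"
proof -
  have C: "graded R C" and fin: "finite {n. Deg C n \<noteq> {\<zero>\<^bsub>C\<^esub>}}"
    and ldb: "\<And>n. \<exists>r. local_dual_basis k (restrict_scalars R C) (Deg C n) {\<zero>\<^bsub>C\<^esub>} r"
    using assms by (auto simp: AG_obj_iff)
  interpret C: graded R C by (rule C)
  interpret K: dual_module k "restrict_scalars R C" "restrict_scalars R (gr_dual k R C)"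
    by (rule dual_module_restrict_scalars[OF alg C.module_axioms same_gr_dual])
  note ann = annihilator_carrier[OF C.module_axioms same_gr_dual]
  have "\<exists>r. local_dual_basis k (restrict_scalars R (gr_dual k R C)) (Deg (gr_dual k R C) q) {\<zero>\<^bsub>gr_dual k R C\<^esub>} r" for q
  proof -
    obtain r where "local_dual_basis k (restrict_scalars R C) (Deg C (- q)) {\<zero>\<^bsub>C\<^esub>} r" using ldb by blast
    then have r: "local_dual_basis k (restrict_scalars R C) (carrier C) (off_degree C {- q}) r"
      using off_degree_local_dual_basis[OF C, of "- q" "{}"] by (simp add: off_degree_empty)
    have "local_dual_basis k (restrict_scalars R (gr_dual k R C))
        (annihilator k (restrict_scalars R (gr_dual k R C)) (off_degree C {- q}))
        (annihilator k (restrict_scalars R (gr_dual k R C)) (carrier C)) r"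
      using r K.carrier_is_submodule K.local_dual_basis_refl[OF K.carrier_is_submodule]
      by (intro K.local_dual_basis_annihilator[where r' = 0] off_degree_submodule[OF C]) (auto simp: off_degree_def)
    then show ?thesis unfolding Deg_gr_dual[OF C] ann by blast
  qed
  moreover have "{q. Deg (gr_dual k R C) q \<noteq> {\<zero>\<^bsub>gr_dual k R C\<^esub>}} \<subseteq> uminus ` {n. Deg C n \<noteq> {\<zero>\<^bsub>C\<^esub>}}"
  proof
    fix q assume q: "q \<in> {q. Deg (gr_dual k R C) q \<noteq> {\<zero>\<^bsub>gr_dual k R C\<^esub>}}"
    have "Deg C (- q) \<noteq> {\<zero>\<^bsub>C\<^esub>}"
    proof
      assume "Deg C (- q) = {\<zero>\<^bsub>C\<^esub>}"
      then have "off_degree C {- q} = carrier C" using C.component_Deg[of _ "- q"] by (auto simp: off_degree_def)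
      then have "Deg (gr_dual k R C) q = {\<zero>\<^bsub>gr_dual k R C\<^esub>}" unfolding Deg_gr_dual[OF C] using ann by simp
      then show False using q by blast
    qed
    then have "- (- q) \<in> uminus ` {n. Deg C n \<noteq> {\<zero>\<^bsub>C\<^esub>}}" by blast
    then show "q \<in> uminus ` {n. Deg C n \<noteq> {\<zero>\<^bsub>C\<^esub>}}" by simp
  qed
  ultimately show ?thesis
    unfolding AG_obj_iff using graded_dual[OF assms] finite_subset[OF _ finite_imageI[OF fin]] by blast
qed

end

section \<open>Zero object, products and duality of graded modules\<close>

lemma additive_subgroup_cong:
  assumes "additive_subgroup H M" "carrier N = carrier M" "add N = add M" "zero N = zero M"
  shows "additive_subgroup H N"
  using assms by (simp add: additive_subgroup_def subgroup_def m_inv_def)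

context graded_noetherian_algebra
begin

definition gr_zero :: "('r, 'c) graded_module" where
  "gr_zero = module.extend zero_module \<lparr>Deg = (\<lambda>_. {undefined})\<rparr>"

lemma gr_zero_obj: "(gr_zero :: ('r, 'c) graded_module) \<in> Obj (AG k R)"
proof -
  let ?Z = "gr_zero :: ('r, 'c) graded_module"
  have same: "same_module zero_module ?Z" by (simp add: same_module_def gr_zero_def module.defs)
  have Z: "module R ?Z" by (rule module_same[OF module_zero_module[OF A.M_cring] same])
  interpret Z: module R ?Z by (rule Z)
  have F: "Deg ?Z n = {\<zero>\<^bsub>?Z\<^esub>}" "carrier ?Z = {\<zero>\<^bsub>?Z\<^esub>}" for n
    by (simp_all add: gr_zero_def zero_module_def module.defs)
  have "is_graded_module R ?Z"
  proof (rule is_graded_moduleI[where p = "\<lambda>x n. x", OF Z])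
    show "additive_subgroup (Deg ?Z n) ?Z" for n
      unfolding F(1) by (rule submodule_additive_subgroup[OF Z.zero_is_submodule])
    show "\<exists>J. finite J \<and> (\<forall>n. n \<notin> J \<longrightarrow> x = \<zero>\<^bsub>?Z\<^esub>) \<and> x = (\<Oplus>\<^bsub>?Z\<^esub>n\<in>J. x)" if "x \<in> carrier ?Z" for x
      using that F(2) by (intro exI[of _ "{}"]) auto
  qed (use F Deg_algebra in auto)
  then show ?thesis
    using zero_module_local_dual_basis[OF Z F(2)] by (auto simp: AG_obj_iff is_graded_module_graded F(1))
qed

definition gr_prod ::
  "('r, 'b, 'u) graded_module_scheme \<Rightarrow> ('r, 'c, 'v) graded_module_scheme \<Rightarrow> ('r, 'b \<times> 'c) graded_module" where
  "gr_prod B C = module.extend (prod_module B C) \<lparr>Deg = (\<lambda>n. Deg B n \<times> Deg C n)\<rparr>"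

lemma same_gr_prod: "same_module (prod_module B C) (gr_prod B C)"
  by (simp add: same_module_def gr_prod_def module.defs)

lemma gr_prod_obj:
  assumes B: "B \<in> Obj (AG k R)" and C: "C \<in> Obj (AG k R)"
  shows "gr_prod B C \<in> Obj (AG k R)"
proof -
  let ?P = "gr_prod B C"
  have gB: "graded R B" "finite {n. Deg B n \<noteq> {\<zero>\<^bsub>B\<^esub>}}" and gC: "graded R C" "finite {n. Deg C n \<noteq> {\<zero>\<^bsub>C\<^esub>}}"
    using B C by (auto simp: AG_obj_iff)
  interpret B: graded R B by (rule gB(1))
  interpret C: graded R C by (rule gC(1))
  have P [simp]: "Deg ?P n = Deg B n \<times> Deg C n" "carrier ?P = carrier B \<times> carrier C" "\<zero>\<^bsub>?P\<^esub> = (\<zero>\<^bsub>B\<^esub>, \<zero>\<^bsub>C\<^esub>)"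
    "smult ?P = (\<lambda>a x. (a \<odot>\<^bsub>B\<^esub> fst x, a \<odot>\<^bsub>C\<^esub> snd x))"
    "add ?P = (\<lambda>x y. (fst x \<oplus>\<^bsub>B\<^esub> fst y, snd x \<oplus>\<^bsub>C\<^esub> snd y))" for n
    by (simp_all add: gr_prod_def prod_module_def module.defs)
  have mP: "module R ?P"
    by (rule module_same[OF module_prod_module[OF B.module_axioms C.module_axioms] same_gr_prod])
  interpret P: module R ?P by (rule mP)
  have K: "module k (restrict_scalars R B)" "module k (restrict_scalars R C)" "module k (restrict_scalars R ?P)"
    using module_restrict_scalars[OF alg] B.module_axioms C.module_axioms mP by auto
  have sameK: "same_module (prod_module (restrict_scalars R B) (restrict_scalars R C)) (restrict_scalars R ?P)"
    by (auto simp: same_module_def prod_module_def restrict_scalars_def)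
  define p where "p x n = (component B (fst x) n, component C (snd x) n)" for x n
  have "is_graded_module R ?P"
  proof (rule is_graded_moduleI[where p = p, OF mP])
    show "additive_subgroup (Deg ?P n) ?P" for n
      unfolding P(1)
      using submodule_additive_subgroup[OF submodule_prod[OF K sameK Deg_submodule[OF gB(1)] Deg_submodule[OF gC(1)]]]
      by (rule additive_subgroup_cong) (simp_all only: restrict_scalars_simps)
    show "\<exists>J. finite J \<and> (\<forall>n. n \<notin> J \<longrightarrow> p x n = \<zero>\<^bsub>?P\<^esub>) \<and> x = (\<Oplus>\<^bsub>?P\<^esub>n\<in>J. p x n)" if x: "x \<in> carrier ?P" for x
    proof (intro exI conjI allI impI)
      have xBC: "fst x \<in> carrier B" "snd x \<in> carrier C" using x by auto
      let ?J = "support B (component B (fst x)) \<union> support C (component C (snd x))"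
      show fin: "finite ?J" using B.component_finite[OF xBC(1)] C.component_finite[OF xBC(2)] by blast
      show "p x n = \<zero>\<^bsub>?P\<^esub>" if "n \<notin> ?J" for n using that by (simp add: p_def support_def)
      have pc: "p x \<in> ?J \<rightarrow> carrier ?P"
        using B.component_carrier[OF xBC(1)] C.component_carrier[OF xBC(2)] by (simp add: p_def)
      have "fst (\<Oplus>\<^bsub>?P\<^esub>n\<in>?J. p x n) = (\<Oplus>\<^bsub>B\<^esub>n\<in>?J. fst (p x n))"
        by (rule additive_finsum[OF P.M.abelian_group_axioms B.M.abelian_group_axioms _ _ pc]) auto
      also have "\<dots> = fst x"
        using B.component_sum_superset[OF xBC(1) fin] by (simp add: p_def support_def)
      finally have 1: "fst (\<Oplus>\<^bsub>?P\<^esub>n\<in>?J. p x n) = fst x" .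
      have "snd (\<Oplus>\<^bsub>?P\<^esub>n\<in>?J. p x n) = (\<Oplus>\<^bsub>C\<^esub>n\<in>?J. snd (p x n))"
        by (rule additive_finsum[OF P.M.abelian_group_axioms C.M.abelian_group_axioms _ _ pc]) auto
      also have "\<dots> = snd x"
        using C.component_sum_superset[OF xBC(2) fin] by (simp add: p_def support_def)
      finally show "x = (\<Oplus>\<^bsub>?P\<^esub>n\<in>?J. p x n)" using 1 by (simp add: prod_eq_iff)
    qed
  qed (auto simp: p_def B.Deg_smult C.Deg_smult B.component_Deg C.component_Deg B.component_add C.component_add
      B.component_of_Deg C.component_of_Deg)
  moreover have "finite {n. Deg ?P n \<noteq> {\<zero>\<^bsub>?P\<^esub>}}"
    by (rule finite_subset[OF _ finite_UnI[OF gB(2) gC(2)]]) auto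
  moreover have "\<exists>r. local_dual_basis k (restrict_scalars R ?P) (Deg ?P n) {\<zero>\<^bsub>?P\<^esub>} r" for n
  proof -
    obtain r where "local_dual_basis k (restrict_scalars R B) (Deg B n) {\<zero>\<^bsub>B\<^esub>} r" using B by (auto simp: AG_obj_iff)
    moreover obtain r' where "local_dual_basis k (restrict_scalars R C) (Deg C n) {\<zero>\<^bsub>C\<^esub>} r'" using C by (auto simp: AG_obj_iff)
    ultimately have "local_dual_basis k (restrict_scalars R ?P) (Deg B n \<times> Deg C n) ({\<zero>\<^bsub>B\<^esub>} \<times> {\<zero>\<^bsub>C\<^esub>}) (r + r')"
      using B.Deg_zero C.Deg_zero
      by (intro prod_local_dual_basis[OF B.module_axioms C.module_axioms same_gr_prod]
          Deg_submodule gB(1) gC(1) zero_submodule_restrict B.module_axioms C.module_axioms) auto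
    then show ?thesis by auto
  qed
  ultimately show ?thesis by (simp add: AG_obj_iff is_graded_module_graded)
qed

lemma AG_additive:
  "additive_category (AG k R :: ('c, \<lparr>smult :: 'r \<Rightarrow> 'c \<Rightarrow> 'c, Deg :: int \<Rightarrow> 'c set\<rparr>) mod_cat)
     (AG k R) (gr_hom R) (gr_hom R)"
  unfolding gr_hom_eq_fam_hom
proof (rule additive_category_fam_hom)
  show "Mor (AG k R) = fam_hom R Deg Deg"
    by (simp add: AG_def gr_hom_eq_fam_hom)
  show "module R C" if "C \<in> Obj (AG k R)" for C :: "('r, 'c) graded_module"
    using that by (simp add: AG_def is_graded_module_def)
  show "additive_subgroup (Deg C n) C" if "C \<in> Obj (AG k R)" for C :: "('r, 'c) graded_module" and n
    using that by (simp add: AG_def is_graded_module_def)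
  show "\<exists>Z\<in>Obj (AG k R :: ('c, \<lparr>smult :: 'r \<Rightarrow> 'c \<Rightarrow> 'c, Deg :: int \<Rightarrow> 'c set\<rparr>) mod_cat). carrier Z = {\<zero>\<^bsub>Z\<^esub>}"
    by (intro bexI[OF _ gr_zero_obj]) (simp add: gr_zero_def zero_module_def module.defs)
  fix B C :: "('r, 'c) graded_module" assume "B \<in> Obj (AG k R)" "C \<in> Obj (AG k R)"
  then show "\<exists>P\<in>Obj (AG k R). same_module (prod_module B C) P \<and> (\<forall>n. Deg P n = Deg B n \<times> Deg C n)"
    by (intro bexI[OF _ gr_prod_obj[of B C]]) (simp_all add: same_gr_prod, simp add: gr_prod_def module.defs)
qed

lemma AG_contravariant:
  "contravariant_functor (AG k R :: ('c, \<lparr>smult :: 'r \<Rightarrow> 'c \<Rightarrow> 'c, Deg :: int \<Rightarrow> 'c set\<rparr>) mod_cat) (AG k R)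
     (gr_dual k R) (dual_map k R)"
proof (rule contravariant_functor_dual[OF alg, where S = Deg and T = Deg])
  fix B C :: "('r, 'c) graded_module" and f g n
  assume B: "B \<in> Obj (AG k R)" and C: "C \<in> Obj (AG k R)" and f: "f \<in> fam_hom R Deg Deg B C"
    and g: "g \<in> Deg (gr_dual k R C) n"
  have "graded R B" using B by (simp add: AG_obj_iff)
  then interpret B: graded R B .
  show "g \<in> carrier (dual k R C) \<and> compose (carrier B) g f \<in> Deg (gr_dual k R B) n"
    using compose_dual[OF alg B.module_axioms fam_hom_mod_hom[OF f], of g] g fam_hom_mem[OF f] B.Deg_carrier
    by (auto simp: compose_eq)
qed (auto simp: gr_dual_obj same_gr_dual, auto simp: AG_def gr_hom_eq_fam_hom is_graded_module_def)

text \<open>To see that the component of degree \<open>l \<noteq> n\<close> vanishes, compose an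
  arbitrary functional with that component: the result has degree \<open>- l\<close> in the dual, so
  evaluation at \<open>x\<close> kills it. Functionals separate points, hence the component is
  zero.\<close>

lemma double_dual_map_Deg_iff:
  assumes "C \<in> Obj (AG k R)" and x: "x \<in> carrier C"
  shows "double_dual_map k R C x \<in> Deg (gr_dual k R (gr_dual k R C)) n \<longleftrightarrow> x \<in> Deg C n"
proof -
  have C: "graded R C" using assms by (simp add: AG_obj_iff)
  interpret C: graded R C by (rule C)
  interpret K: dual_module k "restrict_scalars R C" "restrict_scalars R (gr_dual k R C)"
    by (rule dual_module_restrict_scalars[OF alg C.module_axioms same_gr_dual])
  have "double_dual_map k R C x \<in> carrier (dual k R (dual k R C))"
    using mod_hom_closed[OF double_dual_map_mod_hom[OF alg C.module_axioms] x] .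
  then have "double_dual_map k R C x \<in> Deg (gr_dual k R (gr_dual k R C)) n \<longleftrightarrow>
      (\<forall>m. m \<noteq> - n \<longrightarrow> (\<forall>f\<in>Deg (gr_dual k R C) m. f x = \<zero>\<^bsub>k\<^esub>))"
    using dual_same[OF same_gr_dual[of C], where k = k and A = R, symmetric] x
    by (auto simp: double_dual_map_def)
  also have "\<dots> \<longleftrightarrow> x \<in> Deg C n"
  proof
    assume van: "\<forall>m. m \<noteq> - n \<longrightarrow> (\<forall>f\<in>Deg (gr_dual k R C) m. f x = \<zero>\<^bsub>k\<^esub>)"
    obtain r where r: "local_dual_basis k (restrict_scalars R C) (carrier (restrict_scalars R C)) {\<zero>\<^bsub>restrict_scalars R C\<^esub>} r"
      using graded_local_dual_basis[OF assms(1)] by auto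
    have "component C x l = \<zero>\<^bsub>C\<^esub>" if l: "l \<noteq> n" for l
    proof -
      have "component C x l \<in> {\<zero>\<^bsub>restrict_scalars R C\<^esub>}"
      proof (rule K.local_dual_basis_torsionless[OF K.carrier_is_submodule K.zero_is_submodule r])
        fix f assume "linear_on k (restrict_scalars R C) (carrier (restrict_scalars R C)) f"
        from K.restrict_dual[OF this] have f: "restrict f (carrier C) \<in> carrier (dual k R C)" by simp
        have "(\<lambda>y\<in>carrier C. restrict f (carrier C) (component C y l)) x = \<zero>\<^bsub>k\<^esub>"
          using van dual_compose_component[OF C f, of l] l by (metis minus_minus)
        then show "f (component C x l) = \<zero>\<^bsub>k\<^esub>" using x C.component_carrier[OF x] by simp
      qed (use C.component_carrier[OF x] in simp)
      then show ?thesis by simp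
    qed
    then have "x = (\<Oplus>\<^bsub>C\<^esub>l\<in>{n}. component C x l)" by (intro C.component_sum_superset[OF x]) auto
    then have "x = component C x n"
      using C.M.finsum_single[of "{n}" n "component C x"] C.component_carrier[OF x] by simp
    then show "x \<in> Deg C n" using C.component_Deg[OF x, of n] by simp
  next
    assume xn: "x \<in> Deg C n"
    show "\<forall>m. m \<noteq> - n \<longrightarrow> (\<forall>f\<in>Deg (gr_dual k R C) m. f x = \<zero>\<^bsub>k\<^esub>)"
    proof (intro allI impI ballI)
      fix m f assume "m \<noteq> - n" and f: "f \<in> Deg (gr_dual k R C) m"
      then have "n \<noteq> - m" by simp
      then show "f x = \<zero>\<^bsub>k\<^esub>" using f xn unfolding gr_dual_simps by blast
    qed
  qed
  finally show ?thesis .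
qed

lemma AG_dualizing:
  "dualizing_functor (AG k R :: ('c, \<lparr>smult :: 'r \<Rightarrow> 'c \<Rightarrow> 'c, Deg :: int \<Rightarrow> 'c set\<rparr>) mod_cat)
     (AG k R) (AG k R) (gr_hom R) (gr_hom R)
     (gr_dual k R) (dual_map k R) (gr_dual k R) (dual_map k R)"
  unfolding gr_hom_eq_fam_hom
proof (rule dualizing_functor_dual[OF alg _ _ _ _ _ AG_contravariant AG_contravariant])
  fix C :: "('r, 'c) graded_module" and n assume C: "C \<in> Obj (AG k R)"
  have "graded R C" using C by (simp add: AG_obj_iff)
  then interpret C: graded R C .
  show "module R C" by (rule C.module_axioms)
  show "Deg C n \<subseteq> carrier C" using C.Deg_carrier by auto
  show "gr_dual k R C \<in> Obj (AG k R)" by (rule gr_dual_obj[OF C])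
  show "\<exists>r. local_dual_basis k (restrict_scalars R C) (carrier C) {\<zero>\<^bsub>C\<^esub>} r"
    by (rule graded_local_dual_basis[OF C])
  show "double_dual_map k R C x \<in> Deg (gr_dual k R (gr_dual k R C)) n \<longleftrightarrow> x \<in> Deg C n"
    if "x \<in> carrier C" for x
    by (rule double_dual_map_Deg_iff[OF C that])
qed (auto simp: same_gr_dual, auto simp: AG_def gr_hom_eq_fam_hom)

end

section \<open>The associated graded functor\<close>

context filtration
begin

abbreviation single :: "int \<Rightarrow> 'b \<Rightarrow> int \<Rightarrow> 'b" where
  "single n x \<equiv> (\<lambda>m. if m = n then x else \<zero>\<^bsub>M\<^esub>)"

lemma cls_single_gr_degree: "x \<in> Fil M n \<Longrightarrow> cls_fam M (single n x) \<in> gr_degree M n"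
proof -
  assume x: "x \<in> Fil M n"
  have "cls_fam M (single n x) m = \<zero>\<^bsub>gr_part M m\<^esub>" if "m \<noteq> n" for m
    using that by (simp add: cls_fam_def gr_part_zero)
  with cls_fam_gr_carrier[OF families_single[OF x]] show ?thesis by (simp add: gr_degree_def)
qed

lemma gr_degreeE:
  assumes "y \<in> gr_degree M n"
  obtains x where "x \<in> Fil M n" "y = cls_fam M (single n x)"
proof
  have y: "y \<in> gr_carrier M" "\<And>m. m \<noteq> n \<Longrightarrow> y m = \<zero>\<^bsub>gr_part M m\<^esub>" using assms by (auto simp: gr_degree_def)
  show "rep (y n) \<in> Fil M n" by (rule gr_carrier_rep[OF y(1)])
  show "y = cls_fam M (single n (rep (y n)))"
  proof
    fix m show "y m = cls_fam M (single n (rep (y n))) m"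
      using gr_carrier_rep(2)[OF y(1), of n] y(2) by (cases "m = n") (auto simp: cls_fam_def gr_part_zero)
  qed
qed

lemma cls_single_zero_iff:
  assumes "x \<in> Fil M n"
  shows "cls_fam M (single n x) = (\<lambda>m. \<zero>\<^bsub>gr_part M m\<^esub>) \<longleftrightarrow> x \<in> Fil M (n + 1)"
proof -
  have "cls_fam M (single n x) = (\<lambda>m. \<zero>\<^bsub>gr_part M m\<^esub>) \<longleftrightarrow> cls n x = cls n \<zero>\<^bsub>M\<^esub>"
    by (auto simp: cls_fam_def gr_part_zero fun_eq_iff)
  then show ?thesis using assms by (simp add: cls_eq_zero_iff)
qed

lemma single_add: "x \<in> carrier M \<Longrightarrow> y \<in> carrier M \<Longrightarrow> (\<lambda>m. single n x m \<oplus>\<^bsub>M\<^esub> single n y m) = single n (x \<oplus>\<^bsub>M\<^esub> y)"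
  by auto

end

context filtered_pair
begin

lemma gr_module_finsum:
  assumes "f \<in> I \<rightarrow> gr_carrier C"
  shows "(\<Oplus>\<^bsub>gr_module A C\<^esub>i\<in>I. f i) n = (\<Oplus>\<^bsub>gr_part C n\<^esub>i\<in>I. f i n)"
  by (rule additive_finsum[where h = "\<lambda>x. x n", OF module.axioms(2)[OF module_gr_module] module.axioms(2)[OF C.module_gr_part]])
    (use assms in \<open>auto simp: gr_module_simps gr_carrier_def\<close>)

text \<open>The projections keep one entry and put zero classes elsewhere. Homogeneous elements are
  classes of families with a single entry, and the convolution of two such families is again one, in
  the sum of the degrees.\<close>

lemma is_graded_gr_module: "is_graded_module (gr_algebra A) (gr_module A C)"
proof (rule is_graded_moduleI[where p = "\<lambda>x n m. if m = n then x n else \<zero>\<^bsub>gr_part C m\<^esub>", OF module_gr_module])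
  interpret G: module "gr_algebra A" "gr_module A C" by (rule module_gr_module)
  interpret P: module A "gr_part C n" for n by (rule C.module_gr_part)
  have carr: "x n \<in> carrier (gr_part C n)" if "x \<in> gr_carrier C" for x n
    using that by (simp add: gr_carrier_def)
  show "additive_subgroup (Deg (gr_module A C) n) (gr_module A C)" for n
  proof (rule additive_subgroupI'[OF G.M.abelian_group_axioms])
    show "\<ominus>\<^bsub>gr_module A C\<^esub> x \<in> Deg (gr_module A C) n" if x: "x \<in> Deg (gr_module A C) n" for x
    proof -
      have xc: "x \<in> carrier (gr_module A C)" using x by (simp add: gr_module_simps gr_degree_def)
      then have ic: "\<ominus>\<^bsub>gr_module A C\<^esub> x \<in> gr_carrier C" using G.M.a_inv_closed by (simp add: gr_module_simps(1))
      have "(\<ominus>\<^bsub>gr_module A C\<^esub> x) m = \<zero>\<^bsub>gr_part C m\<^esub>" if "m \<noteq> n" for m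
      proof -
        have "(\<ominus>\<^bsub>gr_module A C\<^esub> x) m \<oplus>\<^bsub>gr_part C m\<^esub> x m = \<zero>\<^bsub>gr_part C m\<^esub>"
          using fun_cong[OF G.M.l_neg[OF xc], of m] by (simp add: gr_module_simps(2,3))
        moreover have "x m = \<zero>\<^bsub>gr_part C m\<^esub>" using x that by (simp add: gr_module_simps gr_degree_def)
        ultimately show ?thesis using carr[OF ic, of m] by simp
      qed
      with ic show ?thesis by (simp add: gr_module_simps(4) gr_degree_def)
    qed
  qed (use G.M.zero_closed G.M.a_closed in \<open>auto simp: gr_module_simps gr_degree_def\<close>)
  show "a \<odot>\<^bsub>gr_module A C\<^esub> x \<in> Deg (gr_module A C) (m + n)"
    if ax: "a \<in> Deg (gr_algebra A) m" "x \<in> Deg (gr_module A C) n" for m n a x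
  proof -
    have ax': "a \<in> gr_degree A m" "x \<in> gr_degree C n" using ax by (simp_all add: gr_algebra_simps gr_module_simps)
    obtain a0 where a: "a0 \<in> Fil A m" "a = cls_fam A (A.single m a0)" using ax'(1) by (rule A.gr_degreeE)
    obtain x0 where x: "x0 \<in> Fil C n" "x = cls_fam C (C.single n x0)" using ax'(2) by (rule C.gr_degreeE)
    have "a \<odot>\<^bsub>gr_module A C\<^esub> x = cls_fam C (\<lambda>l. a0 \<odot>\<^bsub>C\<^esub> C.single n x0 (l - m))"
      unfolding a(2) x(2) gr_smult_cls_fam[OF A.families_single[OF a(1)] C.families_single[OF x(1)]]
      using conv_single[OF a(1) C.families_single[OF x(1)]] by simp
    also have "(\<lambda>l. a0 \<odot>\<^bsub>C\<^esub> C.single n x0 (l - m)) = C.single (m + n) (a0 \<odot>\<^bsub>C\<^esub> x0)"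
      using A.Fil_carrier[OF a(1)] by (auto simp: fun_eq_iff)
    finally show ?thesis
      using C.cls_single_gr_degree[OF smult_Fil[OF a(1) x(1) refl]] by (simp add: gr_module_simps)
  qed
  fix x :: "int \<Rightarrow> 'c set"
  {
    assume x: "x \<in> carrier (gr_module A C)"
    show pD: "(\<lambda>m. if m = n then x n else \<zero>\<^bsub>gr_part C m\<^esub>) \<in> Deg (gr_module A C) n" for n
    proof -
      have fin: "finite {m. (if m = n then x n else \<zero>\<^bsub>gr_part C m\<^esub>) \<noteq> \<zero>\<^bsub>gr_part C m\<^esub>}"
        by (rule finite_subset[of _ "{n}"]) auto
      have "x n \<in> carrier (gr_part C n)" using x carr by (simp add: gr_module_simps)
      then have "(if m = n then x n else \<zero>\<^bsub>gr_part C m\<^esub>) \<in> carrier (gr_part C m)" for m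
        using P.M.zero_closed by simp
      with fin show ?thesis unfolding gr_module_simps gr_degree_def gr_carrier_def by simp
    qed
    show "\<exists>J. finite J \<and> (\<forall>n. n \<notin> J \<longrightarrow> (\<lambda>m. if m = n then x n else \<zero>\<^bsub>gr_part C m\<^esub>) = \<zero>\<^bsub>gr_module A C\<^esub>) \<and>
        x = (\<Oplus>\<^bsub>gr_module A C\<^esub>n\<in>J. (\<lambda>m. if m = n then x n else \<zero>\<^bsub>gr_part C m\<^esub>))"
    proof (intro exI conjI allI impI)
      let ?J = "{n. x n \<noteq> \<zero>\<^bsub>gr_part C n\<^esub>}"
      show fin: "finite ?J" using x by (simp add: gr_module_simps gr_carrier_def)
      show "(\<lambda>m. if m = n then x n else \<zero>\<^bsub>gr_part C m\<^esub>) = \<zero>\<^bsub>gr_module A C\<^esub>" if "n \<notin> ?J" for n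
        using that by (simp add: gr_module_simps fun_eq_iff)
      show "x = (\<Oplus>\<^bsub>gr_module A C\<^esub>n\<in>?J. (\<lambda>m. if m = n then x n else \<zero>\<^bsub>gr_part C m\<^esub>))"
      proof
        fix m
        have "(\<Oplus>\<^bsub>gr_module A C\<^esub>n\<in>?J. (\<lambda>m. if m = n then x n else \<zero>\<^bsub>gr_part C m\<^esub>)) m =
            (\<Oplus>\<^bsub>gr_part C m\<^esub>n\<in>?J. if m = n then x n else \<zero>\<^bsub>gr_part C m\<^esub>)"
        proof (rule gr_module_finsum[THEN trans])
          show "(\<lambda>n m. if m = n then x n else \<zero>\<^bsub>gr_part C m\<^esub>) \<in> ?J \<rightarrow> gr_carrier C"
            using pD unfolding gr_module_simps gr_degree_def by blast
        qed (rule refl)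
        also have "\<dots> = x m"
        proof (cases "m \<in> ?J")
          case True
          have xm: "x m \<in> carrier (gr_part C m)" using x carr by (simp add: gr_module_simps)
          show ?thesis
            by (rule P.M.finsum_single[where n = m, OF fin True, THEN trans]) (use xm in simp_all)
        next
          case False
          then have "(\<Oplus>\<^bsub>gr_part C m\<^esub>n\<in>?J. if m = n then x n else \<zero>\<^bsub>gr_part C m\<^esub>) = \<zero>\<^bsub>gr_part C m\<^esub>"
            by (intro P.M.add.finprod_one_eqI) auto
          then show ?thesis using False by simp
        qed
        finally show "x m = (\<Oplus>\<^bsub>gr_module A C\<^esub>n\<in>?J. (\<lambda>m. if m = n then x n else \<zero>\<^bsub>gr_part C m\<^esub>)) m" by simp
      qed
    qed
    fix y assume y: "y \<in> carrier (gr_module A C)"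
    show "(\<lambda>m. if m = n then (x \<oplus>\<^bsub>gr_module A C\<^esub> y) n else \<zero>\<^bsub>gr_part C m\<^esub>) =
      (\<lambda>m. if m = n then x n else \<zero>\<^bsub>gr_part C m\<^esub>) \<oplus>\<^bsub>gr_module A C\<^esub> (\<lambda>m. if m = n then y n else \<zero>\<^bsub>gr_part C m\<^esub>)" for n
    proof
      fix m
      interpret Pm: abelian_group "gr_part C m" by (rule P.M.abelian_group_axioms)
      show "(if m = n then (x \<oplus>\<^bsub>gr_module A C\<^esub> y) n else \<zero>\<^bsub>gr_part C m\<^esub>) =
        ((\<lambda>m. if m = n then x n else \<zero>\<^bsub>gr_part C m\<^esub>) \<oplus>\<^bsub>gr_module A C\<^esub> (\<lambda>m. if m = n then y n else \<zero>\<^bsub>gr_part C m\<^esub>)) m"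
        by (cases "m = n") (simp_all add: gr_module_simps(3))
    qed
  }
  show "(\<lambda>m'. if m' = n then x n else \<zero>\<^bsub>gr_part C m'\<^esub>) = (if n = m then x else \<zero>\<^bsub>gr_module A C\<^esub>)"
    if "x \<in> Deg (gr_module A C) m" for m n
  proof
    fix m'
    have "l \<noteq> m \<Longrightarrow> x l = \<zero>\<^bsub>gr_part C l\<^esub>" for l using that by (simp add: gr_module_simps(4) gr_degree_def)
    then show "(if m' = n then x n else \<zero>\<^bsub>gr_part C m'\<^esub>) = (if n = m then x else \<zero>\<^bsub>gr_module A C\<^esub>) m'"
      by (cases "n = m"; cases "m' = n") (simp_all add: gr_module_simps(2))
  qed
qed

lemma gr_module_single_scalar:
  assumes "c \<in> carrier k" "x \<in> Fil C n"
  shows "(c \<odot>\<^bsub>gr_algebra A\<^esub> \<one>\<^bsub>gr_algebra A\<^esub>) \<odot>\<^bsub>gr_module A C\<^esub> cls_fam C (C.single n x) =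
    cls_fam C (C.single n ((c \<odot>\<^bsub>A\<^esub> \<one>\<^bsub>A\<^esub>) \<odot>\<^bsub>C\<^esub> x))"
proof -
  have "c \<odot>\<^bsub>A\<^esub> \<one>\<^bsub>A\<^esub> \<in> carrier A" using assms(1) A.Fil_carrier[OF one_Fil] by simp
  then have "(\<lambda>m. (c \<odot>\<^bsub>A\<^esub> \<one>\<^bsub>A\<^esub>) \<odot>\<^bsub>C\<^esub> C.single n x m) = C.single n ((c \<odot>\<^bsub>A\<^esub> \<one>\<^bsub>A\<^esub>) \<odot>\<^bsub>C\<^esub> x)" by auto
  then show ?thesis using gr_scalar[OF assms(1) C.families_single[OF assms(2)]] by simp
qed

end

text \<open>\<open>gr_map\<close> applies \<open>f\<close> to picked representatives. As
  \<open>f\<close> is additive and respects every step, another choice changes the image by an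
  element one step deeper, so any representing family may be used.\<close>

lemma
  assumes B: "filtration R B" and C: "filtration R C" and f: "f \<in> filt_hom R B C" and \<xi>: "\<xi> \<in> families B"
  shows gr_map_cls_fam: "gr_map B C f (cls_fam B \<xi>) = cls_fam C (\<lambda>n. f (\<xi> n))"
    and filt_hom_families: "(\<lambda>n. f (\<xi> n)) \<in> families C"
proof -
  interpret B: filtration R B by (rule B)
  interpret C: filtration R C by (rule C)
  have fm: "f \<in> mod_hom R B C" and fF: "\<And>x n. x \<in> Fil B n \<Longrightarrow> f x \<in> Fil C n"
    using f by (auto simp: filt_hom_def)
  have f0: "f \<zero>\<^bsub>B\<^esub> = \<zero>\<^bsub>C\<^esub>" by (rule mod_hom_zero[OF fm B.M.abelian_group_axioms C.M.abelian_group_axioms])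
  have f_minus: "f (x \<ominus>\<^bsub>B\<^esub> y) = f x \<ominus>\<^bsub>C\<^esub> f y" if "x \<in> carrier B" "y \<in> carrier B" for x y
    by (rule linear_map_lin_comb(2)[OF B.module_axioms C.module_axioms B.carrier_is_submodule])
      (use that mod_hom_closed[OF fm] mod_hom_add[OF fm] mod_hom_smult[OF fm] in auto)
  show "(\<lambda>n. f (\<xi> n)) \<in> families C"
    by (rule C.familiesI[OF fF[OF B.families_mem[OF \<xi>]] B.families_finite[OF \<xi>]]) (simp add: support_def f0)
  show "gr_map B C f (cls_fam B \<xi>) = cls_fam C (\<lambda>n. f (\<xi> n))"
  proof
    fix n
    let ?x = "rep (cls_fam B \<xi> n)"
    have x: "?x \<in> Fil B n" "B.cls n ?x = B.cls n (\<xi> n)"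
      using B.gr_carrier_rep[OF B.cls_fam_gr_carrier[OF \<xi>], of n] by (auto simp: cls_fam_def)
    note c = B.Fil_carrier[OF x(1)] B.families_carrier[OF \<xi>, of n]
    have "?x \<ominus>\<^bsub>B\<^esub> \<xi> n \<in> Fil B (n + 1)" using x(2) B.cls_eq_iff[OF c] by simp
    then have "f ?x \<ominus>\<^bsub>C\<^esub> f (\<xi> n) \<in> Fil C (n + 1)" using fF f_minus[OF c] by metis
    then have "C.cls n (f ?x) = C.cls n (f (\<xi> n))"
      using C.cls_eq_iff[OF mod_hom_closed[OF fm c(1)] mod_hom_closed[OF fm c(2)]] by simp
    then show "gr_map B C f (cls_fam B \<xi>) n = cls_fam C (\<lambda>n. f (\<xi> n)) n"
      using B.cls_fam_gr_carrier[OF \<xi>] by (simp add: gr_map_def) (simp add: cls_fam_def)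
  qed
qed

section \<open>Objects and morphisms under the associated graded functor\<close>

context filtered_noetherian_algebra
begin

lemma pair: "filtered_module A C \<Longrightarrow> filtered_pair k A C"
  by (simp add: filtered_pair_def filt)

lemma self_filt_pair: "filtered_pair k A (self_filt A)"
  by (rule pair[OF filtered_module_self_filt[OF filt]])

text \<open>The unit of the graded algebra is the class of a family with its single entry in degree
  zero, and so are its multiples by scalars from \<open>k\<close>. The results on graded modules
  thereby apply over \<open>gr_algebra A\<close>.\<close>

sublocale G: graded_noetherian_algebra k "gr_algebra A"
proof -
  interpret S: filtered_pair k A "self_filt A" by (rule self_filt_pair)
  show "graded_noetherian_algebra k (gr_algebra A)"
  proof (intro graded_noetherian_algebra.intro noetherian_algebra.intro graded_noetherian_algebra_axioms.intro
      noeth S.gr_algebra_is_algebra)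
    show "a \<in> carrier (gr_algebra A)" if "a \<in> Deg (gr_algebra A) n" for a n
      using that by (simp add: S.gr_algebra_simps gr_degree_def)
    fix c assume c: "c \<in> carrier k"
    have "c \<odot>\<^bsub>gr_algebra A\<^esub> \<one>\<^bsub>gr_algebra A\<^esub> = cls_fam A (\<lambda>n. c \<odot>\<^bsub>A\<^esub> S.delta n)"
      using S.A.cls_fam_smult[OF c S.delta_families] by (simp only: S.gr_algebra_simps S.gr_one)
    also have "(\<lambda>n. c \<odot>\<^bsub>A\<^esub> S.delta n) = S.A.single 0 (c \<odot>\<^bsub>A\<^esub> \<one>\<^bsub>A\<^esub>)"
      using c by (auto simp: fun_eq_iff)
    finally show "c \<odot>\<^bsub>gr_algebra A\<^esub> \<one>\<^bsub>gr_algebra A\<^esub> \<in> Deg (gr_algebra A) 0"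
      using S.A.cls_single_gr_degree[OF S.A.Fil_smult[OF c S.one_Fil]] by (simp only: S.gr_algebra_simps)
  qed
qed

text \<open>Sending \<open>x\<close> to the family with the single entry \<open>x\<close> in degree
  \<open>n\<close> induces an isomorphism of the quotient of \<open>Fil C n\<close> by
  \<open>Fil C (n + 1)\<close> with the homogeneous part of degree \<open>n\<close>.\<close>

lemma gr_module_obj:
  assumes "C \<in> Obj (AF k A)"
  shows "gr_module A C \<in> Obj (AG k (gr_algebra A))"
proof -
  have fC: "filtered_module A C" "filtered_locally_free C" using assms by (auto simp: AF_obj_iff)
  interpret C: filtered_pair k A C by (rule pair[OF fC(1)])
  have gr: "graded (gr_algebra A) (gr_module A C)" by (rule is_graded_module_graded[OF C.is_graded_gr_module])
  interpret GC: graded "gr_algebra A" "gr_module A C" by (rule gr)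
  obtain a b where a: "\<And>n. n \<le> a \<Longrightarrow> Fil C n = carrier C" and b: "\<And>n. n \<ge> b \<Longrightarrow> Fil C n = {\<zero>\<^bsub>C\<^esub>}"
    using fC(2) by (auto simp: filtered_locally_free_def finite_filtration_def)
  have "gr_degree C n = {\<zero>\<^bsub>gr_module A C\<^esub>}" if n: "n \<notin> {a..b}" for n
  proof -
    \<comment> \<open>Below \<open>a\<close> both steps are all of \<open>C\<close>, and above
      \<open>b\<close> the first one is zero; either way the quotient is trivial.\<close>
    have "Fil C n \<subseteq> Fil C (n + 1)"
      using n a[of n] a[of "n + 1"] b[of n] by (cases "n < a") auto
    have "y = \<zero>\<^bsub>gr_module A C\<^esub>" if "y \<in> gr_degree C n" for y
    proof -
      obtain x where x: "x \<in> Fil C n" "y = cls_fam C (C.C.single n x)" using \<open>y \<in> gr_degree C n\<close> by (rule C.C.gr_degreeE)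
      then have "x \<in> Fil C (n + 1)" using \<open>Fil C n \<subseteq> Fil C (n + 1)\<close> by blast
      then show ?thesis using C.C.cls_single_zero_iff[OF x(1)] x(2) by (simp add: C.gr_module_simps(2))
    qed
    moreover have "\<zero>\<^bsub>gr_module A C\<^esub> \<in> gr_degree C n" using GC.Deg_zero[of n] by (simp add: C.gr_module_simps(4))
    ultimately show ?thesis by blast
  qed
  then have "{n. gr_degree C n \<noteq> {\<zero>\<^bsub>gr_module A C\<^esub>}} \<subseteq> {a..b}" by blast
  from finite_subset[OF this] have "finite {n. Deg (gr_module A C) n \<noteq> {\<zero>\<^bsub>gr_module A C\<^esub>}}"
    by (simp add: C.gr_module_simps(4))
  moreover have "\<exists>r. local_dual_basis k (restrict_scalars (gr_algebra A) (gr_module A C))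
      (Deg (gr_module A C) n) {\<zero>\<^bsub>gr_module A C\<^esub>} r" for n
  proof -
    obtain r where r: "local_dual_basis k (restrict_scalars A C) (Fil C n) (Fil C (n + 1)) r"
      using fC(2) unfolding filtered_locally_free_def by blast
    have "local_dual_basis k (restrict_scalars A C) (Fil C n) (Fil C (n + 1)) r \<longleftrightarrow>
        local_dual_basis k (restrict_scalars (gr_algebra A) (gr_module A C)) (Deg (gr_module A C) n) {\<zero>\<^bsub>gr_module A C\<^esub>} r"
    proof (rule local_dual_basis_transfer[where h = "\<lambda>x. cls_fam C (C.C.single n x)"])
      show "module k (restrict_scalars A C)" by (rule module_restrict_scalars[OF alg C.C.module_axioms])
      show "module k (restrict_scalars (gr_algebra A) (gr_module A C))"
        by (rule module_restrict_scalars[OF G.alg GC.module_axioms])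
      show "submodule (Fil C n) k (restrict_scalars A C)"
        by (rule submodule_restrict_scalars[OF alg C.C.module_axioms C.C.Fil_submodule])
      show "submodule (Deg (gr_module A C) n) k (restrict_scalars (gr_algebra A) (gr_module A C))"
        by (rule G.Deg_submodule[OF gr])
      show "submodule {\<zero>\<^bsub>gr_module A C\<^esub>} k (restrict_scalars (gr_algebra A) (gr_module A C))"
        by (rule G.zero_submodule_restrict[OF GC.module_axioms])
      show "Fil C (n + 1) \<subseteq> Fil C n" by (rule C.C.Fil_step)
      show "{\<zero>\<^bsub>gr_module A C\<^esub>} \<subseteq> Deg (gr_module A C) n" using GC.Deg_zero by simp
      fix x assume x: "x \<in> Fil C n"
      show "cls_fam C (C.C.single n x) \<in> Deg (gr_module A C) n"
        using C.C.cls_single_gr_degree[OF x] by (simp add: C.gr_module_simps(4))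
      show "cls_fam C (C.C.single n x) \<in> {\<zero>\<^bsub>gr_module A C\<^esub>} \<longleftrightarrow> x \<in> Fil C (n + 1)"
        using C.C.cls_single_zero_iff[OF x] by (simp add: C.gr_module_simps(2))
      show "cls_fam C (C.C.single n (x \<oplus>\<^bsub>restrict_scalars A C\<^esub> y)) =
          cls_fam C (C.C.single n x) \<oplus>\<^bsub>restrict_scalars (gr_algebra A) (gr_module A C)\<^esub> cls_fam C (C.C.single n y)"
        if y: "y \<in> Fil C n" for y
        using C.C.cls_fam_add[OF C.C.families_single[OF x] C.C.families_single[OF y]]
          C.C.single_add[OF C.C.Fil_carrier[OF x] C.C.Fil_carrier[OF y], of n]
        unfolding restrict_scalars_simps C.gr_module_simps(3) by simp
      show "cls_fam C (C.C.single n (c \<odot>\<^bsub>restrict_scalars A C\<^esub> x)) =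
          c \<odot>\<^bsub>restrict_scalars (gr_algebra A) (gr_module A C)\<^esub> cls_fam C (C.C.single n x)"
        if c: "c \<in> carrier k" for c
        using C.gr_module_single_scalar[OF c x] unfolding restrict_scalars_simps by simp
    next
      fix y assume "y \<in> Deg (gr_module A C) n"
      then have "y \<in> gr_degree C n" by (simp add: C.gr_module_simps(4))
      then obtain x where "x \<in> Fil C n" "y = cls_fam C (C.C.single n x)" by (rule C.C.gr_degreeE)
      then show "\<exists>x\<in>Fil C n. cls_fam C (C.C.single n x) = y" by blast
    qed
    with r show ?thesis by blast
  qed
  ultimately show ?thesis using gr by (simp add: G.AG_obj_iff)
qed

lemma gr_map_gr_hom:
  assumes B: "filtered_module A B" and C: "filtered_module A C" and f: "f \<in> filt_hom A B C"
  shows "gr_map B C f \<in> gr_hom (gr_algebra A) (gr_module A B) (gr_module A C)"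
proof -
  interpret B: filtered_pair k A B by (rule pair[OF B])
  interpret C: filtered_pair k A C by (rule pair[OF C])
  have fm: "f \<in> mod_hom A B C" using f by (simp add: filt_hom_def)
  note gm = gr_map_cls_fam[OF B.C.filtration_axioms C.C.filtration_axioms f]
    filt_hom_families[OF B.C.filtration_axioms C.C.filtration_axioms f]
  have f0: "f \<zero>\<^bsub>B\<^esub> = \<zero>\<^bsub>C\<^esub>" by (rule mod_hom_zero[OF fm B.C.M.abelian_group_axioms C.C.M.abelian_group_axioms])
  have carrB: "\<exists>\<xi>\<in>families B. x = cls_fam B \<xi>" if "x \<in> carrier (gr_module A B)" for x
    using that by (auto simp: B.gr_module_simps elim: B.C.gr_carrierE)
  have carrA: "\<exists>\<alpha>\<in>families A. x = cls_fam A \<alpha>" if "x \<in> carrier (gr_algebra A)" for x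
    using that by (auto simp: B.gr_algebra_simps elim: B.A.gr_carrierE)
  have "gr_map B C f \<in> mod_hom (gr_algebra A) (gr_module A B) (gr_module A C)"
  proof (rule mod_homI)
    show "gr_map B C f \<in> extensional (carrier (gr_module A B))" by (simp add: gr_map_def B.gr_module_simps)
    fix x assume "x \<in> carrier (gr_module A B)"
    then obtain \<xi> where \<xi>: "\<xi> \<in> families B" "x = cls_fam B \<xi>" using carrB by blast
    show "gr_map B C f x \<in> carrier (gr_module A C)"
      using gm[OF \<xi>(1)] C.C.cls_fam_gr_carrier by (simp add: \<xi>(2) C.gr_module_simps)
    {
      fix y assume "y \<in> carrier (gr_module A B)"
      then obtain \<eta> where \<eta>: "\<eta> \<in> families B" "y = cls_fam B \<eta>" using carrB by blast
      have "gr_map B C f (x \<oplus>\<^bsub>gr_module A B\<^esub> y) = cls_fam C (\<lambda>n. f (\<xi> n \<oplus>\<^bsub>B\<^esub> \<eta> n))"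
        using gm(1)[OF B.C.families_add[OF \<xi>(1) \<eta>(1)]] B.C.cls_fam_add[OF \<xi>(1) \<eta>(1)]
        by (simp add: \<xi>(2) \<eta>(2) B.gr_module_simps)
      also have "(\<lambda>n. f (\<xi> n \<oplus>\<^bsub>B\<^esub> \<eta> n)) = (\<lambda>n. f (\<xi> n) \<oplus>\<^bsub>C\<^esub> f (\<eta> n))"
        using mod_hom_add[OF fm B.C.families_carrier[OF \<xi>(1)] B.C.families_carrier[OF \<eta>(1)]] by simp
      finally show "gr_map B C f (x \<oplus>\<^bsub>gr_module A B\<^esub> y) = gr_map B C f x \<oplus>\<^bsub>gr_module A C\<^esub> gr_map B C f y"
        using C.C.cls_fam_add[OF gm(2)[OF \<xi>(1)] gm(2)[OF \<eta>(1)]] gm(1)[OF \<xi>(1)] gm(1)[OF \<eta>(1)]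
        by (simp add: \<xi>(2) \<eta>(2) C.gr_module_simps)
    }
    fix a assume "a \<in> carrier (gr_algebra A)"
    then obtain \<alpha> where \<alpha>: "\<alpha> \<in> families A" "a = cls_fam A \<alpha>" using carrA by blast
    \<comment> \<open>Linearity over the graded algebra comes down to \<open>f\<close> commuting
      with convolutions, term by term.\<close>
    have "f (B.conv \<alpha> \<xi> n) = C.conv \<alpha> (\<lambda>n. f (\<xi> n)) n" for n
    proof -
      note c = B.C.smult_closed[OF B.A.families_carrier[OF \<alpha>(1)] B.C.families_carrier[OF \<xi>(1)]]
      have "f (B.conv \<alpha> \<xi> n) = (\<Oplus>\<^bsub>C\<^esub>i\<in>support A \<alpha>. f (\<alpha> i \<odot>\<^bsub>B\<^esub> \<xi> (n - i)))"
        unfolding B.conv_def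
        by (rule additive_finsum[OF B.C.M.abelian_group_axioms C.C.M.abelian_group_axioms mod_hom_closed[OF fm] mod_hom_add[OF fm]])
          (use c in auto)
      also have "\<dots> = C.conv \<alpha> (\<lambda>n. f (\<xi> n)) n"
        unfolding C.conv_def
        using mod_hom_smult[OF fm B.A.families_carrier[OF \<alpha>(1)] B.C.families_carrier[OF \<xi>(1)]]
          mod_hom_closed[OF fm c]
        by (intro C.C.M.finsum_cong') auto
      finally show ?thesis .
    qed
    then show "gr_map B C f (a \<odot>\<^bsub>gr_module A B\<^esub> x) = a \<odot>\<^bsub>gr_module A C\<^esub> gr_map B C f x"
      unfolding \<alpha>(2) \<xi>(2) B.gr_smult_cls_fam[OF \<alpha>(1) \<xi>(1)] gm(1)[OF \<xi>(1)]
        C.gr_smult_cls_fam[OF \<alpha>(1) gm(2)[OF \<xi>(1)]] gm(1)[OF B.conv_families[OF \<alpha>(1) \<xi>(1)]] by simp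
  qed
  moreover have "gr_map B C f x \<in> gr_degree C n" if "x \<in> gr_degree B n" for x n
  proof -
    from that obtain x0 where x0: "x0 \<in> Fil B n" "x = cls_fam B (B.C.single n x0)" by (rule B.C.gr_degreeE)
    have "(\<lambda>m. f (B.C.single n x0 m)) = C.C.single n (f x0)" using f0 by auto
    then have "gr_map B C f x = cls_fam C (C.C.single n (f x0))"
      using gm(1)[OF B.C.families_single[OF x0(1)]] x0(2) by simp
    moreover have "f x0 \<in> Fil C n" using f x0(1) by (auto simp: filt_hom_def)
    ultimately show ?thesis using C.C.cls_single_gr_degree by simp
  qed
  ultimately show ?thesis by (auto simp: gr_hom_def B.gr_module_simps(4) C.gr_module_simps(4))
qed

lemma gr_covariant:
  "covariant_functor (AF k A :: ('c, \<lparr>smult :: 'a \<Rightarrow> 'c \<Rightarrow> 'c, Fil :: int \<Rightarrow> 'c set\<rparr>) mod_cat)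
     (AG k (gr_algebra A)) (gr_module A) gr_map"
  unfolding covariant_functor_def
proof (intro conjI ballI)
  show "gr_module A C \<in> Obj (AG k (gr_algebra A))" if "C \<in> Obj (AF k A)" for C :: "('a, 'c) filt_module"
    by (rule gr_module_obj[OF that])
  show "gr_map B C f \<in> Mor (AG k (gr_algebra A)) (gr_module A B) (gr_module A C)"
    if "B \<in> Obj (AF k A)" "C \<in> Obj (AF k A)" "f \<in> Mor (AF k A) B C" for B C :: "('a, 'c) filt_module" and f
    using that gr_map_gr_hom[of B C f] by (simp add: AF_def AG_def)
next
  fix C :: "('a, 'c) filt_module" assume "C \<in> Obj (AF k A)"
  then have fC: "filtered_module A C" by (simp add: AF_obj_iff)
  interpret C: filtered_pair k A C by (rule pair[OF fC])
  have id: "ident C \<in> filt_hom A C C"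
    using ident_mod_hom[OF C.C.module_axioms] C.C.Fil_carrier by (auto simp: filt_hom_def ident_def)
  show "gr_map C C (ident C) = ident (gr_module A C)"
  proof (rule extensionalityI[of _ "gr_carrier C"])
    fix x assume x: "x \<in> gr_carrier C"
    then obtain \<xi> where \<xi>: "\<xi> \<in> families C" "x = cls_fam C \<xi>" by (rule C.C.gr_carrierE)
    have "(\<lambda>n. ident C (\<xi> n)) = \<xi>" using C.C.families_carrier[OF \<xi>(1)] by (simp add: ident_def)
    then show "gr_map C C (ident C) x = ident (gr_module A C) x"
      using gr_map_cls_fam[OF C.C.filtration_axioms C.C.filtration_axioms id \<xi>(1)] x
      by (simp add: \<xi>(2)) (simp add: ident_def C.gr_module_simps)
  qed (simp_all add: gr_map_def ident_def C.gr_module_simps)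
next
  fix B C D :: "('a, 'c) filt_module" and f g
  assume obj: "B \<in> Obj (AF k A)" "C \<in> Obj (AF k A)" "D \<in> Obj (AF k A)"
    and "f \<in> Mor (AF k A) B C" "g \<in> Mor (AF k A) C D"
  then have f: "f \<in> filt_hom A B C" and g: "g \<in> filt_hom A C D" by (simp_all add: AF_def)
  have fB: "filtered_module A B" and fC: "filtered_module A C" and fD: "filtered_module A D"
    using obj by (simp_all add: AF_obj_iff)
  interpret B: filtered_pair k A B by (rule pair[OF fB])
  interpret C: filtered_pair k A C by (rule pair[OF fC])
  interpret D: filtered_pair k A D by (rule pair[OF fD])
  note Bf = B.C.filtration_axioms and Cf = C.C.filtration_axioms and Df = D.C.filtration_axioms
  have gf: "compose (carrier B) g f \<in> filt_hom A B D"
    using compose_mod_hom[of f A B C g D] f g B.C.module_axioms B.C.Fil_carrier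
    by (auto simp: filt_hom_def compose_def image_subset_iff)
  show "gr_map B D (compose (carrier B) g f) = compose (carrier (gr_module A B)) (gr_map C D g) (gr_map B C f)"
    unfolding B.gr_module_simps
  proof (rule extensionalityI[of _ "gr_carrier B"])
    fix x assume x: "x \<in> gr_carrier B"
    then obtain \<xi> where \<xi>: "\<xi> \<in> families B" "x = cls_fam B \<xi>" by (rule B.C.gr_carrierE)
    have "(\<lambda>n. compose (carrier B) g f (\<xi> n)) = (\<lambda>n. g (f (\<xi> n)))"
      using B.C.families_carrier[OF \<xi>(1)] by (simp add: compose_eq)
    then have "gr_map B D (compose (carrier B) g f) x = gr_map C D g (gr_map B C f x)"
      using gr_map_cls_fam[OF Bf Df gf \<xi>(1)] gr_map_cls_fam[OF Bf Cf f \<xi>(1)]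
        gr_map_cls_fam[OF Cf Df g filt_hom_families[OF Bf Cf f \<xi>(1)]] by (simp add: \<xi>(2))
    then show "gr_map B D (compose (carrier B) g f) x = compose (gr_carrier B) (gr_map C D g) (gr_map B C f) x"
      using x by (simp add: compose_eq)
  qed (simp_all add: gr_map_def compose_def)
qed

end

section \<open>Duality and the associated graded functor\<close>

lemma (in abelian_group) minus_add_cancel: "x \<in> carrier G \<Longrightarrow> y \<in> carrier G \<Longrightarrow> (x \<ominus> y) \<oplus> y = x"
  by (simp add: a_minus_def a_assoc l_neg)

lemma (in graded_noetherian_algebra) dual_eq_on_Deg:
  assumes "graded R C" "f \<in> carrier (dual k R C)" "g \<in> carrier (dual k R C)"
    and eq: "\<And>n x. x \<in> Deg C n \<Longrightarrow> f x = g x"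
  shows "f = g"
proof (rule extensionalityI[OF dual_extensional[OF assms(2)] dual_extensional[OF assms(3)]])
  interpret C: graded R C by fact
  fix x assume x: "x \<in> carrier C"
  have J: "n \<notin> support C (component C x) \<Longrightarrow> component C x n = \<zero>\<^bsub>C\<^esub>" for n by (simp add: support_def)
  have "f x = (\<Oplus>\<^bsub>k\<^esub>n\<in>support C (component C x). f (component C x n))"
    by (rule dual_component_sum[OF assms(1,2) x C.component_finite[OF x] J])
  also have "\<dots> = g x"
    unfolding eq[OF C.component_Deg[OF x]]
    by (rule dual_component_sum[OF assms(1,3) x C.component_finite[OF x] J, symmetric])
  finally show "f x = g x" .
qed

locale filtered_dual_pairing = filtered_noetherian_algebra k A
  for k :: "('k, 'l) ring_scheme" and A :: "('k, 'a, 'y) filt_module_scheme" +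
  fixes C :: "('a, 'c, 'z) filt_module_scheme"
  assumes fC: "filtered_module A C"
begin

abbreviation "D \<equiv> filt_dual k A C"

sublocale C: filtered_pair k A C by (rule pair[OF fC])
sublocale D: filtered_pair k A D by (rule pair[OF filtered_module_dual[OF fC]])

lemma
  assumes "F \<in> families D"
  shows families_dual: "F q \<in> carrier (dual k A C)"
    and families_dual_closed: "x \<in> carrier C \<Longrightarrow> F q x \<in> carrier k"
  using D.C.families_mem[OF assms, of q] dual_closed by auto

text \<open>The pairing of \<open>Fil D q\<close> with \<open>Fil C (- q)\<close> descends to
  classes: the difference of \<open>f\<close> and \<open>g\<close> lies one step deeper and vanishes
  on \<open>Fil C (- q)\<close>, and \<open>g\<close> vanishes on the difference of \<open>x\<close>
  and \<open>y\<close>, which lies in \<open>Fil C (1 - q)\<close>.\<close>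

lemma cls_apply_eq:
  assumes f: "f \<in> Fil D q" "g \<in> Fil D q" "D.C.cls q f = D.C.cls q g"
    and x: "x \<in> Fil C (- q)" "y \<in> Fil C (- q)" "C.C.cls (- q) x = C.C.cls (- q) y"
  shows "f x = g y"
proof -
  have fc: "f \<in> carrier D" "g \<in> carrier D" and xc: "x \<in> carrier C" "y \<in> carrier C"
    using f(1,2) x(1,2) D.C.Fil_carrier C.C.Fil_carrier by blast+
  have fd: "f \<in> carrier (dual k A C)" "g \<in> carrier (dual k A C)" using fc by simp_all
  have fg: "f \<ominus>\<^bsub>D\<^esub> g \<in> Fil D (q + 1)" using f(3) D.C.cls_eq_iff[OF fc] by simp
  have "- q + 1 = 1 - q" by simp
  then have xy: "x \<ominus>\<^bsub>C\<^esub> y \<in> Fil C (1 - q)" using x(3) C.C.cls_eq_iff[OF xc] by metis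
  have "f x = ((f \<ominus>\<^bsub>D\<^esub> g) \<oplus>\<^bsub>D\<^esub> g) x" using D.C.M.minus_add_cancel[OF fc] by simp
  also have "\<dots> = (f \<ominus>\<^bsub>D\<^esub> g) x \<oplus>\<^bsub>k\<^esub> g x" using xc by simp
  also have "(f \<ominus>\<^bsub>D\<^esub> g) x = \<zero>\<^bsub>k\<^esub>" using fg x(1) by simp
  also have "\<zero>\<^bsub>k\<^esub> \<oplus>\<^bsub>k\<^esub> g x = g ((x \<ominus>\<^bsub>C\<^esub> y) \<oplus>\<^bsub>C\<^esub> y)"
    using C.C.M.minus_add_cancel[OF xc] dual_closed[OF fd(2) xc(1)] by simp
  also have "\<dots> = g (x \<ominus>\<^bsub>C\<^esub> y) \<oplus>\<^bsub>k\<^esub> g y"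
    by (rule dual_add[OF fd(2) C.C.M.minus_closed[OF xc] xc(2)])
  also have "g (x \<ominus>\<^bsub>C\<^esub> y) = \<zero>\<^bsub>k\<^esub>" using f(2) xy by simp
  finally show ?thesis using dual_closed[OF fd(2) xc(2)] by simp
qed

text \<open>The comparison map written on families. Entry \<open>q\<close> of the functionals meets
  entry \<open>- q\<close> of the elements, as degree \<open>q\<close> of a graded dual is the dual
  of degree \<open>- q\<close>.\<close>

definition pairing :: "(int \<Rightarrow> 'c \<Rightarrow> 'k) \<Rightarrow> (int \<Rightarrow> 'c) \<Rightarrow> 'k" where
  "pairing F \<xi> = (\<Oplus>\<^bsub>k\<^esub>q\<in>support D F. F q (\<xi> (- q)))"

lemma pairing_closed: "F \<in> families D \<Longrightarrow> \<xi> \<in> families C \<Longrightarrow> pairing F \<xi> \<in> carrier k"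
  unfolding pairing_def using families_dual_closed C.C.families_carrier by (intro A.R.finsum_closed) auto

lemma pairing_superset:
  assumes F: "F \<in> families D" and \<xi>: "\<xi> \<in> families C" and J: "finite J" "support D F \<subseteq> J"
  shows "pairing F \<xi> = (\<Oplus>\<^bsub>k\<^esub>q\<in>J. F q (\<xi> (- q)))"
  unfolding pairing_def
proof (rule A.R.finsum_superset[OF J])
  note c = C.C.families_carrier[OF \<xi>]
  show "F q (\<xi> (- q)) \<in> carrier k" for q by (rule families_dual_closed[OF F c])
  show "F q (\<xi> (- q)) = \<zero>\<^bsub>k\<^esub>" if "q \<in> J - support D F" for q
    using that c by (simp add: support_def)
qed

lemma pairing_add_right:
  assumes F: "F \<in> families D" and "\<xi> \<in> families C" "\<eta> \<in> families C"
  shows "pairing F (\<lambda>n. \<xi> n \<oplus>\<^bsub>C\<^esub> \<eta> n) = pairing F \<xi> \<oplus>\<^bsub>k\<^esub> pairing F \<eta>"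
proof -
  note c = C.C.families_carrier[OF assms(2)] C.C.families_carrier[OF assms(3)]
  have "pairing F (\<lambda>n. \<xi> n \<oplus>\<^bsub>C\<^esub> \<eta> n) = (\<Oplus>\<^bsub>k\<^esub>q\<in>support D F. F q (\<xi> (- q)) \<oplus>\<^bsub>k\<^esub> F q (\<eta> (- q)))"
    unfolding pairing_def using dual_add[OF families_dual[OF F] c] families_dual_closed[OF F] c
    by (intro A.R.finsum_cong') auto
  also have "\<dots> = pairing F \<xi> \<oplus>\<^bsub>k\<^esub> pairing F \<eta>"
    unfolding pairing_def using families_dual_closed[OF F] c by (intro A.R.finsum_addf) auto
  finally show ?thesis .
qed

lemma pairing_add_left:
  assumes F: "F \<in> families D" and G: "G \<in> families D" and \<xi>: "\<xi> \<in> families C"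
  shows "pairing (\<lambda>n. F n \<oplus>\<^bsub>D\<^esub> G n) \<xi> = pairing F \<xi> \<oplus>\<^bsub>k\<^esub> pairing G \<xi>"
proof -
  note c = C.C.families_carrier[OF \<xi>]
  let ?J = "support D F \<union> support D G"
  have J: "finite ?J" "support D F \<subseteq> ?J" "support D G \<subseteq> ?J"
    using D.C.families_finite[OF F] D.C.families_finite[OF G] by auto
  have "support D (\<lambda>n. F n \<oplus>\<^bsub>D\<^esub> G n) \<subseteq> ?J"
  proof
    fix n assume n: "n \<in> support D (\<lambda>n. F n \<oplus>\<^bsub>D\<^esub> G n)"
    show "n \<in> ?J"
    proof (rule ccontr)
      assume "n \<notin> ?J"
      then have "F n = \<zero>\<^bsub>D\<^esub>" "G n = \<zero>\<^bsub>D\<^esub>" by (simp_all add: support_def del: filt_dual_simps dual_simps)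
      then show False using n by (simp add: support_def D.C.M.l_zero del: filt_dual_simps dual_simps)
    qed
  qed
  then have "pairing (\<lambda>n. F n \<oplus>\<^bsub>D\<^esub> G n) \<xi> = (\<Oplus>\<^bsub>k\<^esub>q\<in>?J. (F q \<oplus>\<^bsub>D\<^esub> G q) (\<xi> (- q)))"
    by (rule pairing_superset[OF D.C.families_add[OF F G] \<xi> J(1)])
  also have "\<dots> = (\<Oplus>\<^bsub>k\<^esub>q\<in>?J. F q (\<xi> (- q)) \<oplus>\<^bsub>k\<^esub> G q (\<xi> (- q)))"
    using families_dual_closed[OF F] families_dual_closed[OF G] c by (intro A.R.finsum_cong') auto
  also have "\<dots> = pairing F \<xi> \<oplus>\<^bsub>k\<^esub> pairing G \<xi>"
    unfolding pairing_superset[OF F \<xi> J(1,2)] pairing_superset[OF G \<xi> J(1,3)]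
    using families_dual_closed[OF F] families_dual_closed[OF G] c by (intro A.R.finsum_addf) auto
  finally show ?thesis .
qed

lemma pairing_scalar:
  assumes F: "F \<in> families D" and \<xi>: "\<xi> \<in> families C" and c: "c \<in> carrier k"
  shows "pairing F (\<lambda>n. (c \<odot>\<^bsub>A\<^esub> \<one>\<^bsub>A\<^esub>) \<odot>\<^bsub>C\<^esub> \<xi> n) = c \<otimes>\<^bsub>k\<^esub> pairing F \<xi>"
proof -
  note \<xi>c = C.C.families_carrier[OF \<xi>]
  have "pairing F (\<lambda>n. (c \<odot>\<^bsub>A\<^esub> \<one>\<^bsub>A\<^esub>) \<odot>\<^bsub>C\<^esub> \<xi> n) = (\<Oplus>\<^bsub>k\<^esub>q\<in>support D F. c \<otimes>\<^bsub>k\<^esub> F q (\<xi> (- q)))"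
    unfolding pairing_def using dual_smult[OF families_dual[OF F] c \<xi>c] families_dual_closed[OF F \<xi>c] c
    by (intro A.R.finsum_cong') auto
  also have "\<dots> = c \<otimes>\<^bsub>k\<^esub> pairing F \<xi>"
    unfolding pairing_def using families_dual_closed[OF F \<xi>c]
    by (intro A.R.finsum_rdistr[symmetric] D.C.families_finite[OF F] c) auto
  finally show ?thesis .
qed

text \<open>The action on the dual is precomposition, so both sides are the double sum of the
  \<open>F q (\<alpha> i \<xi> (- q - i))\<close>; the left one is organized by
  \<open>m = i + q\<close>. This is the linearity of the comparison map over the graded
  algebra.\<close>

lemma pairing_conv:
  assumes \<alpha>: "\<alpha> \<in> families A" and F: "F \<in> families D" and \<xi>: "\<xi> \<in> families C"
  shows "pairing (D.conv \<alpha> F) \<xi> = pairing F (C.conv \<alpha> \<xi>)"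
proof -
  let ?I = "support A \<alpha>" and ?J = "support D F"
  let ?K = "(\<lambda>(i, j). i + j) ` (?I \<times> ?J)"
  note \<alpha>c = C.A.families_carrier[OF \<alpha>] and \<xi>c = C.C.families_carrier[OF \<xi>]
  have \<alpha>\<xi>: "\<alpha> i \<odot>\<^bsub>C\<^esub> \<xi> n \<in> carrier C" for i n by (rule C.C.smult_closed[OF \<alpha>c \<xi>c])
  have t: "F q (\<alpha> i \<odot>\<^bsub>C\<^esub> \<xi> n) \<in> carrier k" for q i n by (rule families_dual_closed[OF F \<alpha>\<xi>])
  have fin: "finite ?I" "finite ?J" "finite ?K" using C.A.families_finite[OF \<alpha>] D.C.families_finite[OF F] by auto
  have sub: "support D (D.conv \<alpha> F) \<subseteq> ?K"
    using D.conv_eq_zero[OF F \<alpha>] unfolding support_def by blast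
  have "pairing (D.conv \<alpha> F) \<xi> = (\<Oplus>\<^bsub>k\<^esub>m\<in>?K. D.conv \<alpha> F m (\<xi> (- m)))"
    by (rule pairing_superset[OF D.conv_families[OF \<alpha> F] \<xi> fin(3) sub])
  also have "\<dots> = (\<Oplus>\<^bsub>k\<^esub>m\<in>?K. \<Oplus>\<^bsub>k\<^esub>i\<in>?I. F (m - i) (\<alpha> i \<odot>\<^bsub>C\<^esub> \<xi> (- m)))"
  proof (rule A.R.finsum_cong')
    fix m
    have "D.conv \<alpha> F m (\<xi> (- m)) = (\<Oplus>\<^bsub>k\<^esub>i\<in>?I. (\<alpha> i \<odot>\<^bsub>D\<^esub> F (m - i)) (\<xi> (- m)))"
      unfolding D.conv_def
    proof (rule additive_finsum[where h = "\<lambda>f. f (\<xi> (- m))", OF D.C.M.abelian_group_axioms A.R.abelian_group_axioms])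
      show "f (\<xi> (- m)) \<in> carrier k" if "f \<in> carrier D" for f using that dual_closed[OF _ \<xi>c] by simp
      show "(f \<oplus>\<^bsub>D\<^esub> g) (\<xi> (- m)) = f (\<xi> (- m)) \<oplus>\<^bsub>k\<^esub> g (\<xi> (- m))" for f g using \<xi>c by simp
      show "(\<lambda>i. \<alpha> i \<odot>\<^bsub>D\<^esub> F (m - i)) \<in> ?I \<rightarrow> carrier D"
        using D.C.smult_closed[OF \<alpha>c D.C.families_carrier[OF F]] by blast
    qed
    then show "D.conv \<alpha> F m (\<xi> (- m)) = (\<Oplus>\<^bsub>k\<^esub>i\<in>?I. F (m - i) (\<alpha> i \<odot>\<^bsub>C\<^esub> \<xi> (- m)))"
      using \<xi>c by simp
  qed (use t in \<open>auto intro!: A.R.finsum_closed\<close>)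
  also have "\<dots> = (\<Oplus>\<^bsub>k\<^esub>i\<in>?I. \<Oplus>\<^bsub>k\<^esub>m\<in>?K. F (m - i) (\<alpha> i \<odot>\<^bsub>C\<^esub> \<xi> (- m)))"
    by (rule A.R.finsum_swap[OF fin(3,1) t])
  also have "\<dots> = (\<Oplus>\<^bsub>k\<^esub>i\<in>?I. \<Oplus>\<^bsub>k\<^esub>q\<in>?J. F q (\<alpha> i \<odot>\<^bsub>C\<^esub> \<xi> (- q - i)))"
  proof (rule A.R.finsum_cong')
    fix i assume i: "i \<in> ?I"
    let ?g = "\<lambda>m. F (m - i) (\<alpha> i \<odot>\<^bsub>C\<^esub> \<xi> (- m))"
    \<comment> \<open>Outside the translate of the support of \<open>F\<close> the functional
      \<open>F (m - i)\<close> is zero.\<close>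
    have "finsum k ?g ((\<lambda>q. i + q) ` ?J) = finsum k ?g ?K"
    proof (rule A.R.finsum_superset[OF fin(3)])
      show "(\<lambda>q. i + q) ` ?J \<subseteq> ?K" using i by force
      fix m assume m: "m \<in> ?K - (\<lambda>q. i + q) ` ?J"
      have "m - i \<notin> ?J"
      proof
        assume "m - i \<in> ?J"
        then have "i + (m - i) \<in> (\<lambda>q. i + q) ` ?J" by (rule imageI)
        then show False using m by simp
      qed
      then show "?g m = \<zero>\<^bsub>k\<^esub>" using \<alpha>\<xi> by (simp add: support_def)
    qed (rule t)
    moreover have "finsum k ?g ((\<lambda>q. i + q) ` ?J) = (\<Oplus>\<^bsub>k\<^esub>q\<in>?J. ?g (i + q))"
      by (rule A.R.finsum_reindex) (use t in auto)
    moreover have "?g (i + q) = F q (\<alpha> i \<odot>\<^bsub>C\<^esub> \<xi> (- q - i))" for q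
    proof -
      have "i + q - i = q" "- (i + q) = - q - i" by simp_all
      then show ?thesis by (simp only:)
    qed
    ultimately show "finsum k ?g ?K = (\<Oplus>\<^bsub>k\<^esub>q\<in>?J. F q (\<alpha> i \<odot>\<^bsub>C\<^esub> \<xi> (- q - i)))" by (simp only:)
  qed (use t in \<open>auto intro!: A.R.finsum_closed\<close>)
  also have "\<dots> = (\<Oplus>\<^bsub>k\<^esub>q\<in>?J. \<Oplus>\<^bsub>k\<^esub>i\<in>?I. F q (\<alpha> i \<odot>\<^bsub>C\<^esub> \<xi> (- q - i)))"
    by (rule A.R.finsum_swap[OF fin(1,2) t])
  also have "\<dots> = pairing F (C.conv \<alpha> \<xi>)"
    unfolding pairing_def
  proof (rule A.R.finsum_cong')
    fix q
    show "(\<Oplus>\<^bsub>k\<^esub>i\<in>?I. F q (\<alpha> i \<odot>\<^bsub>C\<^esub> \<xi> (- q - i))) = F q (C.conv \<alpha> \<xi> (- q))"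
      unfolding C.conv_def
      by (rule additive_finsum[where h = "F q", symmetric, OF C.C.M.abelian_group_axioms A.R.abelian_group_axioms
          families_dual_closed[OF F] dual_add[OF families_dual[OF F]]])
        (use \<alpha>\<xi> in auto)
  qed (use families_dual_closed[OF F C.C.families_carrier[OF C.conv_families[OF \<alpha> \<xi>]]] in auto)
  finally show ?thesis .
qed

text \<open>Testing on a family with a single entry isolates one functional; injectivity,
  surjectivity and degrees of the comparison map are all read off from such tests.\<close>

lemma pairing_single:
  assumes F: "F \<in> families D" and x: "x \<in> Fil C (- q)"
  shows "pairing F (C.C.single (- q) x) = F q x"
proof -
  let ?J = "insert q (support D F)"
  note xc = C.C.families_carrier[OF C.C.families_single[OF x]]
  have "pairing F (C.C.single (- q) x) = (\<Oplus>\<^bsub>k\<^esub>p\<in>?J. F p (C.C.single (- q) x (- p)))"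
    by (rule pairing_superset[OF F C.C.families_single[OF x]]) (use D.C.families_finite[OF F] in auto)
  also have "\<dots> = F q (C.C.single (- q) x (- q))"
  proof (rule A.R.finsum_single)
    show "F p (C.C.single (- q) x (- p)) = \<zero>\<^bsub>k\<^esub>" if "p \<in> ?J - {q}" for p
      using that additive_map_zero[where f = "F p", OF C.C.M.abelian_group_axioms A.R.abelian_group_axioms
          families_dual_closed[OF F C.C.M.zero_closed] dual_add[OF families_dual[OF F] C.C.M.zero_closed C.C.M.zero_closed]]
      by simp
    show "F q (C.C.single (- q) x (- q)) \<in> carrier k" by (rule families_dual_closed[OF F xc])
  qed (use D.C.families_finite[OF F] in auto)
  finally show ?thesis by simp
qed

text \<open>Removes the picked representatives from the definition of the comparison map: by
  \<open>cls_apply_eq\<close> its terms depend on classes only.\<close>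

lemma comparison_cls_fam:
  assumes F: "F \<in> families D" and \<xi>: "\<xi> \<in> families C"
  shows "gr_dual_comparison k A C (cls_fam D F) (cls_fam C \<xi>) = pairing F \<xi>"
proof -
  let ?S = "{q. cls_fam D F q \<noteq> \<zero>\<^bsub>gr_part D q\<^esub>}"
  have rF: "rep (cls_fam D F q) \<in> Fil D q" "D.C.cls q (rep (cls_fam D F q)) = D.C.cls q (F q)" for q
    using D.C.gr_carrier_rep[OF D.C.cls_fam_gr_carrier[OF F], of q] by (auto simp only: cls_fam_def)
  have rx: "rep (cls_fam C \<xi> n) \<in> Fil C n" "C.C.cls n (rep (cls_fam C \<xi> n)) = C.C.cls n (\<xi> n)" for n
    using C.C.gr_carrier_rep[OF C.C.cls_fam_gr_carrier[OF \<xi>], of n] by (auto simp only: cls_fam_def)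
  have eq: "rep (cls_fam D F q) (rep (cls_fam C \<xi> (- q))) = F q (\<xi> (- q))" for q
    by (rule cls_apply_eq[OF rF(1) D.C.families_mem[OF F] rF(2) rx(1) C.C.families_mem[OF \<xi>] rx(2)])
  have sub: "?S \<subseteq> support D F" by (auto simp only: support_def cls_fam_def D.C.gr_part_zero)
  have "gr_dual_comparison k A C (cls_fam D F) (cls_fam C \<xi>) = (\<Oplus>\<^bsub>k\<^esub>q\<in>?S. F q (\<xi> (- q)))"
    using D.C.cls_fam_gr_carrier[OF F] C.C.cls_fam_gr_carrier[OF \<xi>] by (simp add: gr_dual_comparison_def eq)
  also have "\<dots> = pairing F \<xi>"
    unfolding pairing_def
  proof (rule A.R.finsum_superset[OF D.C.families_finite[OF F] sub])
    show "F q (\<xi> (- q)) \<in> carrier k" for q by (rule families_dual_closed[OF F C.C.families_carrier[OF \<xi>]])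
    fix q assume "q \<in> support D F - ?S"
    then have "D.C.cls q (F q) = D.C.cls q \<zero>\<^bsub>D\<^esub>" by (simp add: cls_fam_def D.C.gr_part_zero del: filt_dual_simps dual_simps)
    \<comment> \<open>A zero class with a possibly nonzero entry: \<open>F q\<close> then vanishes
      on \<open>Fil C (- q)\<close>, which contains the element it is applied to.\<close>
    then have "F q \<in> Fil D (q + 1)" using D.C.cls_eq_zero_iff[OF D.C.families_carrier[OF F]] by blast
    then show "F q (\<xi> (- q)) = \<zero>\<^bsub>k\<^esub>" using C.C.families_mem[OF \<xi>, of "- q"] by simp
  qed
  finally show ?thesis .
qed

end

section \<open>The comparison map as an isomorphism of graded modules\<close>

context filtered_dual_pairing
begin

abbreviation "GA \<equiv> gr_algebra A"
abbreviation "GC \<equiv> gr_module A C"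
abbreviation "GD \<equiv> gr_module A D"
abbreviation "GC_dual \<equiv> gr_dual k GA GC"
abbreviation "comparison \<equiv> gr_dual_comparison k A C"

lemma graded_gr: "graded GA GC"
  by (rule is_graded_module_graded[OF C.is_graded_gr_module])

lemma Deg_gr_moduleE:
  assumes "x \<in> Deg GC n"
  obtains x0 where "x0 \<in> Fil C n" "x = cls_fam C (C.C.single n x0)"
  using assms C.C.gr_degreeE unfolding C.gr_module_simps by blast

lemma carrier_gr_moduleE:
  assumes "x \<in> carrier GC"
  obtains \<xi> where "\<xi> \<in> families C" "x = cls_fam C \<xi>"
  using assms C.C.gr_carrierE unfolding C.gr_module_simps by blast

lemma carrier_gr_dualE:
  assumes "\<phi> \<in> carrier GD"
  obtains F where "F \<in> families D" "\<phi> = cls_fam D F"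
  using assms D.C.gr_carrierE unfolding D.gr_module_simps by blast

lemma comparison_dual:
  assumes F: "F \<in> families D"
  shows "comparison (cls_fam D F) \<in> carrier (dual k GA GC)"
proof (rule dualI)
  show "comparison (cls_fam D F) \<in> extensional (carrier GC)"
    using D.C.cls_fam_gr_carrier[OF F] by (simp add: gr_dual_comparison_def C.gr_module_simps)
  fix x assume "x \<in> carrier GC"
  then obtain \<xi> where \<xi>: "\<xi> \<in> families C" "x = cls_fam C \<xi>" by (rule carrier_gr_moduleE)
  show "comparison (cls_fam D F) x \<in> carrier k"
    unfolding \<xi>(2) comparison_cls_fam[OF F \<xi>(1)] by (rule pairing_closed[OF F \<xi>(1)])
  show "comparison (cls_fam D F) ((c \<odot>\<^bsub>GA\<^esub> \<one>\<^bsub>GA\<^esub>) \<odot>\<^bsub>GC\<^esub> x) =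
      c \<otimes>\<^bsub>k\<^esub> comparison (cls_fam D F) x" if c: "c \<in> carrier k" for c
  proof -
    have "(\<lambda>n. (c \<odot>\<^bsub>A\<^esub> \<one>\<^bsub>A\<^esub>) \<odot>\<^bsub>C\<^esub> \<xi> n) \<in> families C"
      by (rule C.C.families_smult[OF _ \<xi>(1)]) (use c in simp)
    then show ?thesis
      unfolding \<xi>(2) C.gr_scalar[OF c \<xi>(1)] comparison_cls_fam[OF F \<xi>(1)]
      using comparison_cls_fam[OF F] pairing_scalar[OF F \<xi>(1) c] by simp
  qed
  fix y assume "y \<in> carrier GC"
  then obtain \<eta> where \<eta>: "\<eta> \<in> families C" "y = cls_fam C \<eta>" by (rule carrier_gr_moduleE)
  show "comparison (cls_fam D F) (x \<oplus>\<^bsub>GC\<^esub> y) =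
      comparison (cls_fam D F) x \<oplus>\<^bsub>k\<^esub> comparison (cls_fam D F) y"
    unfolding \<xi>(2) \<eta>(2) C.gr_module_simps C.C.cls_fam_add[OF \<xi>(1) \<eta>(1)] comparison_cls_fam[OF F \<xi>(1)]
      comparison_cls_fam[OF F \<eta>(1)] comparison_cls_fam[OF F C.C.families_add[OF \<xi>(1) \<eta>(1)]]
    by (rule pairing_add_right[OF F \<xi>(1) \<eta>(1)])
qed

lemma comparison_single:
  assumes F: "F \<in> families D" and x: "x \<in> Fil C (- q)"
  shows "comparison (cls_fam D F) (cls_fam C (C.C.single (- q) x)) = F q x"
  using comparison_cls_fam[OF F C.C.families_single[OF x]] pairing_single[OF F x] by simp

lemma comparison_mod_hom:
  "comparison \<in> mod_hom GA GD (GC_dual)"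
proof (rule mod_homI)
  show "comparison \<in> extensional (carrier GD)"
    by (simp add: gr_dual_comparison_def D.gr_module_simps)
  fix \<phi> assume "\<phi> \<in> carrier GD"
  then obtain F where F: "F \<in> families D" "\<phi> = cls_fam D F" by (rule carrier_gr_dualE)
  show "comparison \<phi> \<in> carrier (GC_dual)"
    using comparison_dual[OF F(1)] F(2) by simp
  {
    fix \<psi> assume "\<psi> \<in> carrier GD"
    then obtain G where G: "G \<in> families D" "\<psi> = cls_fam D G" by (rule carrier_gr_dualE)
    note FG = D.C.families_add[OF F(1) G(1)]
    show "comparison (\<phi> \<oplus>\<^bsub>GD\<^esub> \<psi>) = comparison \<phi> \<oplus>\<^bsub>GC_dual\<^esub> comparison \<psi>"
      unfolding F(2) G(2) D.gr_module_simps(3) D.C.cls_fam_add[OF F(1) G(1)] G.gr_dual_simps dual_simps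
    proof (rule extensionalityI[of _ "carrier GC"])
      show "comparison (cls_fam D (\<lambda>n. F n \<oplus>\<^bsub>D\<^esub> G n)) \<in> extensional (carrier GC)"
        by (rule dual_extensional[OF comparison_dual[OF FG]])
      fix x assume x: "x \<in> carrier GC"
      then obtain \<xi> where \<xi>: "\<xi> \<in> families C" "x = cls_fam C \<xi>" by (rule carrier_gr_moduleE)
      have "comparison (cls_fam D (\<lambda>n. F n \<oplus>\<^bsub>D\<^esub> G n)) x = comparison (cls_fam D F) x \<oplus>\<^bsub>k\<^esub> comparison (cls_fam D G) x"
        unfolding \<xi>(2) comparison_cls_fam[OF FG \<xi>(1)] comparison_cls_fam[OF F(1) \<xi>(1)] comparison_cls_fam[OF G(1) \<xi>(1)]
        by (rule pairing_add_left[OF F(1) G(1) \<xi>(1)])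
      with x show "comparison (cls_fam D (\<lambda>n. F n \<oplus>\<^bsub>D\<^esub> G n)) x =
          (\<lambda>x\<in>carrier GC. comparison (cls_fam D F) x \<oplus>\<^bsub>k\<^esub> comparison (cls_fam D G) x) x" by simp
    qed simp
  }
  fix a assume "a \<in> carrier GA"
  then have "a \<in> gr_carrier A" by (simp add: C.gr_algebra_simps)
  then obtain \<alpha> where \<alpha>: "\<alpha> \<in> families A" "a = cls_fam A \<alpha>" by (rule C.A.gr_carrierE)
  note aF = D.conv_families[OF \<alpha>(1) F(1)]
  show "comparison (a \<odot>\<^bsub>GD\<^esub> \<phi>) = a \<odot>\<^bsub>GC_dual\<^esub> comparison \<phi>"
    unfolding F(2) \<alpha>(2) D.gr_smult_cls_fam[OF \<alpha>(1) F(1)] G.gr_dual_simps dual_simps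
  proof (rule extensionalityI[of _ "carrier GC"])
    show "comparison (cls_fam D (D.conv \<alpha> F)) \<in> extensional (carrier GC)"
      by (rule dual_extensional[OF comparison_dual[OF aF]])
    fix x assume x: "x \<in> carrier GC"
    then obtain \<xi> where \<xi>: "\<xi> \<in> families C" "x = cls_fam C \<xi>" by (rule carrier_gr_moduleE)
    have "comparison (cls_fam D (D.conv \<alpha> F)) x = comparison (cls_fam D F) (cls_fam A \<alpha> \<odot>\<^bsub>GC\<^esub> x)"
      unfolding \<xi>(2) C.gr_smult_cls_fam[OF \<alpha>(1) \<xi>(1)] comparison_cls_fam[OF aF \<xi>(1)]
        comparison_cls_fam[OF F(1) C.conv_families[OF \<alpha>(1) \<xi>(1)]]
      by (rule pairing_conv[OF \<alpha>(1) F(1) \<xi>(1)])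
    with x show "comparison (cls_fam D (D.conv \<alpha> F)) x =
        (\<lambda>x\<in>carrier GC. comparison (cls_fam D F) (cls_fam A \<alpha> \<odot>\<^bsub>GC\<^esub> x)) x" by simp
  qed simp
qed

text \<open>Equal values on single entries make \<open>F q\<close> and \<open>G q\<close> agree on
  \<open>Fil C (- q)\<close>. Since \<open>1 - (q + 1) = - q\<close>, their difference then lies one
  step deeper, and the classes coincide.\<close>

lemma comparison_inj: "inj_on comparison (carrier GD)"
proof
  fix \<phi> \<psi> assume "\<phi> \<in> carrier GD" "\<psi> \<in> carrier GD" and eq: "comparison \<phi> = comparison \<psi>"
  then obtain F G where F: "F \<in> families D" "\<phi> = cls_fam D F" and G: "G \<in> families D" "\<psi> = cls_fam D G"
    by (metis carrier_gr_dualE)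
  show "\<phi> = \<psi>"
    unfolding F(2) G(2)
  proof (rule D.C.cls_fam_eqI)
    fix q
    note c = D.C.families_carrier[OF F(1), of q] D.C.families_carrier[OF G(1), of q]
    have d: "F q \<ominus>\<^bsub>D\<^esub> G q \<in> carrier D" by (rule D.C.M.minus_closed[OF c])
    have "(F q \<ominus>\<^bsub>D\<^esub> G q) x = \<zero>\<^bsub>k\<^esub>" if x: "x \<in> Fil C (- q)" for x
    proof -
      have xc: "x \<in> carrier C" by (rule C.C.Fil_carrier[OF x])
      have dx: "(F q \<ominus>\<^bsub>D\<^esub> G q) x \<in> carrier k" "G q x \<in> carrier k"
        using d c(2) dual_closed[OF _ xc] by simp_all
      have "((F q \<ominus>\<^bsub>D\<^esub> G q) \<oplus>\<^bsub>D\<^esub> G q) x = G q x"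
        using comparison_single[OF F(1) x] comparison_single[OF G(1) x] eq F(2) G(2) D.C.M.minus_add_cancel[OF c] by simp
      then have "(F q \<ominus>\<^bsub>D\<^esub> G q) x \<oplus>\<^bsub>k\<^esub> G q x = G q x" using xc by simp
      then show ?thesis using A.R.add.r_cancel_one[OF dx(2,1)] by simp
    qed
    then show "F q \<ominus>\<^bsub>D\<^esub> G q \<in> Fil D (q + 1)" using d by simp
  qed (use D.C.families_carrier[OF F(1)] D.C.families_carrier[OF G(1)] in blast)+
qed

text \<open>If the image has degree \<open>n\<close>, tests on single entries in degree
  \<open>- q\<close> with \<open>q \<noteq> n\<close> show that \<open>F q\<close> vanishes on
  \<open>Fil C (- q)\<close>, so its class is zero. This is the direction that makes the isomorphism
  strict.\<close>

lemma comparison_Deg_iff: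
  assumes "\<phi> \<in> carrier GD"
  shows "comparison \<phi> \<in> Deg (GC_dual) n \<longleftrightarrow> \<phi> \<in> Deg GD n"
proof
  obtain F where F: "F \<in> families D" "\<phi> = cls_fam D F" using assms by (rule carrier_gr_dualE)
  assume "\<phi> \<in> Deg GD n"
  then have "\<phi> \<in> gr_degree D n" by (simp add: D.gr_module_simps)
  then obtain f where f: "f \<in> Fil D n" "\<phi> = cls_fam D (D.C.single n f)" by (rule D.C.gr_degreeE)
  have "comparison \<phi> x = \<zero>\<^bsub>k\<^esub>" if m: "m \<noteq> - n" "x \<in> Deg GC m" for m x
  proof -
    obtain x0 where x0: "x0 \<in> Fil C m" "x = cls_fam C (C.C.single m x0)" using m(2) by (rule Deg_gr_moduleE)
    have "- m \<noteq> n" using m(1) by auto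
    then show ?thesis
      using comparison_single[OF D.C.families_single[OF f(1)], of x0 "- m"] x0 f(2) C.C.Fil_carrier[OF x0(1)] by simp
  qed
  then show "comparison \<phi> \<in> Deg (GC_dual) n"
    using comparison_dual[OF F(1)] F(2) by simp
next
  obtain F where F: "F \<in> families D" "\<phi> = cls_fam D F" using assms by (rule carrier_gr_dualE)
  assume "comparison \<phi> \<in> Deg (GC_dual) n"
  then have z: "comparison \<phi> x = \<zero>\<^bsub>k\<^esub>" if "m \<noteq> - n" "x \<in> Deg GC m" for m x
    using that unfolding G.gr_dual_simps by blast
  have "cls_fam D F q = \<zero>\<^bsub>gr_part D q\<^esub>" if q: "q \<noteq> n" for q
  proof -
    have "F q x = \<zero>\<^bsub>k\<^esub>" if x: "x \<in> Fil C (- q)" for x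
    proof -
      have "cls_fam C (C.C.single (- q) x) \<in> Deg GC (- q)"
        using C.C.cls_single_gr_degree[OF x] by (simp add: C.gr_module_simps)
      then show ?thesis using z[of "- q"] q comparison_single[OF F(1) x] F(2) by simp
    qed
    then have "F q \<in> Fil D (q + 1)" using families_dual[OF F(1)] by simp
    then show ?thesis
      using D.C.cls_eq_zero_iff[OF D.C.families_carrier[OF F(1)]] unfolding cls_fam_def D.C.gr_part_zero by blast
  qed
  then show "\<phi> \<in> Deg GD n"
    using D.C.cls_fam_gr_carrier[OF F(1)] F(2) unfolding D.gr_module_simps gr_degree_def by blast
qed

text \<open>In each degree \<Psi> gives a functional on \<open>Fil C n\<close> vanishing on
  \<open>Fil C (n + 1)\<close>. It extends to \<open>C\<close> because the quotient of
  \<open>C\<close> by \<open>Fil C n\<close> is locally free, and its vanishing on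
  \<open>Fil C (n + 1)\<close> places the extension in step \<open>- n\<close> of the dual.\<close>

lemma comparison_surj:
  assumes free: "filtered_locally_free C" and \<Psi>: "\<Psi> \<in> carrier (dual k GA GC)"
  shows "\<exists>\<phi>\<in>carrier GD. comparison \<phi> = \<Psi>"
proof -
  interpret K: dual_module k "restrict_scalars A C" "restrict_scalars A D"
    by (rule dual_module_restrict_scalars[OF alg C.C.module_axioms same_filt_dual])
  have sub: "submodule (Fil C n) k (restrict_scalars A C)" for n
    by (rule submodule_restrict_scalars[OF alg C.C.module_axioms C.C.Fil_submodule])
  define g where "g n x = \<Psi> (cls_fam C (C.C.single n x))" for n x
  have mem: "cls_fam C (C.C.single n x) \<in> carrier GC" if "x \<in> Fil C n" for n x
    using C.C.cls_fam_gr_carrier[OF C.C.families_single[OF that]] by (simp add: C.gr_module_simps)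
  have g: "linear_on k (restrict_scalars A C) (Fil C n) (g n)" for n
  proof (rule linear_onI, unfold restrict_scalars_simps)
    fix x assume x: "x \<in> Fil C n"
    show "g n x \<in> carrier k" unfolding g_def by (rule dual_closed[OF \<Psi> mem[OF x]])
    show "g n ((c \<odot>\<^bsub>A\<^esub> \<one>\<^bsub>A\<^esub>) \<odot>\<^bsub>C\<^esub> x) = c \<otimes>\<^bsub>k\<^esub> g n x" if c: "c \<in> carrier k" for c
      unfolding g_def C.gr_module_single_scalar[OF c x, symmetric] by (rule dual_smult[OF \<Psi> c mem[OF x]])
    fix y assume y: "y \<in> Fil C n"
    have "cls_fam C (C.C.single n (x \<oplus>\<^bsub>C\<^esub> y)) = cls_fam C (C.C.single n x) \<oplus>\<^bsub>GC\<^esub> cls_fam C (C.C.single n y)"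
      unfolding C.gr_module_simps C.C.cls_fam_add[OF C.C.families_single[OF x] C.C.families_single[OF y]]
        C.C.single_add[OF C.C.Fil_carrier[OF x] C.C.Fil_carrier[OF y]] ..
    then show "g n (x \<oplus>\<^bsub>C\<^esub> y) = g n x \<oplus>\<^bsub>k\<^esub> g n y"
      unfolding g_def using dual_add[OF \<Psi> mem[OF x] mem[OF y]] by simp
  qed
  have g0: "g n x = \<zero>\<^bsub>k\<^esub>" if x: "x \<in> Fil C (n + 1)" for n x
  proof -
    have xn: "x \<in> Fil C n" using x C.C.Fil_step by blast
    have "cls_fam C (C.C.single n x) = \<zero>\<^bsub>GC\<^esub>"
      unfolding C.gr_module_simps using C.C.cls_single_zero_iff[OF xn] x by blast
    then show ?thesis unfolding g_def using G.dual_zero[OF C.module_gr_module \<Psi>] by simp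
  qed
  have "\<exists>h\<in>carrier D. \<forall>x\<in>Fil C n. h x = g n x" for n
  proof -
    obtain r where r: "local_dual_basis k (restrict_scalars A C) (carrier (restrict_scalars A C)) (Fil C n) r"
      using filtered_locally_free_carrier(1)[OF free, of n] by auto
    obtain h where h: "linear_on k (restrict_scalars A C) (carrier (restrict_scalars A C)) h"
      "\<And>x. x \<in> Fil C n \<Longrightarrow> h x = g n x"
      by (rule K.extend_functional[OF K.carrier_is_submodule sub _ r g]) (use C.C.Fil_carrier in auto)
    have "restrict h (carrier C) \<in> carrier D" using K.restrict_dual[OF h(1)] by simp
    moreover have "restrict h (carrier C) x = g n x" if "x \<in> Fil C n" for x
      using h(2)[OF that] C.C.Fil_carrier[OF that] by simp
    ultimately show ?thesis by blast
  qed
  then obtain h where h: "\<And>n. h n \<in> carrier D" "\<And>n x. x \<in> Fil C n \<Longrightarrow> h n x = g n x" by metis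
  obtain a b where a: "\<And>n. n \<le> a \<Longrightarrow> Fil C n = carrier C" and b: "\<And>n. n \<ge> b \<Longrightarrow> Fil C n = {\<zero>\<^bsub>C\<^esub>}"
    using free by (auto simp: filtered_locally_free_def finite_filtration_def)
  \<comment> \<open>Outside \<open>{a..b}\<close> the extensions are replaced by zero to make the
    family finite. Nothing is lost, since there every element of a step already lies in the next
    one, on which \<open>g\<close> vanishes.\<close>
  define F where "F q = (if - q \<in> {a..b} then h (- q) else \<zero>\<^bsub>D\<^esub>)" for q
  have Fg: "F q x = g (- q) x" if x: "x \<in> Fil C (- q)" for q x
  proof (cases "- q \<in> {a..b}")
    case False
    have "Fil C (- q) \<subseteq> Fil C (- q + 1)"
      using False a[of "- q"] a[of "- q + 1"] b[of "- q"] by (cases "- q < a") auto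
    then have "g (- q) x = \<zero>\<^bsub>k\<^esub>" using x by (intro g0) blast
    moreover have "F q = \<zero>\<^bsub>D\<^esub>" unfolding F_def using False by (rule if_not_P)
    ultimately show ?thesis using C.C.Fil_carrier[OF x] by simp
  qed (use h(2)[OF x] in \<open>simp add: F_def\<close>)
  have Fc: "F q \<in> carrier D" for q
    using h(1) D.C.M.zero_closed by (simp add: F_def del: filt_dual_simps dual_simps)
  have F: "F \<in> families D"
  proof (rule D.C.familiesI)
    show "F q \<in> Fil D q" for q
    proof -
      have "F q x = \<zero>\<^bsub>k\<^esub>" if x: "x \<in> Fil C (1 - q)" for x
      proof -
        \<comment> \<open>The element lies one step deeper than \<open>Fil C (- q)\<close>: there
          \<open>F q\<close> agrees with \<open>g (- q)\<close>, which vanishes.\<close>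
        have "x \<in> Fil C (- q + 1)" using x by simp
        then show ?thesis using Fg[of x q] g0[of x "- q"] C.C.Fil_step[of "- q"] by auto
      qed
      then show ?thesis using Fc by simp
    qed
    show "finite (uminus ` {a..b})" by simp
    show "F q = \<zero>\<^bsub>D\<^esub>" if "q \<notin> uminus ` {a..b}" for q
    proof -
      have "- q \<notin> {a..b}" using that by (metis imageI minus_minus)
      then show ?thesis unfolding F_def by (rule if_not_P)
    qed
  qed
  have "comparison (cls_fam D F) = \<Psi>"
  proof (rule G.dual_eq_on_Deg[OF graded_gr comparison_dual[OF F] \<Psi>])
    fix n x assume "x \<in> Deg GC n"
    then obtain x0 where x0: "x0 \<in> Fil C n" "x = cls_fam C (C.C.single n x0)" by (rule Deg_gr_moduleE)
    then show "comparison (cls_fam D F) x = \<Psi> x"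
      using comparison_single[OF F, of x0 "- n"] Fg[of x0 "- n"] by (simp add: g_def)
  qed
  moreover have "cls_fam D F \<in> carrier GD"
    using D.C.cls_fam_gr_carrier[OF F] by (simp add: D.gr_module_simps)
  ultimately show ?thesis by blast
qed

lemma comparison_iso:
  assumes "filtered_locally_free C"
  shows "iso_via (gr_hom GA) (gr_hom GA) GD
    (GC_dual) comparison"
  unfolding gr_hom_eq_fam_hom
proof (rule iso_via_fam_hom[where S = Deg and T = Deg, OF comparison_mod_hom])
  show "bij_betw comparison (carrier GD) (carrier (GC_dual))"
    unfolding bij_betw_def
  proof (intro conjI comparison_inj equalityI subsetI)
    show "\<Psi> \<in> comparison ` carrier GD" if "\<Psi> \<in> carrier (GC_dual)" for \<Psi>
      using comparison_surj[OF assms, of \<Psi>] that by auto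
  qed (use mod_hom_closed[OF comparison_mod_hom] in blast)
  show "comparison \<phi> \<in> Deg (GC_dual) n \<longleftrightarrow> \<phi> \<in> Deg GD n"
    if "\<phi> \<in> carrier GD" for \<phi> n by (rule comparison_Deg_iff[OF that])
  show "Deg GD n \<subseteq> carrier GD" for n
    by (auto simp: D.gr_module_simps gr_degree_def)
  show "Deg (GC_dual) n \<subseteq> carrier (GC_dual)" for n
    by auto
  show "module GA GD" by (rule D.module_gr_module)
qed

end

context filtered_noetherian_algebra
begin

text \<open>Both composites, applied to the class of \<open>F\<close> and evaluated at the class of
  \<xi>, give the sum of the \<open>F q (f (\<xi> (- q)))\<close>; the isomorphisms on objects are
  \<open>comparison_iso\<close>.\<close>

lemma gr_dual_nat_iso:
  "nat_iso_contravariant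
     (AF k A :: ('c, \<lparr>smult :: 'a \<Rightarrow> 'c \<Rightarrow> 'c, Fil :: int \<Rightarrow> 'c set\<rparr>) mod_cat)
     (gr_hom (gr_algebra A)) (gr_hom (gr_algebra A))
     (\<lambda>C. gr_module A (filt_dual k A C))
     (\<lambda>B C f. gr_map (filt_dual k A C) (filt_dual k A B) (dual_map k A B C f))
     (\<lambda>C. gr_dual k (gr_algebra A) (gr_module A C))
     (\<lambda>B C f. dual_map k (gr_algebra A) (gr_module A B) (gr_module A C) (gr_map B C f))
     (gr_dual_comparison k A)"
  unfolding nat_iso_contravariant_def
proof (intro conjI ballI)
  have loc: "filtered_dual_pairing k A C" if "C \<in> Obj (AF k A)" for C :: "('a, 'c) filt_module"
    using that filtered_noetherian_algebra_axioms
    by (simp add: filtered_dual_pairing_def filtered_dual_pairing_axioms_def AF_obj_iff)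
  show "iso_via (gr_hom (gr_algebra A)) (gr_hom (gr_algebra A)) (gr_module A (filt_dual k A C))
      (gr_dual k (gr_algebra A) (gr_module A C)) (gr_dual_comparison k A C)"
    if "C \<in> Obj (AF k A)" for C :: "('a, 'c) filt_module"
    using filtered_dual_pairing.comparison_iso[OF loc[OF that]] that by (simp add: AF_obj_iff)
  fix B C :: "('a, 'c) filt_module" and f
  assume obj: "B \<in> Obj (AF k A)" "C \<in> Obj (AF k A)" and fM: "f \<in> Mor (AF k A) B C"
  interpret B: filtered_dual_pairing k A B by (rule loc[OF obj(1)])
  interpret C: filtered_dual_pairing k A C by (rule loc[OF obj(2)])
  have f: "f \<in> filt_hom A B C" using fM by (simp add: AF_def)
  have f': "dual_map k A B C f \<in> filt_hom A (filt_dual k A C) (filt_dual k A B)"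
  proof -
    have "dual_map k A B C f \<in> Mor (AF k A) (filt_dual k A C) (filt_dual k A B)"
      using AF_contravariant obj fM unfolding contravariant_functor_def by blast
    then show ?thesis by (simp only: AF_def mod_cat.simps)
  qed
  then have f'm: "dual_map k A B C f \<in> mod_hom A (filt_dual k A C) (filt_dual k A B)" by (simp only: filt_hom_def mem_Collect_eq)
  note gf = gr_map_cls_fam[OF B.C.C.filtration_axioms C.C.C.filtration_axioms f]
    filt_hom_families[OF B.C.C.filtration_axioms C.C.C.filtration_axioms f]
  note gf' = gr_map_cls_fam[OF C.D.C.filtration_axioms B.D.C.filtration_axioms f']
    filt_hom_families[OF C.D.C.filtration_axioms B.D.C.filtration_axioms f']
  have grf: "gr_map B C f \<in> mod_hom (gr_algebra A) (gr_module A B) (gr_module A C)"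
    using gr_map_gr_hom[OF B.fC C.fC f] by (simp add: gr_hom_def)
  show "compose (carrier (gr_module A (filt_dual k A C))) (gr_dual_comparison k A B)
        (gr_map (filt_dual k A C) (filt_dual k A B) (dual_map k A B C f)) =
      compose (carrier (gr_module A (filt_dual k A C)))
        (dual_map k (gr_algebra A) (gr_module A B) (gr_module A C) (gr_map B C f)) (gr_dual_comparison k A C)"
  proof (rule extensionalityI[of _ "carrier (gr_module A (filt_dual k A C))"])
    fix \<phi> assume \<phi>: "\<phi> \<in> carrier (gr_module A (filt_dual k A C))"
    then obtain F where F: "F \<in> families (filt_dual k A C)" "\<phi> = cls_fam (filt_dual k A C) F"
      by (rule C.carrier_gr_dualE)
    have "gr_dual_comparison k A B (cls_fam (filt_dual k A B) (\<lambda>n. dual_map k A B C f (F n))) =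
        compose (carrier (gr_module A B)) (gr_dual_comparison k A C (cls_fam (filt_dual k A C) F)) (gr_map B C f)"
    proof (rule extensionalityI[of _ "carrier (gr_module A B)"])
      fix x assume x: "x \<in> carrier (gr_module A B)"
      then obtain \<xi> where \<xi>: "\<xi> \<in> families B" "x = cls_fam B \<xi>" by (rule B.carrier_gr_moduleE)
      let ?S = "support (filt_dual k A C) F"
      have app: "dual_map k A B C f (F q) y = F q (f y)" if "y \<in> carrier B" for q y
        using C.families_dual[OF F(1)] that by (simp add: dual_map_def compose_eq)
      have z: "dual_map k A B C f \<zero>\<^bsub>filt_dual k A C\<^esub> = \<zero>\<^bsub>filt_dual k A B\<^esub>"
        by (rule mod_hom_zero[OF f'm C.D.C.M.abelian_group_axioms B.D.C.M.abelian_group_axioms])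
      \<comment> \<open>Applying the dual of \<open>f\<close> entry by entry can only shrink the
        support, so the pairing on \<open>B\<close> may be summed over the support of
        \<open>F\<close>.\<close>
      have "B.pairing (\<lambda>n. dual_map k A B C f (F n)) \<xi> = (\<Oplus>\<^bsub>k\<^esub>q\<in>?S. dual_map k A B C f (F q) (\<xi> (- q)))"
        by (rule B.pairing_superset[OF gf'(2)[OF F(1)] \<xi>(1) C.D.C.families_finite[OF F(1)]])
          (use z in \<open>auto simp only: support_def\<close>)
      also have "\<dots> = C.pairing F (\<lambda>n. f (\<xi> n))"
        unfolding C.pairing_def app[OF B.C.C.families_carrier[OF \<xi>(1)]] ..
      finally have "B.pairing (\<lambda>n. dual_map k A B C f (F n)) \<xi> = C.pairing F (\<lambda>n. f (\<xi> n))" .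
      then show "gr_dual_comparison k A B (cls_fam (filt_dual k A B) (\<lambda>n. dual_map k A B C f (F n))) x =
          compose (carrier (gr_module A B)) (gr_dual_comparison k A C (cls_fam (filt_dual k A C) F)) (gr_map B C f) x"
        unfolding compose_eq[OF x] unfolding \<xi>(2) gf(1)[OF \<xi>(1)] B.comparison_cls_fam[OF gf'(2)[OF F(1)] \<xi>(1)]
          C.comparison_cls_fam[OF F(1) gf(2)[OF \<xi>(1)]] .
    qed (use dual_extensional[OF B.comparison_dual[OF gf'(2)[OF F(1)]]] in simp_all)
    then show "compose (carrier (gr_module A (filt_dual k A C))) (gr_dual_comparison k A B)
        (gr_map (filt_dual k A C) (filt_dual k A B) (dual_map k A B C f)) \<phi> =
      compose (carrier (gr_module A (filt_dual k A C)))
        (dual_map k (gr_algebra A) (gr_module A B) (gr_module A C) (gr_map B C f)) (gr_dual_comparison k A C) \<phi>"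
      unfolding compose_eq[OF \<phi>] unfolding F(2) gf'(1)[OF F(1)]
      using C.comparison_dual[OF F(1)] by (simp add: dual_map_def)
  qed simp_all
qed

end

section \<open>Filtered modules of homomorphisms\<close>

lemma filt_Hom_simps [simp]:
  "carrier (filt_Hom A B C) = mod_hom A B C"
  "zero (filt_Hom A B C) = hom_zero B C"
  "add (filt_Hom A B C) = hom_add B C"
  "a \<odot>\<^bsub>filt_Hom A B C\<^esub> f = (\<lambda>x\<in>carrier B. a \<odot>\<^bsub>C\<^esub> f x)"
  "Fil (filt_Hom A B C) p = {f \<in> mod_hom A B C. \<forall>n. f ` Fil B n \<subseteq> Fil C (n + p)}"
  by (simp_all add: filt_Hom_def)

lemma module_filt_Hom:
  assumes "module R B" "module R C"
  shows "module R (filt_Hom R B C)"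
proof -
  interpret B: module R B by fact
  interpret C: module R C by fact
  have cl: "f x \<in> carrier C" if "f \<in> mod_hom R B C" "x \<in> carrier B" for f x
    by (rule mod_hom_closed[OF that])
  have r: "restrict f (carrier B) = f" if "f \<in> mod_hom R B C" for f
    using mod_hom_ext[OF that] by (rule extensional_restrict)
  have smult: "(\<lambda>x\<in>carrier B. a \<odot>\<^bsub>C\<^esub> f x) \<in> mod_hom R B C" if a: "a \<in> carrier R" and f: "f \<in> mod_hom R B C" for a f
  proof (rule mod_homI)
    fix b x assume b: "b \<in> carrier R" and x: "x \<in> carrier B"
    \<comment> \<open>Commutativity of the scalars is what makes the multiple of \<open>f\<close> by
      \<open>a\<close> linear again.\<close>
    have "a \<odot>\<^bsub>C\<^esub> (b \<odot>\<^bsub>C\<^esub> f x) = b \<odot>\<^bsub>C\<^esub> (a \<odot>\<^bsub>C\<^esub> f x)"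
      using a b cl[OF f x] by (simp add: C.smult_assoc1[symmetric] B.R.m_comm)
    then show "(\<lambda>x\<in>carrier B. a \<odot>\<^bsub>C\<^esub> f x) (b \<odot>\<^bsub>B\<^esub> x) = b \<odot>\<^bsub>C\<^esub> (\<lambda>x\<in>carrier B. a \<odot>\<^bsub>C\<^esub> f x) x"
      using b x mod_hom_smult[OF f b x] by simp
  qed (use a cl[OF f] mod_hom_add[OF f] in \<open>auto simp: C.smult_r_distr\<close>)
  interpret G: comm_group "\<lparr>carrier = mod_hom R B C, mult = hom_add B C, one = hom_zero B C\<rparr>"
    by (rule abelian_group_mod_hom[OF assms order_refl hom_zero_mod_hom[OF assms]
        hom_add_mod_hom[OF _ _ assms] hom_minus_mod_hom[OF _ assms]])
  have "abelian_group (filt_Hom R B C)"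
  proof (rule abelian_groupI)
    show "\<exists>g\<in>carrier (filt_Hom R B C). g \<oplus>\<^bsub>filt_Hom R B C\<^esub> f = \<zero>\<^bsub>filt_Hom R B C\<^esub>"
      if "f \<in> carrier (filt_Hom R B C)" for f
      using that G.l_inv_ex[of f] by simp
  qed (use G.m_closed G.one_closed G.m_assoc G.m_comm G.l_one in simp_all)
  then show ?thesis
  proof (intro moduleI B.R.is_cring)
    fix a f assume a: "a \<in> carrier R" and "f \<in> carrier (filt_Hom R B C)"
    then have f: "f \<in> mod_hom R B C" by simp
    show "a \<odot>\<^bsub>filt_Hom R B C\<^esub> f \<in> carrier (filt_Hom R B C)" using smult[OF a f] by simp
    {
      fix b assume b: "b \<in> carrier R"
      show "(a \<oplus>\<^bsub>R\<^esub> b) \<odot>\<^bsub>filt_Hom R B C\<^esub> f = a \<odot>\<^bsub>filt_Hom R B C\<^esub> f \<oplus>\<^bsub>filt_Hom R B C\<^esub> b \<odot>\<^bsub>filt_Hom R B C\<^esub> f"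
        using a b cl[OF f] by (simp add: hom_add_def C.smult_l_distr cong: restrict_cong)
      show "(a \<otimes>\<^bsub>R\<^esub> b) \<odot>\<^bsub>filt_Hom R B C\<^esub> f = a \<odot>\<^bsub>filt_Hom R B C\<^esub> (b \<odot>\<^bsub>filt_Hom R B C\<^esub> f)"
        using a b cl[OF f] by (simp add: C.smult_assoc1 cong: restrict_cong)
    }
    fix g assume "g \<in> carrier (filt_Hom R B C)"
    then have g: "g \<in> mod_hom R B C" by simp
    show "a \<odot>\<^bsub>filt_Hom R B C\<^esub> (f \<oplus>\<^bsub>filt_Hom R B C\<^esub> g) = a \<odot>\<^bsub>filt_Hom R B C\<^esub> f \<oplus>\<^bsub>filt_Hom R B C\<^esub> a \<odot>\<^bsub>filt_Hom R B C\<^esub> g"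
      using a cl[OF f] cl[OF g] by (simp add: hom_add_def C.smult_r_distr cong: restrict_cong)
  next
    fix f assume "f \<in> carrier (filt_Hom R B C)"
    then have f: "f \<in> mod_hom R B C" by simp
    show "\<one>\<^bsub>R\<^esub> \<odot>\<^bsub>filt_Hom R B C\<^esub> f = f"
      using r[OF f] cl[OF f] by (simp cong: restrict_cong)
  qed
qed

context filtered_noetherian_algebra
begin

lemma filtered_module_filt_Hom:
  assumes "filtered_module A B" "filtered_module A C"
  shows "filtered_module A (filt_Hom A B C)"
proof -
  interpret B: filtration A B by (rule filtered_module_filtration[OF assms(1)])
  interpret C: filtration A C by (rule filtered_module_filtration[OF assms(2)])
  let ?H = "filt_Hom A B C"
  have H: "module A ?H" by (rule module_filt_Hom[OF B.module_axioms C.module_axioms])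
  interpret H: module A ?H by (rule H)
  have act: "a \<odot>\<^bsub>?H\<^esub> f \<in> Fil ?H (m + p)" if a: "a \<in> Fil A m" and f: "f \<in> Fil ?H p" for a f m p
  proof -
    have "a \<odot>\<^bsub>?H\<^esub> f \<in> mod_hom A B C" using H.smult_closed[OF Fil_algebra(1)[OF a], of f] f by simp
    moreover have "a \<odot>\<^bsub>C\<^esub> f x \<in> Fil C (n + (m + p))" if x: "x \<in> Fil B n" for x n
    proof -
      have "a \<odot>\<^bsub>C\<^esub> f x \<in> Fil C (m + (n + p))"
        using assms(2) a f x unfolding filtered_module_def filt_Hom_simps by blast
      then show ?thesis by (simp add: algebra_simps)
    qed
    ultimately show ?thesis using B.Fil_carrier by auto
  qed
  have sub: "submodule (Fil ?H p) A ?H" for p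
  proof (rule H.submoduleI)
    show "Fil ?H p \<subseteq> carrier ?H" by auto
    show "\<zero>\<^bsub>?H\<^esub> \<in> Fil ?H p"
      using H.M.zero_closed B.Fil_carrier by (auto simp: hom_zero_def)
    show "f \<oplus>\<^bsub>?H\<^esub> g \<in> Fil ?H p" if f: "f \<in> Fil ?H p" "g \<in> Fil ?H p" for f g
    proof -
      have "f \<oplus>\<^bsub>?H\<^esub> g \<in> carrier ?H" using f by (intro H.M.a_closed) simp_all
      moreover have "f x \<oplus>\<^bsub>C\<^esub> g x \<in> Fil C (n + p)" if "x \<in> Fil B n" for x n
        by (rule C.Fil_add) (use f that in \<open>simp_all add: image_subset_iff\<close>)
      ultimately show ?thesis using B.Fil_carrier by (auto simp: hom_add_def)
    qed
    show *: "a \<odot>\<^bsub>?H\<^esub> f \<in> Fil ?H p" if "a \<in> carrier A" "f \<in> Fil ?H p" for a f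
      using act[of a 0 f p] that Fil_algebra(2) by simp
    show "\<ominus>\<^bsub>?H\<^esub> f \<in> Fil ?H p" if f: "f \<in> Fil ?H p" for f
    proof -
      have fc: "f \<in> carrier ?H" using f by simp
      have "\<ominus>\<^bsub>?H\<^esub> f = (\<ominus>\<^bsub>A\<^esub> \<one>\<^bsub>A\<^esub>) \<odot>\<^bsub>?H\<^esub> f"
        by (simp only: H.smult_l_minus[OF A.one_closed fc] H.smult_one[OF fc])
      then show ?thesis using *[OF _ f, of "\<ominus>\<^bsub>A\<^esub> \<one>\<^bsub>A\<^esub>"] by simp
    qed
  qed
  have "Fil ?H (p + 1) \<subseteq> Fil ?H p" for p
  proof -
    have "Fil C (n + (p + 1)) \<subseteq> Fil C (n + p)" for n by (rule C.Fil_antimono) simp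
    then show ?thesis unfolding filt_Hom_simps by blast
  qed
  with H sub act show ?thesis unfolding filtered_module_def by blast
qed

lemma filtered_module_Hom_obj:
  "B \<in> Obj (AF k A) \<Longrightarrow> C \<in> Obj (AF k A) \<Longrightarrow> filtered_module A (filt_Hom A B C)"
  by (simp add: AF_obj_iff filtered_module_filt_Hom)

lemmas graded_noetherian_algebra = G.graded_noetherian_algebra_axioms

text \<open>The evaluation map is injective and strict for the filtrations, so functionals tell
  apart the elements and the steps of \<open>C\<close>. Identities in \<open>C\<close> can thus be
  checked after applying functionals.\<close>

lemma
  assumes C: "C \<in> Obj (AF k A)" and y: "y \<in> carrier C"
  shows dual_separates: "y' \<in> carrier C \<Longrightarrow> (\<And>f. f \<in> carrier (dual k A C) \<Longrightarrow> f y = f y') \<Longrightarrow> y = y'"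
    and dual_separates_Fil:
      "(\<And>f. f \<in> carrier (dual k A C) \<Longrightarrow> \<forall>z\<in>Fil C n. f z = \<zero>\<^bsub>k\<^esub> \<Longrightarrow> f y = \<zero>\<^bsub>k\<^esub>) \<Longrightarrow> y \<in> Fil C n"
proof -
  have fC: "filtered_module A C" "filtered_locally_free C" using C by (auto simp: AF_obj_iff)
  interpret C: filtration A C by (rule filtered_module_filtration[OF fC(1)])
  obtain r where "local_dual_basis k (restrict_scalars A C) (carrier C) {\<zero>\<^bsub>C\<^esub>} r"
    using filtered_locally_free_carrier(2)[OF fC(2)] by blast
  then have inj: "inj_on (double_dual_map k A C) (carrier C)"
    using double_dual_map_bij[OF alg C.module_axioms] by (simp add: bij_betw_def)
  show "y = y'" if "y' \<in> carrier C" "\<And>f. f \<in> carrier (dual k A C) \<Longrightarrow> f y = f y'"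
  proof (rule inj_onD[OF inj _ y that(1)])
    show "double_dual_map k A C y = double_dual_map k A C y'"
      unfolding double_dual_map_def restrict_apply'[OF y] restrict_apply'[OF that(1)]
      by (rule restrict_ext) (rule that(2))
  qed
  assume van: "\<And>f. f \<in> carrier (dual k A C) \<Longrightarrow> \<forall>z\<in>Fil C n. f z = \<zero>\<^bsub>k\<^esub> \<Longrightarrow> f y = \<zero>\<^bsub>k\<^esub>"
  have "double_dual_map k A C y \<in> carrier (dual k A (filt_dual k A C))"
    using mod_hom_closed[OF double_dual_map_mod_hom[OF alg C.module_axioms] y]
      dual_same[OF same_filt_dual[of C], where k = k and A = A] by simp
  then have "double_dual_map k A C y \<in> Fil (filt_dual k A (filt_dual k A C)) n"
    using van y by (auto simp: double_dual_map_def)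
  then show "y \<in> Fil C n" using double_dual_map_Fil_iff[OF C y] by blast
qed

section \<open>Homomorphisms and their duals\<close>

lemma filt_dual_mod_hom: "mod_hom A (filt_dual k A C) (filt_dual k A B) = mod_hom A (dual k A C) (dual k A B)"
  by (rule mod_hom_same[symmetric, OF same_filt_dual same_filt_dual])

lemma dual_map_Hom_mod_hom:
  assumes B: "module A B" and C: "module A C"
  shows "(\<lambda>\<beta>\<in>mod_hom A B C. dual_map k A B C \<beta>) \<in>
    mod_hom A (filt_Hom A B C) (filt_Hom A (filt_dual k A C) (filt_dual k A B))"
proof (rule mod_homI)
  interpret B: module A B by (rule B)
  interpret C: module A C by (rule C)
  interpret H: module A "filt_Hom A B C" by (rule module_filt_Hom[OF B C])
  let ?H' = "filt_Hom A (filt_dual k A C) (filt_dual k A B)"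
  fix \<beta> assume "\<beta> \<in> carrier (filt_Hom A B C)"
  then have \<beta>: "\<beta> \<in> mod_hom A B C" by simp
  note \<beta>c = mod_hom_closed[OF \<beta>]
  show "(\<lambda>\<beta>\<in>mod_hom A B C. dual_map k A B C \<beta>) \<beta> \<in> carrier ?H'"
    using dual_map_mod_hom[OF alg B C \<beta>] \<beta> by (simp add: filt_dual_mod_hom)
  {
    fix \<gamma> assume "\<gamma> \<in> carrier (filt_Hom A B C)"
    then have \<gamma>: "\<gamma> \<in> mod_hom A B C" by simp
    note \<gamma>c = mod_hom_closed[OF \<gamma>]
    have "dual_map k A B C (hom_add B C \<beta> \<gamma>) =
        hom_add (filt_dual k A C) (filt_dual k A B) (dual_map k A B C \<beta>) (dual_map k A B C \<gamma>)"
      using \<beta>c \<gamma>c by (simp add: dual_map_def hom_add_def compose_def dual_add cong: restrict_cong)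
    then show "(\<lambda>\<beta>\<in>mod_hom A B C. dual_map k A B C \<beta>) (\<beta> \<oplus>\<^bsub>filt_Hom A B C\<^esub> \<gamma>) =
        (\<lambda>\<beta>\<in>mod_hom A B C. dual_map k A B C \<beta>) \<beta> \<oplus>\<^bsub>?H'\<^esub> (\<lambda>\<beta>\<in>mod_hom A B C. dual_map k A B C \<beta>) \<gamma>"
      using \<beta> \<gamma> hom_add_mod_hom[OF \<beta> \<gamma> B C] by simp
  }
  fix a assume a: "a \<in> carrier A"
  have "dual_map k A B C (\<lambda>x\<in>carrier B. a \<odot>\<^bsub>C\<^esub> \<beta> x) =
      (\<lambda>f\<in>carrier (filt_dual k A C). a \<odot>\<^bsub>filt_dual k A B\<^esub> dual_map k A B C \<beta> f)"
    using a \<beta>c mod_hom_smult[OF \<beta> a] by (simp add: dual_map_def compose_def cong: restrict_cong)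
  then show "(\<lambda>\<beta>\<in>mod_hom A B C. dual_map k A B C \<beta>) (a \<odot>\<^bsub>filt_Hom A B C\<^esub> \<beta>) =
      a \<odot>\<^bsub>?H'\<^esub> (\<lambda>\<beta>\<in>mod_hom A B C. dual_map k A B C \<beta>) \<beta>"
    using \<beta> H.smult_closed[OF a, of \<beta>] by simp
qed simp

lemma dual_map_Hom_bij:
  assumes B: "B \<in> Obj (AF k A)" and C: "C \<in> Obj (AF k A)"
  shows "bij_betw (\<lambda>\<beta>\<in>mod_hom A B C. dual_map k A B C \<beta>) (mod_hom A B C) (mod_hom A (dual k A C) (dual k A B))"
proof (rule bij_betw_imageI)
  have fB: "filtered_module A B" and fC: "filtered_module A C" "filtered_locally_free C" using B C by (auto simp: AF_obj_iff)
  interpret B: filtration A B by (rule filtered_module_filtration[OF fB])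
  interpret C: filtration A C by (rule filtered_module_filtration[OF fC(1)])
  interpret DC: module A "dual k A C" by (rule module_dual[OF alg C.module_axioms])
  have app: "dual_map k A B C \<beta> f x = f (\<beta> x)" if "f \<in> carrier (dual k A C)" "x \<in> carrier B" for \<beta> f x
    using that by (simp add: dual_map_def compose_eq)
  show "inj_on (\<lambda>\<beta>\<in>mod_hom A B C. dual_map k A B C \<beta>) (mod_hom A B C)"
  proof (rule inj_onI)
    fix \<beta> \<gamma> assume h: "\<beta> \<in> mod_hom A B C" "\<gamma> \<in> mod_hom A B C"
      and "(\<lambda>\<beta>\<in>mod_hom A B C. dual_map k A B C \<beta>) \<beta> = (\<lambda>\<beta>\<in>mod_hom A B C. dual_map k A B C \<beta>) \<gamma>"
    then have eq: "dual_map k A B C \<beta> = dual_map k A B C \<gamma>" by simp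
    show "\<beta> = \<gamma>"
    proof (rule extensionalityI[OF mod_hom_ext[OF h(1)] mod_hom_ext[OF h(2)]])
      fix x assume x: "x \<in> carrier B"
      show "\<beta> x = \<gamma> x"
        by (rule dual_separates[OF C mod_hom_closed[OF h(1) x] mod_hom_closed[OF h(2) x]])
          (use app[OF _ x] eq in metis)
    qed
  qed
  show "(\<lambda>\<beta>\<in>mod_hom A B C. dual_map k A B C \<beta>) ` mod_hom A B C = mod_hom A (dual k A C) (dual k A B)"
  proof (intro equalityI subsetI)
    fix \<gamma> assume \<gamma>: "\<gamma> \<in> mod_hom A (dual k A C) (dual k A B)"
    have \<gamma>d: "\<gamma> f \<in> carrier (dual k A B)" if "f \<in> carrier (dual k A C)" for f
      by (rule mod_hom_closed[OF \<gamma> that])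
    have "\<exists>y\<in>carrier C. \<forall>f\<in>carrier (dual k A C). f y = \<gamma> f x" if x: "x \<in> carrier B" for x
    proof -
      obtain r where "local_dual_basis k (restrict_scalars A C) (carrier C) {\<zero>\<^bsub>C\<^esub>} r"
        using filtered_locally_free_carrier(2)[OF fC(2)] by blast
      then have im: "double_dual_map k A C ` carrier C = carrier (dual k A (dual k A C))"
        using double_dual_map_bij[OF alg C.module_axioms] by (simp add: bij_betw_def)
      \<comment> \<open>As a functional on the dual of \<open>C\<close>,
        \<open>f \<mapsto> \<gamma> f x\<close> is evaluation at \<open>x\<close> composed with
        \<gamma>, hence lies in the double dual of \<open>C\<close>; reflexivity of \<open>C\<close>
        supplies the value at \<open>x\<close>.\<close>
      have "compose (carrier (dual k A C)) (double_dual_map k A B x) \<gamma> \<in> double_dual_map k A C ` carrier C"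
        unfolding im by (rule compose_dual[OF alg DC.module_axioms \<gamma> mod_hom_closed[OF double_dual_map_mod_hom[OF alg B.module_axioms] x]])
      then obtain y where y: "compose (carrier (dual k A C)) (double_dual_map k A B x) \<gamma> = double_dual_map k A C y"
        "y \<in> carrier C" by (rule imageE)
      have "f y = \<gamma> f x" if f: "f \<in> carrier (dual k A C)" for f
        using fun_cong[OF y(1), of f] f y(2) x \<gamma>d[OF f] by (simp add: double_dual_map_def compose_eq)
      then show ?thesis using y(2) by blast
    qed
    then obtain b where b: "\<And>x. x \<in> carrier B \<Longrightarrow> b x \<in> carrier C"
      "\<And>x f. x \<in> carrier B \<Longrightarrow> f \<in> carrier (dual k A C) \<Longrightarrow> f (b x) = \<gamma> f x" by metis
    have bhom: "restrict b (carrier B) \<in> mod_hom A B C"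
    proof (rule mod_homI)
      fix x assume x: "x \<in> carrier B"
      show "restrict b (carrier B) x \<in> carrier C" using b(1) x by simp
      {
        fix y assume y: "y \<in> carrier B"
        \<comment> \<open>The pointwise choices fit together because functionals separate points and
          every functional takes the same value on both sides.\<close>
        have "b (x \<oplus>\<^bsub>B\<^esub> y) = b x \<oplus>\<^bsub>C\<^esub> b y"
        proof (rule dual_separates[OF C b(1)])
          fix f assume f: "f \<in> carrier (dual k A C)"
          show "f (b (x \<oplus>\<^bsub>B\<^esub> y)) = f (b x \<oplus>\<^bsub>C\<^esub> b y)"
            using x y b f dual_add[OF f] dual_add[OF \<gamma>d[OF f] x y] by simp
        qed (use x y b(1) in auto)
        then show "restrict b (carrier B) (x \<oplus>\<^bsub>B\<^esub> y) = restrict b (carrier B) x \<oplus>\<^bsub>C\<^esub> restrict b (carrier B) y"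
          using x y by simp
      }
      fix a assume a: "a \<in> carrier A"
      have "b (a \<odot>\<^bsub>B\<^esub> x) = a \<odot>\<^bsub>C\<^esub> b x"
      proof (rule dual_separates[OF C b(1)])
        fix f assume f: "f \<in> carrier (dual k A C)"
        \<comment> \<open>Linearity of \<gamma> over \<open>A\<close> moves \<open>a\<close> from
          the argument \<open>x\<close> onto \<open>f\<close>, and from there onto
          \<open>b x\<close>.\<close>
        have "f (b (a \<odot>\<^bsub>B\<^esub> x)) = \<gamma> f (a \<odot>\<^bsub>B\<^esub> x)" using a x b(2) f by simp
        also have "\<dots> = (a \<odot>\<^bsub>dual k A B\<^esub> \<gamma> f) x" using x by simp
        also have "\<dots> = \<gamma> (a \<odot>\<^bsub>dual k A C\<^esub> f) x" using mod_hom_smult[OF \<gamma> a f] by simp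
        also have "\<dots> = (a \<odot>\<^bsub>dual k A C\<^esub> f) (b x)" by (rule b(2)[OF x DC.smult_closed[OF a f], symmetric])
        also have "\<dots> = f (a \<odot>\<^bsub>C\<^esub> b x)" using b(1)[OF x] by simp
        finally show "f (b (a \<odot>\<^bsub>B\<^esub> x)) = f (a \<odot>\<^bsub>C\<^esub> b x)" .
      qed (use a x b(1) in auto)
      then show "restrict b (carrier B) (a \<odot>\<^bsub>B\<^esub> x) = a \<odot>\<^bsub>C\<^esub> restrict b (carrier B) x" using a x by simp
    qed simp
    have "\<gamma> = dual_map k A B C (restrict b (carrier B))"
    proof (rule extensionalityI[OF mod_hom_ext[OF \<gamma>]])
      fix f assume f: "f \<in> carrier (dual k A C)"
      show "\<gamma> f = dual_map k A B C (restrict b (carrier B)) f"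
      proof (rule extensionalityI[OF dual_extensional[OF \<gamma>d[OF f]]])
        show "\<gamma> f x = dual_map k A B C (restrict b (carrier B)) f x" if "x \<in> carrier B" for x
          using app[OF f that] b(2)[OF that f] that by simp
      qed (use f in \<open>simp add: dual_map_def\<close>)
    qed (simp add: dual_map_def)
    with bhom show "\<gamma> \<in> (\<lambda>\<beta>\<in>mod_hom A B C. dual_map k A B C \<beta>) ` mod_hom A B C"
      by (intro image_eqI[of _ _ "restrict b (carrier B)"]) simp_all
  qed (use dual_map_mod_hom[OF alg B.module_axioms C.module_axioms] in auto)
qed

text \<open>If the dual of \<beta> raises steps by \<open>p\<close>, it takes a functional vanishing
  on \<open>Fil C (n + p)\<close>, of step \<open>1 - (n + p)\<close>, to step \<open>1 - n\<close>,
  whose members vanish on \<open>Fil B n\<close>; so \<open>dual_separates_Fil\<close> puts the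
  image of \<open>Fil B n\<close> into \<open>Fil C (n + p)\<close>. The converse is the same count
  of indices read directly.\<close>

lemma dual_map_Fil_iff:
  assumes B: "B \<in> Obj (AF k A)" and C: "C \<in> Obj (AF k A)" and \<beta>: "\<beta> \<in> mod_hom A B C"
  shows "dual_map k A B C \<beta> \<in> Fil (filt_Hom A (filt_dual k A C) (filt_dual k A B)) p \<longleftrightarrow> \<beta> \<in> Fil (filt_Hom A B C) p"
proof
  have fB: "filtered_module A B" and fC: "filtered_module A C" using B C by (auto simp: AF_obj_iff)
  interpret B: filtration A B by (rule filtered_module_filtration[OF fB])
  interpret C: filtration A C by (rule filtered_module_filtration[OF fC])
  have app: "dual_map k A B C \<beta> f x = f (\<beta> x)" if "f \<in> carrier (dual k A C)" "x \<in> carrier B" for f x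
    using that by (simp add: dual_map_def compose_eq)
  note dm = dual_map_mod_hom[OF alg B.module_axioms C.module_axioms \<beta>]
  {
    assume *: "dual_map k A B C \<beta> \<in> Fil (filt_Hom A (filt_dual k A C) (filt_dual k A B)) p"
    have "\<beta> x \<in> Fil C (n + p)" if x: "x \<in> Fil B n" for x n
    proof (rule dual_separates_Fil[OF C mod_hom_closed[OF \<beta> B.Fil_carrier[OF x]]])
      fix f assume f: "f \<in> carrier (dual k A C)" and van: "\<forall>z\<in>Fil C (n + p). f z = \<zero>\<^bsub>k\<^esub>"
      have "1 - (1 - (n + p)) = n + p" by simp
      then have "f \<in> Fil (filt_dual k A C) (1 - (n + p))" using f van by simp
      then have "dual_map k A B C \<beta> f \<in> Fil (filt_dual k A B) (1 - (n + p) + p)"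
        using * unfolding filt_Hom_simps by blast
      moreover have "1 - (1 - (n + p) + p) = n" by simp
      ultimately have "dual_map k A B C \<beta> f x = \<zero>\<^bsub>k\<^esub>" using x by simp
      then show "f (\<beta> x) = \<zero>\<^bsub>k\<^esub>" using app[OF f B.Fil_carrier[OF x]] by simp
    qed
    then show "\<beta> \<in> Fil (filt_Hom A B C) p" using \<beta> by auto
  }
  assume *: "\<beta> \<in> Fil (filt_Hom A B C) p"
  have "dual_map k A B C \<beta> f \<in> Fil (filt_dual k A B) (n + p)" if f: "f \<in> Fil (filt_dual k A C) n" for f n
  proof -
    have fd: "f \<in> carrier (dual k A C)" using f by simp
    have "dual_map k A B C \<beta> f x = \<zero>\<^bsub>k\<^esub>" if x: "x \<in> Fil B (1 - (n + p))" for x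
    proof -
      have "\<beta> x \<in> Fil C (1 - (n + p) + p)" using * x unfolding filt_Hom_simps by blast
      moreover have "1 - (n + p) + p = 1 - n" by simp
      ultimately have "\<beta> x \<in> Fil C (1 - n)" by metis
      then show ?thesis using f app[OF fd B.Fil_carrier[OF x]] by simp
    qed
    then show ?thesis using mod_hom_closed[OF dm fd] by simp
  qed
  then show "dual_map k A B C \<beta> \<in> Fil (filt_Hom A (filt_dual k A C) (filt_dual k A B)) p"
    using dm unfolding filt_Hom_simps filt_dual_mod_hom by blast
qed

lemma dual_map_Hom_iso:
  assumes B: "B \<in> Obj (AF k A)" and C: "C \<in> Obj (AF k A)"
  shows "iso_via (filt_hom A) (filt_hom A) (filt_Hom A B C) (filt_Hom A (filt_dual k A C) (filt_dual k A B))
    (\<lambda>\<beta>\<in>mod_hom A B C. dual_map k A B C \<beta>)"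
  unfolding filt_hom_eq_fam_hom
proof (rule iso_via_fam_hom[where S = Fil and T = Fil])
  have "filtered_module A B" "filtered_module A C" using B C by (auto simp: AF_obj_iff)
  then have m: "module A B" "module A C" by (simp_all add: filtered_module_def)
  show "(\<lambda>\<beta>\<in>mod_hom A B C. dual_map k A B C \<beta>) \<in>
      mod_hom A (filt_Hom A B C) (filt_Hom A (filt_dual k A C) (filt_dual k A B))"
    by (rule dual_map_Hom_mod_hom[OF m])
  show "bij_betw (\<lambda>\<beta>\<in>mod_hom A B C. dual_map k A B C \<beta>) (carrier (filt_Hom A B C))
      (carrier (filt_Hom A (filt_dual k A C) (filt_dual k A B)))"
    using dual_map_Hom_bij[OF B C] by (simp add: filt_dual_mod_hom)
  show "(\<lambda>\<beta>\<in>mod_hom A B C. dual_map k A B C \<beta>) x \<in> Fil (filt_Hom A (filt_dual k A C) (filt_dual k A B)) n \<longleftrightarrow>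
      x \<in> Fil (filt_Hom A B C) n" if "x \<in> carrier (filt_Hom A B C)" for x n
    using dual_map_Fil_iff[OF B C, of x n] that by (simp del: filt_Hom_simps(5))
  show "Fil (filt_Hom A B C) n \<subseteq> carrier (filt_Hom A B C)"
    "Fil (filt_Hom A (filt_dual k A C) (filt_dual k A B)) n \<subseteq> carrier (filt_Hom A (filt_dual k A C) (filt_dual k A B))" for n
    by auto
  show "module A (filt_Hom A B C)" by (rule module_filt_Hom[OF m])
qed

end

theorem mainTheorem11:
  fixes k :: "('k, 'l) ring_scheme"
    and A :: "('k, 'a, 'y) filt_module_scheme"
  assumes "noetherian_ring k"
    and "cring k"
    and "algebra k A"
  shows
    "additive_category
       (AM k A :: ('c, \<lparr>smult :: 'a \<Rightarrow> 'c \<Rightarrow> 'c\<rparr>) mod_cat)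
       (AM k A) (mod_hom A) (mod_hom A) \<and>
     dualizing_functor
       (AM k A :: ('c, \<lparr>smult :: 'a \<Rightarrow> 'c \<Rightarrow> 'c\<rparr>) mod_cat)
       (AM k A) (AM k A) (mod_hom A) (mod_hom A)
       (dual k A) (dual_map k A) (dual k A) (dual_map k A) \<and>
     (filtered_algebra k A \<longrightarrow>
       additive_category
         (AF k A :: ('c, \<lparr>smult :: 'a \<Rightarrow> 'c \<Rightarrow> 'c, Fil :: int \<Rightarrow> 'c set\<rparr>) mod_cat)
         (AF k A) (filt_hom A) (filt_hom A) \<and>
       dualizing_functor
         (AF k A :: ('c, \<lparr>smult :: 'a \<Rightarrow> 'c \<Rightarrow> 'c, Fil :: int \<Rightarrow> 'c set\<rparr>) mod_cat)
         (AF k A) (AF k A) (filt_hom A) (filt_hom A)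
         (filt_dual k A) (dual_map k A) (filt_dual k A) (dual_map k A) \<and>
       additive_category
         (AG k (gr_algebra A) ::
           ('c, \<lparr>smult :: (int \<Rightarrow> 'a set) \<Rightarrow> 'c \<Rightarrow> 'c, Deg :: int \<Rightarrow> 'c set\<rparr>) mod_cat)
         (AG k (gr_algebra A)) (gr_hom (gr_algebra A)) (gr_hom (gr_algebra A)) \<and>
       dualizing_functor
         (AG k (gr_algebra A) ::
           ('c, \<lparr>smult :: (int \<Rightarrow> 'a set) \<Rightarrow> 'c \<Rightarrow> 'c, Deg :: int \<Rightarrow> 'c set\<rparr>) mod_cat)
         (AG k (gr_algebra A)) (AG k (gr_algebra A))
         (gr_hom (gr_algebra A)) (gr_hom (gr_algebra A))
         (gr_dual k (gr_algebra A)) (dual_map k (gr_algebra A))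
         (gr_dual k (gr_algebra A)) (dual_map k (gr_algebra A)) \<and>
       covariant_functor
         (AF k A :: ('c, \<lparr>smult :: 'a \<Rightarrow> 'c \<Rightarrow> 'c, Fil :: int \<Rightarrow> 'c set\<rparr>) mod_cat)
         (AG k (gr_algebra A)) (gr_module A) gr_map \<and>
       nat_iso_contravariant
         (AF k A :: ('c, \<lparr>smult :: 'a \<Rightarrow> 'c \<Rightarrow> 'c, Fil :: int \<Rightarrow> 'c set\<rparr>) mod_cat)
         (gr_hom (gr_algebra A)) (gr_hom (gr_algebra A))
         (\<lambda>C. gr_module A (filt_dual k A C))
         (\<lambda>B C f. gr_map (filt_dual k A C) (filt_dual k A B) (dual_map k A B C f))
         (\<lambda>C. gr_dual k (gr_algebra A) (gr_module A C))
         (\<lambda>B C f. dual_map k (gr_algebra A) (gr_module A B) (gr_module A C) (gr_map B C f))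
         (gr_dual_comparison k A) \<and>
       (\<forall>B \<in> Obj (AF k A :: ('b, \<lparr>smult :: 'a \<Rightarrow> 'b \<Rightarrow> 'b, Fil :: int \<Rightarrow> 'b set\<rparr>) mod_cat).
        \<forall>C \<in> Obj (AF k A :: ('c, \<lparr>smult :: 'a \<Rightarrow> 'c \<Rightarrow> 'c, Fil :: int \<Rightarrow> 'c set\<rparr>) mod_cat).
          filtered_module A (filt_Hom A B C) \<and>
          filtered_module A (filt_Hom A (filt_dual k A C) (filt_dual k A B)) \<and>
          iso_via (filt_hom A) (filt_hom A)
            (filt_Hom A B C) (filt_Hom A (filt_dual k A C) (filt_dual k A B))
            (\<lambda>\<beta>\<in>mod_hom A B C. dual_map k A B C \<beta>)))"
proof -
  interpret noetherian_algebra k A by (rule noetherian_algebra.intro[OF assms(1,3)])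
  have F: "filtered_noetherian_algebra k A" if "filtered_algebra k A"
    using that noetherian_algebra_axioms
    by (intro filtered_noetherian_algebra.intro filtered_noetherian_algebra_axioms.intro)
  note G = F[THEN filtered_noetherian_algebra.graded_noetherian_algebra]
  show ?thesis
    by (intro conjI impI ballI AM_additive AM_dualizing
        F[THEN filtered_noetherian_algebra.AF_additive] F[THEN filtered_noetherian_algebra.AF_dualizing]
        G[THEN graded_noetherian_algebra.AG_additive] G[THEN graded_noetherian_algebra.AG_dualizing]
        F[THEN filtered_noetherian_algebra.gr_covariant] F[THEN filtered_noetherian_algebra.gr_dual_nat_iso]
        F[THEN filtered_noetherian_algebra.filtered_module_Hom_obj]
        F[THEN filtered_noetherian_algebra.filt_dual_obj] F[THEN filtered_noetherian_algebra.dual_map_Hom_iso])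
qed

end
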